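(* Let $\bullet$ denote any one of the four versions (regular, causal $c$, anticausal $ac$, bicausal $bc$). Let $p\in[1,\infty)$, $\mu,\tilde\mu\in\mathcal P_p(\mathcal X)$, $\nu,\tilde\nu\in\mathcal P_p(\mathcal Y)$, let $c:\mathcal X\times\mathcal Y\to\mathbb R$ be continuous with growth of order at most $p$, and let $c$ satisfy $A(L,p,\mu,\nu)$ for some $L>0$, i.e. $$\Big|\int c\,d\pi-\int c\,d\tilde\pi\Big|\le L\,W_p(\pi,\tilde\pi)\qquad\text{for all }\pi,\tilde\pi\in\Pi(\mu,\nu).$$ Let $\Delta\ge 0$ be given by $\Delta^p:=W_{p,bc}(\mu,\tilde\mu)^p+W_{p,bc}(\nu,\tilde\nu)^p$. (i) We have $$|V_\bullet(\mu,\nu,c)-V_\bullet(\tilde\mu,\tilde\nu,c)|\le L\Delta,\qquad |E_\bullet(\mu,\nu,c)-E_\bullet(\tilde\mu,\tilde\nu,c)|\le L\Delta.$$ (ii) Let $1\le q<p$. Let $\pi^*$ be the optimizer of $E_\bullet(\mu,\nu,c)$ and $\tilde\pi^*$ the optimizer of $E_\bullet(\tilde\mu,\tilde\nu,c)$. If $\mu,\nu$ satisfy $T(q,C_q)$ (for some $C_q>0$), then $$W_q(\pi^*,\tilde\pi^* )\le 2^{\frac1q-\frac1p}\Delta+C_q(2L\Delta)^{\frac1{2q}}.$$ If $\mu,\nu$ and $\tilde\mu,\tilde\nu$ even satisfy $T_a(q,C_q)$, then $$\max\{W_{q,c}(\pi^*,\tilde\pi^* ),W_{q,ac}(\pi^*,\tilde\pi^*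 )\}\le 2^{\frac1q-\frac1p}\Delta+C_q(2L\Delta)^{\frac1{2q}}.$$
   Context: $N\in\mathbb N$ is the number of time steps; $\mathcal X=\mathcal X_1\times\dots\times\mathcal X_N$ and $\mathcal Y=\mathcal Y_1\times\dots\times\mathcal Y_N$ are Polish path spaces with metrics $d_{\mathcal X},d_{\mathcal Y}$. $\mathcal P_p(\mathcal X)$ is the set of Borel probability measures $\mu$ on $\mathcal X$ with $\int d_{\mathcal X}(\hat x,x)^p\,\mu(dx)<\infty$ for some $\hat x$, and $\mathcal P_p(\mathcal Y)$ is defined in the same way. The function $c$ has growth of order at most $p$ if $c/(1+d_{\mathcal X}(\hat x,\cdot)^p+d_{\mathcal Y}(\hat y,\cdot)^p)$ is bounded for some $(\hat x,\hat y)$. $X_t,Y_t$ are coordinate projections, $X_{1:t}=(X_1,\dots,X_t)$, etc. $\Pi(\mu,\nu)$ is the set of couplings of $\mu$ and $\nu$. A measure $\pi\in\mathcal P(\mathcal X\times\mathcal Y)$ is causal if under $\pi$, for all $t=1,\dots,N-1$, $X_{t+1}$ is conditionally independent of $Y_{1:t}$ given $X_{1:t}$; anticausal if for all such $t$, $Y_{t+1}$ is conditionally independent of $X_{1:t}$ given $Y_{1:t}$; bicausal if both. $\Pi_c,\Pi_{ac},\Pi_{bc}$ are the corresponding subsets of $\Pi(\mu,\nu)$; $\Pi_\bullet$ stands for any of $\Pi,\Pi_c,\Pi_{ac},\Pi_{bc}$ (with $W_{p,\bullet}=W_p$ in the regular case). $V_\bullet(\mu,\nu,c)=\inf_{\pi\in\Pi_\bullet(\mu,\nu)}\int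 c\,d\pi$ and $E_\bullet(\mu,\nu,c)=\inf_{\pi\in\Pi_\bullet(\mu,\nu)}\int c\,d\pi+D_{\rm KL}(\pi,\mu\otimes\nu)$, where $D_{\rm KL}(\pi,\tilde\pi)=\int\log\frac{d\pi}{d\tilde\pi}\,d\pi$ if $\pi\ll\tilde\pi$ and $+\infty$ otherwise. $W_{p,\bullet}(\mu,\tilde\mu)^p=\inf_{\pi\in\Pi_\bullet(\mu,\tilde\mu)}\int d_{\mathcal X}^p\,d\pi$ on $\mathcal P_p(\mathcal X)$ (similarly on $\mathcal Y$); for $\pi,\tilde\pi\in\mathcal P(\mathcal X\times\mathcal Y)$, $W_{p,\bullet}(\pi,\tilde\pi)^p=\inf_{\theta\in\Pi_\bullet(\pi,\tilde\pi)}\int d_{\mathcal X}(x,\tilde x)^p+d_{\mathcal Y}(y,\tilde y)^p\,\theta(dx,dy,d\tilde x,d\tilde y)$, where for (anti/bi)causality of $\theta$ the space $\mathcal X\times\mathcal Y$ is regarded as a single path space with time-$t$ component $\mathcal X_t\times\mathcal Y_t$. For $q\in[1,\infty)$ and $C_q>0$: $\mu,\nu$ satisfy $T(q,C_q)$ if $W_q(\pi,\tilde\pi)\le C_qD_{\rm KL}(\pi,\tilde\pi)^{\frac1{2q}}$ for all $\pi,\tilde\pi\in\Pi(\mu,\nu)$; they satisfy $T_a(q,C_q)$ if $\max\{W_{q,c}(\pi,\tilde\pi),W_{q,ac}(\pi,\tilde\pi)\}\le C_qD_{\rm KL}(\pi,\tilde\pi)^{\frac1{2q}}$ for all $\pi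,\tilde\pi\in\Pi(\mu,\nu)$.
   Formalization: The condition A is required for all π in Π(μ,ν) and all π̃ in Π(μ̃,ν̃), not for both in Π(μ,ν); as printed the claim fails, e.g. N=1, c(x,y)=100x, L=1, μ=ν=ν̃=δ_0, μ̃=δ_1. *)

theory Defs
  imports "HOL-Probability.Probability"
begin

section \<open>Polish path spaces\<close>

text \<open>
  The components \<open>X\<^sub>1, \<dots>, X\<^sub>N\<close> are topological spaces \<open>T 1, \<dots>, T N\<close> carried by subsets of a common
  type, which may be chosen large enough to hold any \<open>N\<close> given spaces.  A path is an extensional
  function on \<open>{1..N}\<close>.
\<close>

definition polish_space :: "'a topology \<Rightarrow> bool" where
  "polish_space T \<longleftrightarrow> completely_metrizable_space T \<and> separable_space T"

definition path_top :: "nat \<Rightarrow> (nat \<Rightarrow> 'a topology) \<Rightarrow> (nat \<Rightarrow> 'a) topology" where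
  "path_top N T = product_topology T {1..N}"

abbreviation paths :: "nat \<Rightarrow> (nat \<Rightarrow> 'a topology) \<Rightarrow> (nat \<Rightarrow> 'a) set" where
  "paths N T \<equiv> topspace (path_top N T)"

text \<open>The metric has to induce the product topology; it need not be complete itself, nor be built
  from metrics on the components.\<close>

definition polish_path_space ::
    "nat \<Rightarrow> (nat \<Rightarrow> 'a topology) \<Rightarrow> ((nat \<Rightarrow> 'a) \<Rightarrow> (nat \<Rightarrow> 'a) \<Rightarrow> real) \<Rightarrow> bool" where
  "polish_path_space N T d \<longleftrightarrow>
     (\<forall>t\<in>{1..N}. polish_space (T t)) \<and>
     Metric_space (paths N T) d \<and>
     Metric_space.mtopology (paths N T) d = path_top N T"

definition borel_of :: "'a topology \<Rightarrow> 'a measure" where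
  "borel_of T = sigma (topspace T) {U. openin T U}"

definition prob_p ::
    "nat \<Rightarrow> (nat \<Rightarrow> 'a topology) \<Rightarrow> ((nat \<Rightarrow> 'a) \<Rightarrow> (nat \<Rightarrow> 'a) \<Rightarrow> real) \<Rightarrow> real \<Rightarrow> (nat \<Rightarrow> 'a) measure set"
  where
  "prob_p N T d p = {\<mu>. sets \<mu> = sets (borel_of (path_top N T)) \<and> prob_space \<mu> \<and>
     (\<exists>x0\<in>paths N T. (\<integral>\<^sup>+x. ennreal (d x0 x powr p) \<partial>\<mu>) < \<infinity>)}"

definition growth_at_most ::
    "nat \<Rightarrow> (nat \<Rightarrow> 'a topology) \<Rightarrow> ((nat \<Rightarrow> 'a) \<Rightarrow> (nat \<Rightarrow> 'a) \<Rightarrow> real) \<Rightarrow>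
     (nat \<Rightarrow> 'b topology) \<Rightarrow> ((nat \<Rightarrow> 'b) \<Rightarrow> (nat \<Rightarrow> 'b) \<Rightarrow> real) \<Rightarrow>
     real \<Rightarrow> ((nat \<Rightarrow> 'a) \<times> (nat \<Rightarrow> 'b) \<Rightarrow> real) \<Rightarrow> bool" where
  "growth_at_most N TX dX TY dY p c \<longleftrightarrow>
     (\<exists>x0\<in>paths N TX. \<exists>y0\<in>paths N TY.
        bounded ((\<lambda>(x, y). c (x, y) / (1 + dX x0 x powr p + dY y0 y powr p)) `
                 (paths N TX \<times> paths N TY)))"


section \<open>Couplings and causality\<close>

definition couplings :: "'p measure \<Rightarrow> 'q measure \<Rightarrow> ('p \<times> 'q) measure set" where
  "couplings \<mu> \<nu> =
     {\<pi>. sets \<pi> = sets (\<mu> \<Otimes>\<^sub>M \<nu>) \<and> distr \<pi> \<mu> fst = \<mu> \<and> distr \<pi> \<nu> snd = \<nu>}"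

text \<open>Under \<open>M\<close>, the random variables \<open>U\<close> and \<open>V\<close> are conditionally independent given \<open>W\<close>.\<close>

definition cond_indep_var ::
    "'w measure \<Rightarrow> 'u measure \<Rightarrow> ('w \<Rightarrow> 'u) \<Rightarrow> 'v measure \<Rightarrow> ('w \<Rightarrow> 'v) \<Rightarrow>
     'z measure \<Rightarrow> ('w \<Rightarrow> 'z) \<Rightarrow> bool" where
  "cond_indep_var M SU U SV V SW W \<longleftrightarrow>
     U \<in> M \<rightarrow>\<^sub>M SU \<and> V \<in> M \<rightarrow>\<^sub>M SV \<and> W \<in> M \<rightarrow>\<^sub>M SW \<and>
     (\<forall>A\<in>sets SU. \<forall>B\<in>sets SV.
        let P = (\<lambda>E. real_cond_exp M (vimage_algebra (space M) W SW) (indicator E :: 'w \<Rightarrow> real)) in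
        AE \<omega> in M. P (U -` A \<inter> V -` B) \<omega> = P (U -` A) \<omega> * P (V -` B) \<omega>)"

text \<open>
  The coordinate process of a path space, kept separate from the type of its points so that
  \<open>X \<times> Y\<close> can be regarded as the path space with time-\<open>t\<close> coordinate \<open>(x t, y t)\<close> without
  re-encoding pairs of paths as paths of pairs.
\<close>

record ('p, 's) coord_process =
  comp_space :: "nat \<Rightarrow> 's measure"
  coord :: "nat \<Rightarrow> 'p \<Rightarrow> 's"

definition path_process :: "(nat \<Rightarrow> 'a topology) \<Rightarrow> (nat \<Rightarrow> 'a, 'a) coord_process" where
  "path_process T = \<lparr>comp_space = (\<lambda>t. borel_of (T t)), coord = (\<lambda>t x. x t)\<rparr>"

definition pair_process ::
    "('p, 's) coord_process \<Rightarrow> ('q, 'u) coord_process \<Rightarrow> ('p \<times> 'q, 's \<times> 'u) coord_process" where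
  "pair_process P Q =
     \<lparr>comp_space = (\<lambda>t. comp_space P t \<Otimes>\<^sub>M comp_space Q t),
      coord = (\<lambda>t (x, y). (coord P t x, coord Q t y))\<rparr>"

definition hist_space :: "('p, 's) coord_process \<Rightarrow> nat \<Rightarrow> (nat \<Rightarrow> 's) measure" where
  "hist_space P t = Pi\<^sub>M {1..t} (comp_space P)"

definition hist :: "('p, 's) coord_process \<Rightarrow> nat \<Rightarrow> 'p \<Rightarrow> nat \<Rightarrow> 's" where
  "hist P t x = (\<lambda>i\<in>{1..t}. coord P i x)"

definition causal ::
    "nat \<Rightarrow> ('p, 's) coord_process \<Rightarrow> ('q, 'u) coord_process \<Rightarrow> ('p \<times> 'q) measure \<Rightarrow> bool" where
  "causal N P Q \<pi> \<longleftrightarrow>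
     (\<forall>t\<in>{1..<N}. cond_indep_var \<pi>
        (comp_space P (t + 1)) (\<lambda>(x, y). coord P (t + 1) x)
        (hist_space Q t) (\<lambda>(x, y). hist Q t y)
        (hist_space P t) (\<lambda>(x, y). hist P t x))"

definition anticausal ::
    "nat \<Rightarrow> ('p, 's) coord_process \<Rightarrow> ('q, 'u) coord_process \<Rightarrow> ('p \<times> 'q) measure \<Rightarrow> bool" where
  "anticausal N P Q \<pi> \<longleftrightarrow>
     (\<forall>t\<in>{1..<N}. cond_indep_var \<pi>
        (comp_space Q (t + 1)) (\<lambda>(x, y). coord Q (t + 1) y)
        (hist_space P t) (\<lambda>(x, y). hist P t x)
        (hist_space Q t) (\<lambda>(x, y). hist Q t y))"

datatype version = Regular | Causal | Anticausal | Bicausal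

fun admissible ::
    "version \<Rightarrow> nat \<Rightarrow> ('p, 's) coord_process \<Rightarrow> ('q, 'u) coord_process \<Rightarrow> ('p \<times> 'q) measure \<Rightarrow> bool"
  where
  "admissible Regular N P Q \<pi> \<longleftrightarrow> True"
| "admissible Causal N P Q \<pi> \<longleftrightarrow> causal N P Q \<pi>"
| "admissible Anticausal N P Q \<pi> \<longleftrightarrow> anticausal N P Q \<pi>"
| "admissible Bicausal N P Q \<pi> \<longleftrightarrow> causal N P Q \<pi> \<and> anticausal N P Q \<pi>"

definition couplings_of ::
    "version \<Rightarrow> nat \<Rightarrow> ('p, 's) coord_process \<Rightarrow> ('q, 'u) coord_process \<Rightarrow>
     'p measure \<Rightarrow> 'q measure \<Rightarrow> ('p \<times> 'q) measure set" where
  "couplings_of b N P Q \<mu> \<nu> = {\<pi> \<in> couplings \<mu> \<nu>. admissible b N P Q \<pi>}"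


section \<open>Wasserstein distances and relative entropy\<close>

text \<open>Power of an extended nonnegative number, for a positive exponent.\<close>

definition epowr :: "ereal \<Rightarrow> real \<Rightarrow> ereal" where
  "epowr x r = (if x = \<infinity> then \<infinity> else ereal (real_of_ereal x powr r))"

definition wass ::
    "version \<Rightarrow> nat \<Rightarrow> (nat \<Rightarrow> 'a topology) \<Rightarrow> ((nat \<Rightarrow> 'a) \<Rightarrow> (nat \<Rightarrow> 'a) \<Rightarrow> real) \<Rightarrow> real \<Rightarrow>
     (nat \<Rightarrow> 'a) measure \<Rightarrow> (nat \<Rightarrow> 'a) measure \<Rightarrow> ereal" where
  "wass b N T d p \<mu> \<mu>' =
     epowr (INF \<theta> \<in> couplings_of b N (path_process T) (path_process T) \<mu> \<mu>'.
              enn2ereal (\<integral>\<^sup>+(x, x'). ennreal (d x x' powr p) \<partial>\<theta>)) (1 / p)"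

definition wass2 ::
    "version \<Rightarrow> nat \<Rightarrow> (nat \<Rightarrow> 'a topology) \<Rightarrow> ((nat \<Rightarrow> 'a) \<Rightarrow> (nat \<Rightarrow> 'a) \<Rightarrow> real) \<Rightarrow>
     (nat \<Rightarrow> 'b topology) \<Rightarrow> ((nat \<Rightarrow> 'b) \<Rightarrow> (nat \<Rightarrow> 'b) \<Rightarrow> real) \<Rightarrow> real \<Rightarrow>
     ((nat \<Rightarrow> 'a) \<times> (nat \<Rightarrow> 'b)) measure \<Rightarrow> ((nat \<Rightarrow> 'a) \<times> (nat \<Rightarrow> 'b)) measure \<Rightarrow> ereal" where
  "wass2 b N TX dX TY dY p \<pi> \<pi>' =
     (let Z = pair_process (path_process TX) (path_process TY) in
      epowr (INF \<theta> \<in> couplings_of b N Z Z \<pi> \<pi>'.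
               enn2ereal (\<integral>\<^sup>+((x, y), (x', y')). ennreal (dX x x' powr p + dY y y' powr p) \<partial>\<theta>)) (1 / p))"

text \<open>
  \<open>D\<^sub>K\<^sub>L(\<pi>, \<pi>')\<close>; the library's \<^const>\<open>KL_divergence\<close> takes the reference measure first.  For
  probability measures with \<open>\<pi> \<lless> \<pi>'\<close> the negative part of \<open>ln (d\<pi>/d\<pi>')\<close> is always \<open>\<pi>\<close>-integrable, so
  failure of integrability means that the integral equals \<open>+\<infinity>\<close>.
\<close>

definition KL :: "'w measure \<Rightarrow> 'w measure \<Rightarrow> ereal" where
  "KL \<pi> \<pi>' =
     (if absolutely_continuous \<pi>' \<pi> \<and> integrable \<pi> (entropy_density (exp 1) \<pi>' \<pi>)
      then ereal (KL_divergence (exp 1) \<pi>' \<pi>) else \<infinity>)"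


section \<open>Transport problems\<close>

text \<open>For marginals with finite \<open>p\<close>-th moments and \<open>c\<close> measurable with growth of order at most \<open>p\<close>,
  \<open>c\<close> is integrable with respect to every coupling, so the Bochner integrals below are the usual
  ones.\<close>

definition transport_costs ::
    "((nat \<Rightarrow> 'a) \<times> (nat \<Rightarrow> 'b) \<Rightarrow> real) \<Rightarrow> ((nat \<Rightarrow> 'a) \<times> (nat \<Rightarrow> 'b)) measure \<Rightarrow> ereal" where
  "transport_costs c \<pi> = ereal (\<integral>z. c z \<partial>\<pi>)"

definition entropic_costs ::
    "(nat \<Rightarrow> 'a) measure \<Rightarrow> (nat \<Rightarrow> 'b) measure \<Rightarrow> ((nat \<Rightarrow> 'a) \<times> (nat \<Rightarrow> 'b) \<Rightarrow> real) \<Rightarrow>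
     ((nat \<Rightarrow> 'a) \<times> (nat \<Rightarrow> 'b)) measure \<Rightarrow> ereal" where
  "entropic_costs \<mu> \<nu> c \<pi> = ereal (\<integral>z. c z \<partial>\<pi>) + KL \<pi> (\<mu> \<Otimes>\<^sub>M \<nu>)"

definition V_val ::
    "version \<Rightarrow> nat \<Rightarrow> (nat \<Rightarrow> 'a topology) \<Rightarrow> (nat \<Rightarrow> 'b topology) \<Rightarrow>
     (nat \<Rightarrow> 'a) measure \<Rightarrow> (nat \<Rightarrow> 'b) measure \<Rightarrow> ((nat \<Rightarrow> 'a) \<times> (nat \<Rightarrow> 'b) \<Rightarrow> real) \<Rightarrow> ereal" where
  "V_val b N TX TY \<mu> \<nu> c =
     (INF \<pi> \<in> couplings_of b N (path_process TX) (path_process TY) \<mu> \<nu>. transport_costs c \<pi>)"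

definition E_val ::
    "version \<Rightarrow> nat \<Rightarrow> (nat \<Rightarrow> 'a topology) \<Rightarrow> (nat \<Rightarrow> 'b topology) \<Rightarrow>
     (nat \<Rightarrow> 'a) measure \<Rightarrow> (nat \<Rightarrow> 'b) measure \<Rightarrow> ((nat \<Rightarrow> 'a) \<times> (nat \<Rightarrow> 'b) \<Rightarrow> real) \<Rightarrow> ereal" where
  "E_val b N TX TY \<mu> \<nu> c =
     (INF \<pi> \<in> couplings_of b N (path_process TX) (path_process TY) \<mu> \<nu>. entropic_costs \<mu> \<nu> c \<pi>)"

definition E_optimizer ::
    "version \<Rightarrow> nat \<Rightarrow> (nat \<Rightarrow> 'a topology) \<Rightarrow> (nat \<Rightarrow> 'b topology) \<Rightarrow>
     (nat \<Rightarrow> 'a) measure \<Rightarrow> (nat \<Rightarrow> 'b) measure \<Rightarrow> ((nat \<Rightarrow> 'a) \<times> (nat \<Rightarrow> 'b) \<Rightarrow> real) \<Rightarrow>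
     ((nat \<Rightarrow> 'a) \<times> (nat \<Rightarrow> 'b)) measure \<Rightarrow> bool" where
  "E_optimizer b N TX TY \<mu> \<nu> c \<pi> \<longleftrightarrow>
     \<pi> \<in> couplings_of b N (path_process TX) (path_process TY) \<mu> \<nu> \<and>
     entropic_costs \<mu> \<nu> c \<pi> = E_val b N TX TY \<mu> \<nu> c"


section \<open>Assumptions on the cost and on the marginals\<close>

text \<open>
  The condition \<open>A(L, p)\<close>, comparing couplings of \<open>\<mu>, \<nu>\<close> with couplings of \<open>\<mu>', \<nu>'\<close>.  The instance
  \<open>\<mu>' = \<mu>\<close>, \<open>\<nu>' = \<nu>\<close> says nothing about how \<open>c\<close> reacts to a change of the marginals (it holds for
  every \<open>c (x, y) = f x + g y\<close>, whatever \<open>f\<close>, \<open>g\<close> and \<open>L\<close>), so it cannot yield stability in the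
  marginals; that requires the comparison across the two pairs.
\<close>

definition cost_A ::
    "nat \<Rightarrow> (nat \<Rightarrow> 'a topology) \<Rightarrow> ((nat \<Rightarrow> 'a) \<Rightarrow> (nat \<Rightarrow> 'a) \<Rightarrow> real) \<Rightarrow>
     (nat \<Rightarrow> 'b topology) \<Rightarrow> ((nat \<Rightarrow> 'b) \<Rightarrow> (nat \<Rightarrow> 'b) \<Rightarrow> real) \<Rightarrow>
     ((nat \<Rightarrow> 'a) \<times> (nat \<Rightarrow> 'b) \<Rightarrow> real) \<Rightarrow> real \<Rightarrow> real \<Rightarrow>
     (nat \<Rightarrow> 'a) measure \<Rightarrow> (nat \<Rightarrow> 'b) measure \<Rightarrow> (nat \<Rightarrow> 'a) measure \<Rightarrow> (nat \<Rightarrow> 'b) measure \<Rightarrow> bool"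
  where
  "cost_A N TX dX TY dY c L p \<mu> \<nu> \<mu>' \<nu>' \<longleftrightarrow>
     (\<forall>\<pi>\<in>couplings \<mu> \<nu>. \<forall>\<pi>'\<in>couplings \<mu>' \<nu>'.
        ereal \<bar>(\<integral>z. c z \<partial>\<pi>) - (\<integral>z. c z \<partial>\<pi>')\<bar> \<le> ereal L * wass2 Regular N TX dX TY dY p \<pi> \<pi>')"

definition cond_T ::
    "nat \<Rightarrow> (nat \<Rightarrow> 'a topology) \<Rightarrow> ((nat \<Rightarrow> 'a) \<Rightarrow> (nat \<Rightarrow> 'a) \<Rightarrow> real) \<Rightarrow>
     (nat \<Rightarrow> 'b topology) \<Rightarrow> ((nat \<Rightarrow> 'b) \<Rightarrow> (nat \<Rightarrow> 'b) \<Rightarrow> real) \<Rightarrow> real \<Rightarrow> real \<Rightarrow>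
     (nat \<Rightarrow> 'a) measure \<Rightarrow> (nat \<Rightarrow> 'b) measure \<Rightarrow> bool" where
  "cond_T N TX dX TY dY q C \<mu> \<nu> \<longleftrightarrow>
     (\<forall>\<pi>\<in>couplings \<mu> \<nu>. \<forall>\<pi>'\<in>couplings \<mu> \<nu>.
        wass2 Regular N TX dX TY dY q \<pi> \<pi>' \<le> ereal C * epowr (KL \<pi> \<pi>') (1 / (2 * q)))"

definition cond_Ta ::
    "nat \<Rightarrow> (nat \<Rightarrow> 'a topology) \<Rightarrow> ((nat \<Rightarrow> 'a) \<Rightarrow> (nat \<Rightarrow> 'a) \<Rightarrow> real) \<Rightarrow>
     (nat \<Rightarrow> 'b topology) \<Rightarrow> ((nat \<Rightarrow> 'b) \<Rightarrow> (nat \<Rightarrow> 'b) \<Rightarrow> real) \<Rightarrow> real \<Rightarrow> real \<Rightarrow>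
     (nat \<Rightarrow> 'a) measure \<Rightarrow> (nat \<Rightarrow> 'b) measure \<Rightarrow> bool" where
  "cond_Ta N TX dX TY dY q C \<mu> \<nu> \<longleftrightarrow>
     (\<forall>\<pi>\<in>couplings \<mu> \<nu>. \<forall>\<pi>'\<in>couplings \<mu> \<nu>.
        max (wass2 Causal N TX dX TY dY q \<pi> \<pi>') (wass2 Anticausal N TX dX TY dY q \<pi> \<pi>')
          \<le> ereal C * epowr (KL \<pi> \<pi>') (1 / (2 * q)))"

end

theory Submission
  imports Defs
begin

text \<open>
  Near-optimal bicausal couplings of \<open>\<mu>, \<mu>'\<close> and of \<open>\<nu>, \<nu>'\<close>, written as kernels, transport any
  coupling \<open>\<pi>\<close> of \<open>\<mu>, \<nu>\<close> to its shadow, a coupling of \<open>\<mu>', \<nu>'\<close> at \<open>W\<^sub>p\<close>-distance at most \<open>\<Delta>\<close> from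
  \<open>\<pi>\<close>.  Bicausality of the kernels makes the shadow inherit the (anti/bi)causality of \<open>\<pi>\<close>, and since
  \<open>\<mu> \<otimes> \<nu>\<close> is carried to \<open>\<mu>' \<otimes> \<nu>'\<close>, data processing shows that the entropy does not increase.
  With the Lipschitz assumption on the cost this gives (i).

  For (ii), the shadow of one optimizer is \<open>2L\<Delta>\<close>-optimal for the other problem.  The admissible
  couplings form a convex set, so a Pythagorean inequality bounds its entropy relative to the other
  optimizer by \<open>2L\<Delta>\<close>, the transport inequality turns this into a distance, and the triangle
  inequality concludes.  The coupling of \<open>\<pi>\<close> with its shadow is causal but need not be anticausal;
  the anticausal estimate therefore exchanges the two optimizers, which is why both pairs of marginals have
  to satisfy \<open>T\<^sub>a\<close>.  The conditional laws are obtained by disintegration on retracts of the Baire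
  space, where the required measures are built from their values on a tree of cylinders.
\<close>

section \<open>Disintegration on standard spaces\<close>

text \<open>Causality is given by conditional expectations, one time step and one pair of events at
  a time, and does not compose in this form. It is therefore turned into a statement about a kernel,
  \<open>kernel_causal\<close>, in which the whole path of the first process may be tested; in that
  form it composes and mixes, and anticausality is the same predicate with the two variables
  exchanged. The shadow of a causal coupling is reached along X' -> X -> Y -> Y', which uses
  \<open>\<gamma>\<^sub>X\<close> backwards and \<open>\<gamma>\<^sub>Y\<close> forwards, while
  anticausality uses the opposite directions; this is where bicausality enters. Entropy is treated
  as a supremum over bounded test functions, so no density of a shadow or of a mixture has to be
  computed. Infima need not be attained: every estimate is proved for all D > \<Delta> and passes to
  the limit. In 2L\<Delta> one L\<Delta> is the change of cost from an optimizer to its shadow, the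
  other the difference of the two values. The factor 2^(1/q - 1/p) is the price of lowering the
  exponent for a cost made of two terms, that is, on a space of total mass 2.\<close>

abbreviation baire :: "(nat \<Rightarrow> nat) measure" where
  "baire \<equiv> PiM UNIV (\<lambda>_. count_space UNIV)"

section \<open>Cylinders of the Baire space and measures built on them\<close>

definition cyl :: "nat list \<Rightarrow> (nat \<Rightarrow> nat) set" where
  "cyl s = {z. \<forall>i<length s. z i = s ! i}"

lemma cyl_Nil [simp]: "cyl [] = UNIV"
  by (simp add: cyl_def)

lemma cyl_eq: "cyl s = {z. map z [0..<length s] = s}"
proof -
  have "map z [0..<length s] = s \<longleftrightarrow> (\<forall>i<length s. z i = s ! i)" for z
    using list_eq_iff_nth_eq[of "map z [0..<length s]" s] by auto
  then show ?thesis by (simp add: cyl_def)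
qed

lemma sets_cyl [measurable]: "cyl s \<in> sets baire"
proof -
  have "cyl s = {z \<in> space baire. \<forall>i<length s. z i = s ! i}"
    by (auto simp: cyl_def space_PiM)
  also have "\<dots> \<in> sets baire" by measurable
  finally show ?thesis .
qed

text \<open>On \<open>cyl r\<close> the first \<open>length s\<close> values are fixed by the longer
  word, so \<open>r\<close> alone decides membership in \<open>cyl s\<close>.\<close>

lemma cyl_disjoint_or_nested:
  assumes "length s \<le> length r"
  shows "cyl s \<inter> cyl r = (if take (length s) r = s then cyl r else {})"
proof -
  have "z \<in> cyl r \<Longrightarrow> map z [0..<length s] = take (length s) r" for z
    using assms by (intro nth_equalityI) (auto simp: cyl_def)
  then have "z \<in> cyl r \<Longrightarrow> z \<in> cyl s \<longleftrightarrow> take (length s) r = s" for z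
    unfolding cyl_eq[of s] by simp
  then show ?thesis by auto
qed

text \<open>Incomparable words have disjoint cylinders, which is why the empty set is put into the
  generator.\<close>

lemma Int_stable_cyl: "Int_stable (insert {} (range cyl))"
proof (rule Int_stableI)
  fix A B assume "A \<in> insert {} (range cyl)" "B \<in> insert {} (range cyl)"
  then consider "A = {}" | "B = {}" | s r where "A = cyl s" "B = cyl r" by auto
  then show "A \<inter> B \<in> insert {} (range cyl)"
  proof cases
    case 3
    show ?thesis
    proof (cases "length s \<le> length r")
      case True then show ?thesis unfolding 3 by (simp add: cyl_disjoint_or_nested)
    next
      case False then show ?thesis unfolding 3 
        by (subst Int_commute) (simp add: cyl_disjoint_or_nested)
    qed
  qed auto
qed

lemma sets_baire: "sets baire = sigma_sets UNIV (insert {} (range cyl))"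
proof
  show "sigma_sets UNIV (insert {} (range cyl)) \<subseteq> sets baire"
    by (rule sets.sigma_sets_subset'[where M=baire, simplified space_PiM, simplified])
       (use sets_cyl[of "[]"] in \<open>auto intro: sets_cyl\<close>)
  have *: "{z. z i \<in> A} \<in> sigma_sets UNIV (insert {} (range cyl))" for i and A :: "nat set"
  proof -
    \<comment> \<open>Coordinate \<open>i\<close> is decided by the first \<open>Suc i\<close>
      values, and there are only countably many words of that length.\<close>
    have "{z. z i \<in> A} = (\<Union>s\<in>{s. length s = Suc i \<and> s ! i \<in> A}. cyl s)"
    proof safe
      fix z :: "nat \<Rightarrow> nat" assume "z i \<in> A"
      then show "z \<in> (\<Union>s\<in>{s. length s = Suc i \<and> s ! i \<in> A}. cyl s)"
        by (intro UN_I[where a="map z [0..<Suc i]"]) (auto simp: cyl_def simp del: upt_Suc)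
    qed (auto simp: cyl_def)
    also have "\<dots> \<in> sigma_sets UNIV (insert {} (range cyl))"
      by (rule sigma_sets_UNION) (auto intro: sigma_sets.Basic)
    finally show ?thesis .
  qed
  show "sets baire \<subseteq> sigma_sets UNIV (insert {} (range cyl))"
    unfolding sets_PiM_single space_count_space PiE_UNIV_domain
    by (simp, rule sigma_sets_mono) (use * in auto)
qed

text \<open>The ratios \<open>\<rho> (s @ [j]) / \<rho> s\<close> are transition probabilities given
  the past word \<open>s\<close>, so the Ionescu-Tulcea construction yields a process whose word
  probabilities multiply out to \<open>\<rho>\<close>.\<close>

lemma tree_measure_exists:
  fixes \<rho> :: "nat list \<Rightarrow> ennreal"
  assumes root: "\<rho> [] = 1" and child: "\<And>s. (\<Sum>j. \<rho> (s @ [j])) = \<rho> s"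
  shows "\<exists>\<kappa>. sets \<kappa> = sets baire \<and> (\<forall>s. emeasure \<kappa> (cyl s) = \<rho> s)"
proof -
  have le: "\<rho> (s @ [j]) \<le> \<rho> s" for s j
    unfolding child[of s, symmetric]
    using sum_le_suminf[of "\<lambda>j. \<rho> (s @ [j])" "{j}"] by auto
  have le1: "\<rho> s \<le> 1" for s
    by (induction s rule: rev_induct) (auto simp: root intro: order_trans[OF le])
  have fin: "\<rho> s \<noteq> \<top>" for s
    using le1[of s] by (metis ennreal_one_neq_top top.extremum_unique)
  \<comment> \<open>A word of mass zero has no ratios. Any probability measure will do there: the
    masses of its children vanish too, so the product rule \<open>K_mult\<close> survives.\<close>
  define K :: "nat list \<Rightarrow> nat measure" where
    "K s = (if \<rho> s = 0 then return (count_space UNIV) 0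
            else density (count_space UNIV) (\<lambda>j. \<rho> (s @ [j]) / \<rho> s))" for s
  have sets_K: "sets (K s) = UNIV" for s by (simp add: K_def)
  have prob_K: "prob_space (K s)" for s
  proof (cases "\<rho> s = 0")
    case False
    have "emeasure (K s) (space (K s)) = (\<Sum>j. \<rho> (s @ [j]) / \<rho> s)"
      using False by (simp add: K_def emeasure_density nn_integral_count_space_nat)
    also have "\<dots> = 1"
      using False fin[of s] by (simp add: ennreal_suminf_divide child ennreal_divide_self top.not_eq_extremum[symmetric] zero_less_iff_neq_zero)
    finally show ?thesis by (rule prob_spaceI)
  qed (auto simp: K_def intro: prob_space_return)
  have K_mult: "\<rho> s * emeasure (K s) {j} = \<rho> (s @ [j])" for s j
  proof (cases "\<rho> s = 0")
    case True then show ?thesis using le[of s j] by simp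
  next
    case False
    then have "emeasure (K s) {j} = \<rho> (s @ [j]) / \<rho> s"
      by (simp add: K_def emeasure_density nn_integral_count_space_indicator[symmetric] one_ennreal_def[symmetric])
    then show ?thesis using False fin[of s]
      by (simp add: ennreal_times_divide mult.commute[of "\<rho> s"] ennreal_mult_divide_eq)
  qed
  let ?M = "\<lambda>_::nat. count_space (UNIV :: nat set)"
  define P where "P = (\<lambda>n (\<omega> :: nat \<Rightarrow> nat). K (map \<omega> [0..<n]))"
  have meas_map: "(\<lambda>\<omega>. map \<omega> [0..<n]) \<in> PiM {0..<n} ?M \<rightarrow>\<^sub>M count_space UNIV" for n
  proof (subst measurable_count_space_eq2_countable, safe)
    fix s :: "nat list"
    have "(\<lambda>\<omega>. map \<omega> [0..<n]) -` {s} \<inter> space (PiM {0..<n} ?M) =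
      {\<omega> \<in> space (PiM {0..<n} ?M). length s = n \<and> (\<forall>i\<in>{0..<n}. \<omega> i = s ! i)}"
      using list_eq_iff_nth_eq[of "map _ [0..<n]" s] by auto
    also have "\<dots> \<in> sets (PiM {0..<n} ?M)" by measurable
    finally show "(\<lambda>\<omega>. map \<omega> [0..<n]) -` {s} \<inter> space (PiM {0..<n} ?M) \<in> sets (PiM {0..<n} ?M)" .
  qed auto
  have K_meas: "K \<in> count_space UNIV \<rightarrow>\<^sub>M subprob_algebra (count_space UNIV)"
    by (simp add: space_subprob_algebra sets_K prob_K prob_space_imp_subprob_space)
  interpret IT: Ionescu_Tulcea P ?M
  proof (rule Ionescu_Tulcea.intro, goal_cases)
    case (1 i)
    show ?case unfolding P_def by (rule measurable_compose[OF meas_map K_meas])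
  next
    case (2 i \<omega>)
    show ?case unfolding P_def by (rule prob_K)
  qed
  have sing: "{\<omega>} \<in> sets (PiM {0..<n} ?M)" if "\<omega> \<in> extensional {0..<n}" for n \<omega>
  proof -
    have "{\<omega>} = PiE {0..<n} (\<lambda>i. {\<omega> i})"
      using PiE_singleton[OF that] by simp
    then show ?thesis by simp
  qed
  \<comment> \<open>It suffices to weigh single histories: a cylinder is the preimage of one
    history, and each time step contributes one factor by \<open>K_mult\<close>.\<close>
  have C: "emeasure (IT.C 0 n (\<lambda>_. undefined)) {\<omega>} = \<rho> (map \<omega> [0..<n])"
    if "\<omega> \<in> extensional {0..<n}" for n \<omega>
    using that
  proof (induction n arbitrary: \<omega>)
    case 0
    then have "\<omega> = (\<lambda>_. undefined)" by (auto simp: extensional_def)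
    then show ?case using sing[of "\<lambda>_. undefined" 0] by (simp add: root)
  next
    case (Suc n)
    let ?u = "\<lambda>_. undefined" and ?\<omega> = "restrict \<omega> {0..<n}"
    have u: "?u \<in> space (PiM {0..<0} ?M)" by (simp add: space_PiM)
    have ext: "\<omega>'(n := j) = \<omega> \<longleftrightarrow> \<omega>' = ?\<omega> \<and> j = \<omega> n" if "\<omega>' \<in> extensional {0..<n}" for \<omega>' j
    proof
      assume *: "\<omega>'(n := j) = \<omega>"
      have "\<omega>' i = ?\<omega> i" for i
        using that fun_cong[OF *, of i] by (cases "i < n") (auto simp: extensional_def)
      then show "\<omega>' = ?\<omega> \<and> j = \<omega> n" using fun_cong[OF *, of n] by auto
    next
      assume *: "\<omega>' = ?\<omega> \<and> j = \<omega> n"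
      show "\<omega>'(n := j) = \<omega>"
      proof
        show "(\<omega>'(n := j)) i = \<omega> i" for i
          using * Suc.prems by (cases "i < n") (auto simp: extensional_def)
      qed
    qed
    have "emeasure (IT.C 0 (Suc n) ?u) {\<omega>} = (\<integral>\<^sup>+\<omega>'. emeasure (IT.eP n \<omega>') {\<omega>} \<partial>IT.C 0 n ?u)"
      using IT.space_C[OF u, of n] IT.measurable_eP[of n]  sing[OF Suc.prems]
      by (simp add: emeasure_bind[where N="PiM {0..<Suc n} ?M"] measurable_cong_sets[OF IT.sets_C[OF u]] IT.non_empty PiE_eq_empty_iff space_PiM)
    also have "\<dots> = (\<integral>\<^sup>+\<omega>'. emeasure (K (map ?\<omega> [0..<n])) {\<omega> n} * indicator {?\<omega>} \<omega>' \<partial>IT.C 0 n ?u)"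
    proof (rule nn_integral_cong)
      fix \<omega>' assume "\<omega>' \<in> space (IT.C 0 n ?u)"
      then have w: "\<omega>' \<in> space (PiM {0..<n} ?M)" using IT.space_C[OF u, of n] by simp
      then have "\<omega>' \<in> extensional {0..<n}" by (simp add: space_PiM PiE_iff)
      have e: "(\<lambda>x. \<omega>'(n := x)) -` {\<omega>} = (if \<omega>' = ?\<omega> then {\<omega> n} else {})"
        unfolding vimage_def singleton_iff ext[OF \<open>\<omega>' \<in> extensional {0..<n}\<close>] by simp
      show "emeasure (IT.eP n \<omega>') {\<omega>} = emeasure (K (map ?\<omega> [0..<n])) {\<omega> n} * indicator {?\<omega>} \<omega>'"
        unfolding IT.emeasure_eP[OF w sing[OF Suc.prems]] e by (simp add: P_def)
    qed
    also have "\<dots> = emeasure (K (map ?\<omega> [0..<n])) {\<omega> n} * \<rho> (map ?\<omega> [0..<n])"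
      using sing[OF restrict_extensional] IT.sets_C[OF u]
      by (subst nn_integral_cmult_indicator)
         (simp, simp only: Suc.IH[OF restrict_extensional])
    also have "map ?\<omega> [0..<n] = map \<omega> [0..<n]" by simp
    finally show ?case using K_mult[of "map \<omega> [0..<n]" "\<omega> n"] by (simp add: mult.commute)
  qed
  have "emeasure IT.PF.lim (cyl s) = \<rho> s" for s
  proof -
    let ?n = "length s" let ?\<omega> = "restrict (nth s) {0..<length s}"
    have "cyl s = IT.PF.emb UNIV {0..<?n} {?\<omega>}"
      by (auto simp: cyl_def prod_emb_def fun_eq_iff restrict_def) metis
    then have "emeasure IT.PF.lim (cyl s) = IT.CI {0..<?n} {?\<omega>}"
      using IT.lim[of "{0..<?n}" "{?\<omega>}"] sing[of ?\<omega> ?n] by simp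
    also have "\<dots> = IT.C 0 ?n (\<lambda>_. undefined) (IT.PF.emb {0..<?n} {0..<?n} {?\<omega>})"
      by (rule IT.emeasure_CI) (simp_all add: sing)
    also have "IT.PF.emb {0..<?n} {0..<?n} {?\<omega>} = {?\<omega>}"
      by (rule prod_emb_id) simp
    also have "emeasure (IT.C 0 ?n (\<lambda>_. undefined)) {?\<omega>} = \<rho> (map ?\<omega> [0..<?n])" by (rule C) simp
    also have "map ?\<omega> [0..<?n] = s" by (rule nth_equalityI) auto
    finally show ?thesis .
  qed
  then show ?thesis using IT.PF.sets_lim by blast
qed

lemma measure_eqI_cyl:
  assumes "sets \<kappa>1 = sets baire" "sets \<kappa>2 = sets baire" "emeasure \<kappa>1 UNIV \<noteq> \<infinity>"
    and "\<And>s. emeasure \<kappa>1 (cyl s) = emeasure \<kappa>2 (cyl s)"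
  shows "\<kappa>1 = \<kappa>2"
proof (rule measure_eqI_generator_eq[OF Int_stable_cyl, where \<Omega>=UNIV and A="\<lambda>_. UNIV"])
  show "range (\<lambda>_::nat. UNIV) \<subseteq> insert {} (range cyl)"
    by (auto intro: image_eqI[where x="[]"])
qed (use assms sets_baire in auto)

lemma prob_space_baireI:
  assumes "sets \<kappa> = sets baire" "emeasure \<kappa> (cyl []) = 1"
  shows "prob_space \<kappa>"
  using assms sets_eq_imp_space_eq[OF assms(1)] by (intro prob_spaceI) (simp add: space_PiM)

text \<open>For a fixed word \<open>s\<close>, the measure of \<open>A \<times> cyl s\<close> as a
  function of \<open>A\<close> has a density \<open>f s\<close> with respect to the first marginal.
  Uniqueness of densities gives the tree relations almost everywhere, one null set for each of
  countably many words, and \<open>tree_measure_exists\<close> turns the densities at a good point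
  into a measure.\<close>

lemma disintegration_baire:
  assumes \<gamma>: "prob_space \<gamma>" and sets_\<gamma>: "sets \<gamma> = sets (M \<Otimes>\<^sub>M baire)"
  shows "\<exists>\<kappa>\<in>M \<rightarrow>\<^sub>M prob_algebra baire. \<forall>A\<in>sets M. \<forall>s.
    emeasure \<gamma> (A \<times> cyl s) = (\<integral>\<^sup>+x\<in>A. emeasure (\<kappa> x) (cyl s) \<partial>distr \<gamma> M fst)"
proof -
  interpret \<gamma>: prob_space \<gamma> by fact
  note sets_\<gamma>[measurable_cong]
  define \<mu> where "\<mu> = distr \<gamma> M fst"
  have sets_\<mu>[measurable_cong, simp]: "sets \<mu> = sets M" by (simp add: \<mu>_def)
  have sp\<mu>: "space \<mu> = space M" by (simp add: \<mu>_def)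
  interpret \<mu>: prob_space \<mu> unfolding \<mu>_def by (rule \<gamma>.prob_space_distr) simp
  have sp\<gamma>: "space \<gamma> = space M \<times> UNIV"
    using sets_eq_imp_space_eq[OF sets_\<gamma>] by (simp add: space_pair_measure space_PiM)
  have rect[measurable]: "A \<in> sets M \<Longrightarrow> A \<times> cyl s \<in> sets \<gamma>" for A s
    by (simp add: sets_\<gamma>)
  define \<nu> where "\<nu> s = distr (density \<gamma> (indicator (space M \<times> cyl s))) M fst" for s
  have sets_\<nu>: "sets (\<nu> s) = sets \<mu>" for s by (simp add: \<nu>_def)
  have \<nu>: "emeasure (\<nu> s) A = emeasure \<gamma> (A \<times> cyl s)" if "A \<in> sets M" for s A
  proof -
    have "fst -` A \<inter> space \<gamma> = A \<times> UNIV"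
      using sets.sets_into_space[OF that] by (auto simp: sp\<gamma>)
    moreover have "(space M \<times> cyl s) \<inter> (A \<times> UNIV) = A \<times> cyl s"
      using sets.sets_into_space[OF that] by auto
    moreover have "A \<times> UNIV \<in> sets \<gamma>" using rect[OF that, of "[]"] by simp
    ultimately show ?thesis using that unfolding \<nu>_def
      by (subst emeasure_distr) 
         (auto simp: emeasure_density sets_\<gamma> indicator_inter_arith[symmetric])
  qed
  have \<mu>: "emeasure \<mu> A = emeasure \<gamma> (A \<times> cyl [])" if "A \<in> sets M" for A
  proof -
    have "fst -` A \<inter> space \<gamma> = A \<times> UNIV"
      using sets.sets_into_space[OF that] by (auto simp: sp\<gamma>)
    then show ?thesis unfolding \<mu>_def using that by (subst emeasure_distr) auto
  qed
  have ac: "absolutely_continuous \<mu> (\<nu> s)" for s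
    unfolding absolutely_continuous_def
  proof
    fix A assume "A \<in> null_sets \<mu>"
    then have A: "A \<in> sets M" and 0: "emeasure \<gamma> (A \<times> cyl []) = 0" by (auto simp: \<mu> null_sets_def)
    have "emeasure \<gamma> (A \<times> cyl s) \<le> emeasure \<gamma> (A \<times> cyl [])"
      using rect[OF A, of "[]"] by (intro emeasure_mono) auto
    with A 0 show "A \<in> null_sets (\<nu> s)" by (simp add: null_sets_def \<nu> sets_\<nu>)
  qed
  define f where "f s = RN_deriv \<mu> (\<nu> s)" for s
  have f_meas[measurable]: "f s \<in> borel_measurable M" for s
    using borel_measurable_RN_deriv[of \<mu> "\<nu> s"] unfolding f_def
    by (simp add: measurable_cong_sets[OF sets_\<mu> refl])
  have dens: "density \<mu> (f s) = \<nu> s" for s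
    unfolding f_def by (rule \<mu>.density_RN_deriv[OF ac sets_\<nu>])
  have int_f: "(\<integral>\<^sup>+x\<in>A. f s x \<partial>\<mu>) = emeasure \<gamma> (A \<times> cyl s)" if "A \<in> sets M" for s A
    using \<nu>[OF that, of s] that by (simp add: dens[symmetric] emeasure_density)
  have root: "AE x in \<mu>. 1 = f [] x"
    unfolding f_def
  proof (rule \<mu>.RN_deriv_unique)
    show "density \<mu> (\<lambda>_. 1) = \<nu> []"
      by (rule measure_eqI) (simp_all add: sets_\<nu> density_1 \<mu> \<nu>)
  qed simp
  have child: "AE x in \<mu>. (\<Sum>j. f (s @ [j]) x) = f s x" for s
    unfolding f_def[of s]
  proof (rule \<mu>.RN_deriv_unique)
    show "density \<mu> (\<lambda>x. \<Sum>j. f (s @ [j]) x) = \<nu> s"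
    proof (rule measure_eqI)
      fix A assume "A \<in> sets (density \<mu> (\<lambda>x. \<Sum>j. f (s @ [j]) x))"
      then have A[measurable]: "A \<in> sets M" by simp
      have "emeasure (density \<mu> (\<lambda>x. \<Sum>j. f (s @ [j]) x)) A = (\<Sum>j. (\<integral>\<^sup>+x\<in>A. f (s @ [j]) x \<partial>\<mu>))"
        by (simp add: emeasure_density nn_integral_suminf[symmetric] flip: ennreal_suminf_multc)
      also have "\<dots> = (\<Sum>j. emeasure \<gamma> (A \<times> cyl (s @ [j])))"
        by (simp add: int_f)
      also have "\<dots> = emeasure \<gamma> (\<Union>j. A \<times> cyl (s @ [j]))"
      proof (rule suminf_emeasure)
        show "disjoint_family (\<lambda>j. A \<times> cyl (s @ [j]))"
          by (force simp: disjoint_family_on_def cyl_def nth_append)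
      qed auto
      also have "(\<Union>j. A \<times> cyl (s @ [j])) = A \<times> cyl s"
        by (force simp: cyl_def nth_append less_Suc_eq)
      finally show "emeasure (density \<mu> (\<lambda>x. \<Sum>j. f (s @ [j]) x)) A = emeasure (\<nu> s) A"
        by (simp add: \<nu>)
    qed (simp add: sets_\<nu>)
  qed simp
  define G where "G = {x \<in> space M. f [] x = 1 \<and> (\<forall>s. (\<Sum>j. f (s @ [j]) x) = f s x)}"
  have G[measurable]: "G \<in> sets M" unfolding G_def by measurable
  have AE_G: "AE x in \<mu>. x \<in> G"
    using root child[THEN AE_all_countable[THEN iffD2, OF allI]] AE_space
    by eventually_elim (auto simp: G_def sp\<mu>)
  \<comment> \<open>The word masses of the point mass at the zero sequence. They are used off
    \<open>G\<close>, so that \<open>\<kappa> x\<close> is a probability measure for every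
    \<open>x\<close> and not just for almost every one.\<close>
  define z :: "nat list \<Rightarrow> ennreal" where "z s = (if set s \<subseteq> {0} then 1 else 0)" for s
  have z_child: "(\<Sum>j. z (s @ [j])) = z s" for s
    using suminf_finite[of "{0}" "\<lambda>j. z (s @ [j])"] by (auto simp: z_def)
  have "\<exists>\<kappa>. sets \<kappa> = sets baire \<and> (\<forall>s. emeasure \<kappa> (cyl s) = (if x \<in> G then f s x else z s))" for x
  proof (cases "x \<in> G")
    case True
    then show ?thesis by simp (rule tree_measure_exists, auto simp: G_def)
  next
    case False
    then show ?thesis by simp (rule tree_measure_exists, simp add: z_def, rule z_child)
  qed
  then obtain \<kappa> where sets_\<kappa>: "\<And>x. sets (\<kappa> x) = sets baire"
    and \<kappa>: "\<And>x s. emeasure (\<kappa> x) (cyl s) = (if x \<in> G then f s x else z s)"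
    by metis
  have "\<kappa> \<in> M \<rightarrow>\<^sub>M prob_algebra baire"
  proof (rule measurable_prob_algebra_generated[OF sets_baire Int_stable_cyl])
    show "prob_space (\<kappa> x)" for x
      by (rule prob_space_baireI[OF sets_\<kappa>]) (unfold \<kappa>, auto simp: G_def z_def)
    show "(\<lambda>x. emeasure (\<kappa> x) A) \<in> borel_measurable M" if "A \<in> insert {} (range cyl)" for A
      using that by (auto simp: \<kappa>)
  qed (auto simp: sets_\<kappa>)
  moreover have "emeasure \<gamma> (A \<times> cyl s) = (\<integral>\<^sup>+x\<in>A. emeasure (\<kappa> x) (cyl s) \<partial>\<mu>)"
    if "A \<in> sets M" for A s
    unfolding int_f[OF that, symmetric]
    by (rule nn_integral_cong_AE) (use AE_G in eventually_elim, simp add: \<kappa>)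
  ultimately show ?thesis unfolding \<mu>_def by blast
qed

text \<open>A measurable space is standard if it is a measurable retract of the Baire space.  Polish
  spaces are, and finite products inherit the property by interleaving codes.\<close>

definition standard_space :: "'a measure \<Rightarrow> bool" where
  "standard_space M \<longleftrightarrow> (\<exists>f\<in>M \<rightarrow>\<^sub>M baire. \<exists>g\<in>baire \<rightarrow>\<^sub>M M. \<forall>x\<in>space M. g (f x) = x)"

section \<open>Kernels and disintegration\<close>

lemma standard_space_retract:
  assumes "standard_space N" "f \<in> M \<rightarrow>\<^sub>M N" "g \<in> N \<rightarrow>\<^sub>M M" "\<And>x. x \<in> space M \<Longrightarrow> g (f x) = x"
  shows "standard_space M"
proof -
  obtain f' g' where "f' \<in> N \<rightarrow>\<^sub>M baire" "g' \<in> baire \<rightarrow>\<^sub>M N" "\<And>x. x \<in> space N \<Longrightarrow> g' (f' x) = x"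
    using assms(1) unfolding standard_space_def by blast
  then show ?thesis using assms(2-) measurable_space[OF assms(2)] unfolding standard_space_def
    by (intro bexI[of _ "\<lambda>x. f' (f x)"] bexI[of _ "\<lambda>z. g (g' z)"]) auto
qed

text \<open>The semidirect product of a law and a kernel; taking it is the inverse operation of
  disintegration.\<close>

definition kernel_prod :: "'a measure \<Rightarrow> 'b measure \<Rightarrow> ('a \<Rightarrow> 'b measure) \<Rightarrow> ('a \<times> 'b) measure" where
  "kernel_prod \<mu> N \<kappa> = \<mu> \<bind> (\<lambda>x. distr (\<kappa> x) (\<mu> \<Otimes>\<^sub>M N) (Pair x))"

lemma kernel_sets:
  assumes "\<kappa> \<in> M \<rightarrow>\<^sub>M prob_algebra N" "x \<in> space M"
  shows "sets (\<kappa> x) = sets N" "space (\<kappa> x) = space N" "prob_space (\<kappa> x)"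
  using measurable_space[OF assms] sets_eq_imp_space_eq[of "\<kappa> x" N] by (auto simp: space_prob_algebra)

lemma nn_integral_kernel_measurable [measurable]:
  assumes [measurable]: "(\<lambda>(x, y). f x y) \<in> borel_measurable (M \<Otimes>\<^sub>M N)" "\<kappa> \<in> M \<rightarrow>\<^sub>M prob_algebra N"
  shows "(\<lambda>x. \<integral>\<^sup>+y. f x y \<partial>\<kappa> x) \<in> borel_measurable M"
  by (rule nn_integral_measurable_subprob_algebra2[OF assms(1) measurable_prob_algebraD]) fact

lemma
  assumes \<mu>: "prob_space \<mu>" and sets_\<mu>: "sets \<mu> = sets M" and \<kappa>: "\<kappa> \<in> M \<rightarrow>\<^sub>M prob_algebra N"
  shows sets_kernel_prod: "sets (kernel_prod \<mu> N \<kappa>) = sets (M \<Otimes>\<^sub>M N)"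
    and prob_space_kernel_prod: "prob_space (kernel_prod \<mu> N \<kappa>)"
    and nn_integral_kernel_prod: "\<And>f. f \<in> borel_measurable (M \<Otimes>\<^sub>M N) \<Longrightarrow>
      (\<integral>\<^sup>+z. f z \<partial>kernel_prod \<mu> N \<kappa>) = (\<integral>\<^sup>+x. \<integral>\<^sup>+y. f (x, y) \<partial>\<kappa> x \<partial>\<mu>)"
proof -
  interpret prob_space \<mu> by fact
  note \<kappa>[measurable] sets_\<mu>[measurable_cong]
  have sp: "space \<mu> = space M" using sets_eq_imp_space_eq[OF sets_\<mu>] .
  have \<kappa>': "\<kappa> \<in> \<mu> \<rightarrow>\<^sub>M prob_algebra N" by simp
  have K: "(\<lambda>x. distr (\<kappa> x) (\<mu> \<Otimes>\<^sub>M N) (Pair x)) \<in> \<mu> \<rightarrow>\<^sub>M prob_algebra (\<mu> \<Otimes>\<^sub>M N)"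
    by (rule measurable_distr_prob_space2[OF \<kappa>']) simp
  have in\<mu>: "\<mu> \<in> space (prob_algebra \<mu>)" by (simp add: space_prob_algebra \<mu>)
  have s: "sets (\<mu> \<Otimes>\<^sub>M N) = sets (M \<Otimes>\<^sub>M N)" by (rule sets_pair_measure_cong[OF sets_\<mu> refl])
  show "sets (kernel_prod \<mu> N \<kappa>) = sets (M \<Otimes>\<^sub>M N)"
    unfolding kernel_prod_def s[symmetric] by (rule sets_bind'[OF in\<mu> K])
  show "prob_space (kernel_prod \<mu> N \<kappa>)"
    unfolding kernel_prod_def by (rule prob_space_bind'[OF in\<mu> K])
  show "(\<integral>\<^sup>+z. f z \<partial>kernel_prod \<mu> N \<kappa>) = (\<integral>\<^sup>+x. \<integral>\<^sup>+y. f (x, y) \<partial>\<kappa> x \<partial>\<mu>)"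
    if f[measurable]: "f \<in> borel_measurable (M \<Otimes>\<^sub>M N)" for f
    unfolding kernel_prod_def
  proof (subst nn_integral_bind[OF _ measurable_prob_algebraD[OF K]])
    show "(\<integral>\<^sup>+x. \<integral>\<^sup>+z. f z \<partial>distr (\<kappa> x) (\<mu> \<Otimes>\<^sub>M N) (Pair x) \<partial>\<mu>) = (\<integral>\<^sup>+x. \<integral>\<^sup>+y. f (x, y) \<partial>\<kappa> x \<partial>\<mu>)"
    proof (rule nn_integral_cong)
      fix x assume x: "x \<in> space \<mu>"
      have [measurable_cong]: "sets (\<kappa> x) = sets N" using kernel_sets[OF \<kappa>', OF x] by simp
      show "(\<integral>\<^sup>+z. f z \<partial>distr (\<kappa> x) (\<mu> \<Otimes>\<^sub>M N) (Pair x)) = (\<integral>\<^sup>+y. f (x, y) \<partial>\<kappa> x)"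
        using x by (subst nn_integral_distr) (auto simp: sp)
    qed
  qed (simp add: measurable_cong_sets[OF s refl] f)
qed

lemma distr_fst_kernel_prod:
  assumes \<mu>: "prob_space \<mu>" and sets_\<mu>: "sets \<mu> = sets M" and \<kappa>[measurable]: "\<kappa> \<in> M \<rightarrow>\<^sub>M prob_algebra N"
  shows "distr (kernel_prod \<mu> N \<kappa>) \<mu> fst = \<mu>"
proof (rule measure_eqI)
  note sets_\<mu>[measurable_cong] sets_kernel_prod[OF assms, measurable_cong]
  fix A assume "A \<in> sets (distr (kernel_prod \<mu> N \<kappa>) \<mu> fst)"
  then have A[measurable]: "A \<in> sets M" by (simp add: sets_\<mu>)
  have "emeasure (distr (kernel_prod \<mu> N \<kappa>) \<mu> fst) A = (\<integral>\<^sup>+z. indicator A (fst z) \<partial>kernel_prod \<mu> N \<kappa>)"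
    by (subst nn_integral_indicator[symmetric], simp add: sets_\<mu>, subst nn_integral_distr) (auto simp: sets_\<mu>)
  also have "\<dots> = (\<integral>\<^sup>+x. \<integral>\<^sup>+y. indicator A x \<partial>\<kappa> x \<partial>\<mu>)"
    by (subst nn_integral_kernel_prod[OF assms]) auto
  also have "\<dots> = (\<integral>\<^sup>+x. indicator A x \<partial>\<mu>)"
    using sets_eq_imp_space_eq[OF sets_\<mu>] prob_space.emeasure_space_1[OF kernel_sets(3)[OF \<kappa>]]
    by (intro nn_integral_cong) (simp add: kernel_sets[OF \<kappa>])
  finally show "emeasure (distr (kernel_prod \<mu> N \<kappa>) \<mu> fst) A = emeasure \<mu> A"
    by (simp add: sets_\<mu>)
qed simp

lemma prob_measure_eqI_pair:
  assumes sets: "sets \<gamma> = sets (M \<Otimes>\<^sub>M N)" "sets \<gamma>' = sets (M \<Otimes>\<^sub>M N)" and "prob_space \<gamma>"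
    and eq: "\<And>A B. A \<in> sets M \<Longrightarrow> B \<in> sets N \<Longrightarrow> emeasure \<gamma> (A \<times> B) = emeasure \<gamma>' (A \<times> B)"
  shows "\<gamma> = \<gamma>'"
proof (rule measure_eqI_generator_eq[OF Int_stable_pair_measure_generator, where \<Omega>="space M \<times> space N" and A="\<lambda>_. space M \<times> space N"])
  show "emeasure \<gamma> (space M \<times> space N) \<noteq> \<infinity>" for i :: nat
    using prob_space.emeasure_space_1[OF assms(3)] sets_eq_imp_space_eq[OF sets(1)]
    by (simp add: space_pair_measure)
qed (use assms in \<open>auto simp: sets_pair_measure dest: sets.sets_into_space\<close>)

text \<open>Encode the second coordinate by \<open>f\<close>, disintegrate over the Baire space and
  push the kernel back along \<open>g\<close>. Since \<open>g (f y) = y\<close>, an event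
  \<open>B\<close> for the original coordinate corresponds to the preimage of \<open>B\<close> under
  \<open>g\<close> for its code.\<close>

lemma disintegration:
  assumes N: "standard_space N" and \<gamma>: "prob_space \<gamma>" and sets_\<gamma>: "sets \<gamma> = sets (M \<Otimes>\<^sub>M N)"
  obtains \<kappa> where "\<kappa> \<in> M \<rightarrow>\<^sub>M prob_algebra N" "\<gamma> = kernel_prod (distr \<gamma> M fst) N \<kappa>"
proof -
  interpret \<gamma>: prob_space \<gamma> by fact
  note sets_\<gamma>[measurable_cong]
  obtain f g where f[measurable]: "f \<in> N \<rightarrow>\<^sub>M baire" and g[measurable]: "g \<in> baire \<rightarrow>\<^sub>M N"
    and gf: "\<And>y. y \<in> space N \<Longrightarrow> g (f y) = y"
    using N unfolding standard_space_def by blast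
  have sp: "space \<gamma> = space M \<times> space N"
    using sets_eq_imp_space_eq[OF sets_\<gamma>] by (simp add: space_pair_measure)
  define \<gamma>' where "\<gamma>' = distr \<gamma> (M \<Otimes>\<^sub>M baire) (\<lambda>(x, y). (x, f y))"
  have p\<gamma>': "prob_space \<gamma>'" unfolding \<gamma>'_def by (rule \<gamma>.prob_space_distr) simp
  have s\<gamma>': "sets \<gamma>' = sets (M \<Otimes>\<^sub>M baire)" by (simp add: \<gamma>'_def)
  define \<mu> where "\<mu> = distr \<gamma> M fst"
  have \<mu>': "distr \<gamma>' M fst = \<mu>"
    unfolding \<gamma>'_def \<mu>_def by (subst distr_distr) (auto intro!: distr_cong simp: sp)
  have p\<mu>: "prob_space \<mu>" unfolding \<mu>_def by (rule \<gamma>.prob_space_distr) simp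
  have s\<mu>[measurable_cong]: "sets \<mu> = sets M" by (simp add: \<mu>_def)
  obtain \<kappa> where \<kappa>[measurable]: "\<kappa> \<in> M \<rightarrow>\<^sub>M prob_algebra baire"
    and eq: "\<And>A s. A \<in> sets M \<Longrightarrow> emeasure \<gamma>' (A \<times> cyl s) = (\<integral>\<^sup>+x\<in>A. emeasure (\<kappa> x) (cyl s) \<partial>\<mu>)"
    using disintegration_baire[OF p\<gamma>' s\<gamma>'] unfolding \<mu>' by blast
  have spb: "space baire = UNIV" by (simp add: space_PiM)
  define \<kappa>' where "\<kappa>' x = distr (\<kappa> x) N g" for x
  have \<kappa>'[measurable]: "\<kappa>' \<in> M \<rightarrow>\<^sub>M prob_algebra N"
    unfolding \<kappa>'_def by (rule measurable_distr_prob_space2[OF \<kappa>]) simp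
  \<comment> \<open>\<open>disintegration_baire\<close> only speaks of cylinders. For fixed
    \<open>A\<close> both sides are finite measures in \<open>B\<close>, realised as
    \<open>?a\<close> and \<open>?b\<close>, so agreement on cylinders suffices.\<close>
  have eq': "emeasure \<gamma>' (A \<times> B) = (\<integral>\<^sup>+x\<in>A. emeasure (\<kappa> x) B \<partial>\<mu>)"
    if A[measurable]: "A \<in> sets M" and B[measurable]: "B \<in> sets baire" for A B
  proof -
    let ?a = "distr (density \<gamma>' (\<lambda>z. indicator A (fst z))) baire snd"
    let ?b = "distr (density (kernel_prod \<mu> baire \<kappa>) (\<lambda>z. indicator A (fst z))) baire snd"
    note s\<gamma>'[measurable_cong] sets_kernel_prod[OF p\<mu> s\<mu> \<kappa>, measurable_cong]
    have a: "emeasure ?a C = emeasure \<gamma>' (A \<times> C)" if C[measurable]: "C \<in> sets baire" for C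
    proof -
      have "emeasure ?a C = (\<integral>\<^sup>+z. indicator C z \<partial>?a)" by simp
      also have "\<dots> = (\<integral>\<^sup>+z. indicator A (fst z) * indicator C (snd z) \<partial>\<gamma>')"
        by (subst nn_integral_distr) (auto simp: nn_integral_density)
      also have "\<dots> = (\<integral>\<^sup>+z. indicator (A \<times> C) z \<partial>\<gamma>')"
        by (intro nn_integral_cong) (auto simp: indicator_def)
      finally show ?thesis by (simp add: s\<gamma>')
    qed
    have b: "emeasure ?b C = (\<integral>\<^sup>+x\<in>A. emeasure (\<kappa> x) C \<partial>\<mu>)" if C[measurable]: "C \<in> sets baire" for C
    proof -
      have "emeasure ?b C = (\<integral>\<^sup>+z. indicator C z \<partial>?b)" by simp
      also have "\<dots> = (\<integral>\<^sup>+z. indicator A (fst z) * indicator C (snd z) \<partial>kernel_prod \<mu> baire \<kappa>)"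
        by (subst nn_integral_distr) (auto simp: nn_integral_density)
      also have "\<dots> = (\<integral>\<^sup>+x. \<integral>\<^sup>+z. indicator A x * indicator C z \<partial>\<kappa> x \<partial>\<mu>)"
        by (subst nn_integral_kernel_prod[OF p\<mu> s\<mu> \<kappa>]) auto
      also have "\<dots> = (\<integral>\<^sup>+x\<in>A. emeasure (\<kappa> x) C \<partial>\<mu>)"
        using sets_eq_imp_space_eq[OF s\<mu>]
        by (intro nn_integral_cong) (simp add: nn_integral_cmult_indicator kernel_sets[OF \<kappa>] mult.commute[of _ "indicator A _"])
      finally show ?thesis .
    qed
    have "?a = ?b"
    proof (rule measure_eqI_cyl)
      have "emeasure ?a UNIV = emeasure \<gamma>' (A \<times> UNIV)" using a[of UNIV] sets.top[of baire] by (simp add: spb)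
      also have "\<dots> \<le> 1" using prob_space.emeasure_space_1[OF p\<gamma>'] prob_space.measure_le_1[OF p\<gamma>'] by simp
      finally show "emeasure ?a UNIV \<noteq> \<infinity>" by (metis ennreal_one_neq_top infinity_ennreal_def top.extremum_unique)
    qed (simp_all add: a b eq)
    then have "emeasure ?a B = emeasure ?b B" by simp
    then show ?thesis unfolding a[OF B] b[OF B] .
  qed
  have "\<gamma> = kernel_prod \<mu> N \<kappa>'"
  proof (rule prob_measure_eqI_pair[OF sets_\<gamma> sets_kernel_prod[OF p\<mu> s\<mu> \<kappa>'] \<gamma>])
    fix A B assume A[measurable]: "A \<in> sets M" and B[measurable]: "B \<in> sets N"
    note sets_kernel_prod[OF p\<mu> s\<mu> \<kappa>', measurable_cong]
    have "(\<lambda>(x, y). (x, f y)) -` (A \<times> (g -` B \<inter> space baire)) \<inter> space \<gamma> = A \<times> B"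
      using sets.sets_into_space[OF A] sets.sets_into_space[OF B] by (auto simp: sp gf spb)
    then have "emeasure \<gamma> (A \<times> B) = emeasure \<gamma>' (A \<times> (g -` B \<inter> space baire))"
      unfolding \<gamma>'_def by (subst emeasure_distr) auto
    also have "\<dots> = (\<integral>\<^sup>+x\<in>A. emeasure (\<kappa> x) (g -` B \<inter> space baire) \<partial>\<mu>)"
      by (rule eq') auto
    also have "\<dots> = (\<integral>\<^sup>+x\<in>A. emeasure (\<kappa>' x) B \<partial>\<mu>)"
      using sets_eq_imp_space_eq[OF s\<mu>]
      by (intro nn_integral_cong) (simp add: \<kappa>'_def emeasure_distr measurable_cong_sets[OF kernel_sets(1)[OF \<kappa>] refl] kernel_sets(2)[OF \<kappa>])
    also have "\<dots> = (\<integral>\<^sup>+x. \<integral>\<^sup>+y. indicator A x * indicator B y \<partial>\<kappa>' x \<partial>\<mu>)"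
        using sets_eq_imp_space_eq[OF s\<mu>]
        by (intro nn_integral_cong) (simp add: nn_integral_cmult_indicator kernel_sets[OF \<kappa>'] mult.commute[of _ "indicator A _"])
    also have "\<dots> = (\<integral>\<^sup>+z. indicator (A \<times> B) z \<partial>kernel_prod \<mu> N \<kappa>')"
      by (subst nn_integral_kernel_prod[OF p\<mu> s\<mu> \<kappa>']) (auto simp: indicator_times)
    finally show "emeasure \<gamma> (A \<times> B) = emeasure (kernel_prod \<mu> N \<kappa>') (A \<times> B)"
      by simp
  qed
  with \<kappa>' show ?thesis unfolding \<mu>_def by (rule that)
qed

text \<open>The exceptional null set in the hypothesis depends on \<open>B\<close>. Restricting to
  the countably many cylinders of the code leaves a single null set, off which the laws of the code
  agree; decoding recovers the laws themselves.\<close>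

lemma kernel_AE_eqI:
  assumes N: "standard_space N" and \<kappa>: "\<kappa>1 \<in> M \<rightarrow>\<^sub>M prob_algebra N" "\<kappa>2 \<in> M \<rightarrow>\<^sub>M prob_algebra N"
    and sets: "sets \<mu> = sets M"
    and eq: "\<And>B. B \<in> sets N \<Longrightarrow> AE x in \<mu>. emeasure (\<kappa>1 x) B = emeasure (\<kappa>2 x) B"
  shows "AE x in \<mu>. \<kappa>1 x = \<kappa>2 x"
proof -
  obtain f g where f[measurable]: "f \<in> N \<rightarrow>\<^sub>M baire" and g[measurable]: "g \<in> baire \<rightarrow>\<^sub>M N"
    and gf: "\<And>y. y \<in> space N \<Longrightarrow> g (f y) = y"
    using N unfolding standard_space_def by blast
  have "AE x in \<mu>. \<forall>s. emeasure (\<kappa>1 x) (f -` cyl s \<inter> space N) = emeasure (\<kappa>2 x) (f -` cyl s \<inter> space N)"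
    by (subst AE_all_countable) (intro allI eq measurable_sets[OF f] sets_cyl)
  with AE_space show ?thesis
  proof eventually_elim
    case (elim x)
    then have x: "x \<in> space M" using sets_eq_imp_space_eq[OF sets] by simp
    note k = kernel_sets[OF \<kappa>(1) x] kernel_sets[OF \<kappa>(2) x]
    note k(1)[measurable_cong] k(4)[measurable_cong]
    have "distr (\<kappa>1 x) baire f = distr (\<kappa>2 x) baire f"
    proof (rule measure_eqI_cyl)
      show "emeasure (distr (\<kappa>1 x) baire f) UNIV \<noteq> \<infinity>"
        using prob_space.emeasure_space_1[OF prob_space.prob_space_distr[OF k(3), of f baire]]
        by (simp add: space_PiM)
      show "emeasure (distr (\<kappa>1 x) baire f) (cyl s) = emeasure (distr (\<kappa>2 x) baire f) (cyl s)" for s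
        using elim by (simp add: emeasure_distr k)
    qed simp_all
    then have "distr (distr (\<kappa>1 x) baire f) N g = distr (distr (\<kappa>2 x) baire f) N g" by simp
    moreover have "distr (distr k baire f) N g = k" if [measurable_cong]: "sets k = sets N" for k
    proof -
      have "distr (distr k baire f) N g = distr k N (\<lambda>y. y)"
        using sets_eq_imp_space_eq[OF that] by (subst distr_distr) (auto simp: gf intro!: distr_cong)
      also have "\<dots> = k" by (rule distr_id2) (simp add: that)
      finally show ?thesis .
    qed
    ultimately show ?case using k(1,4) by metis
  qed
qed

section \<open>Relative entropy\<close>

text \<open>The Donsker--Varadhan functional in linearised form: \<open>log a \<le> a - 1\<close> replaces the logarithm of
  the exponential moment, which leaves the supremum over \<open>g\<close> unchanged and makes the functional
  affine in both measures.\<close>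

definition dv :: "'w measure \<Rightarrow> 'w measure \<Rightarrow> ('w \<Rightarrow> real) \<Rightarrow> real" where
  "dv \<pi> R g = (\<integral>x. g x \<partial>\<pi>) - (\<integral>x. exp (g x) \<partial>R) + 1"

definition bdd_meas :: "'w measure \<Rightarrow> ('w \<Rightarrow> real) \<Rightarrow> bool" where
  "bdd_meas M g \<longleftrightarrow> g \<in> borel_measurable M \<and> (\<exists>B. \<forall>x\<in>space M. \<bar>g x\<bar> \<le> B)"

lemma bdd_meas_integrable:
  assumes "bdd_meas M g" "prob_space P" "sets P = sets M"
  shows "integrable P g"
proof -
  interpret prob_space P by fact
  obtain B where "\<forall>x\<in>space M. \<bar>g x\<bar> \<le> B" using assms(1) by (auto simp: bdd_meas_def)
  then show ?thesis using assms sets_eq_imp_space_eq[OF assms(3)]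
    by (intro integrable_const_bound[of _ B])
       (auto simp: bdd_meas_def measurable_cong_sets[OF assms(3) refl])
qed

lemma bdd_meas_exp: "bdd_meas M g \<Longrightarrow> bdd_meas M (\<lambda>x. exp (g x))"
proof -
  assume g: "bdd_meas M g"
  then obtain B where "\<forall>x\<in>space M. \<bar>g x\<bar> \<le> B" by (auto simp: bdd_meas_def)
  then have "\<forall>x\<in>space M. \<bar>exp (g x)\<bar> \<le> exp B" by (auto simp: abs_le_iff)
  with g show ?thesis by (auto simp: bdd_meas_def)
qed

lemma bdd_meas_cong_sets: "sets M = sets N \<Longrightarrow> bdd_meas M g = bdd_meas N g"
  using sets_eq_imp_space_eq[of M N] measurable_cong_sets[of M N "borel :: real measure" borel]
  by (simp add: bdd_meas_def)

lemma entropy_density_AE: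
  assumes "AE x in R. RN_deriv R \<pi> x = ennreal (D x)" "absolutely_continuous R \<pi>" "sets \<pi> = sets R"
    "\<And>x. 0 \<le> D x"
  shows "AE x in \<pi>. entropy_density (exp 1) R \<pi> x = ln (D x)"
proof -
  have "AE x in \<pi>. RN_deriv R \<pi> x = ennreal (D x)"
    using assms(1) by (rule absolutely_continuous_AE[OF assms(3,2)])
  then show ?thesis
    by eventually_elim (simp add: entropy_density_def log_def assms(4))
qed

text \<open>With \<open>D\<close> the density of \<pi>, the inequality g - ln D \<le> exp g / D - 1
  is integrated against \<pi>. The integral of exp g / D is at most the exponential moment under
  \<open>R\<close>; it can be smaller because the set where \<open>D\<close> vanishes contributes
  nothing to it.\<close>

lemma KL_ge_dv:
  assumes "prob_space \<pi>" "prob_space R" "sets \<pi> = sets R" and g: "bdd_meas R g"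
  shows "ereal (dv \<pi> R g) \<le> KL \<pi> R"
proof (cases "absolutely_continuous R \<pi> \<and> integrable \<pi> (entropy_density (exp 1) R \<pi>)")
  case False then show ?thesis by (simp only: KL_def if_False) simp
next
  case True
  then have ac: "absolutely_continuous R \<pi>" and int: "integrable \<pi> (entropy_density (exp 1) R \<pi>)" by auto
  interpret \<pi>: prob_space \<pi> by fact
  interpret R: prob_space R by fact
  note assms(3)[measurable_cong]
  obtain D where D[measurable]: "D \<in> borel_measurable R"
    and RN: "AE x in R. RN_deriv R \<pi> x = ennreal (D x)"
    and pos: "AE x in \<pi>. 0 < D x" and nn: "\<And>x. 0 \<le> D x"
    using R.real_RN_deriv[OF \<pi>.finite_measure_axioms ac assms(3)] by blast
  have \<pi>: "\<pi> = density R (\<lambda>x. ennreal (D x))"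
    using R.density_RN_deriv[OF ac assms(3)] density_cong[OF _ _ RN] by simp
  note ed = entropy_density_AE[OF RN ac assms(3) nn]
  have [measurable]: "g \<in> borel_measurable R" using g by (simp add: bdd_meas_def)
  have g\<pi>: "integrable \<pi> g" by (rule bdd_meas_integrable[OF g assms(1,3)])
  have eg: "integrable R (\<lambda>x. exp (g x))" by (rule bdd_meas_integrable[OF bdd_meas_exp[OF g] assms(2) refl])
  have lnD: "integrable \<pi> (\<lambda>x. ln (D x))"
    using int ed by (subst (asm) integrable_cong_AE[OF _ _ ed]) auto
  have KL: "KL \<pi> R = ereal (\<integral>x. ln (D x) \<partial>\<pi>)"
    using True integral_cong_AE[OF _ _ ed] by (simp add: KL_def KL_divergence_def)
  have i1: "integrable \<pi> (\<lambda>x. exp (g x) / D x)"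
    unfolding \<pi> by (subst integrable_real_density)
      (auto simp: nn intro!: Bochner_Integration.integrable_bound[OF eg])
  have "(\<integral>x. exp (g x) / D x \<partial>\<pi>) = (\<integral>x. D x * (exp (g x) / D x) \<partial>R)"
    unfolding \<pi> by (subst integral_real_density) (auto simp: nn)
  also have "\<dots> \<le> (\<integral>x. exp (g x) \<partial>R)"
    by (intro integral_mono Bochner_Integration.integrable_bound[OF eg] eg) (auto simp: nn)
  finally have i2: "(\<integral>x. exp (g x) / D x \<partial>\<pi>) \<le> (\<integral>x. exp (g x) \<partial>R)" .
  have "(\<integral>x. g x - ln (D x) \<partial>\<pi>) \<le> (\<integral>x. exp (g x) / D x - 1 \<partial>\<pi>)"
  proof (rule integral_mono_AE)
    show "AE x in \<pi>. g x - ln (D x) \<le> exp (g x) / D x - 1"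
      using pos
    proof eventually_elim
      case (elim x)
      have "1 + (g x - ln (D x)) \<le> exp (g x - ln (D x))" by (rule exp_ge_add_one_self)
      also have "\<dots> = exp (g x) / D x" using elim by (simp add: exp_diff)
      finally show ?case by simp
    qed
  qed (use g\<pi> lnD i1 in auto)
  then have "(\<integral>x. g x \<partial>\<pi>) - (\<integral>x. ln (D x) \<partial>\<pi>) \<le> (\<integral>x. exp (g x) / D x \<partial>\<pi>) - 1"
    using g\<pi> lnD i1 by (simp add: \<pi>.prob_space)
  with i2 show ?thesis unfolding KL dv_def by simp
qed

text \<open>The ideal test function is ln D, which need not be bounded. Large multiples of
  indicators first force absolute continuity; then truncations of ln D are tested. The negative part
  of ln D is always \<pi>-integrable, the tests control the positive part, and dominated convergence
  removes the truncation.\<close>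

lemma KL_leI:
  assumes "prob_space \<pi>" "prob_space R" "sets \<pi> = sets R"
    and k: "\<And>g. bdd_meas R g \<Longrightarrow> dv \<pi> R g \<le> k"
  shows "KL \<pi> R \<le> ereal k"
proof -
  interpret \<pi>: prob_space \<pi> by fact
  interpret R: prob_space R by fact
  note assms(3)[measurable_cong]
  have sp: "space \<pi> = space R" using sets_eq_imp_space_eq[OF assms(3)] .
  have ac: "absolutely_continuous R \<pi>"
    unfolding absolutely_continuous_def
  proof
    fix A assume "A \<in> null_sets R"
    then have A[measurable]: "A \<in> sets R" and A0: "AE x in R. x \<notin> A"
      using AE_not_in by (auto simp: null_sets_def)
    from A0 have A0': "AE x in R. indicat_real A x = 0" by eventually_elim simp
    \<comment> \<open>For a null set of \<open>R\<close> the exponential term does not notice the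
      test function \<open>n\<close> times its indicator, so its \<pi>-measure is at most k / n for
      every n.\<close>
    have "real n * measure \<pi> A \<le> k" for n :: nat
    proof -
      have "(\<integral>x. exp (real n * indicator A x) \<partial>R) = (\<integral>x. 1 \<partial>R)"
        using A0' by (intro integral_cong_AE) auto
      then have "dv \<pi> R (\<lambda>x. real n * indicator A x) = real n * measure \<pi> A"
        unfolding dv_def by (simp add: R.prob_space sp assms(3) Int_absorb2 sets.sets_into_space[OF A])
      moreover have "bdd_meas R (\<lambda>x. real n * indicator A x)"
        unfolding bdd_meas_def by (auto intro!: exI[of _ "real n"] simp: indicator_def)
      ultimately show ?thesis using k by metis
    qed
    then have "measure \<pi> A \<le> 0"
      using reals_Archimedean3[of "measure \<pi> A"] by (metis linorder_not_le)
    then show "A \<in> null_sets \<pi>"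
      using assms(3) by (simp add: null_sets_def \<pi>.emeasure_eq_measure measure_le_0_iff)
  qed
  obtain D where D[measurable]: "D \<in> borel_measurable R"
    and RN: "AE x in R. RN_deriv R \<pi> x = ennreal (D x)"
    and pos: "AE x in \<pi>. 0 < D x" and nn: "\<And>x. 0 \<le> D x"
    using R.real_RN_deriv[OF \<pi>.finite_measure_axioms ac assms(3)] by blast
  have \<pi>: "\<pi> = density R (\<lambda>x. ennreal (D x))"
    using R.density_RN_deriv[OF ac assms(3)] density_cong[OF _ _ RN] by simp
  note ed = entropy_density_AE[OF RN ac assms(3) nn]
  have intD: "integrable R D" "(\<integral>x. D x \<partial>R) = 1"
    using integrable_real_density[of D R "\<lambda>_. 1"] integral_real_density[of D R "\<lambda>_. 1"] \<pi>.prob_space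
    by (auto simp: nn \<pi>[symmetric])
  \<comment> \<open>Where \<open>D\<close> vanishes the lower cut is inserted by hand. This gives
    exp (g n) \<le> D + exp (- n) everywhere, hence an exponential moment of at most 1 + exp (-
    n).\<close>
  define g where "g n x = (if D x = 0 then - real n else max (- real n) (min (real n) (ln (D x))))" for n x
  have g_meas[measurable]: "g n \<in> borel_measurable R" for n unfolding g_def by measurable
  have g_bdd: "bdd_meas R (g n)" for n
    unfolding bdd_meas_def by (auto intro!: exI[of _ "real n"] simp: g_def)
  have gi: "integrable \<pi> (g n)" for n by (rule bdd_meas_integrable[OF g_bdd assms(1,3)])
  have g_le: "(\<integral>x. g n x \<partial>\<pi>) \<le> k + exp (- real n)" for n
  proof -
    have "exp (g n x) \<le> D x + exp (- real n)" for x
    proof (cases "D x = 0")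
      case False
      then have p: "0 < D x" using nn[of x] by simp
      have "g n x \<le> max (- real n) (ln (D x))" using False by (auto simp: g_def)
      then consider "g n x \<le> - real n" | "g n x \<le> ln (D x)" by (auto simp: max_def split: if_splits)
      then show ?thesis
      proof cases
        case 1
        then have "exp (g n x) \<le> exp (- real n)" by simp
        with p show ?thesis by linarith
      next
        case 2
        then have "exp (g n x) \<le> D x" using p by (metis exp_le_cancel_iff exp_ln)
        then show ?thesis using exp_ge_zero[of "- real n"] by linarith
      qed
    qed (simp add: g_def)
    then have "(\<integral>x. exp (g n x) \<partial>R) \<le> (\<integral>x. D x + exp (- real n) \<partial>R)"
      using bdd_meas_integrable[OF bdd_meas_exp[OF g_bdd[of n]] assms(2) refl] intD
      by (intro integral_mono) auto
    also have "\<dots> = 1 + exp (- real n)" using intD by (simp add: R.prob_space)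
    finally show ?thesis using k[OF g_bdd[of n]] by (simp add: dv_def)
  qed
  \<comment> \<open>The negative part of ln D. Since u * ln (1 / u) \<le> 1 for u between 0 and 1,
    its product with \<open>D\<close> is bounded, which makes it \<pi>-integrable.\<close>
  define N where "N x = max 0 (- ln (D x))" for x
  have [measurable]: "N \<in> borel_measurable R" unfolding N_def by measurable
  have DN: "\<bar>D x * N x\<bar> \<le> 1" for x
  proof (cases "D x = 0 \<or> D x \<ge> 1")
    case True then show ?thesis by (auto simp: N_def max_def)
  next
    case False
    then have p: "0 < D x" "D x < 1" using nn[of x] by auto
    have "- ln (D x) \<le> 1 / D x - 1"
      using ln_le_minus_one[of "1 / D x"] p by (simp add: ln_div)
    then have "D x * (- ln (D x)) \<le> D x * (1 / D x - 1)" using p by (intro mult_left_mono) auto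
    also have "\<dots> \<le> 1" using p by (simp add: field_simps)
    finally have "D x * (- ln (D x)) \<le> 1" .
    moreover have "N x = - ln (D x)" using p by (simp add: N_def)
    moreover have "0 \<le> D x * (- ln (D x))" using p by (simp add: mult_nonneg_nonpos)
    ultimately show ?thesis by simp
  qed
  have iN: "integrable \<pi> N"
    unfolding \<pi> by (subst integrable_real_density)
      (use DN nn in \<open>auto intro!: R.integrable_const_bound[of _ 1]\<close>)
  \<comment> \<open>Truncations of the positive part. Their integrals increase and stay bounded by
    the tests with \<open>g n\<close>, so monotone convergence yields integrability of the positive
    part.\<close>
  define P where "P n x = min (real n) (max 0 (ln (D x)))" for n x
  have [measurable]: "P n \<in> borel_measurable R" for n unfolding P_def by measurable
  have iP: "integrable \<pi> (P n)" for n
    by (rule \<pi>.integrable_const_bound[of _ "real n"]) (auto simp: P_def)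
  have bP: "(\<integral>x. P n x \<partial>\<pi>) \<le> k + 1 + (\<integral>x. N x \<partial>\<pi>)" for n
  proof -
    have "(\<integral>x. P n x \<partial>\<pi>) \<le> (\<integral>x. g n x + N x \<partial>\<pi>)"
    proof (rule integral_mono_AE)
      show "AE x in \<pi>. P n x \<le> g n x + N x"
        using pos by eventually_elim (auto simp: P_def g_def N_def)
    qed (use iP gi iN in auto)
    also have "\<dots> = (\<integral>x. g n x \<partial>\<pi>) + (\<integral>x. N x \<partial>\<pi>)" using gi iN by simp
    also have "\<dots> \<le> k + 1 + (\<integral>x. N x \<partial>\<pi>)" using g_le[of n] by (smt (verit) exp_le_one_iff of_nat_0_le_iff)
    finally show ?thesis .
  qed
  have monoP: "mono (\<lambda>n. P n x)" for x by (auto simp: mono_def P_def)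
  obtain l where l: "(\<lambda>n. \<integral>x. P n x \<partial>\<pi>) \<longlonglongrightarrow> l"
  proof (rule incseq_convergent)
    show "incseq (\<lambda>n. \<integral>x. P n x \<partial>\<pi>)"
      using monoP by (auto simp: incseq_def mono_def intro!: integral_mono iP)
  qed (use bP in blast)
  have limP: "(\<lambda>n. P n x) \<longlonglongrightarrow> max 0 (ln (D x))" for x
  proof (rule tendsto_eventually)
    obtain m :: nat where "max 0 (ln (D x)) \<le> real m" using real_arch_simple by blast
    then show "\<forall>\<^sub>F n in sequentially. P n x = max 0 (ln (D x))"
      by (auto simp: P_def eventually_sequentially intro!: exI[of _ m])
  qed
  have ipos: "integrable \<pi> (\<lambda>x. max 0 (ln (D x)))"
    by (rule integrable_monotone_convergence[OF iP _ _ l]) (use monoP limP in auto)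
  have lnD: "integrable \<pi> (\<lambda>x. ln (D x))"
  proof -
    have "integrable \<pi> (\<lambda>x. max 0 (ln (D x)) - N x)" using ipos iN by simp
    moreover have "max 0 (ln (D x)) - N x = ln (D x)" for x by (simp add: N_def)
    ultimately show ?thesis by simp
  qed
  have "integrable \<pi> (entropy_density (exp 1) R \<pi>)"
    using lnD ed by (subst integrable_cong_AE[OF _ _ ed]) auto
  then have KL: "KL \<pi> R = ereal (\<integral>x. ln (D x) \<partial>\<pi>)"
    using ac integral_cong_AE[OF _ _ ed] by (simp add: KL_def KL_divergence_def)
  have "(\<lambda>n. \<integral>x. g n x \<partial>\<pi>) \<longlonglongrightarrow> (\<integral>x. ln (D x) \<partial>\<pi>)"
  proof (rule integral_dominated_convergence[where w="\<lambda>x. \<bar>ln (D x)\<bar>"])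
    show "AE x in \<pi>. (\<lambda>n. g n x) \<longlonglongrightarrow> ln (D x)"
      using pos
    proof eventually_elim
      case (elim x)
      obtain m :: nat where "\<bar>ln (D x)\<bar> \<le> real m" using real_arch_simple by blast
      then show ?case using elim
        by (intro tendsto_eventually) (auto simp: g_def eventually_sequentially intro!: exI[of _ m])
    qed
    show "AE x in \<pi>. norm (g n x) \<le> \<bar>ln (D x)\<bar>" for n
      using pos by eventually_elim (auto simp: g_def)
  qed (use lnD in auto)
  moreover have "(\<lambda>n. k + exp (- real n)) \<longlonglongrightarrow> k + 0"
    by (intro tendsto_add tendsto_const filterlim_compose[OF exp_at_bot] 
        filterlim_compose[OF filterlim_uminus_at_bot_at_top] filterlim_real_sequentially)
  ultimately have "(\<integral>x. ln (D x) \<partial>\<pi>) \<le> k + 0"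
    by (rule LIMSEQ_le) (use g_le in auto)
  then show ?thesis by (simp add: KL)
qed

lemma KL_nonneg:
  assumes "prob_space \<pi>" "prob_space R" "sets \<pi> = sets R"
  shows "0 \<le> KL \<pi> R"
  using KL_ge_dv[OF assms, of "\<lambda>_. 0"] prob_space.prob_space[OF assms(2)]
  by (auto simp: dv_def bdd_meas_def zero_ereal_def)

lemma KL_self:
  assumes "prob_space R" shows "KL R R = 0"
proof (rule antisym[OF _ KL_nonneg[OF assms assms refl]])
  interpret R: prob_space R by fact
  have "dv R R g \<le> 0" if g: "bdd_meas R g" for g
  proof -
    note i = bdd_meas_integrable[OF g assms refl] bdd_meas_integrable[OF bdd_meas_exp[OF g] assms refl]
    have "(\<integral>x. g x + 1 \<partial>R) \<le> (\<integral>x. exp (g x) \<partial>R)"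
      using i by (intro integral_mono) (auto simp: add.commute)
    then show ?thesis using i by (simp add: dv_def R.prob_space)
  qed
  then show "KL R R \<le> 0" using KL_leI[OF assms assms refl, of 0] by (simp add: zero_ereal_def)
qed

text \<open>Data processing: by the Donsker--Varadhan formula it suffices to test with functions
  \<open>\<kappa>g\<close>, and \<open>exp (\<kappa>g) \<le> \<kappa>(exp g)\<close>.\<close>

lemma KL_bind_le:
  assumes \<pi>: "prob_space \<pi>" "sets \<pi> = sets M" and R: "prob_space R" "sets R = sets M"
    and \<kappa>: "\<kappa> \<in> M \<rightarrow>\<^sub>M prob_algebra N"
  shows "KL (\<pi> \<bind> \<kappa>) (R \<bind> \<kappa>) \<le> KL \<pi> R"
proof (cases "KL \<pi> R = \<infinity>")
  case False
  interpret \<pi>: prob_space \<pi> by fact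
  interpret R: prob_space R by fact
  note \<pi>(2)[measurable_cong] R(2)[measurable_cong]
  have sp: "space \<pi> = space M" "space R = space M"
    using sets_eq_imp_space_eq[OF \<pi>(2)] sets_eq_imp_space_eq[OF R(2)] by auto
  have in\<pi>: "\<pi> \<in> space (prob_algebra M)" and inR: "R \<in> space (prob_algebra M)"
    using \<pi> R by (auto simp: space_prob_algebra)
  obtain k where k: "KL \<pi> R = ereal k"
    using False KL_nonneg[OF \<pi>(1) R(1)] \<pi> R by (cases "KL \<pi> R") auto
  note [measurable] = measurable_prob_algebraD[OF \<kappa>]
  have ibind: "(\<integral>y. g y \<partial>(P \<bind> \<kappa>)) = (\<integral>x. \<integral>y. g y \<partial>\<kappa> x \<partial>P)"
    if g: "bdd_meas N g" and P: "prob_space P" "sets P = sets M" for g P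
  proof -
    interpret P: prob_space P by fact
    note P(2)[measurable_cong]
    obtain B where B: "\<forall>x\<in>space N. \<bar>g x\<bar> \<le> B" using g by (auto simp: bdd_meas_def)
    have spP: "space P = space M" using sets_eq_imp_space_eq[OF P(2)] .
    show ?thesis
    proof (rule integral_bind[where K=N and B'=1 and B=B])
      show "\<kappa> \<in> P \<rightarrow>\<^sub>M subprob_algebra N" by simp
      show "\<bar>g x\<bar> \<le> B" if "x \<in> space N" for x using B that by blast
      show "AE x in P. emeasure (\<kappa> x) (space (\<kappa> x)) \<le> ennreal 1"
        using kernel_sets(3)[OF \<kappa>] by (intro AE_I2) (simp add: spP prob_space.emeasure_space_1)
    qed (use g P.finite_measure_axioms in \<open>auto simp: bdd_meas_def\<close>)
  qed
  have "KL (\<pi> \<bind> \<kappa>) (R \<bind> \<kappa>) \<le> ereal k"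
  proof (rule KL_leI)
    show "prob_space (\<pi> \<bind> \<kappa>)" "prob_space (R \<bind> \<kappa>)"
      by (rule prob_space_bind'[OF in\<pi> \<kappa>] prob_space_bind'[OF inR \<kappa>])+
    have sets: "sets (\<pi> \<bind> \<kappa>) = sets N" "sets (R \<bind> \<kappa>) = sets N"
      by (rule sets_bind'[OF in\<pi> \<kappa>] sets_bind'[OF inR \<kappa>])+
    then show "sets (\<pi> \<bind> \<kappa>) = sets (R \<bind> \<kappa>)" by simp
    fix g assume "bdd_meas (R \<bind> \<kappa>) g"
    then have g: "bdd_meas N g" by (simp add: bdd_meas_cong_sets[OF sets(2)])
    then have [measurable]: "g \<in> borel_measurable N" by (simp add: bdd_meas_def)
    obtain B where B: "\<And>x. x \<in> space N \<Longrightarrow> \<bar>g x\<bar> \<le> B" using g by (auto simp: bdd_meas_def)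
    let ?G = "\<lambda>x. \<integral>y. g y \<partial>\<kappa> x" and ?E = "\<lambda>x. \<integral>y. exp (g y) \<partial>\<kappa> x"
    have bm: "bdd_meas M (\<lambda>x. \<integral>y. h y \<partial>\<kappa> x)" if h: "bdd_meas N h" for h
    proof -
      have [measurable]: "h \<in> borel_measurable N" using h by (simp add: bdd_meas_def)
      obtain B where B: "\<And>x. x \<in> space N \<Longrightarrow> \<bar>h x\<bar> \<le> B" using h by (auto simp: bdd_meas_def)
      have "\<bar>\<integral>y. h y \<partial>\<kappa> x\<bar> \<le> B" if x: "x \<in> space M" for x
      proof -
        interpret kx: prob_space "\<kappa> x" by (rule kernel_sets(3)[OF \<kappa> x])
        have "\<bar>\<integral>y. h y \<partial>\<kappa> x\<bar> \<le> (\<integral>y. \<bar>h y\<bar> \<partial>\<kappa> x)" by (rule integral_abs_bound)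
        also have "\<dots> \<le> (\<integral>y. B \<partial>\<kappa> x)"
          using bdd_meas_integrable[OF h kernel_sets(3,1)[OF \<kappa> x]] B kernel_sets(2)[OF \<kappa> x]
          by (intro integral_mono) auto
        finally show ?thesis by (simp add: kx.prob_space)
      qed
      moreover have "(\<lambda>x. \<integral>y. h y \<partial>\<kappa> x) \<in> borel_measurable M"
        by (rule measurable_compose[OF measurable_prob_algebraD[OF \<kappa>] integral_measurable_subprob_algebra]) simp
      ultimately show ?thesis by (auto simp: bdd_meas_def)
    qed
    have Jensen: "exp (?G x) \<le> ?E x" if x: "x \<in> space M" for x
    proof -
      interpret kx: prob_space "\<kappa> x" by (rule kernel_sets(3)[OF \<kappa> x])
      note i = bdd_meas_integrable[OF g kernel_sets(3,1)[OF \<kappa> x]]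
        bdd_meas_integrable[OF bdd_meas_exp[OF g] kernel_sets(3,1)[OF \<kappa> x]]
      \<comment> \<open>The tangent of exp at the mean \<open>?G x\<close>, integrated over
        \<open>\<kappa> x\<close>: its linear term vanishes.\<close>
      have "exp (?G x) = (\<integral>y. exp (?G x) * (1 + (g y - ?G x)) \<partial>\<kappa> x)"
        using i by (simp add: kx.prob_space)
      also have "\<dots> \<le> ?E x"
      proof (rule integral_mono)
        show "exp (?G x) * (1 + (g y - ?G x)) \<le> exp (g y)" for y
        proof -
          have "exp (?G x) * (1 + (g y - ?G x)) \<le> exp (?G x) * exp (g y - ?G x)"
            by (intro mult_left_mono exp_ge_add_one_self) auto
          then show ?thesis by (simp add: exp_diff)
        qed
      qed (use i in auto)
      finally show ?thesis .
    qed
    have "(\<integral>x. exp (?G x) \<partial>R) \<le> (\<integral>x. ?E x \<partial>R)"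
      using Jensen bdd_meas_integrable[OF bdd_meas_exp[OF bm[OF g]] R]
        bdd_meas_integrable[OF bm[OF bdd_meas_exp[OF g]] R]
      by (intro integral_mono) (auto simp: sp)
    then have "dv (\<pi> \<bind> \<kappa>) (R \<bind> \<kappa>) g \<le> dv \<pi> R ?G"
      by (simp add: dv_def ibind[OF g \<pi>] ibind[OF bdd_meas_exp[OF g] R])
    also have "\<dots> \<le> k"
      using KL_ge_dv[OF \<pi>(1) R(1), of ?G] bm[OF g] \<pi> R k by (simp add: bdd_meas_cong_sets[OF R(2)])
    finally show "dv (\<pi> \<bind> \<kappa>) (R \<bind> \<kappa>) g \<le> k" .
  qed
  then show ?thesis by (simp add: k)
qed simp

text \<open>The convex combination t \<pi> + (1 - t) \<pi>', written as the toss of a biased coin so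
  that it is a bind and the rules for kernels apply.\<close>

definition mix :: "real \<Rightarrow> 'a measure \<Rightarrow> 'a measure \<Rightarrow> 'a measure" where
  "mix t \<pi> \<pi>' = measure_pmf (bernoulli_pmf t) \<bind> (\<lambda>b. if b then \<pi> else \<pi>')"

context
  fixes t :: real and \<pi> \<pi>' :: "'a measure"
  assumes t: "0 \<le> t" "t \<le> 1" and \<pi>: "prob_space \<pi>" "prob_space \<pi>'" "sets \<pi>' = sets \<pi>"
begin

lemma mix_kernel: "(\<lambda>b. if b then \<pi> else \<pi>') \<in> measure_pmf (bernoulli_pmf t) \<rightarrow>\<^sub>M prob_algebra \<pi>"
  using \<pi> by (auto simp: space_prob_algebra)

lemma mix_pmf_in: "measure_pmf (bernoulli_pmf t) \<in> space (prob_algebra (measure_pmf (bernoulli_pmf t)))"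
  by (simp add: space_prob_algebra measure_pmf.prob_space_axioms)

lemma sets_mix: "sets (mix t \<pi> \<pi>') = sets \<pi>"
  unfolding mix_def by (rule sets_bind'[OF mix_pmf_in mix_kernel])

lemma prob_space_mix: "prob_space (mix t \<pi> \<pi>')"
  unfolding mix_def by (rule prob_space_bind'[OF mix_pmf_in mix_kernel])

lemma nn_integral_mix:
  assumes "f \<in> borel_measurable \<pi>"
  shows "(\<integral>\<^sup>+x. f x \<partial>mix t \<pi> \<pi>') = ennreal t * (\<integral>\<^sup>+x. f x \<partial>\<pi>) + ennreal (1 - t) * (\<integral>\<^sup>+x. f x \<partial>\<pi>')"
  unfolding mix_def
  by (subst nn_integral_bind[OF assms measurable_prob_algebraD[OF mix_kernel]])
     (use t in \<open>simp add: nn_integral_measure_pmf nn_integral_count_space_finite UNIV_bool pmf_bernoulli_True pmf_bernoulli_False mult.commute\<close>)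

lemma integrable_mix:
  fixes f :: "'a \<Rightarrow> real"
  assumes "integrable \<pi> f" "integrable \<pi>' f"
  shows "integrable (mix t \<pi> \<pi>') f"
proof (rule integrableI_bounded)
  show "f \<in> borel_measurable (mix t \<pi> \<pi>')"
    using assms by (simp add: measurable_cong_sets[OF sets_mix refl])
  have "(\<lambda>x. ennreal (norm (f x))) \<in> borel_measurable \<pi>" using assms(1) by measurable
  from nn_integral_mix[OF this] show "(\<integral>\<^sup>+x. ennreal (norm (f x)) \<partial>mix t \<pi> \<pi>') < \<infinity>"
    using assms by (simp add: integrable_iff_bounded ennreal_mult_less_top)
qed

lemma enn2real_convex_comb:
  assumes "0 \<le> t" "0 \<le> u" "a < \<top>" "b < \<top>"
  shows "enn2real (ennreal t * a + ennreal u * b) = t * enn2real a + u * enn2real b"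
  using assms by (cases a; cases b) (auto simp flip: ennreal_mult ennreal_plus)

lemma integral_mix:
  fixes f :: "'a \<Rightarrow> real"
  assumes "integrable \<pi> f" "integrable \<pi>' f"
  shows "(\<integral>x. f x \<partial>mix t \<pi> \<pi>') = t * (\<integral>x. f x \<partial>\<pi>) + (1 - t) * (\<integral>x. f x \<partial>\<pi>')"
proof -
  have fin: "(\<integral>\<^sup>+x. ennreal (g x) \<partial>P) < \<top>" if "integrable P g" for P and g :: "'a \<Rightarrow> real"
    using that by (simp add: real_integrable_def top.not_eq_extremum)
  have m: "(\<lambda>x. ennreal (f x)) \<in> borel_measurable \<pi>" "(\<lambda>x. ennreal (- f x)) \<in> borel_measurable \<pi>"
    using assms by auto
  have n: "integrable \<pi> (\<lambda>x. - f x)" "integrable \<pi>' (\<lambda>x. - f x)" using assms by auto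
  have 1: "0 \<le> 1 - t" using t by simp
  show ?thesis
    unfolding real_lebesgue_integral_def[OF assms(1)] real_lebesgue_integral_def[OF assms(2)]
      real_lebesgue_integral_def[OF integrable_mix[OF assms]] nn_integral_mix[OF m(1)] nn_integral_mix[OF m(2)]
      enn2real_convex_comb[OF t(1) 1 fin[OF assms(1)] fin[OF assms(2)]]
      enn2real_convex_comb[OF t(1) 1 fin[OF n(1)] fin[OF n(2)]]
    by (simp add: algebra_simps)
qed

end

text \<open>Write m for the mixture. Convexity of entropy along it holds with a reserve: t k + (1 -
  t) k' exceeds KL m R by at least t times KL \<pi> m. Inserting this into \<open>opt\<close> and
  dividing by t bounds KL \<pi> m by the gap, and as t tends to 0 the mixture becomes \<pi>'. The
  argument is run for one test function \<open>g\<close> at a time, with \<open>dv\<close> in place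
  of KL \<pi> m, so that the limit involves only the numbers \<open>C\<close> and
  \<open>C'\<close>.\<close>

lemma KL_pythagoras:
  assumes \<pi>: "prob_space \<pi>" "prob_space \<pi>'" "prob_space R" "sets \<pi> = sets R" "sets \<pi>' = sets R"
    and k: "KL \<pi> R = ereal k" "KL \<pi>' R = ereal k'"
    and opt: "\<And>t. 0 < t \<Longrightarrow> t < 1 \<Longrightarrow> ereal (I' + k') \<le> ereal (t * I + (1 - t) * I') + KL (mix t \<pi> \<pi>') R"
  shows "KL \<pi> \<pi>' \<le> ereal ((I + k) - (I' + k'))"
proof (rule KL_leI)
  show "prob_space \<pi>" "prob_space \<pi>'" "sets \<pi> = sets \<pi>'" using \<pi> by auto
  fix g assume "bdd_meas \<pi>' g"
  then have g: "bdd_meas R g" by (simp add: bdd_meas_cong_sets[OF \<pi>(5)])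
  then obtain B where B: "\<And>x. x \<in> space R \<Longrightarrow> \<bar>g x\<bar> \<le> B" by (auto simp: bdd_meas_def)
  have [measurable]: "g \<in> borel_measurable R" using g by (simp add: bdd_meas_def)
  define A C C' where "A = (\<integral>x. g x \<partial>\<pi>)" and "C = (\<integral>x. exp (g x) \<partial>\<pi>)" and "C' = (\<integral>x. exp (g x) \<partial>\<pi>')"
  note eg = bdd_meas_exp[OF g]
  note egi = bdd_meas_integrable[OF eg \<pi>(1,4)] bdd_meas_integrable[OF eg \<pi>(2,5)]
  interpret P1: prob_space \<pi> by fact
  interpret P2: prob_space \<pi>' by fact
  \<comment> \<open>The left-hand side is \<open>dv\<close> of \<pi> against the mixture at
    \<open>g\<close>.\<close>
  have main: "A - (t * C + (1 - t) * C') + 1 \<le> (I + k) - (I' + k')" if t: "0 < t" "t < 1" for t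
  proof -
    have t': "0 \<le> t" "t \<le> 1" using t by auto
    let ?m = "mix t \<pi> \<pi>'"
    have pm: "prob_space ?m" by (rule prob_space_mix) (use t \<pi> in auto)
    have sm: "sets ?m = sets R" using sets_mix[OF t' \<pi>(1,2)] \<pi>(4,5) by simp
    \<comment> \<open>The shift is chosen so that t exp (h + g + a) + (1 - t) exp (h + a) = exp h.
      Testing \<pi> with h + g + a and \<pi>' with h + a then adds up to a test of the mixture with
      \<open>h\<close>.\<close>
    define a where "a x = - ln (1 + t * (exp (g x) - 1))" for x
    have pos: "1 + t * (exp (g x) - 1) = (1 - t) + t * exp (g x)" for x by (simp add: algebra_simps)
    have pos': "0 < 1 + t * (exp (g x) - 1)" for x
      unfolding pos using t by (intro add_pos_pos mult_pos_pos) auto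
    have a_bdd: "bdd_meas R a"
      unfolding bdd_meas_def
    proof (intro conjI exI ballI)
      show "a \<in> borel_measurable R" unfolding a_def by measurable
      fix x assume x: "x \<in> space R"
      have B0: "0 \<le> B" using B[OF x] by simp
      have "exp (- B) \<le> exp (g x)" "exp (g x) \<le> exp B" using B[OF x] by auto
      moreover have "exp (- B) \<le> 1" "1 \<le> exp B" using B0 by auto
      ultimately have "exp (- B) \<le> 1 + t * (exp (g x) - 1)" "1 + t * (exp (g x) - 1) \<le> exp B"
        unfolding pos using t convex_bound_le[of 1 "exp B" "exp (g x)" "1 - t" t]
          convex_bound_le[of "-1" "- exp (-B)" "- exp (g x)" "1 - t" t] by auto
      then have "- B \<le> ln (1 + t * (exp (g x) - 1))" "ln (1 + t * (exp (g x) - 1)) \<le> ln (exp B)"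
        using ln_ge_iff[OF pos'[of x], of "- B"] ln_le_cancel_iff[OF pos'[of x] exp_gt_zero[of B]] by blast+
      then show "\<bar>a x\<bar> \<le> B" unfolding a_def by simp
    qed
    have KLm: "KL ?m R \<le> ereal (t * k + (1 - t) * k' - t * (A - (t * C + (1 - t) * C') + 1))"
    proof (rule KL_leI[OF pm \<pi>(3) sm])
      fix h assume h: "bdd_meas R h"
      have G: "bdd_meas R (\<lambda>x. h x + g x + a x)" and G': "bdd_meas R (\<lambda>x. h x + a x)"
      proof -
        obtain H where H: "\<And>x. x \<in> space R \<Longrightarrow> \<bar>h x\<bar> \<le> H" using h by (auto simp: bdd_meas_def)
        obtain B' where B': "\<And>x. x \<in> space R \<Longrightarrow> \<bar>a x\<bar> \<le> B'" using a_bdd by (auto simp: bdd_meas_def)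
        have [measurable]: "h \<in> borel_measurable R" "a \<in> borel_measurable R" using h a_bdd by (auto simp: bdd_meas_def)
        show "bdd_meas R (\<lambda>x. h x + g x + a x)" unfolding bdd_meas_def
        proof (intro conjI exI[of _ "H + B + B'"] ballI)
          show "\<bar>h x + g x + a x\<bar> \<le> H + B + B'" if "x \<in> space R" for x
            using B[OF that] B'[OF that] H[OF that] by arith
        qed measurable
        show "bdd_meas R (\<lambda>x. h x + a x)" unfolding bdd_meas_def
        proof (intro conjI exI[of _ "H + B'"] ballI)
          show "\<bar>h x + a x\<bar> \<le> H + B'" if "x \<in> space R" for x
            using B'[OF that] H[OF that] by arith
        qed measurable
      qed
      note i = bdd_meas_integrable[OF h \<pi>(1,4)] bdd_meas_integrable[OF h \<pi>(2,5)]
        bdd_meas_integrable[OF a_bdd \<pi>(1,4)] bdd_meas_integrable[OF a_bdd \<pi>(2,5)] bdd_meas_integrable[OF g \<pi>(1,4)]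
        bdd_meas_integrable[OF bdd_meas_exp[OF G] \<pi>(3) refl] bdd_meas_integrable[OF bdd_meas_exp[OF G'] \<pi>(3) refl]
      note im = integral_mix[OF t' \<pi>(1,2)]
      have s: "sets \<pi>' = sets \<pi>" using \<pi> by simp
      have 1: "dv \<pi> R (\<lambda>x. h x + g x + a x) \<le> k"
        using KL_ge_dv[OF \<pi>(1,3,4) G] k by simp
      have 2: "dv \<pi>' R (\<lambda>x. h x + a x) \<le> k'"
        using KL_ge_dv[OF \<pi>(2,3,5) G'] k by simp
      have "t * (\<integral>x. exp (h x + g x + a x) \<partial>R) + (1 - t) * (\<integral>x. exp (h x + a x) \<partial>R)
          = (\<integral>x. t * exp (h x + g x + a x) + (1 - t) * exp (h x + a x) \<partial>R)"
        using i by simp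
      also have "\<dots> = (\<integral>x. exp (h x) \<partial>R)"
      proof (rule Bochner_Integration.integral_cong[OF refl])
        fix x
        have "t * exp (h x + g x + a x) + (1 - t) * exp (h x + a x)
          = exp (h x) * exp (a x) * (1 + t * (exp (g x) - 1))"
          by (simp add: exp_add algebra_simps)
        also have "exp (a x) = 1 / (1 + t * (exp (g x) - 1))"
          unfolding a_def using pos'[of x] by (simp add: exp_minus inverse_eq_divide)
        finally show "t * exp (h x + g x + a x) + (1 - t) * exp (h x + a x) = exp (h x)"
          using pos'[of x] by simp
      qed
      finally have 3: "t * (\<integral>x. exp (h x + g x + a x) \<partial>R) + (1 - t) * (\<integral>x. exp (h x + a x) \<partial>R) = (\<integral>x. exp (h x) \<partial>R)" .
      have "- t * (t * C + (1 - t) * C' - 1) = (\<integral>x. - t * (exp (g x) - 1) \<partial>?m)"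
      proof -
        have c: "(\<integral>x. - t * (exp (g x) - 1) \<partial>\<pi>) = - t * (C - 1)" "(\<integral>x. - t * (exp (g x) - 1) \<partial>\<pi>') = - t * (C' - 1)"
          unfolding C_def C'_def using egi by (simp_all add: P1.prob_space P2.prob_space)
        have "integrable \<pi> (\<lambda>x. - t * (exp (g x) - 1))" "integrable \<pi>' (\<lambda>x. - t * (exp (g x) - 1))"
          using egi by simp_all
        from im[OF s this] have "(\<integral>x. - t * (exp (g x) - 1) \<partial>?m) = t * (- t * (C - 1)) + (1 - t) * (- t * (C' - 1))"
          unfolding c .
        also have "\<dots> = - t * (t * C + (1 - t) * C' - 1)" by (simp add: algebra_simps)
        finally show ?thesis by (rule sym)
      qed
      \<comment> \<open>From ln (1 + u) \<le> u with u = t (exp g - 1). This bound on the shift is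
        where the exponential moment of \<open>g\<close> under the mixture comes from.\<close>
      also have "\<dots> \<le> (\<integral>x. a x \<partial>?m)"
      proof (rule integral_mono)
        show "- t * (exp (g x) - 1) \<le> a x" for x
          using ln_add_one_self_le_self2[of "t * (exp (g x) - 1)"] pos'[of x] by (simp add: a_def)
      qed (use i egi prob_space_mix[OF t' \<pi>(1,2) s] in \<open>auto intro!: integrable_mix[OF t' \<pi>(1,2) s]\<close>)
      also have "\<dots> = t * (\<integral>x. a x \<partial>\<pi>) + (1 - t) * (\<integral>x. a x \<partial>\<pi>')"
        by (rule im[OF s]) (use i in auto)
      finally have 4: "- t * (t * C + (1 - t) * C' - 1) \<le> t * (\<integral>x. a x \<partial>\<pi>) + (1 - t) * (\<integral>x. a x \<partial>\<pi>')" .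
      have 5: "dv ?m R h = t * (\<integral>x. h x \<partial>\<pi>) + (1 - t) * (\<integral>x. h x \<partial>\<pi>') - (\<integral>x. exp (h x) \<partial>R) + 1"
        unfolding dv_def by (subst im[OF s]) (use i in auto)
      have "t * dv \<pi> R (\<lambda>x. h x + g x + a x) + (1 - t) * dv \<pi>' R (\<lambda>x. h x + a x) \<le> t * k + (1 - t) * k'"
        using 1 2 t by (intro add_mono mult_left_mono) auto
      moreover have "t * dv \<pi> R (\<lambda>x. h x + g x + a x) + (1 - t) * dv \<pi>' R (\<lambda>x. h x + a x)
        = t * (\<integral>x. h x \<partial>\<pi>) + (1 - t) * (\<integral>x. h x \<partial>\<pi>') + t * A + (t * (\<integral>x. a x \<partial>\<pi>) + (1 - t) * (\<integral>x. a x \<partial>\<pi>'))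
          - (\<integral>x. exp (h x) \<partial>R) + 1"
        unfolding dv_def 3[symmetric] A_def using i by (simp add: algebra_simps)
      ultimately show "dv ?m R h \<le> t * k + (1 - t) * k' - t * (A - (t * C + (1 - t) * C') + 1)"
        using 4 unfolding 5 by (simp add: algebra_simps)
    qed
    have "ereal (I' + k') \<le> ereal (t * I + (1 - t) * I') + ereal (t * k + (1 - t) * k' - t * (A - (t * C + (1 - t) * C') + 1))"
      by (rule order_trans[OF opt[OF t] add_left_mono[OF KLm]])
    then have "t * (A - (t * C + (1 - t) * C') + 1) \<le> t * ((I + k) - (I' + k'))"
      by (simp add: algebra_simps)
    then show ?thesis using t by simp
  qed
  \<comment> \<open>The values 1 / (n + 2) stay strictly between 0 and 1, as \<open>main\<close>
    requires.\<close>
  have "(\<lambda>n. A - (1 / real (n + 2) * C + (1 - 1 / real (n + 2)) * C') + 1) \<longlonglongrightarrow> A - (0 * C + (1 - 0) * C') + 1"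
    by (intro tendsto_intros LIMSEQ_ignore_initial_segment[OF lim_1_over_n, of 2])
  then have "A - (0 * C + (1 - 0) * C') + 1 \<le> (I + k) - (I' + k')"
    by (rule LIMSEQ_le_const2) (intro exI[of _ 0] allI impI main; simp)
  then show "dv \<pi> \<pi>' g \<le> (I + k) - (I' + k')" by (simp add: dv_def A_def C'_def)
qed

section \<open>Conditional independence and kernels\<close>

lemma sets_vimage_algebraE:
  assumes "A \<in> sets (vimage_algebra (space M) W SW)" "W \<in> M \<rightarrow>\<^sub>M SW"
  obtains C where "C \<in> sets SW" "A = W -` C \<inter> space M"
proof -
  have "W \<in> space M \<rightarrow> space SW" using assms(2) by (auto dest: measurable_space)
  from sets_vimage_algebra2[OF this] assms(1) that show ?thesis by auto
qed

lemma finite_measure_subalgebra_vimage: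
  assumes "prob_space M" "W \<in> M \<rightarrow>\<^sub>M SW"
  shows "finite_measure_subalgebra M (vimage_algebra (space M) W SW)"
proof (intro finite_measure_subalgebra.intro finite_measure_subalgebra_axioms.intro)
  show "finite_measure M" using assms(1) by (simp add: prob_space_def)
  show "subalgebra M (vimage_algebra (space M) W SW)"
    unfolding subalgebra_def using measurable_sets[OF assms(2)]
    by (auto elim!: sets_vimage_algebraE[OF _ assms(2)])
qed

lemma measurable_vimage_algebra_compose:
  assumes "h \<in> SW \<rightarrow>\<^sub>M L" "W \<in> M \<rightarrow>\<^sub>M SW"
  shows "(\<lambda>x. h (W x)) \<in> vimage_algebra (space M) W SW \<rightarrow>\<^sub>M L"
  by (rule measurable_compose[OF measurable_vimage_algebra1 assms(1)])
     (use measurable_space[OF assms(2)] in auto)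

context
  fixes M :: "'w measure" and SU :: "'u measure" and U and SV :: "'v measure" and V
    and SW :: "'z measure" and W
  assumes M: "prob_space M" and U[measurable]: "U \<in> M \<rightarrow>\<^sub>M SU" and V[measurable]: "V \<in> M \<rightarrow>\<^sub>M SV"
    and W[measurable]: "W \<in> M \<rightarrow>\<^sub>M SW"
begin

interpretation M: prob_space M by (rule M)

abbreviation (input) "FW \<equiv> vimage_algebra (space M) W SW"

interpretation F: finite_measure_subalgebra M FW by (rule finite_measure_subalgebra_vimage[OF M W])

lemma integrable_bdd: "f \<in> borel_measurable M \<Longrightarrow> (\<And>x. x \<in> space M \<Longrightarrow> \<bar>f x :: real\<bar> \<le> B) \<Longrightarrow> integrable M f"
  by (rule M.integrable_const_bound[of _ B]) auto

text \<open>Events generated by \<open>W\<close> are preimages, so testing with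
  \<open>indicator C (W x)\<close> is enough.\<close>

lemma cond_exp_eqI:
  fixes f :: "'w \<Rightarrow> real"
  assumes f: "f \<in> borel_measurable M" "\<And>x. \<bar>f x\<bar> \<le> 1"
    and g: "g \<in> borel_measurable FW" "integrable M g"
    and eq: "\<And>C. C \<in> sets SW \<Longrightarrow> (\<integral>x. indicator C (W x) * f x \<partial>M) = (\<integral>x. indicator C (W x) * g x \<partial>M)"
  shows "AE x in M. real_cond_exp M FW f x = g x"
proof (rule F.real_cond_exp_charact)
  fix A assume "A \<in> sets FW"
  then obtain C where C: "C \<in> sets SW" "A = W -` C \<inter> space M" by (rule sets_vimage_algebraE[OF _ W])
  have "(\<integral>x\<in>A. k x \<partial>M) = (\<integral>x. indicator C (W x) * k x \<partial>M)" for k :: "'w \<Rightarrow> real"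
    unfolding set_lebesgue_integral_def C(2)
    by (rule Bochner_Integration.integral_cong) (auto simp: indicator_def)
  then show "(\<integral>x\<in>A. f x \<partial>M) = (\<integral>x\<in>A. g x \<partial>M)" using eq[OF C(1)] by simp
next
  show "integrable M f" by (rule integrable_bdd[OF f(1), of 1]) (rule f(2))
qed (rule g)+

text \<open>By \<open>eq\<close>, \<open>h (W x)\<close> is a version of the conditional probability
  of \<open>B\<close>. Under conditional independence, replacing the indicator of \<open>B\<close>
  by it goes unnoticed not only by \<open>W\<close> but by \<open>U\<close> and \<open>W\<close>
  jointly. This integral form drives the induction over time in
  \<open>kernel_causalI\<close>.\<close>

lemma cond_indep_varD:
  assumes ci: "cond_indep_var M SU U SV V SW W"
    and A[measurable]: "A \<in> sets SU" and B[measurable]: "B \<in> sets SV" and C[measurable]: "C \<in> sets SW"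
    and h[measurable]: "h \<in> borel_measurable SW" and h1: "\<And>w. w \<in> space SW \<Longrightarrow> \<bar>h w :: real\<bar> \<le> 1"
    and eq: "\<And>C. C \<in> sets SW \<Longrightarrow>
      (\<integral>x. indicator C (W x) * indicator B (V x) \<partial>M) = (\<integral>x. indicator C (W x) * h (W x) \<partial>M)"
  shows "(\<integral>x. indicator C (W x) * (indicator A (U x) * indicator B (V x)) \<partial>M) =
    (\<integral>x. indicator C (W x) * (indicator A (U x) * h (W x)) \<partial>M)"
proof -
  let ?P = "real_cond_exp M FW"
  let ?A = "\<lambda>x. indicator A (U x) :: real" and ?B = "\<lambda>x. indicator B (V x) :: real"
    and ?C = "\<lambda>x. indicator C (W x) :: real"
  have hW: "\<bar>h (W x)\<bar> \<le> 1" if "x \<in> space M" for x using h1 measurable_space[OF W that] .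
  have i: "integrable M (\<lambda>x. h (W x))" by (rule integrable_bdd[of _ 1]) (auto simp: hW)
  have hF: "(\<lambda>x. h (W x)) \<in> borel_measurable FW" by (rule measurable_vimage_algebra_compose[OF h W])
  have CF: "(\<lambda>x. indicator C (W x) :: real) \<in> borel_measurable FW" if "C \<in> sets SW" for C
    by (rule measurable_vimage_algebra_compose[OF borel_measurable_indicator[OF that] W])
  have 1: "AE x in M. ?P ?B x = h (W x)"
  proof (rule cond_exp_eqI)
    show "\<bar>?B x\<bar> \<le> 1" for x by simp
    show "(\<lambda>x. h (W x)) \<in> borel_measurable FW" by (rule hF)
  qed (measurable, rule i, rule eq)
  have e: "indicator (U -` A \<inter> V -` B) = (\<lambda>x. ?A x * ?B x)" "indicator (U -` A) = ?A" "indicator (V -` B) = ?B"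
    by (auto simp: indicator_def fun_eq_iff)
  have 2: "AE x in M. ?P (\<lambda>x. ?A x * ?B x) x = ?P ?A x * ?P ?B x"
    using ci A B unfolding cond_indep_var_def Let_def e[symmetric] by blast
  have iA: "integrable M ?A" by (rule integrable_bdd[of _ 1]) auto
  have iC: "integrable M (\<lambda>x. ?C x * h (W x) * ?A x)"
    by (rule integrable_bdd[of _ 1]) (auto simp: indicator_def hW)
  have "(\<integral>x. ?C x * (?A x * ?B x) \<partial>M) = (\<integral>x. ?C x * ?P (\<lambda>x. ?A x * ?B x) x \<partial>M)"
    by (rule F.real_cond_exp_intg(2)[symmetric, OF _ CF[OF C]])
       (auto intro!: integrable_bdd[of _ 1] simp: indicator_def)
  also have "\<dots> = (\<integral>x. ?C x * h (W x) * ?P ?A x \<partial>M)"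
  proof (rule integral_cong_AE)
    show "AE x in M. ?C x * ?P (\<lambda>x. ?A x * ?B x) x = ?C x * h (W x) * ?P ?A x"
      using 1 2 by eventually_elim (simp add: mult_ac)
  qed auto
  also have "\<dots> = (\<integral>x. ?C x * h (W x) * ?A x \<partial>M)"
    by (rule F.real_cond_exp_intg(2)[OF iC borel_measurable_times[OF CF[OF C] hF]]) measurable
  finally show ?thesis by (simp add: mult_ac)
qed

text \<open>A single function \<open>h\<close> for each \<open>B\<close>, tested jointly by
  \<open>U\<close> and \<open>W\<close>, carries both the conditional probability of
  \<open>B\<close> and the factorisation. Together with \<open>cond_indep_varD\<close> this removes
  conditional expectations from the rest of the proof.\<close>

lemma cond_indep_varI:
  assumes "\<And>B. B \<in> sets SV \<Longrightarrow> \<exists>h\<in>borel_measurable SW. (\<forall>w\<in>space SW. \<bar>h w :: real\<bar> \<le> 1) \<and>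
    (\<forall>A\<in>sets SU. \<forall>C\<in>sets SW. (\<integral>x. indicator C (W x) * (indicator A (U x) * indicator B (V x)) \<partial>M) =
      (\<integral>x. indicator C (W x) * (indicator A (U x) * h (W x)) \<partial>M))"
  shows "cond_indep_var M SU U SV V SW W"
  unfolding cond_indep_var_def Let_def
proof (intro conjI U V W ballI)
  fix A B assume A[measurable]: "A \<in> sets SU" and B[measurable]: "B \<in> sets SV"
  let ?P = "real_cond_exp M FW"
  let ?A = "\<lambda>x. indicator A (U x) :: real" and ?B = "\<lambda>x. indicator B (V x) :: real"
  obtain h where h[measurable]: "h \<in> borel_measurable SW" and h1: "\<And>w. w \<in> space SW \<Longrightarrow> \<bar>h w\<bar> \<le> 1"
    and eq: "\<And>A C. A \<in> sets SU \<Longrightarrow> C \<in> sets SW \<Longrightarrow>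
       (\<integral>x. indicator C (W x) * (indicator A (U x) * ?B x) \<partial>M) =
       (\<integral>x. indicator C (W x) * (indicator A (U x) * h (W x)) \<partial>M)"
    using assms[OF B] by blast
  have hW: "\<bar>h (W x)\<bar> \<le> 1" if "x \<in> space M" for x using h1 measurable_space[OF W that] .
  have hF: "(\<lambda>x. h (W x)) \<in> borel_measurable FW" by (rule measurable_vimage_algebra_compose[OF h W])
  have CF: "(\<lambda>x. indicator C (W x) :: real) \<in> borel_measurable FW" if "C \<in> sets SW" for C
    by (rule measurable_vimage_algebra_compose[OF borel_measurable_indicator[OF that] W])
  have i: "integrable M (\<lambda>x. h (W x))" by (rule integrable_bdd[of _ 1]) (auto simp: hW)
  have sp: "indicator (space SU) (U x) = (1::real)" if "x \<in> space M" for x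
    using measurable_space[OF U that] by simp
  have 1: "AE x in M. ?P ?B x = h (W x)"
  proof (rule cond_exp_eqI)
    fix C assume "C \<in> sets SW"
    \<comment> \<open>Taking the whole space for \<open>A\<close> identifies \<open>h (W x)\<close>
      as the conditional probability of \<open>B\<close>.\<close>
    from eq[OF sets.top this] show "(\<integral>x. indicator C (W x) * ?B x \<partial>M) = (\<integral>x. indicator C (W x) * h (W x) \<partial>M)"
      by (simp add: sp cong: Bochner_Integration.integral_cong)
  next
    show "\<bar>?B x\<bar> \<le> 1" for x by simp
    show "(\<lambda>x. h (W x)) \<in> borel_measurable FW" by (rule hF)
  qed (measurable, rule i)
  have iA: "integrable M ?A" by (rule integrable_bdd[of _ 1]) auto
  have ihA: "integrable M (\<lambda>x. h (W x) * ?A x)"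
    by (rule integrable_bdd[of _ 1]) (auto simp: indicator_def hW)
  have 2: "AE x in M. ?P (\<lambda>x. ?A x * ?B x) x = ?P ?A x * h (W x)"
  proof (rule cond_exp_eqI)
    have "integrable M (\<lambda>x. h (W x) * ?P ?A x)"
      by (rule F.real_cond_exp_intg(1)[OF ihA hF]) measurable
    then show "integrable M (\<lambda>x. ?P ?A x * h (W x))" by (simp add: mult.commute)
    fix C assume C[measurable]: "C \<in> sets SW"
    have iC: "integrable M (\<lambda>x. indicator C (W x) * h (W x) * ?A x)"
      by (rule integrable_bdd[of _ 1]) (auto simp: indicator_def hW)
    have "(\<integral>x. indicator C (W x) * (?A x * ?B x) \<partial>M) = (\<integral>x. indicator C (W x) * h (W x) * ?A x \<partial>M)"
      unfolding eq[OF A C] by (simp add: mult_ac)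
    also have "\<dots> = (\<integral>x. indicator C (W x) * h (W x) * ?P ?A x \<partial>M)"
      by (rule F.real_cond_exp_intg(2)[OF iC borel_measurable_times[OF CF[OF C] hF], symmetric]) measurable
    finally show "(\<integral>x. indicator C (W x) * (?A x * ?B x) \<partial>M) = (\<integral>x. indicator C (W x) * (?P ?A x * h (W x)) \<partial>M)"
      by (simp add: mult_ac)
  next
    show "\<bar>?A x * ?B x\<bar> \<le> 1" for x by (simp add: indicator_def)
    show "(\<lambda>x. ?P ?A x * h (W x)) \<in> borel_measurable FW"
      by (intro borel_measurable_times borel_measurable_cond_exp hF)
  qed measurable
  have e: "indicator (U -` A \<inter> V -` B) = (\<lambda>x. ?A x * ?B x)" "indicator (U -` A) = ?A" "indicator (V -` B) = ?B"
    by (auto simp: indicator_def fun_eq_iff)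
  show "AE x in M. ?P (indicator (U -` A \<inter> V -` B)) x = ?P (indicator (U -` A)) x * ?P (indicator (V -` B)) x"
    unfolding e using 1 2 by eventually_elim simp
qed

end

text \<open>Conditional expectations are Bochner integrals, kernels are handled by nonnegative
  integrals; identities between functions with values in [0, 1] pass between the two.\<close>

lemma integral_eq_iff_nn_integral_eq:
  fixes f g :: "'a \<Rightarrow> real"
  assumes "prob_space M" and f: "f \<in> borel_measurable M" "\<And>x. x \<in> space M \<Longrightarrow> 0 \<le> f x \<and> f x \<le> 1"
    and g: "g \<in> borel_measurable M" "\<And>x. x \<in> space M \<Longrightarrow> 0 \<le> g x \<and> g x \<le> 1"
  shows "(\<integral>x. f x \<partial>M) = (\<integral>x. g x \<partial>M) \<longleftrightarrow> (\<integral>\<^sup>+x. ennreal (f x) \<partial>M) = (\<integral>\<^sup>+x. ennreal (g x) \<partial>M)"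
proof -
  interpret prob_space M by fact
  have "integrable M f" by (rule integrable_const_bound[of _ 1]) (use f in auto)
  moreover have "integrable M g" by (rule integrable_const_bound[of _ 1]) (use g in auto)
  moreover have "0 \<le> (\<integral>x. f x \<partial>M)" "0 \<le> (\<integral>x. g x \<partial>M)"
    by (rule integral_nonneg_AE, rule AE_I2, simp add: f g)+
  ultimately show ?thesis using f(2) g(2)
    by (simp add: nn_integral_eq_integral)
qed

text \<open>By the last conjunct the path is a measurable function of its history up to
  \<open>N\<close>, so an event about the path is an event about that history. It also makes the
  path space a retract of a product of standard spaces. No topology is mentioned, so that pairs of
  processes qualify as well.\<close>

definition process_space :: "nat \<Rightarrow> ('p, 's) coord_process \<Rightarrow> 'p measure \<Rightarrow> bool" where
  "process_space N P MP \<longleftrightarrow>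
     (\<forall>t\<in>{1..N}. coord P t \<in> MP \<rightarrow>\<^sub>M comp_space P t \<and> standard_space (comp_space P t)) \<and>
     (\<exists>r\<in>hist_space P N \<rightarrow>\<^sub>M MP. \<forall>x\<in>space MP. r (hist P N x) = x)"

lemma process_coord [measurable]:
  "process_space N P MP \<Longrightarrow> t \<in> {1..N} \<Longrightarrow> coord P t \<in> MP \<rightarrow>\<^sub>M comp_space P t"
  by (simp add: process_space_def)

lemma process_hist [measurable]:
  assumes "process_space N P MP" "t \<le> N"
  shows "hist P t \<in> MP \<rightarrow>\<^sub>M hist_space P t"
  unfolding hist_def hist_space_def
  by (rule measurable_restrict, rule process_coord[OF assms(1)]) (use assms(2) in auto)

lemma restrict_hist: "s \<le> t \<Longrightarrow> restrict (hist P t x) {1..s} = hist P s x"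
  by (auto simp: hist_def restrict_def fun_eq_iff)

lemma measurable_restrict_hist [measurable]:
  "s \<le> t \<Longrightarrow> (\<lambda>w. restrict w {1..s}) \<in> hist_space P t \<rightarrow>\<^sub>M hist_space P s"
  unfolding hist_space_def by (rule measurable_restrict_subset) auto

lemma standard_space_PiM_nat:
  fixes I :: "nat set"
  assumes "\<And>i. i \<in> I \<Longrightarrow> standard_space (M i)"
  shows "standard_space (PiM I M)"
proof -
  have "\<exists>f g. f \<in> M i \<rightarrow>\<^sub>M baire \<and> g \<in> baire \<rightarrow>\<^sub>M M i \<and> (\<forall>x\<in>space (M i). g (f x) = x)" if "i \<in> I" for i
    using assms[OF that] unfolding standard_space_def by blast
  then obtain f g where f[measurable]: "\<And>i. i \<in> I \<Longrightarrow> f i \<in> M i \<rightarrow>\<^sub>M baire"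
    and g[measurable]: "\<And>i. i \<in> I \<Longrightarrow> g i \<in> baire \<rightarrow>\<^sub>M M i"
    and gf: "\<And>i x. i \<in> I \<Longrightarrow> x \<in> space (M i) \<Longrightarrow> g i (f i x) = x" by metis
  let ?F = "\<lambda>x n. case prod_decode n of (i, k) \<Rightarrow> if i \<in> I then f i (x i) k else 0"
  let ?G = "\<lambda>z. \<lambda>i\<in>I. g i (\<lambda>k. z (prod_encode (i, k)))"
  have "?F \<in> PiM I M \<rightarrow>\<^sub>M baire"
  proof (rule measurable_PiM_single')
    fix n
    obtain i k where n: "prod_decode n = (i, k)" by (cases "prod_decode n")
    show "(\<lambda>x. ?F x n) \<in> PiM I M \<rightarrow>\<^sub>M count_space UNIV"
    proof (cases "i \<in> I")
      case True
      have "(\<lambda>x. f i (x i)) \<in> PiM I M \<rightarrow>\<^sub>M baire"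
        by (rule measurable_compose[OF measurable_component_singleton[OF True, of M] f[OF True]])
      then have "(\<lambda>x. f i (x i) k) \<in> PiM I M \<rightarrow>\<^sub>M count_space UNIV"
        by (rule measurable_compose[OF _ measurable_component_singleton]) simp
      then show ?thesis by (simp add: n True)
    qed (simp add: n)
  qed auto
  moreover have "?G \<in> baire \<rightarrow>\<^sub>M PiM I M"
  proof (rule measurable_restrict)
    fix i assume i: "i \<in> I"
    have "(\<lambda>z k. z (prod_encode (i, k))) \<in> baire \<rightarrow>\<^sub>M baire"
      by (rule measurable_PiM_single') (auto intro!: measurable_component_singleton)
    then show "(\<lambda>z. g i (\<lambda>k. z (prod_encode (i, k)))) \<in> baire \<rightarrow>\<^sub>M M i"
      by (rule measurable_compose[OF _ g[OF i]])
  qed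
  moreover have "?G (?F x) = x" if "x \<in> space (PiM I M)" for x
    using that by (auto simp: space_PiM PiE_iff gf fun_eq_iff restrict_def extensional_def)
  ultimately show ?thesis unfolding standard_space_def
    by (intro bexI[of _ ?F] bexI[of _ ?G] ballI)
qed

lemma process_standard:
  "process_space N P MP \<Longrightarrow> t \<in> {1..N} \<Longrightarrow> standard_space (comp_space P t)"
  unfolding process_space_def by blast

lemma process_retract:
  assumes "process_space N P MP"
  obtains r where "r \<in> hist_space P N \<rightarrow>\<^sub>M MP" "\<And>x. x \<in> space MP \<Longrightarrow> r (hist P N x) = x"
  using assms unfolding process_space_def by blast

lemma standard_space_hist:
  assumes "process_space N P MP" "t \<le> N"
  shows "standard_space (hist_space P t)"
  unfolding hist_space_def
  by (rule standard_space_PiM_nat, rule process_standard[OF assms(1)]) (use assms(2) in auto)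

lemma standard_space_process:
  assumes "process_space N P MP"
  shows "standard_space MP"
proof -
  obtain r where "r \<in> hist_space P N \<rightarrow>\<^sub>M MP" "\<And>x. x \<in> space MP \<Longrightarrow> r (hist P N x) = x"
    using process_retract[OF assms] by metis
  then show ?thesis
    by (rule standard_space_retract[OF standard_space_hist[OF assms order_refl] process_hist[OF assms order_refl]])
qed

text \<open>Causality in kernel form: the law of \<open>Y\<^sub>1\<^sub>:\<^sub>t\<close> given the whole path \<open>X\<close> is a kernel in
  \<open>X\<^sub>1\<^sub>:\<^sub>t\<close>.\<close>

definition kernel_causal ::
    "nat \<Rightarrow> ('p, 's) coord_process \<Rightarrow> 'p measure \<Rightarrow> ('q, 'u) coord_process \<Rightarrow>
     'w measure \<Rightarrow> ('w \<Rightarrow> 'p) \<Rightarrow> ('w \<Rightarrow> 'q) \<Rightarrow> bool" where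
  "kernel_causal N P MP Q M X Y \<longleftrightarrow>
     (\<forall>t\<in>{1..<N}. \<exists>k\<in>hist_space P t \<rightarrow>\<^sub>M prob_algebra (hist_space Q t).
        \<forall>g\<in>borel_measurable MP. \<forall>f\<in>borel_measurable (hist_space Q t).
          (\<integral>\<^sup>+\<omega>. g (X \<omega>) * f (hist Q t (Y \<omega>)) \<partial>M) =
          (\<integral>\<^sup>+\<omega>. g (X \<omega>) * (\<integral>\<^sup>+v. f v \<partial>k (hist P t (X \<omega>))) \<partial>M))"

text \<open>The hypothesis looks one step ahead: X at time s + 1 tells nothing about the past of Y
  beyond what X up to s tells. Let k be the conditional law of Y up to t given X up to t. Induction
  on s \<ge> t shows that k is still the conditional law given X up to s, each step revealing one
  more coordinate of X; at s = N the whole path is revealed.\<close>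

lemma kernel_causalI:
  fixes X :: "'w \<Rightarrow> 'p" and Y :: "'w \<Rightarrow> 'q"
  assumes P: "process_space N P MP" and Q: "process_space N Q MQ"
    and M: "prob_space M" and X[measurable]: "X \<in> M \<rightarrow>\<^sub>M MP" and Y[measurable]: "Y \<in> M \<rightarrow>\<^sub>M MQ"
    and ci: "\<And>t. t \<in> {1..<N} \<Longrightarrow> cond_indep_var M (comp_space P (t + 1)) (\<lambda>\<omega>. coord P (t + 1) (X \<omega>))
      (hist_space Q t) (\<lambda>\<omega>. hist Q t (Y \<omega>)) (hist_space P t) (\<lambda>\<omega>. hist P t (X \<omega>))"
  shows "kernel_causal N P MP Q M X Y"
  unfolding kernel_causal_def
proof
  fix t assume t: "t \<in> {1..<N}"
  interpret M: prob_space M by fact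
  have hX: "s \<le> N \<Longrightarrow> (\<lambda>\<omega>. hist P s (X \<omega>)) \<in> M \<rightarrow>\<^sub>M hist_space P s" for s
    by (rule measurable_compose[OF X process_hist[OF P]])
  have hY: "s \<le> N \<Longrightarrow> (\<lambda>\<omega>. hist Q s (Y \<omega>)) \<in> M \<rightarrow>\<^sub>M hist_space Q s" for s
    by (rule measurable_compose[OF Y process_hist[OF Q]])
  have tN: "t \<le> N" using t by auto
  note hXt[measurable] = hX[OF tN] and hYt[measurable] = hY[OF tN]
  define \<gamma> where "\<gamma> = distr M (hist_space P t \<Otimes>\<^sub>M hist_space Q t) (\<lambda>\<omega>. (hist P t (X \<omega>), hist Q t (Y \<omega>)))"
  have p\<gamma>: "prob_space \<gamma>" unfolding \<gamma>_def by (rule M.prob_space_distr) simp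
  define \<mu> where "\<mu> = distr M (hist_space P t) (\<lambda>\<omega>. hist P t (X \<omega>))"
  have \<mu>: "distr \<gamma> (hist_space P t) fst = \<mu>"
    unfolding \<gamma>_def \<mu>_def by (subst distr_distr) (auto simp: comp_def)
  have p\<mu>: "prob_space \<mu>" and s\<mu>: "sets \<mu> = sets (hist_space P t)"
    unfolding \<mu>_def by (auto intro: M.prob_space_distr)
  obtain k where k[measurable]: "k \<in> hist_space P t \<rightarrow>\<^sub>M prob_algebra (hist_space Q t)"
    and \<gamma>k: "\<gamma> = kernel_prod \<mu> (hist_space Q t) k"
    by (rule disintegration[OF standard_space_hist[OF Q tN] p\<gamma>, of "hist_space P t"])
       (auto simp: \<gamma>_def \<mu>[unfolded \<gamma>_def])
  have kk: "prob_space (k (hist P t (X \<omega>)))" "sets (k (hist P t (X \<omega>))) = sets (hist_space Q t)"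
    if "\<omega> \<in> space M" for \<omega>
    using kernel_sets[OF k measurable_space[OF hXt that]] by auto
  have kk1: "measure (k (hist P t (X \<omega>))) B \<le> 1" if "\<omega> \<in> space M" for \<omega> B
    using kk(1)[OF that] by (rule prob_space.prob_le_1)
  \<comment> \<open>The induction runs over s with \<open>B\<close> fixed and \<open>C\<close>
    arbitrary; the kernel keeps looking at the history up to t only.\<close>
  have claim: "(\<integral>\<omega>. indicator C (hist P s (X \<omega>)) * indicator B (hist Q t (Y \<omega>)) \<partial>M) =
      (\<integral>\<omega>. indicator C (hist P s (X \<omega>)) * measure (k (hist P t (X \<omega>))) B \<partial>M)"
    if "t \<le> s" "s \<le> N" "B \<in> sets (hist_space Q t)" "C \<in> sets (hist_space P s)" for s B C
    using that
  proof (induction s arbitrary: C rule: dec_induct)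
    case base
    note [measurable] = base(2,3)
    have "(\<integral>\<^sup>+\<omega>. indicator C (hist P t (X \<omega>)) * indicator B (hist Q t (Y \<omega>)) \<partial>M)
      = (\<integral>\<^sup>+z. indicator C (fst z) * indicator B (snd z) \<partial>\<gamma>)"
      unfolding \<gamma>_def by (subst nn_integral_distr) auto
    also have "\<dots> = (\<integral>\<^sup>+w. \<integral>\<^sup>+v. indicator C w * indicator B v \<partial>k w \<partial>\<mu>)"
      unfolding \<gamma>k by (subst nn_integral_kernel_prod[OF p\<mu> s\<mu> k]) auto
    also have "\<dots> = (\<integral>\<^sup>+\<omega>. \<integral>\<^sup>+v. indicator C (hist P t (X \<omega>)) * indicator B v \<partial>k (hist P t (X \<omega>)) \<partial>M)"
      unfolding \<mu>_def by (subst nn_integral_distr) auto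
    also have "\<dots> = (\<integral>\<^sup>+\<omega>. indicator C (hist P t (X \<omega>)) * emeasure (k (hist P t (X \<omega>))) B \<partial>M)"
      by (intro nn_integral_cong) (simp add: nn_integral_cmult_indicator kk base)
    finally have *: "(\<integral>\<^sup>+\<omega>. indicator C (hist P t (X \<omega>)) * indicator B (hist Q t (Y \<omega>)) \<partial>M) =
      (\<integral>\<^sup>+\<omega>. indicator C (hist P t (X \<omega>)) * emeasure (k (hist P t (X \<omega>))) B \<partial>M)" .
    show ?case
    proof (subst integral_eq_iff_nn_integral_eq[OF M])
      show "(\<integral>\<^sup>+\<omega>. ennreal (indicator C (hist P t (X \<omega>)) * indicator B (hist Q t (Y \<omega>))) \<partial>M) =
        (\<integral>\<^sup>+\<omega>. ennreal (indicator C (hist P t (X \<omega>)) * measure (k (hist P t (X \<omega>))) B) \<partial>M)"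
        unfolding ennreal_mult'[OF indicator_pos_le] ennreal_indicator
        using * kk by (simp add: finite_measure.emeasure_eq_measure prob_space_def cong: nn_integral_cong)
    qed (use kk1 in \<open>auto simp: indicator_def\<close>)
  next
    case (step s)
    then have s: "s < N" "s \<le> N" "Suc s \<le> N" "t \<le> s" "s \<in> {1..<N}" using t by auto
    note [measurable] = hX[OF s(2)] hX[OF s(3)] hY[OF s(2)] step.prems(2) step.prems(3)
    have IH: "C \<in> sets (hist_space P s) \<Longrightarrow>
      (\<integral>\<omega>. indicator C (hist P s (X \<omega>)) * indicator B (hist Q t (Y \<omega>)) \<partial>M) =
      (\<integral>\<omega>. indicator C (hist P s (X \<omega>)) * measure (k (hist P t (X \<omega>))) B \<partial>M)" for C
      by (rule step.IH[OF s(2) step.prems(2)])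
    \<comment> \<open>Conditional independence at time s concerns Y up to s, so the event
      \<open>B\<close> about Y up to t is rewritten as an event about the longer history.\<close>
    define B' where "B' = {v \<in> space (hist_space Q s). restrict v {1..t} \<in> B}"
    have B'[measurable]: "B' \<in> sets (hist_space Q s)"
      unfolding B'_def using measurable_restrict_hist[OF s(4), of Q] by measurable
    have iB': "indicator B' (hist Q s (Y \<omega>)) = (indicator B (hist Q t (Y \<omega>)) :: real)" if "\<omega> \<in> space M" for \<omega>
    proof -
      have "hist Q s (Y \<omega>) \<in> B' \<longleftrightarrow> hist Q t (Y \<omega>) \<in> B"
        unfolding B'_def mem_Collect_eq restrict_hist[OF s(4)] using measurable_space[OF hY[OF s(2)] that] by blast
      then show ?thesis by (simp add: indicator_def)
    qed
    define h where "h w = measure (k (restrict w {1..t})) B" for w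
    have h_meas[measurable]: "h \<in> borel_measurable (hist_space P s)"
    proof -
      have "(\<lambda>w. k (restrict w {1..t})) \<in> hist_space P s \<rightarrow>\<^sub>M prob_algebra (hist_space Q t)"
        by (rule measurable_compose[OF measurable_restrict_hist[OF s(4)] k])
      then show ?thesis unfolding h_def
        by (rule measurable_compose[OF _ measurable_measure_prob_algebra[OF step.prems(2)]])
    qed
    have h1: "\<bar>h w\<bar> \<le> 1" if "w \<in> space (hist_space P s)" for w
      unfolding h_def using kernel_sets(3)[OF k measurable_space[OF measurable_restrict_hist[OF s(4)] that]]
      by (simp add: prob_space.prob_le_1)
    have hh: "h (hist P s (X \<omega>)) = measure (k (hist P t (X \<omega>))) B" for \<omega>
      unfolding h_def restrict_hist[OF s(4)] ..
    have key: "(\<integral>\<omega>. indicator C (hist P s (X \<omega>)) * (indicator A (coord P (s + 1) (X \<omega>)) * indicator B (hist Q t (Y \<omega>))) \<partial>M) =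
      (\<integral>\<omega>. indicator C (hist P s (X \<omega>)) * (indicator A (coord P (s + 1) (X \<omega>)) * measure (k (hist P t (X \<omega>))) B) \<partial>M)"
      if A: "A \<in> sets (comp_space P (s + 1))" and C: "C \<in> sets (hist_space P s)" for A C
    proof -
      have cX: "(\<lambda>\<omega>. coord P (s + 1) (X \<omega>)) \<in> M \<rightarrow>\<^sub>M comp_space P (s + 1)"
        by (rule measurable_compose[OF X process_coord[OF P]]) (use s in auto)
      have "(\<integral>\<omega>. indicator C (hist P s (X \<omega>)) * (indicator A (coord P (s + 1) (X \<omega>)) * indicator B' (hist Q s (Y \<omega>))) \<partial>M) =
        (\<integral>\<omega>. indicator C (hist P s (X \<omega>)) * (indicator A (coord P (s + 1) (X \<omega>)) * h (hist P s (X \<omega>))) \<partial>M)"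
      proof (rule cond_indep_varD[OF M cX hY[OF s(2)] hX[OF s(2)] ci[OF s(5)] A B' C h_meas h1])
        fix C' assume "C' \<in> sets (hist_space P s)"
        from IH[OF this]
        show "(\<integral>\<omega>. indicator C' (hist P s (X \<omega>)) * indicator B' (hist Q s (Y \<omega>)) \<partial>M) =
          (\<integral>\<omega>. indicator C' (hist P s (X \<omega>)) * h (hist P s (X \<omega>)) \<partial>M)"
          by (simp add: hh iB' cong: Bochner_Integration.integral_cong)
      qed
      then show ?thesis by (simp add: hh iB' cong: Bochner_Integration.integral_cong)
    qed
    define \<nu> where "\<nu> f = distr (density M (\<lambda>\<omega>. ennreal (f \<omega>))) (hist_space P (Suc s)) (\<lambda>\<omega>. hist P (Suc s) (X \<omega>))"
      for f :: "'w \<Rightarrow> real"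
    have \<nu>: "emeasure (\<nu> f) D = (\<integral>\<^sup>+\<omega>. ennreal (indicator D (hist P (Suc s) (X \<omega>)) * f \<omega>) \<partial>M)"
      if [measurable]: "f \<in> borel_measurable M" "D \<in> sets (hist_space P (Suc s))" for f D
    proof -
      have "emeasure (\<nu> f) D = (\<integral>\<^sup>+w. indicator D w \<partial>\<nu> f)" by (simp add: \<nu>_def)
      also have "\<dots> = (\<integral>\<^sup>+\<omega>. ennreal (f \<omega>) * indicator D (hist P (Suc s) (X \<omega>)) \<partial>M)"
        unfolding \<nu>_def by (subst nn_integral_distr) (auto simp: nn_integral_density)
      also have "\<dots> = (\<integral>\<^sup>+\<omega>. ennreal (indicator D (hist P (Suc s) (X \<omega>)) * f \<omega>) \<partial>M)"
        unfolding ennreal_mult'[OF indicator_pos_le] ennreal_indicator by (simp add: mult.commute)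
      finally show ?thesis .
    qed
    let ?f = "\<lambda>\<omega>. indicator B (hist Q t (Y \<omega>)) :: real" and ?g = "\<lambda>\<omega>. measure (k (hist P t (X \<omega>))) B"
    have f_meas: "?f \<in> borel_measurable M" by measurable
    have g_meas: "?g \<in> borel_measurable M"
      by (rule measurable_compose[OF measurable_compose[OF hXt k] measurable_measure_prob_algebra[OF step.prems(2)]])
    note [measurable] = f_meas g_meas
    have g01: "0 \<le> ?g \<omega> \<and> ?g \<omega> \<le> 1" if "\<omega> \<in> space M" for \<omega>
      using kk(1)[OF that] by (simp add: prob_space.prob_le_1)
    \<comment> \<open>As functions of \<open>C\<close> both sides are finite measures on histories
      up to s + 1. On boxes the indicator splits into a factor for the history up to s and one for
      coordinate s + 1, the form treated by \<open>key\<close>.\<close>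
    have "\<nu> ?f = \<nu> ?g"
    proof (rule measure_eqI_PiM_finite[where A="\<lambda>_. space (hist_space P (Suc s))"])
      show "sets (\<nu> ?f) = sets (PiM {1..Suc s} (comp_space P))" "sets (\<nu> ?g) = sets (PiM {1..Suc s} (comp_space P))"
        by (simp_all add: \<nu>_def hist_space_def)
      show "range (\<lambda>_::nat. space (hist_space P (Suc s))) \<subseteq> prod_algebra {1..Suc s} (comp_space P)"
        unfolding hist_space_def space_PiM by (auto intro!: prod_algebraI_finite)
      have "emeasure (\<nu> ?f) (space (hist_space P (Suc s))) \<le> (\<integral>\<^sup>+\<omega>. 1 \<partial>M)"
        by (subst \<nu>, measurable, intro nn_integral_mono) (simp add: indicator_def)
      then show "emeasure (\<nu> ?f) (space (hist_space P (Suc s))) \<noteq> \<infinity>"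
        by (auto simp: M.emeasure_space_1 top_unique)
      show "(\<Union>i::nat. space (hist_space P (Suc s))) = space (PiM {1..Suc s} (comp_space P))"
        unfolding hist_space_def by simp
      fix E assume E: "\<And>i. i \<in> {1..Suc s} \<Longrightarrow> E i \<in> sets (comp_space P i)"
      have box: "PiE {1..Suc s} E \<in> sets (hist_space P (Suc s))" "PiE {1..s} E \<in> sets (hist_space P s)"
        unfolding hist_space_def using E by (auto intro!: sets_PiM_I_finite)
      have ES: "E (s + 1) \<in> sets (comp_space P (s + 1))" using E[of "s + 1"] by simp
      have cX: "(\<lambda>\<omega>. coord P (s + 1) (X \<omega>)) \<in> M \<rightarrow>\<^sub>M comp_space P (s + 1)"
        by (rule measurable_compose[OF X process_coord[OF P]]) (use s in auto)
      note [measurable] = cX ES box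
      have ib: "indicator (PiE {1..Suc s} E) (hist P (Suc s) (X \<omega>)) =
        (indicator (PiE {1..s} E) (hist P s (X \<omega>)) * indicator (E (s + 1)) (coord P (s + 1) (X \<omega>)) :: real)" for \<omega>
        by (auto simp: hist_def PiE_iff indicator_def atLeastAtMostSuc_conv)
      show "emeasure (\<nu> ?f) (PiE {1..Suc s} E) = emeasure (\<nu> ?g) (PiE {1..Suc s} E)"
        unfolding \<nu>[OF f_meas box(1)] \<nu>[OF g_meas box(1)] ib mult.assoc
      proof (rule integral_eq_iff_nn_integral_eq[OF M, THEN iffD1])
        show "(\<integral>\<omega>. indicator (PiE {1..s} E) (hist P s (X \<omega>)) * (indicator (E (s + 1)) (coord P (s + 1) (X \<omega>)) * ?f \<omega>) \<partial>M) =
          (\<integral>\<omega>. indicator (PiE {1..s} E) (hist P s (X \<omega>)) * (indicator (E (s + 1)) (coord P (s + 1) (X \<omega>)) * ?g \<omega>) \<partial>M)"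
          by (rule key[OF ES box(2)])
      qed (measurable, simp add: indicator_def, measurable, simp add: indicator_def g01)
    qed simp
    then have "emeasure (\<nu> ?f) C = emeasure (\<nu> ?g) C" by simp
    then show ?case
      unfolding \<nu>[OF f_meas step.prems(3)] \<nu>[OF g_meas step.prems(3)]
      by (subst integral_eq_iff_nn_integral_eq[OF M]) (use g01 in \<open>auto simp: indicator_def\<close>)
  qed
  define k' where "k' x = k (hist P t x)" for x
  have k'[measurable]: "k' \<in> MP \<rightarrow>\<^sub>M prob_algebra (hist_space Q t)"
    unfolding k'_def by (rule measurable_compose[OF process_hist[OF P tN] k])
  define \<mu>X where "\<mu>X = distr M MP X"
  have p\<mu>X: "prob_space \<mu>X" and s\<mu>X[measurable_cong]: "sets \<mu>X = sets MP"
    unfolding \<mu>X_def by (auto intro: M.prob_space_distr)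
  define \<gamma>X where "\<gamma>X = distr M (MP \<Otimes>\<^sub>M hist_space Q t) (\<lambda>\<omega>. (X \<omega>, hist Q t (Y \<omega>)))"
  have \<gamma>X: "\<gamma>X = kernel_prod \<mu>X (hist_space Q t) k'"
  proof (rule prob_measure_eqI_pair[OF _ sets_kernel_prod[OF p\<mu>X s\<mu>X k']])
    show "prob_space \<gamma>X" unfolding \<gamma>X_def by (rule M.prob_space_distr) simp
    fix A B assume A[measurable]: "A \<in> sets MP" and B[measurable]: "B \<in> sets (hist_space Q t)"
    obtain r where r[measurable]: "r \<in> hist_space P N \<rightarrow>\<^sub>M MP" and rh: "\<And>x. x \<in> space MP \<Longrightarrow> r (hist P N x) = x"
      using process_retract[OF P] by metis
    \<comment> \<open>The retraction turns an event about paths into one about full histories, to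
      which \<open>claim\<close> with s = N applies.\<close>
    define C where "C = r -` A \<inter> space (hist_space P N)"
    have C: "C \<in> sets (hist_space P N)" unfolding C_def by measurable
    have iC: "indicator C (hist P N (X \<omega>)) = (indicator A (X \<omega>) :: real)" if "\<omega> \<in> space M" for \<omega>
      using measurable_space[OF X that] measurable_space[OF hX[OF order_refl] that] rh
      by (simp add: C_def indicator_def)
    have "(\<integral>\<omega>. indicator A (X \<omega>) * indicator B (hist Q t (Y \<omega>)) \<partial>M) =
      (\<integral>\<omega>. indicator A (X \<omega>) * measure (k (hist P t (X \<omega>))) B \<partial>M)"
      using claim[OF tN order_refl B C] by (simp add: iC cong: Bochner_Integration.integral_cong)
    then have *: "(\<integral>\<^sup>+\<omega>. ennreal (indicator A (X \<omega>) * indicator B (hist Q t (Y \<omega>))) \<partial>M) =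
      (\<integral>\<^sup>+\<omega>. ennreal (indicator A (X \<omega>) * measure (k (hist P t (X \<omega>))) B) \<partial>M)"
      by (subst (asm) integral_eq_iff_nn_integral_eq[OF M])
         (use kk1 in \<open>auto simp: indicator_def\<close>)
    have "emeasure \<gamma>X (A \<times> B) = (\<integral>\<^sup>+z. indicator (A \<times> B) z \<partial>\<gamma>X)"
      by (subst nn_integral_indicator) (auto simp: \<gamma>X_def)
    also have "\<dots> = (\<integral>\<^sup>+\<omega>. ennreal (indicator A (X \<omega>) * indicator B (hist Q t (Y \<omega>))) \<partial>M)"
      unfolding \<gamma>X_def ennreal_mult'[OF indicator_pos_le] ennreal_indicator
      by (subst nn_integral_distr) (auto simp: indicator_times)
    also note *
    also have "(\<integral>\<^sup>+\<omega>. ennreal (indicator A (X \<omega>) * measure (k (hist P t (X \<omega>))) B) \<partial>M) =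
      (\<integral>\<^sup>+\<omega>. indicator A (X \<omega>) * emeasure (k' (X \<omega>)) B \<partial>M)"
      unfolding ennreal_mult'[OF indicator_pos_le] ennreal_indicator k'_def
      using kk(1) by (intro nn_integral_cong) (simp add: finite_measure.emeasure_eq_measure prob_space_def)
    also have "\<dots> = (\<integral>\<^sup>+x. indicator A x * emeasure (k' x) B \<partial>\<mu>X)"
      unfolding \<mu>X_def
      using measurable_emeasure_kernel[OF measurable_prob_algebraD[OF k'] B]
      by (subst nn_integral_distr) auto
    also have "\<dots> = (\<integral>\<^sup>+x. \<integral>\<^sup>+v. indicator A x * indicator B v \<partial>k' x \<partial>\<mu>X)"
      using sets_eq_imp_space_eq[OF s\<mu>X]
      by (intro nn_integral_cong) (simp add: nn_integral_cmult_indicator kernel_sets[OF k'])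
    also have "\<dots> = (\<integral>\<^sup>+z. indicator (A \<times> B) z \<partial>kernel_prod \<mu>X (hist_space Q t) k')"
      by (subst nn_integral_kernel_prod[OF p\<mu>X s\<mu>X k']) (auto simp: indicator_times)
    finally show "emeasure \<gamma>X (A \<times> B) = emeasure (kernel_prod \<mu>X (hist_space Q t) k') (A \<times> B)"
      by (simp add: sets_kernel_prod[OF p\<mu>X s\<mu>X k'])
  qed (simp add: \<gamma>X_def)
  have "(\<integral>\<^sup>+\<omega>. g (X \<omega>) * f (hist Q t (Y \<omega>)) \<partial>M) = (\<integral>\<^sup>+\<omega>. g (X \<omega>) * (\<integral>\<^sup>+v. f v \<partial>k (hist P t (X \<omega>))) \<partial>M)"
    if g[measurable]: "g \<in> borel_measurable MP" and f[measurable]: "f \<in> borel_measurable (hist_space Q t)" for g f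
  proof -
    have "(\<integral>\<^sup>+\<omega>. g (X \<omega>) * f (hist Q t (Y \<omega>)) \<partial>M) = (\<integral>\<^sup>+z. g (fst z) * f (snd z) \<partial>\<gamma>X)"
      unfolding \<gamma>X_def by (subst nn_integral_distr) auto
    also have "\<dots> = (\<integral>\<^sup>+x. \<integral>\<^sup>+v. g x * f v \<partial>k' x \<partial>\<mu>X)"
      unfolding \<gamma>X by (subst nn_integral_kernel_prod[OF p\<mu>X s\<mu>X k']) auto
    also have "\<dots> = (\<integral>\<^sup>+x. g x * (\<integral>\<^sup>+v. f v \<partial>k' x) \<partial>\<mu>X)"
    proof (intro nn_integral_cong nn_integral_cmult)
      fix x assume "x \<in> space \<mu>X"
      then have x: "x \<in> space MP" using sets_eq_imp_space_eq[OF s\<mu>X] by simp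
      show "f \<in> borel_measurable (k' x)"
        by (subst measurable_cong_sets[OF kernel_sets(1)[OF k' x] refl]) (rule f)
    qed
    also have "\<dots> = (\<integral>\<^sup>+\<omega>. g (X \<omega>) * (\<integral>\<^sup>+v. f v \<partial>k' (X \<omega>)) \<partial>M)"
      unfolding \<mu>X_def by (subst nn_integral_distr) auto
    finally show ?thesis by (simp add: k'_def)
  qed
  with k show "\<exists>k\<in>hist_space P t \<rightarrow>\<^sub>M prob_algebra (hist_space Q t).
        \<forall>g\<in>borel_measurable MP. \<forall>f\<in>borel_measurable (hist_space Q t).
          (\<integral>\<^sup>+\<omega>. g (X \<omega>) * f (hist Q t (Y \<omega>)) \<partial>M) =
          (\<integral>\<^sup>+\<omega>. g (X \<omega>) * (\<integral>\<^sup>+v. f v \<partial>k (hist P t (X \<omega>))) \<partial>M)"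
    by (intro bexI[of _ k] ballI)
qed

text \<open>Coordinate t + 1 and the history up to t are both functions of the path, so the product
  of their indicators may be taken for \<open>g\<close>. The mass that the kernel gives to
  \<open>B\<close> serves as the function \<open>h\<close> of
  \<open>cond_indep_varI\<close>.\<close>

lemma kernel_causalD:
  fixes X :: "'w \<Rightarrow> 'p" and Y :: "'w \<Rightarrow> 'q"
  assumes P: "process_space N P MP" and Q: "process_space N Q MQ"
    and M: "prob_space M" and X[measurable]: "X \<in> M \<rightarrow>\<^sub>M MP" and Y[measurable]: "Y \<in> M \<rightarrow>\<^sub>M MQ"
    and kc: "kernel_causal N P MP Q M X Y" and t: "t \<in> {1..<N}"
  shows "cond_indep_var M (comp_space P (t + 1)) (\<lambda>\<omega>. coord P (t + 1) (X \<omega>))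
      (hist_space Q t) (\<lambda>\<omega>. hist Q t (Y \<omega>)) (hist_space P t) (\<lambda>\<omega>. hist P t (X \<omega>))"
proof -
  have tN: "t \<le> N" "t + 1 \<in> {1..N}" using t by auto
  note hP[measurable] = process_hist[OF P tN(1)]
  note cP[measurable] = process_coord[OF P tN(2)]
  have hX[measurable]: "(\<lambda>\<omega>. hist P t (X \<omega>)) \<in> M \<rightarrow>\<^sub>M hist_space P t"
    by (rule measurable_compose[OF X hP])
  have hY[measurable]: "(\<lambda>\<omega>. hist Q t (Y \<omega>)) \<in> M \<rightarrow>\<^sub>M hist_space Q t"
    by (rule measurable_compose[OF Y process_hist[OF Q tN(1)]])
  have cX[measurable]: "(\<lambda>\<omega>. coord P (t + 1) (X \<omega>)) \<in> M \<rightarrow>\<^sub>M comp_space P (t + 1)"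
    by (rule measurable_compose[OF X cP])
  obtain k where k[measurable]: "k \<in> hist_space P t \<rightarrow>\<^sub>M prob_algebra (hist_space Q t)"
    and eq: "\<And>g f. g \<in> borel_measurable MP \<Longrightarrow> f \<in> borel_measurable (hist_space Q t) \<Longrightarrow>
          (\<integral>\<^sup>+\<omega>. g (X \<omega>) * f (hist Q t (Y \<omega>)) \<partial>M) =
          (\<integral>\<^sup>+\<omega>. g (X \<omega>) * (\<integral>\<^sup>+v. f v \<partial>k (hist P t (X \<omega>))) \<partial>M)"
    using kc t unfolding kernel_causal_def by blast
  have kk: "prob_space (k (hist P t (X \<omega>)))" "sets (k (hist P t (X \<omega>))) = sets (hist_space Q t)"
    if "\<omega> \<in> space M" for \<omega>
    using kernel_sets[OF k measurable_space[OF hX that]] by auto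
  show ?thesis
  proof (rule cond_indep_varI[OF M cX hY hX])
    fix B assume B[measurable]: "B \<in> sets (hist_space Q t)"
    define h where "h w = measure (k w) B" for w
    have h[measurable]: "h \<in> borel_measurable (hist_space P t)"
      unfolding h_def by (rule measurable_compose[OF k measurable_measure_prob_algebra[OF B]])
    have h01: "0 \<le> h w \<and> h w \<le> 1" if "w \<in> space (hist_space P t)" for w
      unfolding h_def using kernel_sets(3)[OF k that] by (simp add: prob_space.prob_le_1)
    have hh01: "0 \<le> h (hist P t (X \<omega>)) \<and> h (hist P t (X \<omega>)) \<le> 1" if "\<omega> \<in> space M" for \<omega>
      using h01[OF measurable_space[OF hX that]] .
    have "(\<integral>\<omega>. indicator C (hist P t (X \<omega>)) * (indicator A (coord P (t + 1) (X \<omega>)) * indicator B (hist Q t (Y \<omega>))) \<partial>M) =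
        (\<integral>\<omega>. indicator C (hist P t (X \<omega>)) * (indicator A (coord P (t + 1) (X \<omega>)) * h (hist P t (X \<omega>))) \<partial>M)"
      if A[measurable]: "A \<in> sets (comp_space P (t + 1))" and C[measurable]: "C \<in> sets (hist_space P t)" for A C
    proof (rule integral_eq_iff_nn_integral_eq[OF M, THEN iffD2])
      have "(\<integral>\<^sup>+\<omega>. ennreal (indicator C (hist P t (X \<omega>)) * (indicator A (coord P (t + 1) (X \<omega>)) * indicator B (hist Q t (Y \<omega>)))) \<partial>M)
        = (\<integral>\<^sup>+\<omega>. (indicator C (hist P t (X \<omega>)) * indicator A (coord P (t + 1) (X \<omega>))) * indicator B (hist Q t (Y \<omega>)) \<partial>M)"
        by (intro nn_integral_cong) (simp add: indicator_def)
      also have "\<dots> = (\<integral>\<^sup>+\<omega>. (indicator C (hist P t (X \<omega>)) * indicator A (coord P (t + 1) (X \<omega>))) * (\<integral>\<^sup>+v. indicator B v \<partial>k (hist P t (X \<omega>))) \<partial>M)"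
      proof (rule eq[of "\<lambda>x. indicator C (hist P t x) * indicator A (coord P (t + 1) x)" "indicator B"])
        show "(\<lambda>x. indicator C (hist P t x) * indicator A (coord P (t + 1) x) :: ennreal) \<in> borel_measurable MP"
          by (intro borel_measurable_times_ennreal measurable_compose[OF hP borel_measurable_indicator[OF C]]
              measurable_compose[OF cP borel_measurable_indicator[OF A]])
      qed measurable
      also have "\<dots> = (\<integral>\<^sup>+\<omega>. ennreal (indicator C (hist P t (X \<omega>)) * (indicator A (coord P (t + 1) (X \<omega>)) * h (hist P t (X \<omega>)))) \<partial>M)"
      proof (intro nn_integral_cong)
        fix \<omega> assume \<omega>: "\<omega> \<in> space M"
        have "(\<integral>\<^sup>+v. indicator B v \<partial>k (hist P t (X \<omega>))) = ennreal (h (hist P t (X \<omega>)))"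
          using kk[OF \<omega>] B by (simp add: h_def finite_measure.emeasure_eq_measure prob_space_def)
        then show "indicator C (hist P t (X \<omega>)) * indicator A (coord P (t + 1) (X \<omega>)) * (\<integral>\<^sup>+v. indicator B v \<partial>k (hist P t (X \<omega>))) =
          ennreal (indicator C (hist P t (X \<omega>)) * (indicator A (coord P (t + 1) (X \<omega>)) * h (hist P t (X \<omega>))))"
          by (simp only:) (simp add: indicator_def)
      qed
      finally show "(\<integral>\<^sup>+\<omega>. ennreal (indicator C (hist P t (X \<omega>)) * (indicator A (coord P (t + 1) (X \<omega>)) * indicator B (hist Q t (Y \<omega>)))) \<partial>M) =
         (\<integral>\<^sup>+\<omega>. ennreal (indicator C (hist P t (X \<omega>)) * (indicator A (coord P (t + 1) (X \<omega>)) * h (hist P t (X \<omega>)))) \<partial>M)" .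
    qed (measurable, simp add: indicator_def, measurable, simp add: indicator_def hh01)
    then show "\<exists>h\<in>borel_measurable (hist_space P t). (\<forall>w\<in>space (hist_space P t). \<bar>h w :: real\<bar> \<le> 1) \<and>
      (\<forall>A\<in>sets (comp_space P (t + 1)). \<forall>C\<in>sets (hist_space P t).
        (\<integral>\<omega>. indicator C (hist P t (X \<omega>)) * (indicator A (coord P (t + 1) (X \<omega>)) * indicator B (hist Q t (Y \<omega>))) \<partial>M) =
        (\<integral>\<omega>. indicator C (hist P t (X \<omega>)) * (indicator A (coord P (t + 1) (X \<omega>)) * h (hist P t (X \<omega>))) \<partial>M))"
      using h h01 by (intro bexI[of _ h] conjI ballI) auto
  qed
qed

section \<open>Polish path spaces\<close>

lemma space_borel_of [simp]: "space (borel_of T) = topspace T"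
  by (simp add: borel_of_def space_measure_of_conv)

lemma sets_borel_of: "sets (borel_of T) = sigma_sets (topspace T) {U. openin T U}"
  unfolding borel_of_def by (rule sets_measure_of) (auto dest: openin_subset)

lemma borel_of_open: "openin T U \<Longrightarrow> U \<in> sets (borel_of T)"
  by (auto simp: sets_borel_of intro: sigma_sets.Basic)

lemma measurable_into_borel_of:
  assumes "\<And>x. x \<in> space M \<Longrightarrow> f x \<in> topspace T" "\<And>U. openin T U \<Longrightarrow> f -` U \<inter> space M \<in> sets M"
  shows "f \<in> M \<rightarrow>\<^sub>M borel_of T"
  unfolding borel_of_def by (rule measurable_measure_of) (use assms in \<open>auto dest: openin_subset\<close>)

lemma continuous_map_measurable:
  assumes "continuous_map S T f"
  shows "f \<in> borel_of S \<rightarrow>\<^sub>M borel_of T"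
proof (rule measurable_into_borel_of)
  show "f x \<in> topspace T" if "x \<in> space (borel_of S)" for x
    using assms that by (auto simp: continuous_map_def)
  fix U assume "openin T U"
  then have "openin S {x \<in> topspace S. f x \<in> U}" using assms by (simp add: continuous_map_def)
  moreover have "{x \<in> topspace S. f x \<in> U} = f -` U \<inter> space (borel_of S)" by auto
  ultimately show "f -` U \<inter> space (borel_of S) \<in> sets (borel_of S)" by (metis borel_of_open)
qed

lemma polish_dense_sequence:
  assumes "polish_space T" "topspace T \<noteq> {}"
  obtains M d and x :: "nat \<Rightarrow> 'a" where "Metric_space M d" "Metric_space.mcomplete M d"
    "T = Metric_space.mtopology M d" "range x \<subseteq> M" "\<And>y e. y \<in> M \<Longrightarrow> 0 < e \<Longrightarrow> \<exists>n. d y (x n) < e"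
proof -
  obtain M d where M: "Metric_space M d" "Metric_space.mcomplete M d" "T = Metric_space.mtopology M d"
    using assms(1) by (auto simp: polish_space_def completely_metrizable_space_def)
  interpret Metric_space M d by fact
  obtain C where C: "countable C" "C \<subseteq> M" "mtopology closure_of C = M"
    using assms(1) by (auto simp: polish_space_def separable_space_def M(3))
  have ne: "C \<noteq> {}"
  proof
    assume "C = {}"
    then have "M = {}" using C(3) by simp
    moreover have "topspace T = M" unfolding M(3) by simp
    ultimately show False using assms(2) by blast
  qed
  have "\<exists>n. d y (from_nat_into C n) < e" if y: "y \<in> M" "0 < e" for y e
  proof -
    have "y \<in> mtopology closure_of C" using C(3) y by simp
    then obtain z where "z \<in> C" "d y z < e"
      using y by (auto simp: metric_closure_of)
    then show ?thesis using from_nat_into_surj[OF C(1)] by metis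
  qed
  moreover have "range (from_nat_into C) \<subseteq> M" using from_nat_into[OF ne] C(2) by auto
  ultimately show ?thesis using that[OF M] by blast
qed

lemma half_power_less: "0 < (e::real) \<Longrightarrow> \<exists>k. c * (1/2) ^ k < e"
proof -
  assume e: "0 < e"
  have "(\<lambda>k. c * (1/2::real) ^ k) \<longlonglongrightarrow> c * 0"
    by (intro tendsto_intros LIMSEQ_realpow_zero) auto
  then have "eventually (\<lambda>k. c * (1/2) ^ k < e) sequentially"
    using e by (auto dest: order_tendstoD(2))
  then show ?thesis by (auto simp: eventually_sequentially)
qed

text \<open>A point is encoded by indices, the k-th being the first member of a dense sequence
  within 2^-k. A sequence is decoded by the limit of the members it names, which exists by
  completeness on the set \<open>Z\<close> of consistent codes; all other sequences are sent to one
  fixed point.\<close>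

lemma polish_standard:
  assumes "polish_space T" "topspace T \<noteq> {}"
  shows "standard_space (borel_of T)"
proof -
  obtain M d and x :: "nat \<Rightarrow> 'a" where "Metric_space M d" "Metric_space.mcomplete M d"
    and T: "T = Metric_space.mtopology M d" and x: "range x \<subseteq> M"
    and dense: "\<And>y e. y \<in> M \<Longrightarrow> 0 < e \<Longrightarrow> \<exists>n. d y (x n) < e"
    using polish_dense_sequence[OF assms] by metis
  interpret Metric_space M d by fact
  note complete = \<open>mcomplete\<close>
  have topT: "topspace T = M" by (simp add: T)
  have xM: "x n \<in> M" for n using x by auto
  define e :: "nat \<Rightarrow> real" where "e k = (1/2) ^ k" for k
  have e0: "0 < e k" for k by (simp add: e_def)
  have small: "\<exists>k. c * e k < r" if "0 < r" for r c using half_power_less[OF that] by (simp add: e_def)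
  define f where "f y k = (LEAST n. d y (x n) < e k)" for y k
  have f: "d y (x (f y k)) < e k" if "y \<in> M" for y k
    unfolding f_def by (rule LeastI_ex) (rule dense[OF that e0])
  \<comment> \<open>Consistency is demanded pairwise, so \<open>Z\<close> is given by countably many
    conditions on coordinates. Codes of points satisfy it by the triangle inequality, and it forces
    the named members to form a Cauchy sequence.\<close>
  define Z where "Z = {z. \<forall>j k. d (x (z j)) (x (z k)) \<le> e j + e k}"
  \<comment> \<open>The decoded point is described by distances instead of as a limit: at most one
    point lies within \<open>e k\<close> of the k-th named member for all k.\<close>
  define lims where "lims z y \<longleftrightarrow> y \<in> M \<and> (\<forall>k. d y (x (z k)) \<le> e k)" for z y
  have uniq: "y = y'" if "lims z y" "lims z y'" for z y y'
  proof (rule ccontr)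
    assume "y \<noteq> y'"
    then have "0 < d y y'" using that by (auto simp: lims_def mdist_pos_eq)
    then obtain k where k: "2 * e k < d y y'" using small by blast
    have "d y y' \<le> d y (x (z k)) + d (x (z k)) y'" using that xM by (auto simp: lims_def intro: triangle)
    moreover have "d y (x (z k)) \<le> e k" "d (x (z k)) y' \<le> e k"
      using that unfolding lims_def commute[of "x (z k)"] by blast+
    ultimately show False using k by linarith
  qed
  have lim_Z: "\<exists>y. lims z y" if z: "z \<in> Z" for z
  proof -
    have "MCauchy (\<lambda>k. x (z k))"
      unfolding MCauchy_def
    proof (intro conjI allI impI)
      show "range (\<lambda>k. x (z k)) \<subseteq> M" using xM by auto
      fix r :: real assume "0 < r"
      then obtain K where K: "2 * e K < r" using small by blast
      have "d (x (z n)) (x (z n')) < r" if "K \<le> n" "K \<le> n'" for n n'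
      proof -
        have "e n \<le> e K" "e n' \<le> e K" using that by (auto simp: e_def intro!: power_decreasing)
        moreover have "d (x (z n)) (x (z n')) \<le> e n + e n'" using z by (simp add: Z_def)
        ultimately show ?thesis using K by simp
      qed
      then show "\<exists>K. \<forall>n n'. K \<le> n \<longrightarrow> K \<le> n' \<longrightarrow> d (x (z n)) (x (z n')) < r" by blast
    qed
    then obtain y where y: "limitin mtopology (\<lambda>k. x (z k)) y sequentially"
      using complete unfolding mcomplete_def by blast
    then have yM: "y \<in> M" by (simp add: limitin_metric)
    have "d y (x (z k)) \<le> e k" for k
    proof (rule field_le_epsilon)
      fix r :: real assume r: "0 < r"
      obtain K where K: "1 * e K < r / 2" using small[of "r/2" 1] r by auto
      have "\<forall>\<^sub>F n in sequentially. x (z n) \<in> M \<and> d (x (z n)) y < r / 2"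
        using y[unfolded limitin_metric] half_gt_zero[OF r] by blast
      then obtain K' where K': "\<And>n. n \<ge> K' \<Longrightarrow> d (x (z n)) y < r / 2"
        by (auto simp: eventually_sequentially)
      let ?n = "max K K'"
      have "d y (x (z k)) \<le> d y (x (z ?n)) + d (x (z ?n)) (x (z k))" using yM xM by (intro triangle) auto
      also have "d y (x (z ?n)) < r / 2" using K'[of ?n] by (simp add: commute)
      also have "d (x (z ?n)) (x (z k)) \<le> e ?n + e k" using z by (simp add: Z_def)
      also have "e ?n \<le> e K" by (auto simp: e_def intro!: power_decreasing)
      finally show "d y (x (z k)) \<le> e k + r" using K by simp
    qed
    then show ?thesis using yM by (auto simp: lims_def)
  qed
  have f_lims: "lims (f y) y" if "y \<in> M" for y
    using f[OF that] that by (auto simp: lims_def intro: less_imp_le)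
  have f_Z: "f y \<in> Z" if "y \<in> M" for y
    unfolding Z_def
  proof (intro CollectI allI)
    fix j k
    have "d (x (f y j)) (x (f y k)) \<le> d (x (f y j)) y + d y (x (f y k))" using that xM by (intro triangle) auto
    then show "d (x (f y j)) (x (f y k)) \<le> e j + e k"
      using f[OF that, of j] f[OF that, of k] by (simp add: commute)
  qed
  define g where "g z = (if z \<in> Z then SOME y. lims z y else x 0)" for z
  have g_lims: "lims z (g z)" if "z \<in> Z" for z
    using someI_ex[OF lim_Z[OF that]] that by (simp add: g_def)
  have gM: "g z \<in> M" for z using g_lims[of z] xM by (cases "z \<in> Z") (auto simp: g_def lims_def)
  have Z: "Z \<in> sets baire"
  proof -
    have "Z = {z \<in> space baire. \<forall>j k. d (x (z j)) (x (z k)) \<le> e j + e k}" by (simp add: Z_def space_PiM)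
    also have "\<dots> \<in> sets baire" by measurable
    finally show ?thesis .
  qed
  have "f \<in> borel_of T \<rightarrow>\<^sub>M baire"
  proof (rule measurable_PiM_single')
    fix k
    have ball: "{y \<in> space (borel_of T). d y (x n) < e k} \<in> sets (borel_of T)" for n
    proof -
      have "{y \<in> space (borel_of T). d y (x n) < e k} = mball (x n) (e k)"
        using xM by (auto simp: topT commute)
      then show ?thesis using borel_of_open[of T "mball (x n) (e k)"] by (simp add: T)
    qed
    note [measurable] = ball
    show "(\<lambda>y. f y k) \<in> borel_of T \<rightarrow>\<^sub>M count_space UNIV"
      unfolding f_def by measurable
  qed auto
  moreover have "g \<in> baire \<rightarrow>\<^sub>M borel_of T"
  proof (rule measurable_into_borel_of)
    show "g z \<in> topspace T" for z by (simp add: topT gM)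
    fix U assume "openin T U"
    then have U: "U \<subseteq> M" "\<And>y. y \<in> U \<Longrightarrow> \<exists>r>0. mball y r \<subseteq> U" by (auto simp: T openin_mtopology)
    let ?P = "\<lambda>k n. mcball (x n) (e k) \<subseteq> U"
    \<comment> \<open>Membership of the decoded point in an open set shows at some stage k from the
      single value \<open>z k\<close>: the closed ball of that stage already lies inside the set.
      This is a countable condition on \<open>z\<close>.\<close>
    have "g z \<in> U \<longleftrightarrow> (\<exists>k. ?P k (z k))" if z: "z \<in> Z" for z
    proof
      assume gz: "g z \<in> U"
      then obtain r where r: "0 < r" "mball (g z) r \<subseteq> U" using U(2) by blast
      obtain k where k: "2 * e k < r" using small[OF r(1)] by blast
      have "mcball (x (z k)) (e k) \<subseteq> mball (g z) r"
      proof
        fix y assume "y \<in> mcball (x (z k)) (e k)"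
        then have y: "y \<in> M" "d (x (z k)) y \<le> e k" by auto
        have "d (g z) y \<le> d (g z) (x (z k)) + d (x (z k)) y" using y gM xM by (intro triangle) auto
        then show "y \<in> mball (g z) r" using y k g_lims[OF z] gM by (auto simp: lims_def intro: le_less_trans order_trans[OF _ add_mono] dest: spec[of _ k])
      qed
      then show "\<exists>k. ?P k (z k)" using r(2) by blast
    next
      assume "\<exists>k. ?P k (z k)"
      then obtain k where k: "?P k (z k)" by blast
      have "g z \<in> mcball (x (z k)) (e k)" using g_lims[OF z] xM gM by (auto simp: lims_def commute)
      then show "g z \<in> U" using k by blast
    qed
    moreover have "g z = x 0" if "z \<notin> Z" for z using that by (simp add: g_def)
    ultimately have "g z \<in> U \<longleftrightarrow> (z \<in> Z \<and> (\<exists>k. ?P k (z k))) \<or> (x 0 \<in> U \<and> z \<notin> Z)" for z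
      by (cases "z \<in> Z") simp_all
    then have "g -` U \<inter> space baire = {z \<in> space baire. z \<in> Z \<and> (\<exists>k. z k \<in> {n. ?P k n})} \<union> (if x 0 \<in> U then space baire - Z else {})"
      by (simp add: set_eq_iff space_PiM)
    also have "\<dots> \<in> sets baire"
    proof (rule sets.Un)
      show "{z \<in> space baire. z \<in> Z \<and> (\<exists>k. z k \<in> {n. ?P k n})} \<in> sets baire"
      proof -
        define A where "A k = {n. ?P k n}" for k
        show ?thesis unfolding A_def[symmetric] using Z by measurable
      qed
    qed (use Z in auto)
    finally show "g -` U \<inter> space baire \<in> sets baire" .
  qed
  moreover have "\<forall>y\<in>space (borel_of T). g (f y) = y"
    using uniq[OF g_lims[OF f_Z] f_lims] by (simp add: topT)
  ultimately show ?thesis unfolding standard_space_def by (intro bexI[of _ f] bexI[of _ g])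
qed

lemma polish_second_countable:
  assumes "polish_space T"
  shows "second_countable T"
proof (cases "topspace T = {}")
  case True
  then show ?thesis
    unfolding second_countable_def by (intro exI[of _ "{}"]) (auto dest: openin_subset)
next
  case False
  obtain M d and x :: "nat \<Rightarrow> 'a" where "Metric_space M d"
    and T: "T = Metric_space.mtopology M d" and x: "range x \<subseteq> M"
    and dense: "\<And>y e. y \<in> M \<Longrightarrow> 0 < e \<Longrightarrow> \<exists>n. d y (x n) < e"
    using polish_dense_sequence[OF assms False] by metis
  interpret Metric_space M d by fact
  let ?B = "range (\<lambda>(n, k). mball (x n) ((1/2) ^ k))"
  have "\<exists>V\<in>?B. y \<in> V \<and> V \<subseteq> U" if U: "openin mtopology U" "y \<in> U" for U y
  proof -
    obtain r where r: "0 < r" "mball y r \<subseteq> U" using U by (auto simp: openin_mtopology)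
    have y: "y \<in> M" using U by (auto simp: openin_mtopology)
    obtain k where k: "2 * (1/2::real) ^ k < r" using half_power_less[OF r(1)] by blast
    obtain n where n: "d y (x n) < (1/2) ^ k" using dense[OF y, of "(1/2) ^ k"] by auto
    have "mball (x n) ((1/2) ^ k) \<subseteq> mball y r"
    proof
      fix z assume z: "z \<in> mball (x n) ((1/2) ^ k)"
      then have "d y z \<le> d y (x n) + d (x n) z" using y by (intro triangle) auto
      then show "z \<in> mball y r" using z n k y by auto
    qed
    then show ?thesis using r(2) n y x
      by (intro bexI[of _ "mball (x n) ((1/2) ^ k)"]) (auto simp: commute intro: range_eqI[of _ _ "(n, k)"])
  qed
  then show ?thesis
    unfolding second_countable_def T by (intro exI[of _ ?B]) auto
qed

lemma second_countableE:
  assumes "second_countable X"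
  obtains A where "countable A" "\<And>V. V \<in> A \<Longrightarrow> openin X V"
    "\<And>U x. openin X U \<Longrightarrow> x \<in> U \<Longrightarrow> \<exists>V\<in>A. x \<in> V \<and> V \<subseteq> U"
proof -
  from assms obtain A where "countable A \<and> (\<forall>V\<in>A. openin X V) \<and>
    (\<forall>U x. openin X U \<and> x \<in> U \<longrightarrow> (\<exists>V\<in>A. x \<in> V \<and> V \<subseteq> U))"
    unfolding second_countable_def ..
  then show ?thesis by (intro that[of A]) simp_all
qed

text \<open>Countably many basic rectangles exhaust an open set of the product topology, which puts
  it into the product of the two Borel sigma-algebras.\<close>

lemma open_prod_measurable:
  assumes X: "second_countable X" and Y: "second_countable Y" and U: "openin (prod_topology X Y) U"
  shows "U \<in> sets (borel_of X \<Otimes>\<^sub>M borel_of Y)"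
proof -
  obtain A where A: "countable A" "\<And>V. V \<in> A \<Longrightarrow> openin X V"
    "\<And>U x. openin X U \<Longrightarrow> x \<in> U \<Longrightarrow> \<exists>V\<in>A. x \<in> V \<and> V \<subseteq> U"
    using second_countableE[OF X] by metis
  obtain B where B: "countable B" "\<And>V. V \<in> B \<Longrightarrow> openin Y V"
    "\<And>U x. openin Y U \<Longrightarrow> x \<in> U \<Longrightarrow> \<exists>V\<in>B. x \<in> V \<and> V \<subseteq> U"
    using second_countableE[OF Y] by metis
  let ?I = "{(V, W). V \<in> A \<and> W \<in> B \<and> V \<times> W \<subseteq> U}"
  have "U = (\<Union>(V, W)\<in>?I. V \<times> W)"
  proof (intro equalityI subsetI)
    fix z assume z: "z \<in> U"
    obtain x y where xy: "z = (x, y)" by (cases z)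
    obtain V W where "openin X V" "openin Y W" "x \<in> V" "y \<in> W" "V \<times> W \<subseteq> U"
      using U[unfolded openin_prod_topology_alt, rule_format, of x y] z xy by auto
    moreover from A(3)[OF this(1,3)] obtain V' where "V' \<in> A" "x \<in> V'" "V' \<subseteq> V" by blast
    moreover from B(3)[OF calculation(2,4)] obtain W' where "W' \<in> B" "y \<in> W'" "W' \<subseteq> W" by blast
    ultimately show "z \<in> (\<Union>(V, W)\<in>?I. V \<times> W)" unfolding xy
      by (intro UN_I[of "(V', W')"]) auto
  qed auto
  also have "\<dots> \<in> sets (borel_of X \<Otimes>\<^sub>M borel_of Y)"
  proof (rule sets.countable_UN')
    show "countable ?I" by (rule countable_subset[of _ "A \<times> B"]) (use A B in auto)
  qed (auto intro!: pair_measureI borel_of_open A B)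
  finally show ?thesis .
qed

text \<open>Boxes of basic sets are countably many because there are finitely many coordinates. They
  are both open and product-measurable: the first property gives second countability, the second the
  comparison of the two sigma-algebras on paths.\<close>

lemma path_top_base:
  assumes T: "\<And>t. t \<in> {1..N} \<Longrightarrow> second_countable (T t)"
  shows "\<exists>\<B>. countable \<B> \<and> (\<forall>V\<in>\<B>. openin (path_top N T) V \<and> V \<in> sets (PiM {1..N} (\<lambda>t. borel_of (T t)))) \<and>
    (\<forall>U x. openin (path_top N T) U \<longrightarrow> x \<in> U \<longrightarrow> (\<exists>V\<in>\<B>. x \<in> V \<and> V \<subseteq> U))"
proof -
  have "\<exists>A. countable A \<and> (\<forall>V\<in>A. openin (T t) V) \<and> (\<forall>U x. openin (T t) U \<and> x \<in> U \<longrightarrow> (\<exists>V\<in>A. x \<in> V \<and> V \<subseteq> U))"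
    if "t \<in> {1..N}" for t using T[OF that] unfolding second_countable_def .
  then obtain A where A: "\<And>t. t \<in> {1..N} \<Longrightarrow> countable (A t)"
    "\<And>t V. t \<in> {1..N} \<Longrightarrow> V \<in> A t \<Longrightarrow> openin (T t) V"
    "\<And>t U x. t \<in> {1..N} \<Longrightarrow> openin (T t) U \<Longrightarrow> x \<in> U \<Longrightarrow> \<exists>V\<in>A t. x \<in> V \<and> V \<subseteq> U"
    by metis
  let ?B = "PiE {1..N} ` PiE {1..N} A"
  show ?thesis
  proof (intro exI[of _ ?B] conjI ballI allI impI)
    show "countable ?B" by (intro countable_image countable_PiE A) auto
    show "openin (path_top N T) V" if "V \<in> ?B" for V
      using that A(2) unfolding path_top_def by (auto simp: openin_PiE_gen PiE_iff)
    show "V \<in> sets (PiM {1..N} (\<lambda>t. borel_of (T t)))" if "V \<in> ?B" for V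
      using that A(2) by (auto intro!: sets_PiM_I_finite borel_of_open simp: PiE_iff)
    fix U x assume U: "openin (path_top N T) U" "x \<in> U"
    from U(1)[unfolded path_top_def openin_product_topology_alt, rule_format, OF U(2)]
    obtain W where W': "(\<forall>i\<in>{1..N}. openin (T i) (W i)) \<and> x \<in> PiE {1..N} W \<and> PiE {1..N} W \<subseteq> U" by blast
    then have W: "\<And>i. i \<in> {1..N} \<Longrightarrow> openin (T i) (W i)" "x \<in> PiE {1..N} W" "PiE {1..N} W \<subseteq> U" by blast+
    have "\<exists>V\<in>A i. x i \<in> V \<and> V \<subseteq> W i" if "i \<in> {1..N}" for i
      using A(3)[OF that W(1)[OF that]] W(2) that by (auto simp: PiE_iff)
    then obtain V where V: "\<And>i. i \<in> {1..N} \<Longrightarrow> V i \<in> A i \<and> x i \<in> V i \<and> V i \<subseteq> W i" by metis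
    have "PiE {1..N} V = PiE {1..N} (restrict V {1..N})" by (rule PiE_cong) simp
    moreover have "restrict V {1..N} \<in> PiE {1..N} A" using V by auto
    ultimately have "PiE {1..N} V \<in> ?B" by blast
    moreover have "x \<in> PiE {1..N} V" using V W(2) by (auto simp: PiE_iff)
    moreover have "PiE {1..N} V \<subseteq> U" using PiE_mono[of "{1..N}" V W] V W(3) by blast
    ultimately show "\<exists>V\<in>?B. x \<in> V \<and> V \<subseteq> U" by blast
  qed
qed

lemma second_countable_path_top:
  assumes "\<And>t. t \<in> {1..N} \<Longrightarrow> second_countable (T t)"
  shows "second_countable (path_top N T)"
proof -
  from path_top_base[of N T, OF assms] obtain \<B> where B: "countable \<B> \<and> (\<forall>V\<in>\<B>. openin (path_top N T) V \<and> V \<in> sets (PiM {1..N} (\<lambda>t. borel_of (T t)))) \<and>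
    (\<forall>U x. openin (path_top N T) U \<longrightarrow> x \<in> U \<longrightarrow> (\<exists>V\<in>\<B>. x \<in> V \<and> V \<subseteq> U))" ..
  then show ?thesis unfolding second_countable_def by (intro exI[of _ \<B>] conjI) blast+
qed

text \<open>An open set is the union of the countably many measurable boxes inside it. This
  inclusion of the Borel sigma-algebra in the product sigma-algebra provides the retraction from
  histories to paths.\<close>

lemma id_measurable_path_top:
  assumes "\<And>t. t \<in> {1..N} \<Longrightarrow> second_countable (T t)"
  shows "(\<lambda>x. x) \<in> PiM {1..N} (\<lambda>t. borel_of (T t)) \<rightarrow>\<^sub>M borel_of (path_top N T)"
proof (rule measurable_into_borel_of)
  have top: "topspace (path_top N T) = space (PiM {1..N} (\<lambda>t. borel_of (T t)))"
    by (simp add: path_top_def space_PiM)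
  show "x \<in> topspace (path_top N T)" if "x \<in> space (PiM {1..N} (\<lambda>t. borel_of (T t)))" for x
    using that by (simp add: top)
  from path_top_base[of N T, OF assms] obtain \<B> where "countable \<B> \<and> (\<forall>V\<in>\<B>. openin (path_top N T) V \<and> V \<in> sets (PiM {1..N} (\<lambda>t. borel_of (T t)))) \<and>
    (\<forall>U x. openin (path_top N T) U \<longrightarrow> x \<in> U \<longrightarrow> (\<exists>V\<in>\<B>. x \<in> V \<and> V \<subseteq> U))" ..
  then have B: "countable \<B>" "\<And>V. V \<in> \<B> \<Longrightarrow> V \<in> sets (PiM {1..N} (\<lambda>t. borel_of (T t)))"
    "\<And>U x. openin (path_top N T) U \<Longrightarrow> x \<in> U \<Longrightarrow> \<exists>V\<in>\<B>. x \<in> V \<and> V \<subseteq> U"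
    by blast+
  fix U assume U: "openin (path_top N T) U"
  then have "U = \<Union>{V \<in> \<B>. V \<subseteq> U}" using B(3)[OF U] by blast
  also have "\<dots> \<in> sets (PiM {1..N} (\<lambda>t. borel_of (T t)))"
    by (rule sets.countable_Union) (use B in \<open>auto intro: countable_subset\<close>)
  finally show "(\<lambda>x. x) -` U \<inter> space (PiM {1..N} (\<lambda>t. borel_of (T t))) \<in> sets (PiM {1..N} (\<lambda>t. borel_of (T t)))"
    using openin_subset[OF U] by (simp add: top Int_absorb2 vimage_ident)
qed

text \<open>The metric induces the product topology, so the set where d < a is open in the product
  of the path space with itself; second countability makes it measurable for the product
  sigma-algebra, on which couplings live.\<close>

lemma metric_measurable:
  assumes d: "polish_path_space N T d"
  shows "(\<lambda>(x, y). d x y) \<in> borel_measurable (borel_of (path_top N T) \<Otimes>\<^sub>M borel_of (path_top N T))"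
proof -
  let ?M = "paths N T"
  interpret Metric_space ?M d using d by (simp add: polish_path_space_def)
  have mt: "mtopology = path_top N T" using d by (simp add: polish_path_space_def)
  have sc: "second_countable (path_top N T)"
    by (rule second_countable_path_top, rule polish_second_countable) (use d in \<open>simp add: polish_path_space_def\<close>)
  have "{z \<in> space (borel_of (path_top N T) \<Otimes>\<^sub>M borel_of (path_top N T)). (case z of (x, y) \<Rightarrow> d x y) < a}
    \<in> sets (borel_of (path_top N T) \<Otimes>\<^sub>M borel_of (path_top N T))" for a
  proof (rule open_prod_measurable[OF sc sc])
    have e: "{z \<in> space (borel_of (path_top N T) \<Otimes>\<^sub>M borel_of (path_top N T)). (case z of (x, y) \<Rightarrow> d x y) < a} =
      {(x, y). x \<in> ?M \<and> y \<in> ?M \<and> d x y < a}" by (auto simp: space_pair_measure)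
    have ex: "\<exists>U V. openin mtopology U \<and> openin mtopology V \<and> x \<in> U \<and> y \<in> V \<and>
       U \<times> V \<subseteq> {(x, y). x \<in> ?M \<and> y \<in> ?M \<and> d x y < a}"
      if xy: "x \<in> ?M" "y \<in> ?M" "d x y < a" for x y
    proof (intro exI conjI)
      let ?r = "(a - d x y) / 2"
      show "x \<in> mball x ?r" "y \<in> mball y ?r" using xy by auto
      show "mball x ?r \<times> mball y ?r \<subseteq> {(x, y). x \<in> ?M \<and> y \<in> ?M \<and> d x y < a}"
      proof
        fix z assume "z \<in> mball x ?r \<times> mball y ?r"
        then obtain x' y' where z: "z = (x', y')" and *: "x' \<in> ?M" "d x x' < ?r" "y' \<in> ?M" "d y y' < ?r"
          by auto
        have "d x' y' \<le> d x' x + d x y'" "d x y' \<le> d x y + d y y'" using * xy by (auto intro: triangle)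
        then have "d x' y' \<le> d x x' + d x y + d y y'" by (simp add: commute[of x' x])
        also have "\<dots> < ?r + d x y + ?r" using * by (intro add_strict_mono add_strict_right_mono)
        also have "\<dots> = a" by (simp add: field_simps)
        finally show "z \<in> {(x, y). x \<in> ?M \<and> y \<in> ?M \<and> d x y < a}" using z * by simp
      qed
    qed auto
    show "openin (prod_topology (path_top N T) (path_top N T))
      {z \<in> space (borel_of (path_top N T) \<Otimes>\<^sub>M borel_of (path_top N T)). (case z of (x, y) \<Rightarrow> d x y) < a}"
      unfolding e openin_prod_topology_alt
    proof (intro allI impI)
      fix x y assume "(x, y) \<in> {(x, y). x \<in> ?M \<and> y \<in> ?M \<and> d x y < a}"
      then show "\<exists>U V. openin (path_top N T) U \<and> openin (path_top N T) V \<and> x \<in> U \<and> y \<in> V \<and>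
        U \<times> V \<subseteq> {(x, y). x \<in> ?M \<and> y \<in> ?M \<and> d x y < a}"
        using ex[of x y] unfolding mt by blast
    qed
  qed
  then show ?thesis unfolding borel_measurable_iff_less by blast
qed

section \<open>Composition of causal kernels\<close>

lemma borel_measurable_kernel:
  assumes "\<kappa> \<in> M \<rightarrow>\<^sub>M prob_algebra N" "x \<in> space M" "f \<in> borel_measurable N"
  shows "f \<in> borel_measurable (\<kappa> x)"
  by (subst measurable_cong_sets[OF kernel_sets(1)[OF assms(1,2)] refl]) (rule assms(3))

lemma nn_integral_distr':
  "T \<in> M \<rightarrow>\<^sub>M M' \<Longrightarrow> f \<in> borel_measurable M' \<Longrightarrow> (\<integral>\<^sup>+x. f x \<partial>distr M M' T) = (\<integral>\<^sup>+x. f (T x) \<partial>M)"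
  by (rule nn_integral_distr) simp_all

text \<open>Only the joint law of \<open>X\<close> and \<open>Y\<close> enters, so a coupling may be
  realised on any probability space.\<close>

lemma kernel_causal_distr:
  assumes \<phi>: "\<phi> \<in> M \<rightarrow>\<^sub>M M'" and X: "X \<in> M' \<rightarrow>\<^sub>M MP" and Y: "Y \<in> M' \<rightarrow>\<^sub>M MQ"
    and P: "process_space N P MP" and Q: "process_space N Q MQ"
  shows "kernel_causal N P MP Q (distr M M' \<phi>) X Y \<longleftrightarrow> kernel_causal N P MP Q M (\<lambda>\<omega>. X (\<phi> \<omega>)) (\<lambda>\<omega>. Y (\<phi> \<omega>))"
proof -
  have eq: "(\<integral>\<^sup>+\<omega>. g (X \<omega>) * f (hist Q t (Y \<omega>)) \<partial>distr M M' \<phi>) = (\<integral>\<^sup>+\<omega>. g (X (\<phi> \<omega>)) * f (hist Q t (Y (\<phi> \<omega>))) \<partial>M) \<and>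
     (\<integral>\<^sup>+\<omega>. g (X \<omega>) * (\<integral>\<^sup>+v. f v \<partial>k (hist P t (X \<omega>))) \<partial>distr M M' \<phi>) =
     (\<integral>\<^sup>+\<omega>. g (X (\<phi> \<omega>)) * (\<integral>\<^sup>+v. f v \<partial>k (hist P t (X (\<phi> \<omega>)))) \<partial>M)"
    if t: "t \<in> {1..<N}" and k[measurable]: "k \<in> hist_space P t \<rightarrow>\<^sub>M prob_algebra (hist_space Q t)"
      and g: "g \<in> borel_measurable MP" and f[measurable]: "f \<in> borel_measurable (hist_space Q t)" for t k g f
  proof -
    have tN: "t \<le> N" using t by auto
    have hX: "(\<lambda>\<omega>. hist P t (X \<omega>)) \<in> M' \<rightarrow>\<^sub>M hist_space P t" by (rule measurable_compose[OF X process_hist[OF P tN]])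
    have hY: "(\<lambda>\<omega>. hist Q t (Y \<omega>)) \<in> M' \<rightarrow>\<^sub>M hist_space Q t" by (rule measurable_compose[OF Y process_hist[OF Q tN]])
    have gX: "(\<lambda>\<omega>. g (X \<omega>)) \<in> borel_measurable M'" by (rule measurable_compose[OF X g])
    have fY: "(\<lambda>\<omega>. f (hist Q t (Y \<omega>))) \<in> borel_measurable M'" by (rule measurable_compose[OF hY f])
    have "(\<lambda>w. \<integral>\<^sup>+v. f v \<partial>k w) \<in> borel_measurable (hist_space P t)" by measurable
    then have kX: "(\<lambda>\<omega>. \<integral>\<^sup>+v. f v \<partial>k (hist P t (X \<omega>))) \<in> borel_measurable M'" by (rule measurable_compose[OF hX])
    show ?thesis
      using nn_integral_distr'[OF \<phi> borel_measurable_times_ennreal[OF gX fY]]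
        nn_integral_distr'[OF \<phi> borel_measurable_times_ennreal[OF gX kX]] by simp
  qed
  show ?thesis
    unfolding kernel_causal_def
    by (intro ball_cong bex_cong refl) (simp add: eq)
qed

section \<open>Pairs of processes\<close>

lemma standard_space_pair:
  assumes "standard_space M" "standard_space N"
  shows "standard_space (M \<Otimes>\<^sub>M N)"
proof -
  obtain f g where f[measurable]: "f \<in> M \<rightarrow>\<^sub>M baire" and g[measurable]: "g \<in> baire \<rightarrow>\<^sub>M M" and gf: "\<forall>x\<in>space M. g (f x) = x"
    using assms(1) unfolding standard_space_def by blast
  obtain f' g' where f'[measurable]: "f' \<in> N \<rightarrow>\<^sub>M baire" and g'[measurable]: "g' \<in> baire \<rightarrow>\<^sub>M N" and gf': "\<forall>x\<in>space N. g' (f' x) = x"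
    using assms(2) unfolding standard_space_def by blast
  let ?F = "\<lambda>z n. if even n then f (fst z) (n div 2) else f' (snd z) (n div 2)"
  let ?G = "\<lambda>z. (g (\<lambda>k. z (2 * k)), g' (\<lambda>k. z (2 * k + 1)))"
  have "?F \<in> M \<Otimes>\<^sub>M N \<rightarrow>\<^sub>M baire"
  proof (rule measurable_PiM_single')
    fix n
    have "(\<lambda>z. f (fst z) (n div 2)) \<in> M \<Otimes>\<^sub>M N \<rightarrow>\<^sub>M count_space UNIV"
      by (rule measurable_compose[OF _ measurable_component_singleton[of "n div 2" UNIV "\<lambda>_. count_space UNIV"]]) auto
    moreover have "(\<lambda>z. f' (snd z) (n div 2)) \<in> M \<Otimes>\<^sub>M N \<rightarrow>\<^sub>M count_space UNIV"
      by (rule measurable_compose[OF _ measurable_component_singleton[of "n div 2" UNIV "\<lambda>_. count_space UNIV"]]) auto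
    ultimately show "(\<lambda>z. ?F z n) \<in> M \<Otimes>\<^sub>M N \<rightarrow>\<^sub>M count_space UNIV" by (cases "even n") simp_all
  qed auto
  moreover have "?G \<in> baire \<rightarrow>\<^sub>M M \<Otimes>\<^sub>M N"
  proof (rule measurable_Pair)
    have "(\<lambda>z k. z (2 * k)) \<in> baire \<rightarrow>\<^sub>M baire" "(\<lambda>z k. z (2 * k + 1)) \<in> baire \<rightarrow>\<^sub>M baire"
      by (rule measurable_PiM_single'; auto intro!: measurable_component_singleton)+
    then show "(\<lambda>z. g (\<lambda>k. z (2 * k))) \<in> baire \<rightarrow>\<^sub>M M" "(\<lambda>z. g' (\<lambda>k. z (2 * k + 1))) \<in> baire \<rightarrow>\<^sub>M N"
      using measurable_compose[OF _ g] measurable_compose[OF _ g'] by blast+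
  qed
  moreover have "\<forall>z\<in>space (M \<Otimes>\<^sub>M N). ?G (?F z) = z"
    using gf gf' by (auto simp: space_pair_measure)
  ultimately show ?thesis unfolding standard_space_def by (intro bexI[of _ ?F] bexI[of _ ?G])
qed

text \<open>A history of a pair process is one function into pairs, while kernels for the two
  coordinates act on a pair of functions. \<open>zip_hist\<close> and \<open>unzip_hist\<close>
  translate between the two.\<close>

definition zip_hist :: "nat \<Rightarrow> (nat \<Rightarrow> 'a) \<times> (nat \<Rightarrow> 'b) \<Rightarrow> nat \<Rightarrow> 'a \<times> 'b" where
  "zip_hist t w = (\<lambda>i\<in>{1..t}. (fst w i, snd w i))"

definition unzip_hist :: "nat \<Rightarrow> (nat \<Rightarrow> 'a \<times> 'b) \<Rightarrow> (nat \<Rightarrow> 'a) \<times> (nat \<Rightarrow> 'b)" where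
  "unzip_hist t z = (\<lambda>i\<in>{1..t}. fst (z i), \<lambda>i\<in>{1..t}. snd (z i))"

lemma comp_space_pair: "comp_space (pair_process P Q) = (\<lambda>t. comp_space P t \<Otimes>\<^sub>M comp_space Q t)"
  by (simp add: pair_process_def)

lemma coord_pair: "coord (pair_process P Q) t z = (coord P t (fst z), coord Q t (snd z))"
  by (simp add: pair_process_def case_prod_beta)

lemma measurable_zip_hist:
  "zip_hist t \<in> hist_space P t \<Otimes>\<^sub>M hist_space Q t \<rightarrow>\<^sub>M hist_space (pair_process P Q) t"
  unfolding hist_space_def zip_hist_def[abs_def] comp_space_pair
proof (rule measurable_restrict)
  fix i assume i: "i \<in> {1..t}"
  show "(\<lambda>w. (fst w i, snd w i)) \<in> PiM {1..t} (comp_space P) \<Otimes>\<^sub>M PiM {1..t} (comp_space Q) \<rightarrow>\<^sub>M comp_space P i \<Otimes>\<^sub>M comp_space Q i"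
    by (intro measurable_Pair measurable_compose[OF measurable_fst measurable_component_singleton[OF i]]
        measurable_compose[OF measurable_snd measurable_component_singleton[OF i]])
qed

lemma measurable_unzip_hist:
  "unzip_hist t \<in> hist_space (pair_process P Q) t \<rightarrow>\<^sub>M hist_space P t \<Otimes>\<^sub>M hist_space Q t"
  unfolding hist_space_def unzip_hist_def[abs_def] comp_space_pair
proof (intro measurable_Pair measurable_restrict)
  fix i assume i: "i \<in> {1..t}"
  note c = measurable_component_singleton[OF i, of "\<lambda>t. comp_space P t \<Otimes>\<^sub>M comp_space Q t"]
  show "(\<lambda>z. fst (z i)) \<in> PiM {1..t} (\<lambda>t. comp_space P t \<Otimes>\<^sub>M comp_space Q t) \<rightarrow>\<^sub>M comp_space P i"
    by (rule measurable_compose[OF c measurable_fst])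
  show "(\<lambda>z. snd (z i)) \<in> PiM {1..t} (\<lambda>t. comp_space P t \<Otimes>\<^sub>M comp_space Q t) \<rightarrow>\<^sub>M comp_space Q i"
    by (rule measurable_compose[OF c measurable_snd])
qed

lemma hist_pair: "hist (pair_process P Q) t z = zip_hist t (hist P t (fst z), hist Q t (snd z))"
  by (auto simp: hist_def zip_hist_def coord_pair fun_eq_iff)

lemma unzip_hist_pair: "unzip_hist t (hist (pair_process P Q) t z) = (hist P t (fst z), hist Q t (snd z))"
  by (auto simp: hist_def unzip_hist_def coord_pair fun_eq_iff)

lemma pair_process_space:
  assumes P: "process_space N P MP" and Q: "process_space N Q MQ"
  shows "process_space N (pair_process P Q) (MP \<Otimes>\<^sub>M MQ)"
  unfolding process_space_def
proof (intro conjI ballI)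
  fix t assume t: "t \<in> {1..N}"
  have "coord (pair_process P Q) t = (\<lambda>z. (coord P t (fst z), coord Q t (snd z)))"
    by (simp add: coord_pair fun_eq_iff)
  moreover have "(\<lambda>z. (coord P t (fst z), coord Q t (snd z))) \<in> MP \<Otimes>\<^sub>M MQ \<rightarrow>\<^sub>M comp_space P t \<Otimes>\<^sub>M comp_space Q t"
    by (intro measurable_Pair measurable_compose[OF measurable_fst process_coord[OF P t]]
        measurable_compose[OF measurable_snd process_coord[OF Q t]])
  ultimately show "coord (pair_process P Q) t \<in> MP \<Otimes>\<^sub>M MQ \<rightarrow>\<^sub>M comp_space (pair_process P Q) t"
    by (simp add: comp_space_pair)
  show "standard_space (comp_space (pair_process P Q) t)"
    unfolding comp_space_pair by (rule standard_space_pair[OF process_standard[OF P t] process_standard[OF Q t]])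
next
  obtain rP where rP: "rP \<in> hist_space P N \<rightarrow>\<^sub>M MP" "\<And>x. x \<in> space MP \<Longrightarrow> rP (hist P N x) = x"
    using process_retract[OF P] by metis
  obtain rQ where rQ: "rQ \<in> hist_space Q N \<rightarrow>\<^sub>M MQ" "\<And>x. x \<in> space MQ \<Longrightarrow> rQ (hist Q N x) = x"
    using process_retract[OF Q] by metis
  let ?r = "\<lambda>z. (rP (fst (unzip_hist N z)), rQ (snd (unzip_hist N z)))"
  have "?r \<in> hist_space (pair_process P Q) N \<rightarrow>\<^sub>M MP \<Otimes>\<^sub>M MQ"
    by (intro measurable_Pair measurable_compose[OF measurable_unzip_hist measurable_compose[OF measurable_fst rP(1)]]
        measurable_compose[OF measurable_unzip_hist measurable_compose[OF measurable_snd rQ(1)]])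
  moreover have "\<forall>z\<in>space (MP \<Otimes>\<^sub>M MQ). ?r (hist (pair_process P Q) N z) = z"
    by (auto simp: unzip_hist_pair space_pair_measure rP(2) rQ(2))
  ultimately show "\<exists>r\<in>hist_space (pair_process P Q) N \<rightarrow>\<^sub>M MP \<Otimes>\<^sub>M MQ. \<forall>z\<in>space (MP \<Otimes>\<^sub>M MQ). r (hist (pair_process P Q) N z) = z"
    by (intro bexI[of _ ?r])
qed

section \<open>Almost sure form of causality, and chains of kernels\<close>

lemma nn_integral_kernel_bind:
  assumes "k \<in> M \<rightarrow>\<^sub>M prob_algebra N" "l \<in> N \<rightarrow>\<^sub>M prob_algebra L" "x \<in> space M" "f \<in> borel_measurable L"
  shows "(\<integral>\<^sup>+v. f v \<partial>(k x \<bind> l)) = (\<integral>\<^sup>+w. \<integral>\<^sup>+v. f v \<partial>l w \<partial>k x)"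
proof (rule nn_integral_bind[OF assms(4)])
  show "l \<in> k x \<rightarrow>\<^sub>M subprob_algebra L"
    by (subst measurable_cong_sets[OF kernel_sets(1)[OF assms(1,3)] refl])
       (rule measurable_prob_algebraD[OF assms(2)])
qed

text \<open>Under the semidirect product, the second past given the whole path \<open>x\<close> has
  as its law the image of \<open>\<kappa> x\<close>, and causality makes it a kernel in the past of
  \<open>x\<close>. The integrated identity becomes an identity of kernels off one null set, so it
  can be substituted inside integrals over any other joint law with the marginal \<mu>.\<close>

lemma kernel_causal_AE:
  assumes P: "process_space N P MP" and Q: "process_space N Q MQ"
    and \<mu>: "prob_space \<mu>" "sets \<mu> = sets MP" and \<kappa>: "\<kappa> \<in> MP \<rightarrow>\<^sub>M prob_algebra MQ"
    and kc: "kernel_causal N P MP Q (kernel_prod \<mu> MQ \<kappa>) fst snd" and t: "t \<in> {1..<N}"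
  shows "\<exists>k\<in>hist_space P t \<rightarrow>\<^sub>M prob_algebra (hist_space Q t).
    AE x in \<mu>. distr (\<kappa> x) (hist_space Q t) (hist Q t) = k (hist P t x)"
proof -
  interpret prob_space \<mu> by fact
  have tN: "t \<le> N" using t by auto
  note hP[measurable] = process_hist[OF P tN] and hQ[measurable] = process_hist[OF Q tN]
  note \<kappa>[measurable] \<mu>(2)[measurable_cong]
  have sp: "space \<mu> = space MP" using sets_eq_imp_space_eq[OF \<mu>(2)] .
  obtain k where k[measurable]: "k \<in> hist_space P t \<rightarrow>\<^sub>M prob_algebra (hist_space Q t)"
    and eq: "\<forall>g\<in>borel_measurable MP. \<forall>f\<in>borel_measurable (hist_space Q t).
      (\<integral>\<^sup>+\<omega>. g (fst \<omega>) * f (hist Q t (snd \<omega>)) \<partial>kernel_prod \<mu> MQ \<kappa>) =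
      (\<integral>\<^sup>+\<omega>. g (fst \<omega>) * (\<integral>\<^sup>+v. f v \<partial>k (hist P t (fst \<omega>))) \<partial>kernel_prod \<mu> MQ \<kappa>)"
    using kc t unfolding kernel_causal_def by blast
  have kh: "(\<lambda>x. k (hist P t x)) \<in> MP \<rightarrow>\<^sub>M prob_algebra (hist_space Q t)" by measurable
  have dk: "(\<lambda>x. distr (\<kappa> x) (hist_space Q t) (hist Q t)) \<in> MP \<rightarrow>\<^sub>M prob_algebra (hist_space Q t)"
    by (rule measurable_distr_prob_space2[OF \<kappa>]) measurable
  have "AE x in \<mu>. distr (\<kappa> x) (hist_space Q t) (hist Q t) = k (hist P t x)"
  proof (rule kernel_AE_eqI[OF standard_space_hist[OF Q tN] dk kh \<mu>(2)])
    fix B assume B[measurable]: "B \<in> sets (hist_space Q t)"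
    let ?u = "\<lambda>x. \<integral>\<^sup>+v. indicator B (hist Q t v) \<partial>\<kappa> x" and ?v = "\<lambda>x. \<integral>\<^sup>+v. indicator B v \<partial>k (hist P t x)"
    have u[measurable]: "?u \<in> borel_measurable MP" by measurable
    have "(\<lambda>w. \<integral>\<^sup>+v. indicator B v \<partial>k w) \<in> borel_measurable (hist_space P t)" by measurable
    then have v[measurable]: "?v \<in> borel_measurable MP" by (rule measurable_compose[OF hP])
    have "density \<mu> ?u = density \<mu> ?v"
    proof (rule measure_eqI)
      fix A assume "A \<in> sets (density \<mu> ?u)"
      then have A[measurable]: "A \<in> sets MP" by (simp add: \<mu>)
      have "emeasure (density \<mu> ?u) A = (\<integral>\<^sup>+x. ?u x * indicator A x \<partial>\<mu>)"
        by (rule emeasure_density) (use u A in \<open>simp_all add: measurable_cong_sets[OF \<mu>(2) refl] \<mu>\<close>)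
      also have "\<dots> = (\<integral>\<^sup>+x. \<integral>\<^sup>+v. indicator A x * indicator B (hist Q t v) \<partial>\<kappa> x \<partial>\<mu>)"
      proof (rule nn_integral_cong)
        fix x assume "x \<in> space \<mu>"
        then have "(\<lambda>v. indicator B (hist Q t v) :: ennreal) \<in> borel_measurable (\<kappa> x)"
          by (intro borel_measurable_kernel[OF \<kappa>]) (simp_all add: sp)
        then show "?u x * indicator A x = (\<integral>\<^sup>+v. indicator A x * indicator B (hist Q t v) \<partial>\<kappa> x)"
          by (simp add: nn_integral_cmult mult.commute)
      qed
      also have "\<dots> = (\<integral>\<^sup>+\<omega>. indicator A (fst \<omega>) * indicator B (hist Q t (snd \<omega>)) \<partial>kernel_prod \<mu> MQ \<kappa>)"
        by (subst nn_integral_kernel_prod[OF \<mu> \<kappa>]) auto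
      also have "\<dots> = (\<integral>\<^sup>+\<omega>. indicator A (fst \<omega>) * ?v (fst \<omega>) \<partial>kernel_prod \<mu> MQ \<kappa>)"
        using eq[rule_format, of "indicator A" "indicator B"] by simp
      also have "\<dots> = (\<integral>\<^sup>+x. \<integral>\<^sup>+y. indicator A x * ?v x \<partial>\<kappa> x \<partial>\<mu>)"
        using v by (subst nn_integral_kernel_prod[OF \<mu> \<kappa>]) auto
      also have "\<dots> = (\<integral>\<^sup>+x. ?v x * indicator A x \<partial>\<mu>)"
        using kernel_sets(3)[OF \<kappa>]
        by (intro nn_integral_cong) (simp add: sp prob_space.emeasure_space_1 mult.commute)
      also have "\<dots> = emeasure (density \<mu> ?v) A"
        by (rule emeasure_density[symmetric]) (use v A in \<open>simp_all add: measurable_cong_sets[OF \<mu>(2) refl] \<mu>\<close>)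
      finally show "emeasure (density \<mu> ?u) A = emeasure (density \<mu> ?v) A" .
    qed simp
    then have "AE x in \<mu>. ?u x = ?v x"
      by (subst (asm) density_unique_iff) (use u v in \<open>simp_all add: measurable_cong_sets[OF \<mu>(2) refl]\<close>)
    with AE_space show "AE x in \<mu>. emeasure (distr (\<kappa> x) (hist_space Q t) (hist Q t)) B = emeasure (k (hist P t x)) B"
    proof eventually_elim
      case (elim x)
      then have x: "x \<in> space MP" by (simp add: sp)
      have h: "hist Q t \<in> \<kappa> x \<rightarrow>\<^sub>M hist_space Q t"
        by (subst measurable_cong_sets[OF kernel_sets(1)[OF \<kappa> x] refl]) (rule hQ)
      have "emeasure (distr (\<kappa> x) (hist_space Q t) (hist Q t)) B = (\<integral>\<^sup>+v. indicator B v \<partial>distr (\<kappa> x) (hist_space Q t) (hist Q t))"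
        by simp
      also have "\<dots> = ?u x" by (rule nn_integral_distr[OF h]) simp
      also have "\<dots> = ?v x" using elim by simp
      also have "\<dots> = emeasure (k (hist P t x)) B"
        by (rule nn_integral_indicator) (simp add: kernel_sets(1)[OF kh x])
      finally show ?case .
    qed
  qed
  with k show ?thesis by (intro bexI[of _ k])
qed

lemma nn_integral_hist_kernel:
  assumes \<kappa>: "\<kappa> \<in> M \<rightarrow>\<^sub>M prob_algebra MQ" "x \<in> space M" and h: "hist Q t \<in> MQ \<rightarrow>\<^sub>M hist_space Q t"
    and eq: "distr (\<kappa> x) (hist_space Q t) (hist Q t) = k'" and f: "f \<in> borel_measurable (hist_space Q t)"
  shows "(\<integral>\<^sup>+v. f (hist Q t v) \<partial>\<kappa> x) = (\<integral>\<^sup>+v. f v \<partial>k')"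
proof -
  have "hist Q t \<in> \<kappa> x \<rightarrow>\<^sub>M hist_space Q t"
    by (subst measurable_cong_sets[OF kernel_sets(1)[OF \<kappa>] refl]) (rule h)
  from nn_integral_distr[OF this, of f] f show ?thesis by (simp add: eq[symmetric])
qed

text \<open>Causality composes along the Markov chain \<open>X' \<rightarrow> X \<rightarrow> Y \<rightarrow> Y'\<close>.\<close>

lemma kernel_causal_chain:
  fixes X :: "'w \<Rightarrow> 'p" and Y :: "'w \<Rightarrow> 'q" and X' :: "'w' \<Rightarrow> 'p" and Y' :: "'w' \<Rightarrow> 'q"
  assumes P: "process_space N P MP" and Q: "process_space N Q MQ"
    and M: "prob_space M" and X[measurable]: "X \<in> M \<rightarrow>\<^sub>M MP" and Y[measurable]: "Y \<in> M \<rightarrow>\<^sub>M MQ"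
    and \<kappa>X[measurable]: "\<kappa>X \<in> MP \<rightarrow>\<^sub>M prob_algebra MP" and \<kappa>Y[measurable]: "\<kappa>Y \<in> MQ \<rightarrow>\<^sub>M prob_algebra MQ"
    and joint: "\<And>g f. g \<in> borel_measurable MP \<Longrightarrow> f \<in> borel_measurable MQ \<Longrightarrow>
      (\<integral>\<^sup>+w. g (X' w) * f (Y' w) \<partial>M') = (\<integral>\<^sup>+z. (\<integral>\<^sup>+u. g u \<partial>\<kappa>X (X z)) * (\<integral>\<^sup>+v. f v \<partial>\<kappa>Y (Y z)) \<partial>M)"
    and kcX: "kernel_causal N P MP P (kernel_prod (distr M MP X) MP \<kappa>X) snd fst"
    and kcY: "kernel_causal N Q MQ Q (kernel_prod (distr M MQ Y) MQ \<kappa>Y) fst snd"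
    and kcM: "kernel_causal N P MP Q M X Y"
  shows "kernel_causal N P MP Q M' X' Y'"
  unfolding kernel_causal_def
proof
  fix t assume t: "t \<in> {1..<N}"
  have tN: "t \<le> N" using t by auto
  interpret M: prob_space M by fact
  note hP[measurable] = process_hist[OF P tN] and hQ[measurable] = process_hist[OF Q tN]
  let ?\<mu> = "distr M MP X" and ?\<nu> = "distr M MQ Y"
  have \<mu>: "prob_space ?\<mu>" "sets ?\<mu> = sets MP" and \<nu>: "prob_space ?\<nu>" "sets ?\<nu> = sets MQ"
    by (auto intro: M.prob_space_distr)
  obtain kY where kY[measurable]: "kY \<in> hist_space Q t \<rightarrow>\<^sub>M prob_algebra (hist_space Q t)"
    and kYeq: "AE y in ?\<nu>. distr (\<kappa>Y y) (hist_space Q t) (hist Q t) = kY (hist Q t y)"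
    using kernel_causal_AE[OF Q Q \<nu> \<kappa>Y kcY t] by blast
  obtain kM where kM[measurable]: "kM \<in> hist_space P t \<rightarrow>\<^sub>M prob_algebra (hist_space Q t)"
    and kMeq: "\<forall>g\<in>borel_measurable MP. \<forall>f\<in>borel_measurable (hist_space Q t).
      (\<integral>\<^sup>+\<omega>. g (X \<omega>) * f (hist Q t (Y \<omega>)) \<partial>M) = (\<integral>\<^sup>+\<omega>. g (X \<omega>) * (\<integral>\<^sup>+v. f v \<partial>kM (hist P t (X \<omega>))) \<partial>M)"
    using kcM t unfolding kernel_causal_def by blast
  obtain kX where kX[measurable]: "kX \<in> hist_space P t \<rightarrow>\<^sub>M prob_algebra (hist_space P t)"
    and kXeq: "\<forall>g\<in>borel_measurable MP. \<forall>f\<in>borel_measurable (hist_space P t).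
      (\<integral>\<^sup>+\<omega>. g (snd \<omega>) * f (hist P t (fst \<omega>)) \<partial>kernel_prod ?\<mu> MP \<kappa>X) =
      (\<integral>\<^sup>+\<omega>. g (snd \<omega>) * (\<integral>\<^sup>+v. f v \<partial>kX (hist P t (snd \<omega>))) \<partial>kernel_prod ?\<mu> MP \<kappa>X)"
    using kcX t unfolding kernel_causal_def by blast
  \<comment> \<open>The past of Y' is reached from that of X' in three stages: \<open>kX\<close>
    leads back to X, \<open>kM\<close> across to Y and \<open>kY\<close> on to Y'. The first stage
    runs against the direction of \<open>\<kappa>X\<close>, hence the reversed projections in
    \<open>kcX\<close>.\<close>
  define kMY where "kMY h = kM h \<bind> kY" for h
  have kMY[measurable]: "kMY \<in> hist_space P t \<rightarrow>\<^sub>M prob_algebra (hist_space Q t)"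
    unfolding kMY_def by (rule measurable_bind_prob_space[OF kM kY])
  define k where "k h = kX h \<bind> kMY" for h
  have k: "k \<in> hist_space P t \<rightarrow>\<^sub>M prob_algebra (hist_space Q t)"
    unfolding k_def by (rule measurable_bind_prob_space[OF kX kMY])
  have main: "(\<integral>\<^sup>+w. g (X' w) * f (hist Q t (Y' w)) \<partial>M') = (\<integral>\<^sup>+w. g (X' w) * (\<integral>\<^sup>+v. f v \<partial>k (hist P t (X' w))) \<partial>M')"
    if g[measurable]: "g \<in> borel_measurable MP" and f[measurable]: "f \<in> borel_measurable (hist_space Q t)" for g f
  proof -
    let ?g = "\<lambda>x. \<integral>\<^sup>+u. g u \<partial>\<kappa>X x"
    let ?f = "\<lambda>b. \<integral>\<^sup>+v. f v \<partial>kY b"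
    let ?F = "\<lambda>a. \<integral>\<^sup>+v. f v \<partial>kMY a"
    have gm[measurable]: "?g \<in> borel_measurable MP" by measurable
    have fm[measurable]: "?f \<in> borel_measurable (hist_space Q t)" by measurable
    have Fm[measurable]: "?F \<in> borel_measurable (hist_space P t)" by measurable
    have km: "(\<lambda>h. \<integral>\<^sup>+v. f v \<partial>k h) \<in> borel_measurable (hist_space P t)" using k by measurable
    have F: "?F h = (\<integral>\<^sup>+b. ?f b \<partial>kM h)" if "h \<in> space (hist_space P t)" for h
      unfolding kMY_def by (rule nn_integral_kernel_bind[OF kM kY that f])
    have kF: "(\<integral>\<^sup>+v. f v \<partial>k h) = (\<integral>\<^sup>+a. ?F a \<partial>kX h)" if "h \<in> space (hist_space P t)" for h
      unfolding k_def by (rule nn_integral_kernel_bind[OF kX kMY that f])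
    have hX: "hist P t (X z) \<in> space (hist_space P t)" if "z \<in> space M" for z
      using measurable_space[OF hP measurable_space[OF X that]] .
    have fQ: "(\<lambda>y. f (hist Q t y)) \<in> borel_measurable MQ" by measurable
    have "(\<integral>\<^sup>+w. g (X' w) * f (hist Q t (Y' w)) \<partial>M') = (\<integral>\<^sup>+z. ?g (X z) * (\<integral>\<^sup>+v. f (hist Q t v) \<partial>\<kappa>Y (Y z)) \<partial>M)"
      by (rule joint[OF g fQ])
    also have "\<dots> = (\<integral>\<^sup>+z. ?g (X z) * ?f (hist Q t (Y z)) \<partial>M)"
    proof (rule nn_integral_cong_AE)
      \<comment> \<open>The identity for \<open>\<kappa>Y\<close> holds almost everywhere for the
        law of Y, hence along Y under \<open>M\<close>.\<close>
      show "AE z in M. ?g (X z) * (\<integral>\<^sup>+v. f (hist Q t v) \<partial>\<kappa>Y (Y z)) = ?g (X z) * ?f (hist Q t (Y z))"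
        using AE_distrD[OF Y kYeq] AE_space
      proof eventually_elim
        case (elim z)
        have "(\<integral>\<^sup>+v. f (hist Q t v) \<partial>\<kappa>Y (Y z)) = ?f (hist Q t (Y z))"
          by (rule nn_integral_hist_kernel[OF \<kappa>Y measurable_space[OF Y elim(2)] hQ elim(1) f])
        then show ?case by simp
      qed
    qed
    also have "\<dots> = (\<integral>\<^sup>+z. ?g (X z) * (\<integral>\<^sup>+b. ?f b \<partial>kM (hist P t (X z))) \<partial>M)"
      by (rule kMeq[rule_format, OF gm fm])
    also have "\<dots> = (\<integral>\<^sup>+z. ?g (X z) * ?F (hist P t (X z)) \<partial>M)"
      by (intro nn_integral_cong) (simp add: F hX)
    \<comment> \<open>The integrand depends on X alone, so the integral moves to the coupling of X
      and X'. There the reversed causality trades the past of X for a kernel in the past of X',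
      while \<open>g\<close> still tests the full path X'.\<close>
    also have "\<dots> = (\<integral>\<^sup>+x. ?g x * ?F (hist P t x) \<partial>?\<mu>)"
      by (rule nn_integral_distr[OF X, symmetric]) measurable
    also have "\<dots> = (\<integral>\<^sup>+x. \<integral>\<^sup>+u. g u * ?F (hist P t x) \<partial>\<kappa>X x \<partial>?\<mu>)"
      by (intro nn_integral_cong nn_integral_multc[symmetric] borel_measurable_kernel[OF \<kappa>X]) auto
    also have "\<dots> = (\<integral>\<^sup>+\<omega>. g (snd \<omega>) * ?F (hist P t (fst \<omega>)) \<partial>kernel_prod ?\<mu> MP \<kappa>X)"
      by (subst nn_integral_kernel_prod[OF \<mu> \<kappa>X]) auto
    also have "\<dots> = (\<integral>\<^sup>+\<omega>. g (snd \<omega>) * (\<integral>\<^sup>+a. ?F a \<partial>kX (hist P t (snd \<omega>))) \<partial>kernel_prod ?\<mu> MP \<kappa>X)"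
      by (rule kXeq[rule_format, OF g Fm])
    also have "\<dots> = (\<integral>\<^sup>+x. \<integral>\<^sup>+u. g u * (\<integral>\<^sup>+a. ?F a \<partial>kX (hist P t u)) \<partial>\<kappa>X x \<partial>?\<mu>)"
      by (subst nn_integral_kernel_prod[OF \<mu> \<kappa>X]) auto
    also have "\<dots> = (\<integral>\<^sup>+x. \<integral>\<^sup>+u. g u * (\<integral>\<^sup>+v. f v \<partial>k (hist P t u)) \<partial>\<kappa>X x \<partial>?\<mu>)"
    proof (intro nn_integral_cong)
      fix x u assume "x \<in> space ?\<mu>" "u \<in> space (\<kappa>X x)"
      then have "u \<in> space MP" using kernel_sets(2)[OF \<kappa>X, of x] by simp
      then show "g u * (\<integral>\<^sup>+a. ?F a \<partial>kX (hist P t u)) = g u * (\<integral>\<^sup>+v. f v \<partial>k (hist P t u))"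
        by (simp add: kF measurable_space[OF hP])
    qed
    also have "\<dots> = (\<integral>\<^sup>+z. \<integral>\<^sup>+u. g u * (\<integral>\<^sup>+v. f v \<partial>k (hist P t u)) \<partial>\<kappa>X (X z) \<partial>M)"
    proof (rule nn_integral_distr'[OF X])
      have "(\<lambda>u. g u * (\<integral>\<^sup>+v. f v \<partial>k (hist P t u))) \<in> borel_measurable MP"
        by (intro borel_measurable_times_ennreal g measurable_compose[OF hP km])
      then show "(\<lambda>x. \<integral>\<^sup>+u. g u * (\<integral>\<^sup>+v. f v \<partial>k (hist P t u)) \<partial>\<kappa>X x) \<in> borel_measurable MP"
        by measurable
    qed
    \<comment> \<open>A factor 1 in place of the last coordinate lets \<open>joint\<close> carry the
      integral back to \<open>M'\<close>.\<close>
    also have "\<dots> = (\<integral>\<^sup>+z. (\<integral>\<^sup>+u. g u * (\<integral>\<^sup>+v. f v \<partial>k (hist P t u)) \<partial>\<kappa>X (X z)) * (\<integral>\<^sup>+v. 1 \<partial>\<kappa>Y (Y z)) \<partial>M)"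
      using kernel_sets(3)[OF \<kappa>Y measurable_space[OF Y]]
      by (intro nn_integral_cong) (simp add: prob_space.emeasure_space_1)
    also have "\<dots> = (\<integral>\<^sup>+w. (g (X' w) * (\<integral>\<^sup>+v. f v \<partial>k (hist P t (X' w)))) * 1 \<partial>M')"
    proof (rule joint[symmetric, of "\<lambda>u. g u * (\<integral>\<^sup>+v. f v \<partial>k (hist P t u))" "\<lambda>_. 1"])
      show "(\<lambda>u. g u * (\<integral>\<^sup>+v. f v \<partial>k (hist P t u))) \<in> borel_measurable MP"
        by (intro borel_measurable_times_ennreal g measurable_compose[OF hP km])
    qed simp
    finally show ?thesis by simp
  qed
  show "\<exists>k\<in>hist_space P t \<rightarrow>\<^sub>M prob_algebra (hist_space Q t).
        \<forall>g\<in>borel_measurable MP. \<forall>f\<in>borel_measurable (hist_space Q t).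
          (\<integral>\<^sup>+\<omega>. g (X' \<omega>) * f (hist Q t (Y' \<omega>)) \<partial>M') =
          (\<integral>\<^sup>+\<omega>. g (X' \<omega>) * (\<integral>\<^sup>+v. f v \<partial>k (hist P t (X' \<omega>))) \<partial>M')"
    using k main by (intro bexI[of _ k] ballI)
qed

lemma kernel_causal_kernel_prodI:
  assumes P: "process_space N P MP" and Q: "process_space N Q MQ"
    and \<mu>: "prob_space \<mu>" "sets \<mu> = sets MP" and \<kappa>[measurable]: "\<kappa> \<in> MP \<rightarrow>\<^sub>M prob_algebra MQ"
    and ae: "\<And>t. t \<in> {1..<N} \<Longrightarrow> \<exists>k\<in>hist_space P t \<rightarrow>\<^sub>M prob_algebra (hist_space Q t).
      AE x in \<mu>. distr (\<kappa> x) (hist_space Q t) (hist Q t) = k (hist P t x)"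
  shows "kernel_causal N P MP Q (kernel_prod \<mu> MQ \<kappa>) fst snd"
  unfolding kernel_causal_def
proof
  fix t assume t: "t \<in> {1..<N}"
  have tN: "t \<le> N" using t by auto
  note hP[measurable] = process_hist[OF P tN] and hQ[measurable] = process_hist[OF Q tN]
  have sp: "space \<mu> = space MP" using sets_eq_imp_space_eq[OF \<mu>(2)] .
  obtain k where k[measurable]: "k \<in> hist_space P t \<rightarrow>\<^sub>M prob_algebra (hist_space Q t)"
    and eq: "AE x in \<mu>. distr (\<kappa> x) (hist_space Q t) (hist Q t) = k (hist P t x)"
    using ae[OF t] by blast
  have "(\<integral>\<^sup>+\<omega>. g (fst \<omega>) * f (hist Q t (snd \<omega>)) \<partial>kernel_prod \<mu> MQ \<kappa>) =
      (\<integral>\<^sup>+\<omega>. g (fst \<omega>) * (\<integral>\<^sup>+v. f v \<partial>k (hist P t (fst \<omega>))) \<partial>kernel_prod \<mu> MQ \<kappa>)"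
    if g[measurable]: "g \<in> borel_measurable MP" and f[measurable]: "f \<in> borel_measurable (hist_space Q t)" for g f
  proof -
    have "(\<lambda>h. \<integral>\<^sup>+v. f v \<partial>k h) \<in> borel_measurable (hist_space P t)" by measurable
    then have km[measurable]: "(\<lambda>x. \<integral>\<^sup>+v. f v \<partial>k (hist P t x)) \<in> borel_measurable MP" by (rule measurable_compose[OF hP])
    have fQ: "(\<lambda>y. f (hist Q t y)) \<in> borel_measurable MQ" by measurable
    have "(\<integral>\<^sup>+\<omega>. g (fst \<omega>) * f (hist Q t (snd \<omega>)) \<partial>kernel_prod \<mu> MQ \<kappa>) = (\<integral>\<^sup>+x. \<integral>\<^sup>+y. g x * f (hist Q t y) \<partial>\<kappa> x \<partial>\<mu>)"
      by (subst nn_integral_kernel_prod[OF \<mu> \<kappa>]) auto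
    also have "\<dots> = (\<integral>\<^sup>+x. \<integral>\<^sup>+y. g x * (\<integral>\<^sup>+v. f v \<partial>k (hist P t x)) \<partial>\<kappa> x \<partial>\<mu>)"
    proof (rule nn_integral_cong_AE)
      show "AE x in \<mu>. (\<integral>\<^sup>+y. g x * f (hist Q t y) \<partial>\<kappa> x) = (\<integral>\<^sup>+y. g x * (\<integral>\<^sup>+v. f v \<partial>k (hist P t x)) \<partial>\<kappa> x)"
        using eq AE_space
      proof eventually_elim
        case (elim x)
        then have x: "x \<in> space MP" by (simp add: sp)
        have "(\<integral>\<^sup>+y. g x * f (hist Q t y) \<partial>\<kappa> x) = g x * (\<integral>\<^sup>+y. f (hist Q t y) \<partial>\<kappa> x)"
          by (rule nn_integral_cmult[OF borel_measurable_kernel[OF \<kappa> x fQ]])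
        also have "(\<integral>\<^sup>+y. f (hist Q t y) \<partial>\<kappa> x) = (\<integral>\<^sup>+v. f v \<partial>k (hist P t x))"
          by (rule nn_integral_hist_kernel[OF \<kappa> x hQ elim(1) f])
        finally show ?case using prob_space.emeasure_space_1[OF kernel_sets(3)[OF \<kappa> x]] by simp
      qed
    qed
    also have "\<dots> = (\<integral>\<^sup>+\<omega>. g (fst \<omega>) * (\<integral>\<^sup>+v. f v \<partial>k (hist P t (fst \<omega>))) \<partial>kernel_prod \<mu> MQ \<kappa>)"
      by (subst nn_integral_kernel_prod[OF \<mu> \<kappa>]) (auto intro!: borel_measurable_times_ennreal measurable_compose[OF measurable_fst g] measurable_compose[OF measurable_fst km])
    finally show ?thesis .
  qed
  then show "\<exists>k\<in>hist_space P t \<rightarrow>\<^sub>M prob_algebra (hist_space Q t).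
        \<forall>g\<in>borel_measurable MP. \<forall>f\<in>borel_measurable (hist_space Q t).
          (\<integral>\<^sup>+\<omega>. g (fst \<omega>) * f (hist Q t (snd \<omega>)) \<partial>kernel_prod \<mu> MQ \<kappa>) =
          (\<integral>\<^sup>+\<omega>. g (fst \<omega>) * (\<integral>\<^sup>+v. f v \<partial>k (hist P t (fst \<omega>))) \<partial>kernel_prod \<mu> MQ \<kappa>)"
    using k by (intro bexI[of _ k] ballI)
qed

section \<open>Independent pairs of kernels, and closure properties of causality\<close>

definition pair_kernel :: "('p \<Rightarrow> 'a measure) \<Rightarrow> ('q \<Rightarrow> 'b measure) \<Rightarrow> 'p \<times> 'q \<Rightarrow> ('a \<times> 'b) measure" where
  "pair_kernel \<kappa>X \<kappa>Y z = \<kappa>X (fst z) \<Otimes>\<^sub>M \<kappa>Y (snd z)"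

lemma measurable_pair_kernel:
  assumes [measurable]: "\<kappa>X \<in> MP \<rightarrow>\<^sub>M prob_algebra MA" "\<kappa>Y \<in> MQ \<rightarrow>\<^sub>M prob_algebra MB"
  shows "pair_kernel \<kappa>X \<kappa>Y \<in> MP \<Otimes>\<^sub>M MQ \<rightarrow>\<^sub>M prob_algebra (MA \<Otimes>\<^sub>M MB)"
  unfolding pair_kernel_def[abs_def] by (rule measurable_pair_prob) measurable

lemma nn_integral_pair_kernel:
  assumes \<kappa>: "\<kappa>X \<in> MP \<rightarrow>\<^sub>M prob_algebra MA" "\<kappa>Y \<in> MQ \<rightarrow>\<^sub>M prob_algebra MB"
    and z: "fst z \<in> space MP" "snd z \<in> space MQ"
    and g: "g \<in> borel_measurable MA" and f: "f \<in> borel_measurable MB"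
  shows "(\<integral>\<^sup>+w. g (fst w) * f (snd w) \<partial>pair_kernel \<kappa>X \<kappa>Y z) = (\<integral>\<^sup>+u. g u \<partial>\<kappa>X (fst z)) * (\<integral>\<^sup>+v. f v \<partial>\<kappa>Y (snd z))"
proof -
  interpret kY: prob_space "\<kappa>Y (snd z)" by (rule kernel_sets(3)[OF \<kappa>(2) z(2)])
  note g' = borel_measurable_kernel[OF \<kappa>(1) z(1) g] and f' = borel_measurable_kernel[OF \<kappa>(2) z(2) f]
  have "(\<integral>\<^sup>+w. g (fst w) * f (snd w) \<partial>pair_kernel \<kappa>X \<kappa>Y z) = (\<integral>\<^sup>+u. \<integral>\<^sup>+v. g u * f v \<partial>\<kappa>Y (snd z) \<partial>\<kappa>X (fst z))"
    unfolding pair_kernel_def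
    by (subst kY.nn_integral_fst[symmetric])
       (auto intro!: borel_measurable_times_ennreal measurable_compose[OF measurable_fst g'] measurable_compose[OF measurable_snd f'])
  also have "\<dots> = (\<integral>\<^sup>+u. g u * (\<integral>\<^sup>+v. f v \<partial>\<kappa>Y (snd z)) \<partial>\<kappa>X (fst z))"
    by (intro nn_integral_cong nn_integral_cmult f')
  also have "\<dots> = (\<integral>\<^sup>+u. g u \<partial>\<kappa>X (fst z)) * (\<integral>\<^sup>+v. f v \<partial>\<kappa>Y (snd z))"
    by (rule nn_integral_multc[OF g'])
  finally show ?thesis .
qed

text \<open>Given the starting point, the two new pasts are independent, each with a law that is a
  kernel in the past of its own coordinate. Jointly they are thus governed by the past of the pair,
  whatever dependence the coordinates have under \<pi>. In the reverse direction the law of the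
  starting point given the end point would involve that dependence.\<close>

lemma kernel_causal_pair_kernel:
  assumes P: "process_space N P MP" and Q: "process_space N Q MQ"
    and \<pi>: "prob_space \<pi>" "sets \<pi> = sets (MP \<Otimes>\<^sub>M MQ)"
    and \<kappa>X: "\<kappa>X \<in> MP \<rightarrow>\<^sub>M prob_algebra MP" and \<kappa>Y: "\<kappa>Y \<in> MQ \<rightarrow>\<^sub>M prob_algebra MQ"
    and kcX: "kernel_causal N P MP P (kernel_prod (distr \<pi> MP fst) MP \<kappa>X) fst snd"
    and kcY: "kernel_causal N Q MQ Q (kernel_prod (distr \<pi> MQ snd) MQ \<kappa>Y) fst snd"
  shows "kernel_causal N (pair_process P Q) (MP \<Otimes>\<^sub>M MQ) (pair_process P Q)
     (kernel_prod \<pi> (MP \<Otimes>\<^sub>M MQ) (pair_kernel \<kappa>X \<kappa>Y)) fst snd"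
proof (rule kernel_causal_kernel_prodI[OF pair_process_space[OF P Q] pair_process_space[OF P Q] \<pi> measurable_pair_kernel[OF \<kappa>X \<kappa>Y]])
  fix t assume t: "t \<in> {1..<N}"
  have tN: "t \<le> N" using t by auto
  let ?Z = "pair_process P Q"
  interpret \<pi>: prob_space \<pi> by fact
  note \<pi>(2)[measurable_cong]
  note hP = process_hist[OF P tN] and hQ = process_hist[OF Q tN]
  have X: "fst \<in> \<pi> \<rightarrow>\<^sub>M MP" and Y: "snd \<in> \<pi> \<rightarrow>\<^sub>M MQ" by measurable
  have \<mu>: "prob_space (distr \<pi> MP fst)" "sets (distr \<pi> MP fst) = sets MP"
    and \<nu>: "prob_space (distr \<pi> MQ snd)" "sets (distr \<pi> MQ snd) = sets MQ"
    by (auto intro!: \<pi>.prob_space_distr)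
  obtain kX where kX: "kX \<in> hist_space P t \<rightarrow>\<^sub>M prob_algebra (hist_space P t)"
    and kXeq: "AE x in distr \<pi> MP fst. distr (\<kappa>X x) (hist_space P t) (hist P t) = kX (hist P t x)"
    using kernel_causal_AE[OF P P \<mu> \<kappa>X kcX t] by blast
  obtain kY where kY: "kY \<in> hist_space Q t \<rightarrow>\<^sub>M prob_algebra (hist_space Q t)"
    and kYeq: "AE y in distr \<pi> MQ snd. distr (\<kappa>Y y) (hist_space Q t) (hist Q t) = kY (hist Q t y)"
    using kernel_causal_AE[OF Q Q \<nu> \<kappa>Y kcY t] by blast
  define k where "k h = distr (pair_kernel kX kY (unzip_hist t h)) (hist_space ?Z t) (zip_hist t)" for h
  have "k \<in> hist_space ?Z t \<rightarrow>\<^sub>M prob_algebra (hist_space ?Z t)"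
    unfolding k_def
    by (rule measurable_compose[OF measurable_compose[OF measurable_unzip_hist measurable_pair_kernel[OF kX kY]]
          measurable_distr_prob_space[OF measurable_zip_hist]])
  moreover have "AE z in \<pi>. distr (pair_kernel \<kappa>X \<kappa>Y z) (hist_space ?Z t) (hist ?Z t) = k (hist ?Z t z)"
    using AE_distrD[OF X kXeq] AE_distrD[OF Y kYeq] AE_space
  proof eventually_elim
    case (elim z)
    have z: "fst z \<in> space MP" "snd z \<in> space MQ"
      using measurable_space[OF X elim(3)] measurable_space[OF Y elim(3)] by auto
    note kx = kernel_sets[OF \<kappa>X z(1)] and ky = kernel_sets[OF \<kappa>Y z(2)]
    have hx: "hist P t \<in> \<kappa>X (fst z) \<rightarrow>\<^sub>M hist_space P t"
      by (subst measurable_cong_sets[OF kx(1) refl]) (rule hP)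
    have hy: "hist Q t \<in> \<kappa>Y (snd z) \<rightarrow>\<^sub>M hist_space Q t"
      by (subst measurable_cong_sets[OF ky(1) refl]) (rule hQ)
    let ?h = "\<lambda>(x, y). (hist P t x, hist Q t y)"
    have hh: "?h \<in> \<kappa>X (fst z) \<Otimes>\<^sub>M \<kappa>Y (snd z) \<rightarrow>\<^sub>M hist_space P t \<Otimes>\<^sub>M hist_space Q t"
      unfolding case_prod_beta'
      by (intro measurable_Pair measurable_compose[OF measurable_fst hx] measurable_compose[OF measurable_snd hy])
    have sf: "sigma_finite_measure (distr (\<kappa>Y (snd z)) (hist_space Q t) (hist Q t))"
      using prob_space.prob_space_distr[OF ky(3) hy] by (simp add: prob_space_imp_sigma_finite)
    have "k (hist ?Z t z) = distr (distr (\<kappa>X (fst z)) (hist_space P t) (hist P t) \<Otimes>\<^sub>M distr (\<kappa>Y (snd z)) (hist_space Q t) (hist Q t))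
       (hist_space ?Z t) (zip_hist t)"
      using elim by (simp add: k_def unzip_hist_pair pair_kernel_def)
    also have "\<dots> = distr (distr (\<kappa>X (fst z) \<Otimes>\<^sub>M \<kappa>Y (snd z)) (hist_space P t \<Otimes>\<^sub>M hist_space Q t) ?h) (hist_space ?Z t) (zip_hist t)"
      by (subst pair_measure_distr[OF hx hy sf]) simp
    also have "\<dots> = distr (\<kappa>X (fst z) \<Otimes>\<^sub>M \<kappa>Y (snd z)) (hist_space ?Z t) (zip_hist t \<circ> ?h)"
      by (rule distr_distr[OF measurable_zip_hist hh])
    also have "zip_hist t \<circ> ?h = hist ?Z t"
      by (auto simp: fun_eq_iff hist_pair)
    finally show ?case by (simp add: pair_kernel_def)
  qed
  ultimately show "\<exists>k\<in>hist_space ?Z t \<rightarrow>\<^sub>M prob_algebra (hist_space ?Z t).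
      AE z in \<pi>. distr (pair_kernel \<kappa>X \<kappa>Y z) (hist_space ?Z t) (hist ?Z t) = k (hist ?Z t z)"
    by (intro bexI[of _ k])
qed

text \<open>The identity coupling read backwards, again with kernel \<open>return\<close>. It is the
  trivial first link when \<open>kernel_causal_chain\<close> is used to glue two couplings.\<close>

lemma kernel_causal_return:
  assumes P: "process_space N P MP" and \<mu>: "prob_space \<mu>" "sets \<mu> = sets MP"
  shows "kernel_causal N P MP P (kernel_prod \<mu> MP (return MP)) snd fst"
  unfolding kernel_causal_def
proof
  fix t assume t: "t \<in> {1..<N}"
  have tN: "t \<le> N" using t by auto
  have sp: "space \<mu> = space MP" using sets_eq_imp_space_eq[OF \<mu>(2)] .
  note hP[measurable] = process_hist[OF P tN]
  have "(\<integral>\<^sup>+\<omega>. g (snd \<omega>) * f (hist P t (fst \<omega>)) \<partial>kernel_prod \<mu> MP (return MP)) =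
     (\<integral>\<^sup>+\<omega>. g (snd \<omega>) * (\<integral>\<^sup>+v. f v \<partial>return (hist_space P t) (hist P t (snd \<omega>))) \<partial>kernel_prod \<mu> MP (return MP))"
    if g[measurable]: "g \<in> borel_measurable MP" and f[measurable]: "f \<in> borel_measurable (hist_space P t)" for g f
  proof -
    have fh[measurable]: "(\<lambda>x. f (hist P t x)) \<in> borel_measurable MP" by measurable
    have R: "(\<integral>\<^sup>+v. f v \<partial>return (hist_space P t) (hist P t x)) = f (hist P t x)" if "x \<in> space MP" for x
      by (rule nn_integral_return[OF measurable_space[OF hP that] f])
    have 1: "(\<integral>\<^sup>+\<omega>. g (snd \<omega>) * f (hist P t (h \<omega>)) \<partial>kernel_prod \<mu> MP (return MP)) = (\<integral>\<^sup>+x. g x * f (hist P t x) \<partial>\<mu>)"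
      if h: "h = fst \<or> h = snd" for h
    proof -
      have hm: "(\<lambda>\<omega>. f (hist P t (h \<omega>))) \<in> borel_measurable (MP \<Otimes>\<^sub>M MP)"
        using h by (auto intro!: measurable_compose[OF _ fh])
      have "(\<integral>\<^sup>+\<omega>. g (snd \<omega>) * f (hist P t (h \<omega>)) \<partial>kernel_prod \<mu> MP (return MP)) =
        (\<integral>\<^sup>+x. \<integral>\<^sup>+y. g y * f (hist P t (h (x, y))) \<partial>return MP x \<partial>\<mu>)"
        by (subst nn_integral_kernel_prod[OF \<mu> measurable_return_prob_space])
           (auto intro!: borel_measurable_times_ennreal hm measurable_compose[OF measurable_snd g])
      also have "\<dots> = (\<integral>\<^sup>+x. g x * f (hist P t x) \<partial>\<mu>)"
      proof (intro nn_integral_cong)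
        fix x assume "x \<in> space \<mu>"
        then have x: "x \<in> space MP" by (simp add: sp)
        have "(\<lambda>y. g y * f (hist P t (h (x, y)))) \<in> borel_measurable MP"
          using h x by (auto intro!: borel_measurable_times_ennreal g fh)
        from nn_integral_return[OF x this] show "(\<integral>\<^sup>+y. g y * f (hist P t (h (x, y))) \<partial>return MP x) = g x * f (hist P t x)"
          using h by auto
      qed
      finally show ?thesis .
    qed
    have s: "space (kernel_prod \<mu> MP (return MP)) = space MP \<times> space MP"
      using sets_eq_imp_space_eq[OF sets_kernel_prod[OF \<mu> measurable_return_prob_space]] by (simp add: space_pair_measure)
    have "(\<integral>\<^sup>+\<omega>. g (snd \<omega>) * (\<integral>\<^sup>+v. f v \<partial>return (hist_space P t) (hist P t (snd \<omega>))) \<partial>kernel_prod \<mu> MP (return MP)) =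
      (\<integral>\<^sup>+\<omega>. g (snd \<omega>) * f (hist P t (snd \<omega>)) \<partial>kernel_prod \<mu> MP (return MP))"
      by (intro nn_integral_cong) (auto simp: R s)
    then show ?thesis using 1[of fst] 1[of snd] by simp
  qed
  then show "\<exists>k\<in>hist_space P t \<rightarrow>\<^sub>M prob_algebra (hist_space P t).
        \<forall>g\<in>borel_measurable MP. \<forall>f\<in>borel_measurable (hist_space P t).
          (\<integral>\<^sup>+\<omega>. g (snd \<omega>) * f (hist P t (fst \<omega>)) \<partial>kernel_prod \<mu> MP (return MP)) =
          (\<integral>\<^sup>+\<omega>. g (snd \<omega>) * (\<integral>\<^sup>+v. f v \<partial>k (hist P t (snd \<omega>))) \<partial>kernel_prod \<mu> MP (return MP))"
    by (intro bexI[of _ "return (hist_space P t)"] ballI) auto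
qed

text \<open>Because the law of \<open>X\<close> is the same under both measures, conditioning on
  \<open>X\<close> does not change the weights: the conditional law under the mixture is the mixture
  of the conditional laws with the constants s and 1 - s, and so remains a kernel in the past of
  \<open>X\<close>.\<close>

lemma kernel_causal_mix:
  assumes P: "process_space N P MP" and Q: "process_space N Q MQ" and t01: "0 \<le> s" "s \<le> 1"
    and \<pi>: "prob_space \<pi>" "prob_space \<pi>'" "sets \<pi>' = sets \<pi>"
    and X: "X \<in> \<pi> \<rightarrow>\<^sub>M MP" and Y: "Y \<in> \<pi> \<rightarrow>\<^sub>M MQ" and marg: "distr \<pi> MP X = distr \<pi>' MP X"
    and kc: "kernel_causal N P MP Q \<pi> X Y" "kernel_causal N P MP Q \<pi>' X Y"
  shows "kernel_causal N P MP Q (mix s \<pi> \<pi>') X Y"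
  unfolding kernel_causal_def
proof
  fix t assume t: "t \<in> {1..<N}"
  have tN: "t \<le> N" using t by auto
  note hP[measurable] = process_hist[OF P tN] and hQ[measurable] = process_hist[OF Q tN]
  have X': "X \<in> \<pi>' \<rightarrow>\<^sub>M MP" using X by (simp add: measurable_cong_sets[OF \<pi>(3) refl])
  obtain k where k[measurable]: "k \<in> hist_space P t \<rightarrow>\<^sub>M prob_algebra (hist_space Q t)"
    and keq: "\<forall>g\<in>borel_measurable MP. \<forall>f\<in>borel_measurable (hist_space Q t).
      (\<integral>\<^sup>+\<omega>. g (X \<omega>) * f (hist Q t (Y \<omega>)) \<partial>\<pi>) = (\<integral>\<^sup>+\<omega>. g (X \<omega>) * (\<integral>\<^sup>+v. f v \<partial>k (hist P t (X \<omega>))) \<partial>\<pi>)"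
    using kc(1) t unfolding kernel_causal_def by blast
  obtain k' where k'[measurable]: "k' \<in> hist_space P t \<rightarrow>\<^sub>M prob_algebra (hist_space Q t)"
    and keq': "\<forall>g\<in>borel_measurable MP. \<forall>f\<in>borel_measurable (hist_space Q t).
      (\<integral>\<^sup>+\<omega>. g (X \<omega>) * f (hist Q t (Y \<omega>)) \<partial>\<pi>') = (\<integral>\<^sup>+\<omega>. g (X \<omega>) * (\<integral>\<^sup>+v. f v \<partial>k' (hist P t (X \<omega>))) \<partial>\<pi>')"
    using kc(2) t unfolding kernel_causal_def by blast
  define l where "l h = mix s (k h) (k' h)" for h
  have l: "l \<in> hist_space P t \<rightarrow>\<^sub>M prob_algebra (hist_space Q t)"
    unfolding l_def mix_def
  proof (rule measurable_bind_prob_space2[where N="count_space UNIV"])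
    show "(\<lambda>h. measure_pmf (bernoulli_pmf s)) \<in> hist_space P t \<rightarrow>\<^sub>M prob_algebra (count_space UNIV)"
      by (rule measurable_const) (simp add: space_prob_algebra measure_pmf.prob_space_axioms)
    show "(\<lambda>(h, b). if b then k h else k' h) \<in> hist_space P t \<Otimes>\<^sub>M count_space UNIV \<rightarrow>\<^sub>M prob_algebra (hist_space Q t)"
      by measurable
  qed
  have lint: "(\<integral>\<^sup>+v. f v \<partial>l h) = ennreal s * (\<integral>\<^sup>+v. f v \<partial>k h) + ennreal (1 - s) * (\<integral>\<^sup>+v. f v \<partial>k' h)"
    if "h \<in> space (hist_space P t)" "f \<in> borel_measurable (hist_space Q t)" for h f
    unfolding l_def
    by (rule nn_integral_mix[OF t01]) (use kernel_sets[OF k that(1)] kernel_sets[OF k' that(1)]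
      borel_measurable_kernel[OF k that] in auto)
  have "(\<integral>\<^sup>+\<omega>. g (X \<omega>) * f (hist Q t (Y \<omega>)) \<partial>mix s \<pi> \<pi>') = (\<integral>\<^sup>+\<omega>. g (X \<omega>) * (\<integral>\<^sup>+v. f v \<partial>l (hist P t (X \<omega>))) \<partial>mix s \<pi> \<pi>')"
    if g[measurable]: "g \<in> borel_measurable MP" and f[measurable]: "f \<in> borel_measurable (hist_space Q t)" for g f
  proof -
    let ?k = "\<lambda>x. \<integral>\<^sup>+v. f v \<partial>k (hist P t x)" and ?k' = "\<lambda>x. \<integral>\<^sup>+v. f v \<partial>k' (hist P t x)" and ?l = "\<lambda>x. \<integral>\<^sup>+v. f v \<partial>l (hist P t x)"
    have "(\<lambda>h. \<integral>\<^sup>+v. f v \<partial>k h) \<in> borel_measurable (hist_space P t)" "(\<lambda>h. \<integral>\<^sup>+v. f v \<partial>k' h) \<in> borel_measurable (hist_space P t)"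
      "(\<lambda>h. \<integral>\<^sup>+v. f v \<partial>l h) \<in> borel_measurable (hist_space P t)" using l by measurable
    then have m[measurable]: "?k \<in> borel_measurable MP" "?k' \<in> borel_measurable MP" "?l \<in> borel_measurable MP"
      using measurable_compose[OF hP] by blast+
    have gf: "(\<lambda>\<omega>. g (X \<omega>) * f (hist Q t (Y \<omega>))) \<in> borel_measurable \<pi>"
      by (intro borel_measurable_times_ennreal measurable_compose[OF X g] measurable_compose[OF Y] measurable_compose[OF hQ f])
    have gl: "(\<lambda>x. g x * ?l x) \<in> borel_measurable MP" "(\<lambda>x. g x * ?k x) \<in> borel_measurable MP" "(\<lambda>x. g x * ?k' x) \<in> borel_measurable MP"
      by measurable
    have swap: "(\<integral>\<^sup>+\<omega>. h (X \<omega>) \<partial>\<pi>') = (\<integral>\<^sup>+\<omega>. h (X \<omega>) \<partial>\<pi>)" if "h \<in> borel_measurable MP" for h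
      using nn_integral_distr'[OF X that] nn_integral_distr'[OF X' that] by (simp add: marg)
    have "(\<integral>\<^sup>+\<omega>. g (X \<omega>) * f (hist Q t (Y \<omega>)) \<partial>mix s \<pi> \<pi>') =
      ennreal s * (\<integral>\<^sup>+\<omega>. g (X \<omega>) * f (hist Q t (Y \<omega>)) \<partial>\<pi>) + ennreal (1 - s) * (\<integral>\<^sup>+\<omega>. g (X \<omega>) * f (hist Q t (Y \<omega>)) \<partial>\<pi>')"
      by (rule nn_integral_mix[OF t01 \<pi> gf])
    also have "\<dots> = ennreal s * (\<integral>\<^sup>+\<omega>. g (X \<omega>) * ?k (X \<omega>) \<partial>\<pi>) + ennreal (1 - s) * (\<integral>\<^sup>+\<omega>. g (X \<omega>) * ?k' (X \<omega>) \<partial>\<pi>')"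
      unfolding keq[rule_format, OF g f] keq'[rule_format, OF g f] ..
    also have "(\<integral>\<^sup>+\<omega>. g (X \<omega>) * ?k' (X \<omega>) \<partial>\<pi>') = (\<integral>\<^sup>+\<omega>. g (X \<omega>) * ?k' (X \<omega>) \<partial>\<pi>)" by (rule swap[OF gl(3)])
    also have "ennreal s * (\<integral>\<^sup>+\<omega>. g (X \<omega>) * ?k (X \<omega>) \<partial>\<pi>) + ennreal (1 - s) * (\<integral>\<^sup>+\<omega>. g (X \<omega>) * ?k' (X \<omega>) \<partial>\<pi>)
      = (\<integral>\<^sup>+\<omega>. ennreal s * (g (X \<omega>) * ?k (X \<omega>)) + ennreal (1 - s) * (g (X \<omega>) * ?k' (X \<omega>)) \<partial>\<pi>)"
      using measurable_compose[OF X gl(2)] measurable_compose[OF X gl(3)]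
      by (simp add: nn_integral_add nn_integral_cmult)
    also have "\<dots> = (\<integral>\<^sup>+\<omega>. g (X \<omega>) * ?l (X \<omega>) \<partial>\<pi>)"
    proof (rule nn_integral_cong)
      fix \<omega> assume "\<omega> \<in> space \<pi>"
      from lint[OF measurable_space[OF hP measurable_space[OF X this]] f]
      show "ennreal s * (g (X \<omega>) * ?k (X \<omega>)) + ennreal (1 - s) * (g (X \<omega>) * ?k' (X \<omega>)) = g (X \<omega>) * ?l (X \<omega>)"
        by (simp add: distrib_left mult.left_commute)
    qed
    also have "\<dots> = ennreal s * (\<integral>\<^sup>+\<omega>. g (X \<omega>) * ?l (X \<omega>) \<partial>\<pi>) + ennreal (1 - s) * (\<integral>\<^sup>+\<omega>. g (X \<omega>) * ?l (X \<omega>) \<partial>\<pi>)"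
      using t01 by (simp flip: distrib_right ennreal_plus)
    also have "\<dots> = ennreal s * (\<integral>\<^sup>+\<omega>. g (X \<omega>) * ?l (X \<omega>) \<partial>\<pi>) + ennreal (1 - s) * (\<integral>\<^sup>+\<omega>. g (X \<omega>) * ?l (X \<omega>) \<partial>\<pi>')"
      unfolding swap[OF gl(1)] ..
    also have "\<dots> = (\<integral>\<^sup>+\<omega>. g (X \<omega>) * ?l (X \<omega>) \<partial>mix s \<pi> \<pi>')"
      by (rule nn_integral_mix[OF t01 \<pi> measurable_compose[OF X gl(1)], symmetric])
    finally show ?thesis .
  qed
  then show "\<exists>k\<in>hist_space P t \<rightarrow>\<^sub>M prob_algebra (hist_space Q t).
        \<forall>g\<in>borel_measurable MP. \<forall>f\<in>borel_measurable (hist_space Q t).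
          (\<integral>\<^sup>+\<omega>. g (X \<omega>) * f (hist Q t (Y \<omega>)) \<partial>mix s \<pi> \<pi>') =
          (\<integral>\<^sup>+\<omega>. g (X \<omega>) * (\<integral>\<^sup>+v. f v \<partial>k (hist P t (X \<omega>))) \<partial>mix s \<pi> \<pi>')"
    using l by (intro bexI[of _ l] ballI)
qed

lemma kernel_causal_independent:
  assumes P: "process_space N P MP" and Q: "process_space N Q MQ" and \<nu>: "prob_space \<nu>" "sets \<nu> = sets MQ"
    and ind: "\<And>g f. g \<in> borel_measurable MP \<Longrightarrow> f \<in> borel_measurable MQ \<Longrightarrow>
      (\<integral>\<^sup>+\<omega>. g (X \<omega>) * f (Y \<omega>) \<partial>M) = (\<integral>\<^sup>+\<omega>. g (X \<omega>) * (\<integral>\<^sup>+y. f y \<partial>\<nu>) \<partial>M)"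
  shows "kernel_causal N P MP Q M X Y"
  unfolding kernel_causal_def
proof
  fix t assume t: "t \<in> {1..<N}"
  have tN: "t \<le> N" using t by auto
  interpret prob_space \<nu> by fact
  have h: "hist Q t \<in> \<nu> \<rightarrow>\<^sub>M hist_space Q t"
    by (subst measurable_cong_sets[OF \<nu>(2) refl]) (rule process_hist[OF Q tN])
  let ?k = "\<lambda>_. distr \<nu> (hist_space Q t) (hist Q t)"
  have "?k \<in> hist_space P t \<rightarrow>\<^sub>M prob_algebra (hist_space Q t)"
    by (rule measurable_const) (simp add: space_prob_algebra prob_space_distr[OF h])
  moreover have "(\<integral>\<^sup>+\<omega>. g (X \<omega>) * f (hist Q t (Y \<omega>)) \<partial>M) = (\<integral>\<^sup>+\<omega>. g (X \<omega>) * (\<integral>\<^sup>+v. f v \<partial>?k (hist P t (X \<omega>))) \<partial>M)"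
    if g: "g \<in> borel_measurable MP" and f: "f \<in> borel_measurable (hist_space Q t)" for g f
    using ind[OF g measurable_compose[OF process_hist[OF Q tN] f]] nn_integral_distr'[OF h f] by simp
  ultimately show "\<exists>k\<in>hist_space P t \<rightarrow>\<^sub>M prob_algebra (hist_space Q t).
        \<forall>g\<in>borel_measurable MP. \<forall>f\<in>borel_measurable (hist_space Q t).
          (\<integral>\<^sup>+\<omega>. g (X \<omega>) * f (hist Q t (Y \<omega>)) \<partial>M) = (\<integral>\<^sup>+\<omega>. g (X \<omega>) * (\<integral>\<^sup>+v. f v \<partial>k (hist P t (X \<omega>))) \<partial>M)"
    by (intro bexI[of _ ?k] ballI)
qed

section \<open>Path spaces and their couplings\<close>

lemma hist_path_process: "x \<in> paths N T \<Longrightarrow> hist (path_process T) N x = x"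
  by (auto simp: hist_def path_process_def path_top_def PiE_iff extensional_def fun_eq_iff)

text \<open>The identity serves as retraction from histories to paths. A path supplies a point of
  every component, as \<open>polish_standard\<close> requires.\<close>

lemma path_process_space:
  assumes T: "polish_path_space N T d" and ne: "paths N T \<noteq> {}"
  shows "process_space N (path_process T) (borel_of (path_top N T))"
  unfolding process_space_def
proof (intro conjI ballI)
  have pol: "polish_space (T t)" if "t \<in> {1..N}" for t using T that by (simp add: polish_path_space_def)
  {
    fix t assume t: "t \<in> {1..N}"
    have "continuous_map (path_top N T) (T t) (\<lambda>x. x t)"
      unfolding path_top_def by (rule continuous_map_product_projection[OF t])
    then show "coord (path_process T) t \<in> borel_of (path_top N T) \<rightarrow>\<^sub>M comp_space (path_process T) t"
      unfolding path_process_def by (simp add: continuous_map_measurable)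
    obtain x where "x \<in> paths N T" using ne by blast
    then have "x t \<in> topspace (T t)" using t by (auto simp: path_top_def PiE_iff)
    then have "topspace (T t) \<noteq> {}" by blast
    from polish_standard[OF pol[OF t] this] show "standard_space (comp_space (path_process T) t)"
      by (simp only: path_process_def coord_process.simps)
  }
  have "hist_space (path_process T) N = PiM {1..N} (\<lambda>t. borel_of (T t))"
    by (simp add: hist_space_def path_process_def)
  moreover have "(\<lambda>x. x) \<in> PiM {1..N} (\<lambda>t. borel_of (T t)) \<rightarrow>\<^sub>M borel_of (path_top N T)"
    by (rule id_measurable_path_top[OF polish_second_countable[OF pol]])
  ultimately have "(\<lambda>x. x) \<in> hist_space (path_process T) N \<rightarrow>\<^sub>M borel_of (path_top N T)" by simp
  then show "\<exists>r\<in>hist_space (path_process T) N \<rightarrow>\<^sub>M borel_of (path_top N T).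
      \<forall>x\<in>space (borel_of (path_top N T)). r (hist (path_process T) N x) = x"
    by (intro bexI[of _ "\<lambda>x. x"]) (auto simp: hist_path_process)
qed

lemma distr_cong_target: "sets \<mu> = sets M \<Longrightarrow> distr \<pi> \<mu> f = distr \<pi> M f"
  by (rule distr_cong) simp_all

lemma couplingsD:
  assumes "\<pi> \<in> couplings \<mu> \<nu>" "prob_space \<mu>" "sets \<mu> = sets M" "sets \<nu> = sets L"
  shows "prob_space \<pi>" "sets \<pi> = sets (M \<Otimes>\<^sub>M L)" "distr \<pi> M fst = \<mu>" "distr \<pi> L snd = \<nu>"
proof -
  show s: "sets \<pi> = sets (M \<Otimes>\<^sub>M L)"
    using assms(1) sets_pair_measure_cong[OF assms(3,4)] by (simp add: couplings_def)
  have 1: "distr \<pi> \<mu> fst = \<mu>" "distr \<pi> \<nu> snd = \<nu>" using assms(1) by (auto simp: couplings_def)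
  show "distr \<pi> M fst = \<mu>" "distr \<pi> L snd = \<nu>"
    using 1 distr_cong_target[OF assms(3), of \<pi> fst] distr_cong_target[OF assms(4), of \<pi> snd] by simp_all
  have "fst \<in> \<pi> \<rightarrow>\<^sub>M \<mu>" using assms(1) by (simp add: couplings_def measurable_cong_sets[of \<pi> "\<mu> \<Otimes>\<^sub>M \<nu>"])
  then show "prob_space \<pi>"
    by (rule prob_space_distrD) (simp add: 1 assms(2))
qed

lemma couplingsI:
  assumes "sets \<mu> = sets M" "sets \<nu> = sets L"
    "sets \<pi> = sets (M \<Otimes>\<^sub>M L)" "distr \<pi> M fst = \<mu>" "distr \<pi> L snd = \<nu>"
  shows "\<pi> \<in> couplings \<mu> \<nu>"
  using assms sets_pair_measure_cong[OF assms(1,2)] distr_cong_target[OF assms(1), of \<pi> fst]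
    distr_cong_target[OF assms(2), of \<pi> snd]
  by (simp add: couplings_def)

lemma distr_eqI_nn_integral:
  assumes f: "f \<in> M' \<rightarrow>\<^sub>M M" and s: "sets \<mu> = sets M"
    and eq: "\<And>A. A \<in> sets M \<Longrightarrow> (\<integral>\<^sup>+\<omega>. indicator A (f \<omega>) \<partial>M') = emeasure \<mu> A"
  shows "distr M' M f = \<mu>"
proof (rule measure_eqI)
  fix A assume "A \<in> sets (distr M' M f)"
  then have A: "A \<in> sets M" by simp
  have "emeasure (distr M' M f) A = (\<integral>\<^sup>+x. indicator A x \<partial>distr M' M f)" using A by simp
  also have "\<dots> = (\<integral>\<^sup>+\<omega>. indicator A (f \<omega>) \<partial>M')" by (rule nn_integral_distr'[OF f borel_measurable_indicator[OF A]])
  finally show "emeasure (distr M' M f) A = emeasure \<mu> A" using eq[OF A] by simp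
qed (simp add: s)

text \<open>The passage to kernels: since anticausality is causality with the projections exchanged,
  each version becomes a conjunction of at most two instances of one predicate.\<close>

lemma admissible_iff:
  assumes P: "process_space N P MP" and Q: "process_space N Q MQ"
    and \<pi>: "prob_space \<pi>" "sets \<pi> = sets (MP \<Otimes>\<^sub>M MQ)"
  shows "admissible b N P Q \<pi> \<longleftrightarrow>
    (b \<in> {Causal, Bicausal} \<longrightarrow> kernel_causal N P MP Q \<pi> fst snd) \<and>
    (b \<in> {Anticausal, Bicausal} \<longrightarrow> kernel_causal N Q MQ P \<pi> snd fst)"
proof -
  have X: "fst \<in> \<pi> \<rightarrow>\<^sub>M MP" and Y: "snd \<in> \<pi> \<rightarrow>\<^sub>M MQ"
    by (simp_all add: measurable_cong_sets[OF \<pi>(2) refl])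
  have "causal N P Q \<pi> \<longleftrightarrow> kernel_causal N P MP Q \<pi> fst snd"
    unfolding causal_def case_prod_beta'
    using kernel_causalI[OF P Q \<pi>(1) X Y] kernel_causalD[OF P Q \<pi>(1) X Y] by blast
  moreover have "anticausal N P Q \<pi> \<longleftrightarrow> kernel_causal N Q MQ P \<pi> snd fst"
    unfolding anticausal_def case_prod_beta'
    using kernel_causalI[OF Q P \<pi>(1) Y X] kernel_causalD[OF Q P \<pi>(1) Y X] by blast
  ultimately show ?thesis by (cases b) auto
qed

fun swap_version :: "version \<Rightarrow> version" where
  "swap_version Causal = Anticausal"
| "swap_version Anticausal = Causal"
| "swap_version b = b"

lemma measurable_swap: "prod.swap \<in> M \<Otimes>\<^sub>M N \<rightarrow>\<^sub>M N \<Otimes>\<^sub>M M"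
  unfolding prod.swap_def[abs_def] by measurable

lemma couplings_of_swap:
  assumes P: "process_space N P MP" and Q: "process_space N Q MQ"
    and \<mu>: "prob_space \<mu>" "sets \<mu> = sets MP" and \<nu>: "prob_space \<nu>" "sets \<nu> = sets MQ"
    and \<pi>: "\<pi> \<in> couplings_of b N P Q \<mu> \<nu>"
  shows "distr \<pi> (MQ \<Otimes>\<^sub>M MP) prod.swap \<in> couplings_of (swap_version b) N Q P \<nu> \<mu>"
proof -
  let ?\<sigma> = "distr \<pi> (MQ \<Otimes>\<^sub>M MP) prod.swap"
  have \<pi>': "\<pi> \<in> couplings \<mu> \<nu>" "admissible b N P Q \<pi>" using \<pi> by (auto simp: couplings_of_def)
  note c = couplingsD[OF \<pi>'(1) \<mu> \<nu>(2)]
  interpret \<pi>: prob_space \<pi> by (rule c(1))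
  have sw: "prod.swap \<in> \<pi> \<rightarrow>\<^sub>M MQ \<Otimes>\<^sub>M MP" using measurable_swap by (simp add: measurable_cong_sets[OF c(2) refl])
  have p: "prob_space ?\<sigma>" by (rule \<pi>.prob_space_distr[OF sw])
  have s: "sets ?\<sigma> = sets (MQ \<Otimes>\<^sub>M MP)" by simp
  have "?\<sigma> \<in> couplings \<nu> \<mu>"
  proof (rule couplingsI[OF \<nu>(2) \<mu>(2) s])
    show "distr ?\<sigma> MQ fst = \<nu>" using c(4) by (subst distr_distr[OF _ sw]) (auto simp: comp_def)
    show "distr ?\<sigma> MP snd = \<mu>" using c(3) by (subst distr_distr[OF _ sw]) (auto simp: comp_def)
  qed
  moreover have "admissible (swap_version b) N Q P ?\<sigma>"
    using \<pi>'(2) unfolding admissible_iff[OF P Q c(1,2)] admissible_iff[OF Q P p s]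
      kernel_causal_distr[OF sw measurable_fst measurable_snd Q P]
      kernel_causal_distr[OF sw measurable_snd measurable_fst P Q]
    by (cases b) simp_all
  ultimately show ?thesis by (simp add: couplings_of_def)
qed

text \<open>The conditional law of either coordinate given the other is constant, so all four
  versions admit the product. Hence the infima run over nonempty sets, and they contain a coupling
  of zero entropy.\<close>

lemma product_coupling:
  assumes P: "process_space N P MP" and Q: "process_space N Q MQ"
    and \<mu>: "prob_space \<mu>" "sets \<mu> = sets MP" and \<nu>: "prob_space \<nu>" "sets \<nu> = sets MQ"
  shows "\<mu> \<Otimes>\<^sub>M \<nu> \<in> couplings_of b N P Q \<mu> \<nu>"
proof -
  interpret \<mu>: prob_space \<mu> by fact
  interpret \<nu>: prob_space \<nu> by fact
  interpret pair_prob_space \<mu> \<nu> ..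
  have s: "sets (\<mu> \<Otimes>\<^sub>M \<nu>) = sets (MP \<Otimes>\<^sub>M MQ)" by (rule sets_pair_measure_cong[OF \<mu>(2) \<nu>(2)])
  have p: "prob_space (\<mu> \<Otimes>\<^sub>M \<nu>)" by (rule prob_space_pair[OF \<mu>(1) \<nu>(1)])
  have gm: "(\<lambda>\<omega>. g (fst \<omega>)) \<in> borel_measurable (\<mu> \<Otimes>\<^sub>M \<nu>)" if "g \<in> borel_measurable MP" for g :: "_ \<Rightarrow> ennreal"
    using that by (simp add: measurable_cong_sets[OF s refl])
  have fm: "(\<lambda>\<omega>. f (snd \<omega>)) \<in> borel_measurable (\<mu> \<Otimes>\<^sub>M \<nu>)" if "f \<in> borel_measurable MQ" for f :: "_ \<Rightarrow> ennreal"
    using that by (simp add: measurable_cong_sets[OF s refl])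
  have prod: "(\<integral>\<^sup>+\<omega>. g (fst \<omega>) * f (snd \<omega>) \<partial>(\<mu> \<Otimes>\<^sub>M \<nu>)) = (\<integral>\<^sup>+x. g x \<partial>\<mu>) * (\<integral>\<^sup>+y. f y \<partial>\<nu>)"
    if g: "g \<in> borel_measurable MP" and f: "f \<in> borel_measurable MQ" for g f
  proof -
    have g': "g \<in> borel_measurable \<mu>" and f': "f \<in> borel_measurable \<nu>"
      using g f by (simp_all add: measurable_cong_sets[OF \<mu>(2) refl] measurable_cong_sets[OF \<nu>(2) refl])
    have "(\<integral>\<^sup>+\<omega>. g (fst \<omega>) * f (snd \<omega>) \<partial>(\<mu> \<Otimes>\<^sub>M \<nu>)) = (\<integral>\<^sup>+x. \<integral>\<^sup>+y. g x * f y \<partial>\<nu> \<partial>\<mu>)"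
      by (subst \<nu>.nn_integral_fst[symmetric]) (auto intro!: borel_measurable_times_ennreal gm[OF g] fm[OF f])
    also have "\<dots> = (\<integral>\<^sup>+x. g x * (\<integral>\<^sup>+y. f y \<partial>\<nu>) \<partial>\<mu>)"
      by (intro nn_integral_cong nn_integral_cmult f')
    also have "\<dots> = (\<integral>\<^sup>+x. g x \<partial>\<mu>) * (\<integral>\<^sup>+y. f y \<partial>\<nu>)" by (rule nn_integral_multc[OF g'])
    finally show ?thesis .
  qed
  have one: "(\<lambda>_. 1::ennreal) \<in> borel_measurable MP" "(\<lambda>_. 1::ennreal) \<in> borel_measurable MQ" by simp_all
  have 1: "(\<integral>\<^sup>+\<omega>. g (fst \<omega>) \<partial>(\<mu> \<Otimes>\<^sub>M \<nu>)) = (\<integral>\<^sup>+x. g x \<partial>\<mu>)" if "g \<in> borel_measurable MP" for g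
    using prod[OF that one(2)] by (simp add: \<nu>.emeasure_space_1)
  have 2: "(\<integral>\<^sup>+\<omega>. f (snd \<omega>) \<partial>(\<mu> \<Otimes>\<^sub>M \<nu>)) = (\<integral>\<^sup>+y. f y \<partial>\<nu>)" if "f \<in> borel_measurable MQ" for f
    using prod[OF one(1) that] by (simp add: \<mu>.emeasure_space_1)
  have "\<mu> \<Otimes>\<^sub>M \<nu> \<in> couplings \<mu> \<nu>"
  proof (rule couplingsI[OF \<mu>(2) \<nu>(2) s])
    show "distr (\<mu> \<Otimes>\<^sub>M \<nu>) MP fst = \<mu>"
      by (rule distr_eqI_nn_integral[OF _ \<mu>(2)]) (use \<mu>(2) in \<open>auto simp: 1 measurable_cong_sets[OF s refl]\<close>)
    show "distr (\<mu> \<Otimes>\<^sub>M \<nu>) MQ snd = \<nu>"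
      by (rule distr_eqI_nn_integral[OF _ \<nu>(2)]) (use \<nu>(2) in \<open>auto simp: 2 measurable_cong_sets[OF s refl]\<close>)
  qed
  moreover have "kernel_causal N P MP Q (\<mu> \<Otimes>\<^sub>M \<nu>) fst snd"
  proof (rule kernel_causal_independent[OF P Q \<nu>])
    fix g :: "_ \<Rightarrow> ennreal" and f :: "_ \<Rightarrow> ennreal" assume g: "g \<in> borel_measurable MP" and f: "f \<in> borel_measurable MQ"
    show "(\<integral>\<^sup>+\<omega>. g (fst \<omega>) * f (snd \<omega>) \<partial>(\<mu> \<Otimes>\<^sub>M \<nu>)) = (\<integral>\<^sup>+\<omega>. g (fst \<omega>) * (\<integral>\<^sup>+y. f y \<partial>\<nu>) \<partial>(\<mu> \<Otimes>\<^sub>M \<nu>))"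
      using nn_integral_multc[OF gm[OF g], of "\<integral>\<^sup>+y. f y \<partial>\<nu>"] by (simp add: prod[OF g f] 1[OF g])
  qed
  moreover have "kernel_causal N Q MQ P (\<mu> \<Otimes>\<^sub>M \<nu>) snd fst"
  proof (rule kernel_causal_independent[OF Q P \<mu>])
    fix g :: "_ \<Rightarrow> ennreal" and f :: "_ \<Rightarrow> ennreal" assume g: "g \<in> borel_measurable MQ" and f: "f \<in> borel_measurable MP"
    show "(\<integral>\<^sup>+\<omega>. g (snd \<omega>) * f (fst \<omega>) \<partial>(\<mu> \<Otimes>\<^sub>M \<nu>)) = (\<integral>\<^sup>+\<omega>. g (snd \<omega>) * (\<integral>\<^sup>+y. f y \<partial>\<mu>) \<partial>(\<mu> \<Otimes>\<^sub>M \<nu>))"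
      using nn_integral_multc[OF fm[OF g], of "\<integral>\<^sup>+y. f y \<partial>\<mu>"] prod[OF f g] by (simp add: 2[OF g] mult.commute)
  qed
  ultimately show ?thesis
    using admissible_iff[OF P Q p s] by (simp add: couplings_of_def)
qed

lemma couplings_of_mix:
  assumes P: "process_space N P MP" and Q: "process_space N Q MQ"
    and \<mu>: "prob_space \<mu>" "sets \<mu> = sets MP" and \<nu>: "prob_space \<nu>" "sets \<nu> = sets MQ"
    and \<pi>: "\<pi> \<in> couplings_of b N P Q \<mu> \<nu>" and \<pi>': "\<pi>' \<in> couplings_of b N P Q \<mu> \<nu>" and s: "0 \<le> s" "s \<le> 1"
  shows "mix s \<pi> \<pi>' \<in> couplings_of b N P Q \<mu> \<nu>"
proof -
  have c0: "\<pi> \<in> couplings \<mu> \<nu>" "\<pi>' \<in> couplings \<mu> \<nu>" "admissible b N P Q \<pi>" "admissible b N P Q \<pi>'"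
    using \<pi> \<pi>' by (auto simp: couplings_of_def)
  note c = couplingsD[OF c0(1) \<mu> \<nu>(2)] and c' = couplingsD[OF c0(2) \<mu> \<nu>(2)]
  have ss: "sets \<pi>' = sets \<pi>" using c(2) c'(2) by simp
  have sm: "sets (mix s \<pi> \<pi>') = sets (MP \<Otimes>\<^sub>M MQ)" using sets_mix[OF s c(1) c'(1) ss] c(2) by simp
  have pm: "prob_space (mix s \<pi> \<pi>')" by (rule prob_space_mix[OF s c(1) c'(1) ss])
  have X: "fst \<in> \<pi> \<rightarrow>\<^sub>M MP" "fst \<in> \<pi>' \<rightarrow>\<^sub>M MP" "fst \<in> mix s \<pi> \<pi>' \<rightarrow>\<^sub>M MP"
    and Y: "snd \<in> \<pi> \<rightarrow>\<^sub>M MQ" "snd \<in> \<pi>' \<rightarrow>\<^sub>M MQ" "snd \<in> mix s \<pi> \<pi>' \<rightarrow>\<^sub>M MQ"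
    by (simp_all add: measurable_cong_sets[OF c(2) refl] measurable_cong_sets[OF c'(2) refl] measurable_cong_sets[OF sm refl])
  have comb: "ennreal s * a + ennreal (1 - s) * a = a" for a
    using s by (simp flip: distrib_right ennreal_plus)
  have marg: "distr (mix s \<pi> \<pi>') M X = \<rho>"
    if d: "distr \<pi> M X = \<rho>" "distr \<pi>' M X = \<rho>" and m: "X \<in> \<pi> \<rightarrow>\<^sub>M M" "X \<in> \<pi>' \<rightarrow>\<^sub>M M" "X \<in> mix s \<pi> \<pi>' \<rightarrow>\<^sub>M M"
      and r: "sets \<rho> = sets M" for M X \<rho>
  proof (rule distr_eqI_nn_integral[OF m(3) r])
    fix A assume A: "A \<in> sets M"
    have i: "(\<lambda>x. indicator A x :: ennreal) \<in> borel_measurable M" using A by simp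
    have "(\<integral>\<^sup>+\<omega>. indicator A (X \<omega>) \<partial>\<pi>) = emeasure \<rho> A" "(\<integral>\<^sup>+\<omega>. indicator A (X \<omega>) \<partial>\<pi>') = emeasure \<rho> A"
      using nn_integral_distr'[OF m(1) i] nn_integral_distr'[OF m(2) i] A r by (simp_all add: d)
    then show "(\<integral>\<^sup>+\<omega>. indicator A (X \<omega>) \<partial>mix s \<pi> \<pi>') = emeasure \<rho> A"
      by (subst nn_integral_mix[OF s c(1) c'(1) ss measurable_compose[OF m(1) i]]) (simp add: comb)
  qed
  have "mix s \<pi> \<pi>' \<in> couplings \<mu> \<nu>"
    by (rule couplingsI[OF \<mu>(2) \<nu>(2) sm marg[OF c(3) c'(3) X \<mu>(2)] marg[OF c(4) c'(4) Y \<nu>(2)]])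
  moreover have "admissible b N P Q (mix s \<pi> \<pi>')"
    using c0(3,4) unfolding admissible_iff[OF P Q c(1,2)] admissible_iff[OF P Q c'(1,2)] admissible_iff[OF P Q pm sm]
    using kernel_causal_mix[OF P Q s c(1) c'(1) ss X(1) Y(1)] kernel_causal_mix[OF Q P s c(1) c'(1) ss Y(1) X(1)]
      c(3,4) c'(3,4) by simp
  ultimately show ?thesis by (simp add: couplings_of_def)
qed

lemma nn_integral_bind_kernel:
  assumes \<pi>: "sets \<pi> = sets M" and K: "K \<in> M \<rightarrow>\<^sub>M prob_algebra L" and f: "f \<in> borel_measurable L"
  shows "(\<integral>\<^sup>+w. f w \<partial>(\<pi> \<bind> K)) = (\<integral>\<^sup>+z. \<integral>\<^sup>+w. f w \<partial>K z \<partial>\<pi>)"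
proof (rule nn_integral_bind[OF f])
  show "K \<in> \<pi> \<rightarrow>\<^sub>M subprob_algebra L"
    by (subst measurable_cong_sets[OF \<pi> refl]) (rule measurable_prob_algebraD[OF K])
qed

text \<open>The shadow of \<open>\<pi>\<close>: transport both coordinates independently along the kernels of \<open>\<gamma>\<^sub>X\<close> and
  \<open>\<gamma>\<^sub>Y\<close>.  The resulting coupling \<open>\<theta>\<close> of \<open>\<pi>\<close> with its shadow is causal, but in general not
  anticausal.\<close>

lemma shadow_coupling:
  assumes P: "process_space N P MP" and Q: "process_space N Q MQ"
    and \<mu>: "prob_space \<mu>" "sets \<mu> = sets MP" and \<mu>': "prob_space \<mu>'" "sets \<mu>' = sets MP"
    and \<nu>: "prob_space \<nu>" "sets \<nu> = sets MQ" and \<nu>': "prob_space \<nu>'" "sets \<nu>' = sets MQ"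
    and \<gamma>X: "\<gamma>X \<in> couplings_of Bicausal N P P \<mu> \<mu>'" and \<gamma>Y: "\<gamma>Y \<in> couplings_of Bicausal N Q Q \<nu> \<nu>'"
    and \<pi>: "\<pi> \<in> couplings_of b N P Q \<mu> \<nu>"
  obtains \<pi>' \<theta> where "\<pi>' \<in> couplings_of b N P Q \<mu>' \<nu>'"
    "\<theta> \<in> couplings_of Causal N (pair_process P Q) (pair_process P Q) \<pi> \<pi>'"
    "KL \<pi>' (\<mu>' \<Otimes>\<^sub>M \<nu>') \<le> KL \<pi> (\<mu> \<Otimes>\<^sub>M \<nu>)"
    "\<And>F G. F \<in> borel_measurable (MP \<Otimes>\<^sub>M MP) \<Longrightarrow> G \<in> borel_measurable (MQ \<Otimes>\<^sub>M MQ) \<Longrightarrow>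
      (\<integral>\<^sup>+z. F (fst (fst z), fst (snd z)) + G (snd (fst z), snd (snd z)) \<partial>\<theta>) = (\<integral>\<^sup>+z. F z \<partial>\<gamma>X) + (\<integral>\<^sup>+z. G z \<partial>\<gamma>Y)"
proof -
  let ?Z = "pair_process P Q" and ?MZ = "MP \<Otimes>\<^sub>M MQ"
  have Z: "process_space N ?Z ?MZ" by (rule pair_process_space[OF P Q])
  have \<pi>c: "\<pi> \<in> couplings \<mu> \<nu>" "admissible b N P Q \<pi>" using \<pi> by (auto simp: couplings_of_def)
  note c = couplingsD[OF \<pi>c(1) \<mu> \<nu>(2)]
  have Xc: "\<gamma>X \<in> couplings \<mu> \<mu>'" "admissible Bicausal N P P \<gamma>X" using \<gamma>X by (auto simp: couplings_of_def)
  note cX = couplingsD[OF Xc(1) \<mu> \<mu>'(2)]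
  have Yc: "\<gamma>Y \<in> couplings \<nu> \<nu>'" "admissible Bicausal N Q Q \<gamma>Y" using \<gamma>Y by (auto simp: couplings_of_def)
  note cY = couplingsD[OF Yc(1) \<nu> \<nu>'(2)]
  obtain \<kappa>X where \<kappa>X: "\<kappa>X \<in> MP \<rightarrow>\<^sub>M prob_algebra MP" and X: "\<gamma>X = kernel_prod \<mu> MP \<kappa>X"
    using disintegration[OF standard_space_process[OF P] cX(1,2)] unfolding cX(3) by metis
  obtain \<kappa>Y where \<kappa>Y: "\<kappa>Y \<in> MQ \<rightarrow>\<^sub>M prob_algebra MQ" and Y: "\<gamma>Y = kernel_prod \<nu> MQ \<kappa>Y"
    using disintegration[OF standard_space_process[OF Q] cY(1,2)] unfolding cY(3) by metis
  have kcX: "kernel_causal N P MP P \<gamma>X fst snd" "kernel_causal N P MP P \<gamma>X snd fst"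
    using Xc(2) admissible_iff[OF P P cX(1,2)] by simp_all
  have kcY: "kernel_causal N Q MQ Q \<gamma>Y fst snd" "kernel_causal N Q MQ Q \<gamma>Y snd fst"
    using Yc(2) admissible_iff[OF Q Q cY(1,2)] by simp_all
  interpret \<pi>: prob_space \<pi> by (rule c(1))
  interpret \<mu>: prob_space \<mu> by fact
  interpret \<nu>: prob_space \<nu> by fact
  have sp: "space \<pi> = space MP \<times> space MQ" using sets_eq_imp_space_eq[OF c(2)] by (simp add: space_pair_measure)
  have m1: "fst \<in> \<pi> \<rightarrow>\<^sub>M MP" and m2: "snd \<in> \<pi> \<rightarrow>\<^sub>M MQ" by (simp_all add: measurable_cong_sets[OF c(2) refl])
  define K where "K = pair_kernel \<kappa>X \<kappa>Y"
  have K: "K \<in> ?MZ \<rightarrow>\<^sub>M prob_algebra ?MZ" unfolding K_def by (rule measurable_pair_kernel[OF \<kappa>X \<kappa>Y])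
  define \<pi>' where "\<pi>' = \<pi> \<bind> K"
  define \<theta> where "\<theta> = kernel_prod \<pi> ?MZ K"
  have in\<pi>: "\<pi> \<in> space (prob_algebra ?MZ)" using c by (simp add: space_prob_algebra)
  have s': "sets \<pi>' = sets ?MZ" and p': "prob_space \<pi>'"
    unfolding \<pi>'_def by (rule sets_bind'[OF in\<pi> K], rule prob_space_bind'[OF in\<pi> K])
  have m1': "fst \<in> \<pi>' \<rightarrow>\<^sub>M MP" and m2': "snd \<in> \<pi>' \<rightarrow>\<^sub>M MQ" by (simp_all add: measurable_cong_sets[OF s' refl])
  have one: "(\<lambda>_. 1::ennreal) \<in> borel_measurable MP" "(\<lambda>_. 1::ennreal) \<in> borel_measurable MQ" by simp_all
  have Kint: "(\<integral>\<^sup>+w. g (fst w) * f (snd w) \<partial>K z) = (\<integral>\<^sup>+u. g u \<partial>\<kappa>X (fst z)) * (\<integral>\<^sup>+v. f v \<partial>\<kappa>Y (snd z))"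
    if "z \<in> space MP \<times> space MQ" "g \<in> borel_measurable MP" "f \<in> borel_measurable MQ" for g f z
    unfolding K_def by (rule nn_integral_pair_kernel[OF \<kappa>X \<kappa>Y]) (use that in auto)
  have K1: "(\<integral>\<^sup>+w. g (fst w) \<partial>K z) = (\<integral>\<^sup>+u. g u \<partial>\<kappa>X (fst z))"
    if "z \<in> space MP \<times> space MQ" "g \<in> borel_measurable MP" for g z
    using Kint[OF that one(2)] that(1) prob_space.emeasure_space_1[OF kernel_sets(3)[OF \<kappa>Y]] by (simp add: mem_Times_iff)
  have K2: "(\<integral>\<^sup>+w. f (snd w) \<partial>K z) = (\<integral>\<^sup>+u. f u \<partial>\<kappa>Y (snd z))"
    if "z \<in> space MP \<times> space MQ" "f \<in> borel_measurable MQ" for f z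
    using Kint[OF that(1) one(1) that(2)] that(1) prob_space.emeasure_space_1[OF kernel_sets(3)[OF \<kappa>X]] by (simp add: mem_Times_iff)
  have gf: "(\<lambda>w. g (fst w) * f (snd w)) \<in> borel_measurable ?MZ"
    if "g \<in> borel_measurable MP" "f \<in> borel_measurable MQ" for g f :: "_ \<Rightarrow> ennreal"
    using that by measurable
  have joint0: "(\<integral>\<^sup>+w. g (fst w) * f (snd w) \<partial>(\<rho> \<bind> K)) = (\<integral>\<^sup>+z. (\<integral>\<^sup>+u. g u \<partial>\<kappa>X (fst z)) * (\<integral>\<^sup>+v. f v \<partial>\<kappa>Y (snd z)) \<partial>\<rho>)"
    if g: "g \<in> borel_measurable MP" and f: "f \<in> borel_measurable MQ" and \<rho>: "sets \<rho> = sets ?MZ" for g f \<rho>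
    using sets_eq_imp_space_eq[OF \<rho>]
    by (subst nn_integral_bind_kernel[OF \<rho> K gf[OF g f]])
       (intro nn_integral_cong Kint[OF _ g f], simp add: space_pair_measure)
  note joint = joint0[OF _ _ c(2), folded \<pi>'_def]
  have \<kappa>\<mu>: "(\<integral>\<^sup>+x. \<integral>\<^sup>+u. g u \<partial>\<kappa>X x \<partial>\<mu>) = (\<integral>\<^sup>+u. g u \<partial>\<mu>')" if g: "g \<in> borel_measurable MP" for g
  proof -
    have "(\<integral>\<^sup>+u. g u \<partial>\<mu>') = (\<integral>\<^sup>+z. g (snd z) \<partial>\<gamma>X)"
      unfolding cX(4)[symmetric] by (rule nn_integral_distr'[OF _ g]) (simp add: measurable_cong_sets[OF cX(2) refl])
    also have "\<dots> = (\<integral>\<^sup>+x. \<integral>\<^sup>+u. g u \<partial>\<kappa>X x \<partial>\<mu>)"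
      unfolding X by (subst nn_integral_kernel_prod[OF \<mu> \<kappa>X]) (use g in auto)
    finally show ?thesis by simp
  qed
  have \<kappa>\<nu>: "(\<integral>\<^sup>+x. \<integral>\<^sup>+u. g u \<partial>\<kappa>Y x \<partial>\<nu>) = (\<integral>\<^sup>+u. g u \<partial>\<nu>')" if g: "g \<in> borel_measurable MQ" for g
  proof -
    have "(\<integral>\<^sup>+u. g u \<partial>\<nu>') = (\<integral>\<^sup>+z. g (snd z) \<partial>\<gamma>Y)"
      unfolding cY(4)[symmetric] by (rule nn_integral_distr'[OF _ g]) (simp add: measurable_cong_sets[OF cY(2) refl])
    also have "\<dots> = (\<integral>\<^sup>+x. \<integral>\<^sup>+u. g u \<partial>\<kappa>Y x \<partial>\<nu>)"
      unfolding Y by (subst nn_integral_kernel_prod[OF \<nu> \<kappa>Y]) (use g in auto)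
    finally show ?thesis by simp
  qed
  have km1: "(\<lambda>x. \<integral>\<^sup>+u. g u \<partial>\<kappa>X x) \<in> borel_measurable MP" if "g \<in> borel_measurable MP" for g
    using that \<kappa>X by measurable
  have km2: "(\<lambda>x. \<integral>\<^sup>+u. g u \<partial>\<kappa>Y x) \<in> borel_measurable MQ" if "g \<in> borel_measurable MQ" for g
    using that \<kappa>Y by measurable
  have int1: "(\<integral>\<^sup>+z. g (fst z) \<partial>\<pi>) = (\<integral>\<^sup>+x. g x \<partial>\<mu>)" if "g \<in> borel_measurable MP" for g
    using nn_integral_distr'[OF m1 that] by (simp add: c(3))
  have int2: "(\<integral>\<^sup>+z. g (snd z) \<partial>\<pi>) = (\<integral>\<^sup>+x. g x \<partial>\<nu>)" if "g \<in> borel_measurable MQ" for g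
    using nn_integral_distr'[OF m2 that] by (simp add: c(4))
  have \<pi>'c: "\<pi>' \<in> couplings \<mu>' \<nu>'"
  proof (rule couplingsI[OF \<mu>'(2) \<nu>'(2) s'])
    show "distr \<pi>' MP fst = \<mu>'"
    proof (rule distr_eqI_nn_integral[OF m1' \<mu>'(2)])
      fix A assume "A \<in> sets MP"
      then have i: "(\<lambda>x. indicator A x :: ennreal) \<in> borel_measurable MP" by simp
      have "(\<integral>\<^sup>+w. indicator A (fst w) \<partial>\<pi>') = (\<integral>\<^sup>+z. \<integral>\<^sup>+w. indicator A (fst w) \<partial>K z \<partial>\<pi>)"
        unfolding \<pi>'_def by (rule nn_integral_bind_kernel[OF c(2) K]) (use i in measurable)
      also have "\<dots> = (\<integral>\<^sup>+z. \<integral>\<^sup>+u. indicator A u \<partial>\<kappa>X (fst z) \<partial>\<pi>)"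
        by (intro nn_integral_cong K1 i) (simp add: sp)
      also have "\<dots> = (\<integral>\<^sup>+u. indicator A u \<partial>\<mu>')" using int1[OF km1[OF i]] \<kappa>\<mu>[OF i] by simp
      finally show "(\<integral>\<^sup>+w. indicator A (fst w) \<partial>\<pi>') = emeasure \<mu>' A" using \<open>A \<in> sets MP\<close> \<mu>'(2) by simp
    qed
    show "distr \<pi>' MQ snd = \<nu>'"
    proof (rule distr_eqI_nn_integral[OF m2' \<nu>'(2)])
      fix A assume "A \<in> sets MQ"
      then have i: "(\<lambda>x. indicator A x :: ennreal) \<in> borel_measurable MQ" by simp
      have "(\<integral>\<^sup>+w. indicator A (snd w) \<partial>\<pi>') = (\<integral>\<^sup>+z. \<integral>\<^sup>+w. indicator A (snd w) \<partial>K z \<partial>\<pi>)"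
        unfolding \<pi>'_def by (rule nn_integral_bind_kernel[OF c(2) K]) (use i in measurable)
      also have "\<dots> = (\<integral>\<^sup>+z. \<integral>\<^sup>+u. indicator A u \<partial>\<kappa>Y (snd z) \<partial>\<pi>)"
        by (intro nn_integral_cong K2 i) (simp add: sp)
      also have "\<dots> = (\<integral>\<^sup>+u. indicator A u \<partial>\<nu>')" using int2[OF km2[OF i]] \<kappa>\<nu>[OF i] by simp
      finally show "(\<integral>\<^sup>+w. indicator A (snd w) \<partial>\<pi>') = emeasure \<nu>' A" using \<open>A \<in> sets MQ\<close> \<nu>'(2) by simp
    qed
  qed
  \<comment> \<open>The four statements in \<open>kcX\<close> and \<open>kcY\<close> are spent here:
    causality of \<open>\<pi>'\<close> takes \<open>\<gamma>X\<close> backwards and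
    \<open>\<gamma>Y\<close> forwards, anticausality takes the other two directions.\<close>
  have "kernel_causal N P MP Q \<pi>' fst snd" if "kernel_causal N P MP Q \<pi> fst snd"
    by (rule kernel_causal_chain[OF P Q c(1) m1 m2 \<kappa>X \<kappa>Y joint])
       (use that kcX kcY in \<open>simp_all add: c X[symmetric] Y[symmetric]\<close>)
  moreover have "kernel_causal N Q MQ P \<pi>' snd fst" if "kernel_causal N Q MQ P \<pi> snd fst"
  proof (rule kernel_causal_chain[OF Q P c(1) m2 m1 \<kappa>Y \<kappa>X])
    fix g :: "_ \<Rightarrow> ennreal" and f :: "_ \<Rightarrow> ennreal" assume "g \<in> borel_measurable MQ" "f \<in> borel_measurable MP"
    from joint[OF this(2,1)]
    show "(\<integral>\<^sup>+w. g (snd w) * f (fst w) \<partial>\<pi>') = (\<integral>\<^sup>+z. (\<integral>\<^sup>+u. g u \<partial>\<kappa>Y (snd z)) * (\<integral>\<^sup>+v. f v \<partial>\<kappa>X (fst z)) \<partial>\<pi>)"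
      by (simp add: mult.commute)
  qed (use that kcX kcY in \<open>simp_all add: c X[symmetric] Y[symmetric]\<close>)
  ultimately have "admissible b N P Q \<pi>'"
    using \<pi>c(2) unfolding admissible_iff[OF P Q c(1,2)] admissible_iff[OF P Q p' s'] by blast
  with \<pi>'c have 1: "\<pi>' \<in> couplings_of b N P Q \<mu>' \<nu>'" by (simp add: couplings_of_def)
  have s\<theta>: "sets \<theta> = sets (?MZ \<Otimes>\<^sub>M ?MZ)" and p\<theta>: "prob_space \<theta>"
    unfolding \<theta>_def by (rule sets_kernel_prod[OF c(1,2) K], rule prob_space_kernel_prod[OF c(1,2) K])
  have \<theta>int: "(\<integral>\<^sup>+z. f z \<partial>\<theta>) = (\<integral>\<^sup>+z. \<integral>\<^sup>+w. f (z, w) \<partial>K z \<partial>\<pi>)" if "f \<in> borel_measurable (?MZ \<Otimes>\<^sub>M ?MZ)" for f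
    unfolding \<theta>_def by (rule nn_integral_kernel_prod[OF c(1,2) K that])
  have "\<theta> \<in> couplings \<pi> \<pi>'"
  proof (rule couplingsI[OF c(2) s' s\<theta>])
    show "distr \<theta> ?MZ fst = \<pi>"
      using distr_fst_kernel_prod[OF c(1,2) K] distr_cong_target[OF c(2), of \<theta> fst] by (simp add: \<theta>_def)
    show "distr \<theta> ?MZ snd = \<pi>'"
    proof (rule distr_eqI_nn_integral[OF _ s'])
      show "snd \<in> \<theta> \<rightarrow>\<^sub>M ?MZ" by (simp add: measurable_cong_sets[OF s\<theta> refl])
      fix A assume A: "A \<in> sets ?MZ"
      then have i: "(\<lambda>x. indicator A x :: ennreal) \<in> borel_measurable ?MZ" by simp
      have "(\<integral>\<^sup>+z. indicator A (snd z) \<partial>\<theta>) = (\<integral>\<^sup>+z. \<integral>\<^sup>+w. indicator A w \<partial>K z \<partial>\<pi>)"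
        by (subst \<theta>int) (use A in auto)
      also have "\<dots> = (\<integral>\<^sup>+w. indicator A w \<partial>\<pi>')"
        unfolding \<pi>'_def by (rule nn_integral_bind_kernel[OF c(2) K i, symmetric])
      finally show "(\<integral>\<^sup>+z. indicator A (snd z) \<partial>\<theta>) = emeasure \<pi>' A" using A s' by simp
    qed
  qed
  moreover have "admissible Causal N ?Z ?Z \<theta>"
    unfolding admissible_iff[OF Z Z p\<theta> s\<theta>] unfolding \<theta>_def K_def
    by (simp, rule kernel_causal_pair_kernel[OF P Q c(1,2) \<kappa>X \<kappa>Y]) (use kcX kcY in \<open>simp_all add: c X[symmetric] Y[symmetric]\<close>)
  ultimately have 2: "\<theta> \<in> couplings_of Causal N ?Z ?Z \<pi> \<pi>'"
    by (simp add: couplings_of_def)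
  have s\<mu>\<nu>: "sets (\<mu> \<Otimes>\<^sub>M \<nu>) = sets ?MZ" "sets (\<mu>' \<Otimes>\<^sub>M \<nu>') = sets ?MZ"
    by (rule sets_pair_measure_cong[OF \<mu>(2) \<nu>(2)] sets_pair_measure_cong[OF \<mu>'(2) \<nu>'(2)])+
  have p\<mu>\<nu>: "prob_space (\<mu> \<Otimes>\<^sub>M \<nu>)" by (rule prob_space_pair[OF \<mu>(1) \<nu>(1)])
  have in\<mu>\<nu>: "\<mu> \<Otimes>\<^sub>M \<nu> \<in> space (prob_algebra ?MZ)" using p\<mu>\<nu> s\<mu>\<nu> by (simp add: space_prob_algebra)
  have R: "(\<mu> \<Otimes>\<^sub>M \<nu>) \<bind> K = \<mu>' \<Otimes>\<^sub>M \<nu>'"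
  proof (rule prob_measure_eqI_pair[OF sets_bind'[OF in\<mu>\<nu> K] s\<mu>\<nu>(2) prob_space_bind'[OF in\<mu>\<nu> K]])
    fix A B assume A: "A \<in> sets MP" and B: "B \<in> sets MQ"
    interpret \<nu>': prob_space \<nu>' by fact
    let ?a = "\<lambda>x. \<integral>\<^sup>+u. indicator A u \<partial>\<kappa>X x" and ?b = "\<lambda>y. \<integral>\<^sup>+v. indicator B v \<partial>\<kappa>Y y"
    have i: "(\<lambda>x. indicator A x :: ennreal) \<in> borel_measurable MP" "(\<lambda>x. indicator B x :: ennreal) \<in> borel_measurable MQ"
      using A B by simp_all
    have a: "?a \<in> borel_measurable MP" "?a \<in> borel_measurable \<mu>" "?b \<in> borel_measurable \<nu>"
      using km1[OF i(1)] km2[OF i(2)] by (simp_all add: measurable_cong_sets[OF \<mu>(2) refl] measurable_cong_sets[OF \<nu>(2) refl])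
    have "emeasure ((\<mu> \<Otimes>\<^sub>M \<nu>) \<bind> K) (A \<times> B) = (\<integral>\<^sup>+w. indicator (A \<times> B) w \<partial>((\<mu> \<Otimes>\<^sub>M \<nu>) \<bind> K))"
      using A B by (simp add: sets_bind'[OF in\<mu>\<nu> K])
    also have "\<dots> = (\<integral>\<^sup>+w. indicator A (fst w) * indicator B (snd w) \<partial>((\<mu> \<Otimes>\<^sub>M \<nu>) \<bind> K))"
      by (intro nn_integral_cong) (simp add: indicator_times)
    also have "\<dots> = (\<integral>\<^sup>+z. ?a (fst z) * ?b (snd z) \<partial>(\<mu> \<Otimes>\<^sub>M \<nu>))"
      by (rule joint0[OF i s\<mu>\<nu>(1)])
    also have "\<dots> = (\<integral>\<^sup>+x. \<integral>\<^sup>+y. ?a x * ?b y \<partial>\<nu> \<partial>\<mu>)"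
      using gf[OF km1[OF i(1)] km2[OF i(2)]]
      by (subst \<nu>.nn_integral_fst[symmetric]) (simp_all add: measurable_cong_sets[OF s\<mu>\<nu>(1) refl])
    also have "\<dots> = (\<integral>\<^sup>+x. ?a x * (\<integral>\<^sup>+y. ?b y \<partial>\<nu>) \<partial>\<mu>)" by (intro nn_integral_cong nn_integral_cmult a)
    also have "\<dots> = (\<integral>\<^sup>+x. ?a x \<partial>\<mu>) * (\<integral>\<^sup>+y. ?b y \<partial>\<nu>)" by (rule nn_integral_multc[OF a(2)])
    also have "\<dots> = emeasure \<mu>' A * emeasure \<nu>' B"
      unfolding \<kappa>\<mu>[OF i(1)] \<kappa>\<nu>[OF i(2)] using A B \<mu>'(2) \<nu>'(2) by simp
    also have "\<dots> = emeasure (\<mu>' \<Otimes>\<^sub>M \<nu>') (A \<times> B)"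
      by (rule \<nu>'.emeasure_pair_measure_Times[symmetric]) (use A B \<mu>'(2) \<nu>'(2) in simp_all)
    finally show "emeasure ((\<mu> \<Otimes>\<^sub>M \<nu>) \<bind> K) (A \<times> B) = emeasure (\<mu>' \<Otimes>\<^sub>M \<nu>') (A \<times> B)" .
  qed
  have 3: "KL \<pi>' (\<mu>' \<Otimes>\<^sub>M \<nu>') \<le> KL \<pi> (\<mu> \<Otimes>\<^sub>M \<nu>)"
    unfolding \<pi>'_def R[symmetric] by (rule KL_bind_le[OF c(1,2) p\<mu>\<nu> s\<mu>\<nu>(1) K])
  \<comment> \<open>Under \<theta> the two first coordinates have joint law \<open>\<gamma>X\<close>
    and the two second ones \<open>\<gamma>Y\<close>. The cost therefore splits into two separate
    transport costs, which explains the sum of p-th powers in \<Delta>.\<close>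
  have 4: "(\<integral>\<^sup>+z. F (fst (fst z), fst (snd z)) + G (snd (fst z), snd (snd z)) \<partial>\<theta>) = (\<integral>\<^sup>+z. F z \<partial>\<gamma>X) + (\<integral>\<^sup>+z. G z \<partial>\<gamma>Y)"
    if F: "F \<in> borel_measurable (MP \<Otimes>\<^sub>M MP)" and G: "G \<in> borel_measurable (MQ \<Otimes>\<^sub>M MQ)" for F G
  proof -
    have Fm: "(\<lambda>z. F (fst (fst z), fst (snd z))) \<in> borel_measurable (?MZ \<Otimes>\<^sub>M ?MZ)"
      and Gm: "(\<lambda>z. G (snd (fst z), snd (snd z))) \<in> borel_measurable (?MZ \<Otimes>\<^sub>M ?MZ)"
      using measurable_compose[OF _ F] measurable_compose[OF _ G] by measurable
    have Fk: "(\<lambda>x. \<integral>\<^sup>+u. F (x, u) \<partial>\<kappa>X x) \<in> borel_measurable MP"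
      by (rule nn_integral_kernel_measurable[OF _ \<kappa>X]) (use F in simp)
    have Gk: "(\<lambda>x. \<integral>\<^sup>+u. G (x, u) \<partial>\<kappa>Y x) \<in> borel_measurable MQ"
      by (rule nn_integral_kernel_measurable[OF _ \<kappa>Y]) (use G in simp)
    have "(\<integral>\<^sup>+z. F (fst (fst z), fst (snd z)) \<partial>\<theta>) = (\<integral>\<^sup>+z. \<integral>\<^sup>+w. F (fst z, fst w) \<partial>K z \<partial>\<pi>)"
      by (subst \<theta>int[OF Fm]) simp
    also have "\<dots> = (\<integral>\<^sup>+z. \<integral>\<^sup>+u. F (fst z, u) \<partial>\<kappa>X (fst z) \<partial>\<pi>)"
      using measurable_Pair2[OF F] by (intro nn_integral_cong K1) (auto simp: sp)
    also have "\<dots> = (\<integral>\<^sup>+x. \<integral>\<^sup>+u. F (x, u) \<partial>\<kappa>X x \<partial>\<mu>)" by (rule int1[OF Fk])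
    also have "\<dots> = (\<integral>\<^sup>+z. F z \<partial>\<gamma>X)" unfolding X by (rule nn_integral_kernel_prod[OF \<mu> \<kappa>X F, symmetric])
    finally have f: "(\<integral>\<^sup>+z. F (fst (fst z), fst (snd z)) \<partial>\<theta>) = (\<integral>\<^sup>+z. F z \<partial>\<gamma>X)" .
    have "(\<integral>\<^sup>+z. G (snd (fst z), snd (snd z)) \<partial>\<theta>) = (\<integral>\<^sup>+z. \<integral>\<^sup>+w. G (snd z, snd w) \<partial>K z \<partial>\<pi>)"
      by (subst \<theta>int[OF Gm]) simp
    also have "\<dots> = (\<integral>\<^sup>+z. \<integral>\<^sup>+u. G (snd z, u) \<partial>\<kappa>Y (snd z) \<partial>\<pi>)"
      using measurable_Pair2[OF G] by (intro nn_integral_cong K2) (auto simp: sp)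
    also have "\<dots> = (\<integral>\<^sup>+x. \<integral>\<^sup>+u. G (x, u) \<partial>\<kappa>Y x \<partial>\<nu>)" by (rule int2[OF Gk])
    also have "\<dots> = (\<integral>\<^sup>+z. G z \<partial>\<gamma>Y)" unfolding Y by (rule nn_integral_kernel_prod[OF \<nu> \<kappa>Y G, symmetric])
    finally have g: "(\<integral>\<^sup>+z. G (snd (fst z), snd (snd z)) \<partial>\<theta>) = (\<integral>\<^sup>+z. G z \<partial>\<gamma>Y)" .
    show ?thesis
      using Fm Gm by (simp add: nn_integral_add measurable_cong_sets[OF s\<theta> refl] f g)
  qed
  show ?thesis by (rule that[OF 1 2 3 4])
qed

text \<open>Disintegrating \<open>\<theta>2\<close> over its first marginal and appending the kernel
  to \<open>\<theta>1\<close> gives a joint law \<open>\<rho>\<close> of three points, whose outer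
  pair is \<open>\<sigma>\<close>. The conclusion keeps \<open>\<rho>\<close> because the triangle
  inequality has to be integrated under one measure.\<close>

lemma couplings_of_glue:
  assumes Z: "process_space N Z MZ"
    and \<pi>: "prob_space \<pi>1" "sets \<pi>1 = sets MZ" "prob_space \<pi>2" "sets \<pi>2 = sets MZ" "sets \<pi>3 = sets MZ"
    and \<theta>1: "\<theta>1 \<in> couplings_of b N Z Z \<pi>1 \<pi>2" and \<theta>2: "\<theta>2 \<in> couplings_of b N Z Z \<pi>2 \<pi>3"
    and b: "b \<in> {Regular, Causal}"
  obtains \<sigma> \<rho> where "\<sigma> \<in> couplings_of b N Z Z \<pi>1 \<pi>3"
    "sets \<rho> = sets ((MZ \<Otimes>\<^sub>M MZ) \<Otimes>\<^sub>M MZ)"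
    "\<And>f. f \<in> borel_measurable (MZ \<Otimes>\<^sub>M MZ) \<Longrightarrow> (\<integral>\<^sup>+w. f (fst w) \<partial>\<rho>) = (\<integral>\<^sup>+z. f z \<partial>\<theta>1)"
    "\<And>f. f \<in> borel_measurable (MZ \<Otimes>\<^sub>M MZ) \<Longrightarrow> (\<integral>\<^sup>+w. f (snd (fst w), snd w) \<partial>\<rho>) = (\<integral>\<^sup>+z. f z \<partial>\<theta>2)"
    "\<And>f. f \<in> borel_measurable (MZ \<Otimes>\<^sub>M MZ) \<Longrightarrow> (\<integral>\<^sup>+w. f (fst (fst w), snd w) \<partial>\<rho>) = (\<integral>\<^sup>+z. f z \<partial>\<sigma>)"
proof -
  have c0: "\<theta>1 \<in> couplings \<pi>1 \<pi>2" "\<theta>2 \<in> couplings \<pi>2 \<pi>3" "admissible b N Z Z \<theta>1" "admissible b N Z Z \<theta>2"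
    using \<theta>1 \<theta>2 by (auto simp: couplings_of_def)
  note c1 = couplingsD[OF c0(1) \<pi>(1,2,4)] and c2 = couplingsD[OF c0(2) \<pi>(3,4,5)]
  obtain \<kappa> where \<kappa>: "\<kappa> \<in> MZ \<rightarrow>\<^sub>M prob_algebra MZ" and K: "\<theta>2 = kernel_prod \<pi>2 MZ \<kappa>"
    using disintegration[OF standard_space_process[OF Z] c2(1,2)] unfolding c2(3) by metis
  let ?M2 = "MZ \<Otimes>\<^sub>M MZ"
  have \<kappa>': "(\<lambda>z. \<kappa> (snd z)) \<in> ?M2 \<rightarrow>\<^sub>M prob_algebra MZ" by (rule measurable_compose[OF measurable_snd \<kappa>])
  define \<rho> where "\<rho> = kernel_prod \<theta>1 MZ (\<lambda>z. \<kappa> (snd z))"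
  have s\<rho>: "sets \<rho> = sets (?M2 \<Otimes>\<^sub>M MZ)" and p\<rho>: "prob_space \<rho>"
    unfolding \<rho>_def by (rule sets_kernel_prod[OF c1(1,2) \<kappa>'], rule prob_space_kernel_prod[OF c1(1,2) \<kappa>'])
  interpret \<rho>: prob_space \<rho> by fact
  have \<rho>int: "(\<integral>\<^sup>+w. f w \<partial>\<rho>) = (\<integral>\<^sup>+z. \<integral>\<^sup>+v. f (z, v) \<partial>\<kappa> (snd z) \<partial>\<theta>1)" if "f \<in> borel_measurable (?M2 \<Otimes>\<^sub>M MZ)" for f
    unfolding \<rho>_def by (rule nn_integral_kernel_prod[OF c1(1,2) \<kappa>' that])
  have m1: "fst \<in> \<theta>1 \<rightarrow>\<^sub>M MZ" and m2: "snd \<in> \<theta>1 \<rightarrow>\<^sub>M MZ" by (simp_all add: measurable_cong_sets[OF c1(2) refl])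
  have sp: "space \<theta>1 = space MZ \<times> space MZ" using sets_eq_imp_space_eq[OF c1(2)] by (simp add: space_pair_measure)
  have r1: "(\<integral>\<^sup>+w. f (fst w) \<partial>\<rho>) = (\<integral>\<^sup>+z. f z \<partial>\<theta>1)" if f: "f \<in> borel_measurable ?M2" for f
  proof -
    have "(\<integral>\<^sup>+w. f (fst w) \<partial>\<rho>) = (\<integral>\<^sup>+z. \<integral>\<^sup>+v. f z \<partial>\<kappa> (snd z) \<partial>\<theta>1)"
      using f by (subst \<rho>int) auto
    also have "\<dots> = (\<integral>\<^sup>+z. f z \<partial>\<theta>1)"
      using prob_space.emeasure_space_1[OF kernel_sets(3)[OF \<kappa>]]
      by (intro nn_integral_cong) (auto simp: sp)
    finally show ?thesis .
  qed
  have r2: "(\<integral>\<^sup>+w. f (snd (fst w), snd w) \<partial>\<rho>) = (\<integral>\<^sup>+z. f z \<partial>\<theta>2)" if f: "f \<in> borel_measurable ?M2" for f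
  proof -
    have fk: "(\<lambda>x. \<integral>\<^sup>+v. f (x, v) \<partial>\<kappa> x) \<in> borel_measurable MZ"
      by (rule nn_integral_kernel_measurable[OF _ \<kappa>]) (use f in simp)
    have "(\<lambda>w. (snd (fst w), snd w)) \<in> ?M2 \<Otimes>\<^sub>M MZ \<rightarrow>\<^sub>M ?M2" by measurable
    from \<rho>int[OF measurable_compose[OF this f]]
    have "(\<integral>\<^sup>+w. f (snd (fst w), snd w) \<partial>\<rho>) = (\<integral>\<^sup>+z. \<integral>\<^sup>+v. f (snd z, v) \<partial>\<kappa> (snd z) \<partial>\<theta>1)" by simp
    also have "\<dots> = (\<integral>\<^sup>+x. \<integral>\<^sup>+v. f (x, v) \<partial>\<kappa> x \<partial>\<pi>2)"
      using nn_integral_distr'[OF m2 fk] by (simp add: c1(4))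
    also have "\<dots> = (\<integral>\<^sup>+z. f z \<partial>\<theta>2)"
      unfolding K by (rule nn_integral_kernel_prod[OF \<pi>(3,4) \<kappa> f, symmetric])
    finally show ?thesis .
  qed
  have m: "(\<lambda>w. (fst (fst w), snd w)) \<in> \<rho> \<rightarrow>\<^sub>M ?M2" by (simp add: measurable_cong_sets[OF s\<rho> refl])
  define \<sigma> where "\<sigma> = distr \<rho> ?M2 (\<lambda>w. (fst (fst w), snd w))"
  have s\<sigma>: "sets \<sigma> = sets ?M2" and p\<sigma>: "prob_space \<sigma>"
    unfolding \<sigma>_def by (simp, rule \<rho>.prob_space_distr[OF m])
  have r3: "(\<integral>\<^sup>+w. f (fst (fst w), snd w) \<partial>\<rho>) = (\<integral>\<^sup>+z. f z \<partial>\<sigma>)" if f: "f \<in> borel_measurable ?M2" for f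
    unfolding \<sigma>_def by (rule nn_integral_distr'[OF m f, symmetric])
  have "\<sigma> \<in> couplings \<pi>1 \<pi>3"
  proof (rule couplingsI[OF \<pi>(2,5) s\<sigma>])
    show "distr \<sigma> MZ fst = \<pi>1"
    proof (rule distr_eqI_nn_integral[OF _ \<pi>(2)])
      show "fst \<in> \<sigma> \<rightarrow>\<^sub>M MZ" by (simp add: measurable_cong_sets[OF s\<sigma> refl])
      fix A assume A: "A \<in> sets MZ"
      then have i: "(\<lambda>z. indicator A (fst z) :: ennreal) \<in> borel_measurable ?M2" by simp
      have i': "(\<lambda>x. indicator A x :: ennreal) \<in> borel_measurable MZ" using A by simp
      have "(\<integral>\<^sup>+z. indicator A (fst z) \<partial>\<sigma>) = (\<integral>\<^sup>+z. indicator A (fst z) \<partial>\<theta>1)"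
        using r3[OF i] r1[OF i] by simp
      also have "\<dots> = emeasure \<pi>1 A" using nn_integral_distr'[OF m1 i'] A \<pi>(2) by (simp add: c1(3))
      finally show "(\<integral>\<^sup>+z. indicator A (fst z) \<partial>\<sigma>) = emeasure \<pi>1 A" .
    qed
    show "distr \<sigma> MZ snd = \<pi>3"
    proof (rule distr_eqI_nn_integral[OF _ \<pi>(5)])
      show "snd \<in> \<sigma> \<rightarrow>\<^sub>M MZ" by (simp add: measurable_cong_sets[OF s\<sigma> refl])
      fix A assume A: "A \<in> sets MZ"
      then have i: "(\<lambda>z. indicator A (snd z) :: ennreal) \<in> borel_measurable ?M2" by simp
      have i': "(\<lambda>x. indicator A x :: ennreal) \<in> borel_measurable MZ" using A by simp
      have m2': "snd \<in> \<theta>2 \<rightarrow>\<^sub>M MZ" by (simp add: measurable_cong_sets[OF c2(2) refl])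
      have "(\<integral>\<^sup>+z. indicator A (snd z) \<partial>\<sigma>) = (\<integral>\<^sup>+z. indicator A (snd z) \<partial>\<theta>2)"
        using r3[OF i] r2[OF i] by simp
      also have "\<dots> = emeasure \<pi>3 A" using nn_integral_distr'[OF m2' i'] A \<pi>(5) by (simp add: c2(4))
      finally show "(\<integral>\<^sup>+z. indicator A (snd z) \<partial>\<sigma>) = emeasure \<pi>3 A" .
    qed
  qed
  moreover have "admissible b N Z Z \<sigma>"
  proof (cases "b = Causal")
    case True
    have kc: "kernel_causal N Z MZ Z \<theta>1 fst snd" "kernel_causal N Z MZ Z \<theta>2 fst snd"
      using c0(3,4) True unfolding admissible_iff[OF Z Z c1(1,2)] admissible_iff[OF Z Z c2(1,2)] by simp_all
    \<comment> \<open>A chain whose first link does not move the point: \<open>return\<close> on the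
      left, \<open>\<theta>1\<close> in the middle and the kernel of \<open>\<theta>2\<close> on the
      right.\<close>
    have "kernel_causal N Z MZ Z \<sigma> fst snd"
    proof (rule kernel_causal_chain[OF Z Z c1(1) m1 m2 measurable_return_prob_space \<kappa> _ _ _ kc(1)])
      show "kernel_causal N Z MZ Z (kernel_prod (distr \<theta>1 MZ fst) MZ (return MZ)) snd fst"
        unfolding c1(3) by (rule kernel_causal_return[OF Z \<pi>(1,2)])
      show "kernel_causal N Z MZ Z (kernel_prod (distr \<theta>1 MZ snd) MZ \<kappa>) fst snd"
        using kc(2) by (simp add: c1(4) K)
      fix g :: "_ \<Rightarrow> ennreal" and f :: "_ \<Rightarrow> ennreal" assume g: "g \<in> borel_measurable MZ" and f: "f \<in> borel_measurable MZ"
      have gf: "(\<lambda>z. g (fst z) * f (snd z)) \<in> borel_measurable ?M2" using g f by measurable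
      have gf': "(\<lambda>w. g (fst (fst w)) * f (snd w)) \<in> borel_measurable (?M2 \<Otimes>\<^sub>M MZ)" using g f by measurable
      have "(\<integral>\<^sup>+w. g (fst w) * f (snd w) \<partial>\<sigma>) = (\<integral>\<^sup>+w. g (fst (fst w)) * f (snd w) \<partial>\<rho>)"
        using r3[OF gf] by simp
      also have "\<dots> = (\<integral>\<^sup>+z. \<integral>\<^sup>+v. g (fst z) * f v \<partial>\<kappa> (snd z) \<partial>\<theta>1)" by (simp add: \<rho>int[OF gf'])
      also have "\<dots> = (\<integral>\<^sup>+z. (\<integral>\<^sup>+u. g u \<partial>return MZ (fst z)) * (\<integral>\<^sup>+v. f v \<partial>\<kappa> (snd z)) \<partial>\<theta>1)"
        by (intro nn_integral_cong) (auto simp: sp nn_integral_return[OF _ g] nn_integral_cmult[OF borel_measurable_kernel[OF \<kappa> _ f]])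
      finally show "(\<integral>\<^sup>+w. g (fst w) * f (snd w) \<partial>\<sigma>) = (\<integral>\<^sup>+z. (\<integral>\<^sup>+u. g u \<partial>return MZ (fst z)) * (\<integral>\<^sup>+v. f v \<partial>\<kappa> (snd z)) \<partial>\<theta>1)" .
    qed
    then show ?thesis using True admissible_iff[OF Z Z p\<sigma> s\<sigma>] by simp
  qed (use b in auto)
  ultimately have "\<sigma> \<in> couplings_of b N Z Z \<pi>1 \<pi>3" by (simp add: couplings_of_def)
  from that[OF this s\<rho> r1 r2 r3] show ?thesis .
qed

section \<open>Transport costs\<close>

text \<open>Convexity is applied on the open half line; if one argument is 0, the claim reduces to s
  powr q \<le> s for s in [0, 1].\<close>

lemma powr_convex_comb:
  fixes q :: real
  assumes q: "1 \<le> q" and l: "0 \<le> l" "l \<le> 1" and xy: "0 \<le> x" "0 \<le> y"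
  shows "(l * x + (1 - l) * y) powr q \<le> l * x powr q + (1 - l) * y powr q"
proof -
  have low: "s powr q \<le> s" if "0 \<le> s" "s \<le> 1" for s :: real
    using powr_mono'[of 1 q s] that q by simp
  consider "x = 0" | "y = 0" | "0 < x" "0 < y" using xy by fastforce
  then show ?thesis
  proof cases
    case 1
    have "((1 - l) * y) powr q = (1 - l) powr q * y powr q" by (rule powr_mult)
    also have "\<dots> \<le> (1 - l) * y powr q" using low[of "1 - l"] l by (intro mult_right_mono) auto
    finally show ?thesis using 1 q by simp
  next
    case 2
    have "(l * x) powr q = l powr q * x powr q" by (rule powr_mult)
    also have "\<dots> \<le> l * x powr q" using low[of l] l by (intro mult_right_mono) auto
    finally show ?thesis using 2 q by simp
  next
    case 3
    have "convex_on {0<..} (\<lambda>x::real. x powr q)" by (rule powr_convex[OF q])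
    from convex_onD[OF this, of l y x] 3 l show ?thesis by (simp add: add.commute)
  qed
qed

text \<open>Convexity with weights a / (a + b) and b / (a + b) at the points u / a and v / b. With
  \<open>a\<close> and \<open>b\<close> chosen later as bounds on norms, this is Minkowski's
  inequality in pointwise form, with coefficients that do not depend on the point.\<close>

lemma powr_add_le:
  fixes q :: real
  assumes q: "1 \<le> q" and ab: "0 < a" "0 < b" and uv: "0 \<le> u" "0 \<le> v"
  shows "(u + v) powr q \<le> (a + b) powr q * (a / (a + b) / a powr q * u powr q + b / (a + b) / b powr q * v powr q)"
proof -
  let ?l = "a / (a + b)"
  have l: "0 \<le> ?l" "?l \<le> 1" "1 - ?l = b / (a + b)" using ab by (simp_all add: field_simps)
  have "u + v = (a + b) * (?l * (u / a) + (1 - ?l) * (v / b))"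
  proof -
    have "?l * (u / a) = u / (a + b)" "(1 - ?l) * (v / b) = v / (a + b)" unfolding l(3) using ab by simp_all
    then show ?thesis using ab by (simp add: add_divide_distrib[symmetric])
  qed
  then have "(u + v) powr q = (a + b) powr q * (?l * (u / a) + (1 - ?l) * (v / b)) powr q"
    using ab uv l by (simp add: powr_mult)
  also have "\<dots> \<le> (a + b) powr q * (?l * (u / a) powr q + (1 - ?l) * (v / b) powr q)"
    by (intro mult_left_mono powr_convex_comb[OF q]) (use l uv ab in auto)
  also have "\<dots> = (a + b) powr q * (a / (a + b) / a powr q * u powr q + b / (a + b) / b powr q * v powr q)"
    unfolding l(3) using ab uv by (simp add: powr_divide)
  finally show ?thesis .
qed

text \<open>The coefficients are those of \<open>powr_add_le\<close>; against the bounds a^q and b^q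
  they recombine exactly to (a + b)^q. Since \<open>f\<close>, \<open>g\<close> and \<open>h\<close>
  enter through this pointwise estimate, they may be sums of powers of several distances.\<close>

lemma Minkowski_nn_integral:
  fixes q :: real
  assumes q: "1 \<le> q" and ab: "0 < a" "0 < b"
    and m: "f \<in> borel_measurable M" "g \<in> borel_measurable M"
    and h: "\<And>x. x \<in> space M \<Longrightarrow> h x \<le>
      (a + b) powr q * (a / (a + b) / a powr q * f x + b / (a + b) / b powr q * g x)"
    and nn: "\<And>x. 0 \<le> f x" "\<And>x. 0 \<le> g x"
    and f: "(\<integral>\<^sup>+x. ennreal (f x) \<partial>M) \<le> ennreal (a powr q)" and g: "(\<integral>\<^sup>+x. ennreal (g x) \<partial>M) \<le> ennreal (b powr q)"
  shows "(\<integral>\<^sup>+x. ennreal (h x) \<partial>M) \<le> ennreal ((a + b) powr q)"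
proof -
  define A where "A = (a + b) powr q * (a / (a + b) / a powr q)"
  define B where "B = (a + b) powr q * (b / (a + b) / b powr q)"
  have AB: "0 \<le> A" "0 \<le> B" using ab by (auto simp: A_def B_def)
  have "a / (a + b) + b / (a + b) = 1" using ab by (simp add: add_divide_distrib[symmetric])
  moreover have "A * a powr q = (a + b) powr q * (a / (a + b))" "B * b powr q = (a + b) powr q * (b / (a + b))"
    using ab by (simp_all add: A_def B_def)
  ultimately have sum: "A * a powr q + B * b powr q = (a + b) powr q"
    by (metis distrib_left mult.right_neutral)
  have hAB: "h x \<le> A * f x + B * g x" if "x \<in> space M" for x
    using h[OF that] by (simp add: A_def B_def distrib_left mult.assoc)
  have "(\<integral>\<^sup>+x. ennreal (h x) \<partial>M) \<le> (\<integral>\<^sup>+x. ennreal A * ennreal (f x) + ennreal B * ennreal (g x) \<partial>M)"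
  proof (rule nn_integral_mono)
    fix x assume "x \<in> space M"
    then have "ennreal (h x) \<le> ennreal (A * f x + B * g x)" by (intro ennreal_leI hAB)
    also have "\<dots> = ennreal A * ennreal (f x) + ennreal B * ennreal (g x)"
      using AB nn by (simp add: ennreal_plus ennreal_mult)
    finally show "ennreal (h x) \<le> ennreal A * ennreal (f x) + ennreal B * ennreal (g x)" .
  qed
  also have "\<dots> = ennreal A * (\<integral>\<^sup>+x. ennreal (f x) \<partial>M) + ennreal B * (\<integral>\<^sup>+x. ennreal (g x) \<partial>M)"
    using m by (simp add: nn_integral_add nn_integral_cmult)
  also have "\<dots> \<le> ennreal A * ennreal (a powr q) + ennreal B * ennreal (b powr q)"
    by (intro add_mono mult_left_mono f g) auto
  also have "\<dots> = ennreal (A * a powr q + B * b powr q)"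
    using AB by (simp add: ennreal_plus ennreal_mult)
  finally show ?thesis unfolding sum .
qed

text \<open>Young's inequality for u^q / m and 1, with exponent p / q and its conjugate, multiplied
  by m. It bounds u^q by an affine function of u^p, with equality at u^q = m, and so can be
  integrated.\<close>

lemma powr_le_Young:
  fixes q p :: real
  assumes q: "1 \<le> q" "q < p" and m: "0 < m" and u: "0 \<le> u"
  shows "u powr q \<le> m * (q / p) / m powr (p / q) * u powr p + m * (1 - q / p)"
proof -
  define s where "s = p / q"
  have s: "1 < s" using q by (simp add: s_def)
  define r where "r = s / (s - 1)"
  have r: "1 < r" using s by (simp add: r_def)
  have sr: "1 / r = 1 - 1 / s" using s by (simp add: r_def field_simps)
  have "(u powr q / m) * 1 \<le> (u powr q / m) powr s / s + 1 powr r / r"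
    by (rule Youngs_inequality) (use s r sr m in auto)
  moreover have "(u powr q / m) powr s = u powr p / m powr s"
    using q m u by (simp add: powr_divide powr_powr s_def)
  ultimately have "u powr q / m \<le> u powr p / m powr s / s + (1 - 1 / s)" using sr by simp
  then have "m * (u powr q / m) \<le> m * (u powr p / m powr s / s + (1 - 1 / s))"
    using m by (intro mult_left_mono) auto
  moreover have "m * (u powr q / m) = u powr q" using m by simp
  moreover have "m * (u powr p / m powr s / s + (1 - 1 / s)) = m * (1 / s) / m powr s * u powr p + m * (1 - 1 / s)"
    by (simp add: distrib_left)
  moreover have "1 / s = q / p" by (simp add: s_def)
  ultimately show ?thesis
    unfolding s_def[symmetric] by metis
qed

text \<open>The pair u, v acts as one function on a space of total mass 2, where lowering the
  exponent from p to q costs the factor 2^(1/q - 1/p). Jensen's inequality is obtained by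
  integrating the affine bound of \<open>powr_le_Young\<close>.\<close>

lemma nn_integral_powr_sum_le:
  fixes q p :: real
  assumes M: "prob_space M" and q: "1 \<le> q" "q < p" and D: "0 < D"
    and m: "u \<in> borel_measurable M" "v \<in> borel_measurable M"
    and uv: "\<And>x. x \<in> space M \<Longrightarrow> 0 \<le> u x" "\<And>x. x \<in> space M \<Longrightarrow> 0 \<le> v x"
    and le: "(\<integral>\<^sup>+x. ennreal (u x powr p + v x powr p) \<partial>M) \<le> ennreal (D powr p)"
  shows "(\<integral>\<^sup>+x. ennreal (u x powr q + v x powr q) \<partial>M) \<le> ennreal ((2 powr (1 / q - 1 / p) * D) powr q)"
proof -
  interpret prob_space M by fact
  \<comment> \<open>The point of tangency: in the extremal case u and v are constant with u^p = v^p
    = D^p / 2, and \<open>k\<close> is the corresponding value of u^q.\<close>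
  define k where "k = (D powr p / 2) powr (q / p)"
  have k: "0 < k" using D by (simp add: k_def)
  have kp: "k powr (p / q) = D powr p / 2" using q D by (simp add: k_def powr_powr)
  define A where "A = k * (q / p) / k powr (p / q)"
  define B where "B = 2 * k * (1 - q / p)"
  have ab: "0 \<le> A" "0 \<le> B" using k q by (auto simp: A_def B_def field_simps)
  have "(\<integral>\<^sup>+x. ennreal (u x powr q + v x powr q) \<partial>M) \<le> (\<integral>\<^sup>+x. ennreal A * ennreal (u x powr p + v x powr p) + ennreal B \<partial>M)"
  proof (rule nn_integral_mono)
    fix x assume x: "x \<in> space M"
    have "u x powr q + v x powr q \<le> A * (u x powr p + v x powr p) + B"
    proof -
      have "u x powr q \<le> A * u x powr p + k * (1 - q / p)" "v x powr q \<le> A * v x powr p + k * (1 - q / p)"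
        using powr_le_Young[OF q k uv(1)[OF x]] powr_le_Young[OF q k uv(2)[OF x]] by (simp_all add: A_def)
      then show ?thesis
        unfolding distrib_left B_def by linarith
    qed
    then have "ennreal (u x powr q + v x powr q) \<le> ennreal (A * (u x powr p + v x powr p) + B)" by (rule ennreal_leI)
    also have "\<dots> = ennreal A * ennreal (u x powr p + v x powr p) + ennreal B"
      using ab by (subst ennreal_plus) (simp_all add: ennreal_mult del: ennreal_plus)
    finally show "ennreal (u x powr q + v x powr q) \<le> ennreal A * ennreal (u x powr p + v x powr p) + ennreal B" .
  qed
  also have "\<dots> = ennreal A * (\<integral>\<^sup>+x. ennreal (u x powr p + v x powr p) \<partial>M) + ennreal B"
    using m by (simp add: nn_integral_add nn_integral_cmult emeasure_space_1)
  also have "\<dots> \<le> ennreal A * ennreal (D powr p) + ennreal B"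
    by (intro add_mono mult_left_mono le) auto
  also have "\<dots> = ennreal (A * D powr p + B)" using ab by (simp add: ennreal_plus ennreal_mult)
  also have "A * D powr p + B = 2 * k" unfolding A_def B_def kp using D q by (simp add: field_simps)
  also have "2 * k = (2 powr (1 / q - 1 / p) * D) powr q"
  proof -
    have "(2 powr (1 / q - 1 / p) * D) powr q = 2 powr (1 - q / p) * D powr q"
      using q D by (simp add: powr_mult powr_powr algebra_simps)
    also have "2 powr (1 - q / p) = 2 / 2 powr (q / p)" by (simp add: powr_diff)
    also have "k = D powr q / 2 powr (q / p)" using q D by (simp add: k_def powr_divide powr_powr)
    then have "2 / 2 powr (q / p) * D powr q = 2 * k" by simp
    finally show ?thesis by simp
  qed
  finally show ?thesis .
qed

section \<open>Powers of extended nonnegative numbers\<close>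

lemma epowr_ereal [simp]: "epowr (ereal x) r = ereal (x powr r)"
  by (simp add: epowr_def)

lemma epowr_PInf [simp]: "epowr \<infinity> r = \<infinity>"
  by (simp add: epowr_def)

lemma epowr_mono: "0 \<le> x \<Longrightarrow> x \<le> y \<Longrightarrow> 0 \<le> r \<Longrightarrow> epowr x r \<le> epowr y r"
  by (cases x; cases y) (auto intro: powr_mono2)

lemma epowr_inverse: "0 \<le> x \<Longrightarrow> 0 < p \<Longrightarrow> epowr (epowr x (1 / p)) p = x"
  by (cases x) (auto simp: powr_powr)

lemma epowr_root_less:
  assumes "0 \<le> x" "0 < p" "0 \<le> r" "epowr x (1 / p) < ereal r"
  shows "x < ereal (r powr p)"
proof (cases x)
  case (real y)
  then have "y powr (1 / p) < r" "0 \<le> y" using assms by auto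
  then have "(y powr (1 / p)) powr p < r powr p" using assms by (intro powr_less_mono2) auto
  then show ?thesis using real \<open>0 \<le> y\<close> assms by (simp add: powr_powr)
qed (use assms in auto)

lemma epowr_root_le:
  assumes "0 \<le> x" "0 < p" "0 \<le> r" "x \<le> ereal (r powr p)"
  shows "epowr x (1 / p) \<le> ereal r"
  using epowr_mono[OF assms(1,4), of "1 / p"] assms by (simp add: powr_powr)

section \<open>Wasserstein distances between laws on the product of two path spaces\<close>

locale polish_path_spaces =
  fixes N :: nat and TX :: "nat \<Rightarrow> 'a topology" and dX :: "(nat \<Rightarrow> 'a) \<Rightarrow> (nat \<Rightarrow> 'a) \<Rightarrow> real"
    and TY :: "nat \<Rightarrow> 'b topology" and dY :: "(nat \<Rightarrow> 'b) \<Rightarrow> (nat \<Rightarrow> 'b) \<Rightarrow> real"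
  assumes polX: "polish_path_space N TX dX" and polY: "polish_path_space N TY dY"
    and neX: "paths N TX \<noteq> {}" and neY: "paths N TY \<noteq> {}"
begin

abbreviation "BX \<equiv> borel_of (path_top N TX)"
abbreviation "BY \<equiv> borel_of (path_top N TY)"
abbreviation "PX \<equiv> path_process TX"
abbreviation "PY \<equiv> path_process TY"
abbreviation "BZ \<equiv> BX \<Otimes>\<^sub>M BY"
abbreviation "PZ \<equiv> pair_process PX PY"

lemma PX: "process_space N PX BX" by (rule path_process_space[OF polX neX])
lemma PY: "process_space N PY BY" by (rule path_process_space[OF polY neY])
lemma PZ: "process_space N PZ BZ" by (rule pair_process_space[OF PX PY])

sublocale MX: Metric_space "paths N TX" dX using polX by (simp add: polish_path_space_def)
sublocale MY: Metric_space "paths N TY" dY using polY by (simp add: polish_path_space_def)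

lemma dX_measurable: "(\<lambda>z. dX (fst z) (snd z)) \<in> borel_measurable (BX \<Otimes>\<^sub>M BX)"
  using metric_measurable[OF polX] by (simp add: case_prod_beta')

lemma dY_measurable: "(\<lambda>z. dY (fst z) (snd z)) \<in> borel_measurable (BY \<Otimes>\<^sub>M BY)"
  using metric_measurable[OF polY] by (simp add: case_prod_beta')

definition uX where "uX w = dX (fst (fst w)) (fst (snd w))"
definition uY where "uY w = dY (snd (fst w)) (snd (snd w))"
definition cost_fun where "cost_fun q w = uX w powr q + uY w powr q"

lemma uX_measurable: "uX \<in> borel_measurable (BZ \<Otimes>\<^sub>M BZ)"
proof -
  have "(\<lambda>w. (fst (fst w), fst (snd w))) \<in> BZ \<Otimes>\<^sub>M BZ \<rightarrow>\<^sub>M BX \<Otimes>\<^sub>M BX" by measurable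
  from measurable_compose[OF this dX_measurable] show ?thesis by (simp add: uX_def[abs_def])
qed

lemma uY_measurable: "uY \<in> borel_measurable (BZ \<Otimes>\<^sub>M BZ)"
proof -
  have "(\<lambda>w. (snd (fst w), snd (snd w))) \<in> BZ \<Otimes>\<^sub>M BZ \<rightarrow>\<^sub>M BY \<Otimes>\<^sub>M BY" by measurable
  from measurable_compose[OF this dY_measurable] show ?thesis by (simp add: uY_def[abs_def])
qed

lemma cost_fun_measurable: "cost_fun q \<in> borel_measurable (BZ \<Otimes>\<^sub>M BZ)"
  unfolding cost_fun_def[abs_def] using uX_measurable uY_measurable by measurable

lemma cost_fun_nonneg: "0 \<le> cost_fun q w"
  by (simp add: cost_fun_def)

definition total_cost :: "real \<Rightarrow> _ measure \<Rightarrow> ennreal" where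
  "total_cost q \<theta> = (\<integral>\<^sup>+w. ennreal (cost_fun q w) \<partial>\<theta>)"

lemma wass2_eq:
  "wass2 b N TX dX TY dY q \<pi> \<pi>' = epowr (INF \<theta>\<in>couplings_of b N PZ PZ \<pi> \<pi>'. enn2ereal (total_cost q \<theta>)) (1 / q)"
  unfolding wass2_def Let_def total_cost_def cost_fun_def uX_def uY_def by (simp add: case_prod_beta')

lemma wass2_le:
  assumes "\<theta> \<in> couplings_of b N PZ PZ \<pi> \<pi>'" "total_cost q \<theta> \<le> ennreal (r powr q)" "0 \<le> r" "1 \<le> q"
  shows "wass2 b N TX dX TY dY q \<pi> \<pi>' \<le> ereal r"
  unfolding wass2_eq
proof (rule epowr_root_le)
  have "(INF \<theta>\<in>couplings_of b N PZ PZ \<pi> \<pi>'. enn2ereal (total_cost q \<theta>)) \<le> enn2ereal (total_cost q \<theta>)"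
    by (rule INF_lower[OF assms(1)])
  also have "\<dots> \<le> enn2ereal (ennreal (r powr q))"
    using assms(2) by (simp add: less_eq_ennreal.rep_eq)
  finally show "(INF \<theta>\<in>couplings_of b N PZ PZ \<pi> \<pi>'. enn2ereal (total_cost q \<theta>)) \<le> ereal (r powr q)"
    by simp
qed (use assms in \<open>auto intro!: INF_greatest\<close>)

lemma wass2_lessD:
  assumes "wass2 b N TX dX TY dY q \<pi> \<pi>' < ereal r" "0 \<le> r" "1 \<le> q"
  obtains \<theta> where "\<theta> \<in> couplings_of b N PZ PZ \<pi> \<pi>'" "total_cost q \<theta> \<le> ennreal (r powr q)"
proof -
  have "(INF \<theta>\<in>couplings_of b N PZ PZ \<pi> \<pi>'. enn2ereal (total_cost q \<theta>)) < ereal (r powr q)"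
    by (rule epowr_root_less) (use assms in \<open>auto simp: wass2_eq intro!: INF_greatest\<close>)
  then obtain \<theta> where \<theta>: "\<theta> \<in> couplings_of b N PZ PZ \<pi> \<pi>'" "enn2ereal (total_cost q \<theta>) < ereal (r powr q)"
    by (auto simp: INF_less_iff)
  then have "enn2ereal (total_cost q \<theta>) \<le> enn2ereal (ennreal (r powr q))" by simp
  then have "total_cost q \<theta> \<le> ennreal (r powr q)" by (simp add: less_eq_ennreal.rep_eq)
  with \<theta> show ?thesis using that by blast
qed

lemma total_cost_swap:
  assumes "sets \<theta> = sets (BZ \<Otimes>\<^sub>M BZ)"
  shows "total_cost q (distr \<theta> (BZ \<Otimes>\<^sub>M BZ) prod.swap) = total_cost q \<theta>"
proof -
  have sw: "prod.swap \<in> \<theta> \<rightarrow>\<^sub>M BZ \<Otimes>\<^sub>M BZ" using measurable_swap by (simp add: measurable_cong_sets[OF assms refl])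
  have "total_cost q (distr \<theta> (BZ \<Otimes>\<^sub>M BZ) prod.swap) = (\<integral>\<^sup>+w. ennreal (cost_fun q (prod.swap w)) \<partial>\<theta>)"
    unfolding total_cost_def by (rule nn_integral_distr'[OF sw]) (use cost_fun_measurable in measurable)
  also have "\<dots> = total_cost q \<theta>"
    unfolding total_cost_def
    by (intro nn_integral_cong) (simp add: cost_fun_def uX_def uY_def MX.commute MY.commute)
  finally show ?thesis by simp
qed

lemma wass2_swap_le:
  assumes \<pi>: "prob_space \<pi>" "sets \<pi> = sets BZ" and \<pi>': "prob_space \<pi>'" "sets \<pi>' = sets BZ"
  shows "0 < q \<Longrightarrow> wass2 (swap_version b) N TX dX TY dY q \<pi>' \<pi> \<le> wass2 b N TX dX TY dY q \<pi> \<pi>'"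
  unfolding wass2_eq
proof (rule epowr_mono)
  show "(INF \<theta>\<in>couplings_of (swap_version b) N PZ PZ \<pi>' \<pi>. enn2ereal (total_cost q \<theta>))
    \<le> (INF \<theta>\<in>couplings_of b N PZ PZ \<pi> \<pi>'. enn2ereal (total_cost q \<theta>))"
  proof (rule INF_greatest)
    fix \<theta> assume \<theta>: "\<theta> \<in> couplings_of b N PZ PZ \<pi> \<pi>'"
    then have "\<theta> \<in> couplings \<pi> \<pi>'" by (simp add: couplings_of_def)
    note c = couplingsD[OF this \<pi> \<pi>'(2)]
    show "(INF \<theta>\<in>couplings_of (swap_version b) N PZ PZ \<pi>' \<pi>. enn2ereal (total_cost q \<theta>)) \<le> enn2ereal (total_cost q \<theta>)"
      by (rule INF_lower2[OF couplings_of_swap[OF PZ PZ \<pi> \<pi>' \<theta>]]) (use total_cost_swap[OF c(2)] in auto)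
  qed
qed (auto intro!: INF_greatest)

text \<open>Exchanging the two points turns causal couplings into anticausal ones and preserves the
  cost. Anticausal estimates thereby reduce to causal ones with the arguments exchanged.\<close>

lemma wass2_swap:
  assumes "prob_space \<pi>" "sets \<pi> = sets BZ" "prob_space \<pi>'" "sets \<pi>' = sets BZ" "0 < q"
  shows "wass2 (swap_version b) N TX dX TY dY q \<pi>' \<pi> = wass2 b N TX dX TY dY q \<pi> \<pi>'"
proof (rule antisym)
  show "wass2 (swap_version b) N TX dX TY dY q \<pi>' \<pi> \<le> wass2 b N TX dX TY dY q \<pi> \<pi>'"
    by (rule wass2_swap_le) fact+
  have "swap_version (swap_version b) = b" by (cases b) auto
  then show "wass2 b N TX dX TY dY q \<pi> \<pi>' \<le> wass2 (swap_version b) N TX dX TY dY q \<pi>' \<pi>"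
    using wass2_swap_le[OF assms(3,4,1,2,5), of "swap_version b"] by simp
qed

text \<open>The triangle inequality, at the level of couplings with prescribed bounds because infima
  need not be attained. The pointwise estimates for the two metrics have the same coefficients, so
  they add up to one for the cost.\<close>

lemma total_cost_glue:
  assumes q: "1 \<le> q" and ab: "0 < a" "0 < b'"
    and \<pi>: "prob_space \<pi>1" "sets \<pi>1 = sets BZ" "prob_space \<pi>2" "sets \<pi>2 = sets BZ" "sets \<pi>3 = sets BZ"
    and \<theta>1: "\<theta>1 \<in> couplings_of b N PZ PZ \<pi>1 \<pi>2" and \<theta>2: "\<theta>2 \<in> couplings_of b N PZ PZ \<pi>2 \<pi>3"
    and b: "b \<in> {Regular, Causal}"
    and c1: "total_cost q \<theta>1 \<le> ennreal (a powr q)" and c2: "total_cost q \<theta>2 \<le> ennreal (b' powr q)"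
  obtains \<sigma> where "\<sigma> \<in> couplings_of b N PZ PZ \<pi>1 \<pi>3" "total_cost q \<sigma> \<le> ennreal ((a + b') powr q)"
proof (rule couplings_of_glue[OF PZ \<pi> \<theta>1 \<theta>2 b])
  fix \<sigma> \<rho>
  assume \<sigma>: "\<sigma> \<in> couplings_of b N PZ PZ \<pi>1 \<pi>3"
    and s\<rho>: "sets \<rho> = sets ((BZ \<Otimes>\<^sub>M BZ) \<Otimes>\<^sub>M BZ)"
    and r: "\<And>f. f \<in> borel_measurable (BZ \<Otimes>\<^sub>M BZ) \<Longrightarrow> (\<integral>\<^sup>+w. f (fst w) \<partial>\<rho>) = (\<integral>\<^sup>+z. f z \<partial>\<theta>1)"
    "\<And>f. f \<in> borel_measurable (BZ \<Otimes>\<^sub>M BZ) \<Longrightarrow> (\<integral>\<^sup>+w. f (snd (fst w), snd w) \<partial>\<rho>) = (\<integral>\<^sup>+z. f z \<partial>\<theta>2)"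
    "\<And>f. f \<in> borel_measurable (BZ \<Otimes>\<^sub>M BZ) \<Longrightarrow> (\<integral>\<^sup>+w. f (fst (fst w), snd w) \<partial>\<rho>) = (\<integral>\<^sup>+z. f z \<partial>\<sigma>)"
  let ?c = "cost_fun q"
  have cm: "(\<lambda>w. ennreal (?c w)) \<in> borel_measurable (BZ \<Otimes>\<^sub>M BZ)" using cost_fun_measurable by measurable
  have sp: "space \<rho> = (space BZ \<times> space BZ) \<times> space BZ"
    using sets_eq_imp_space_eq[OF s\<rho>] by (simp add: space_pair_measure)
  have m1: "(\<lambda>w. ?c (fst w)) \<in> borel_measurable \<rho>"
    by (subst measurable_cong_sets[OF s\<rho> refl]) (use cost_fun_measurable in measurable)
  have m2: "(\<lambda>w. ?c (snd (fst w), snd w)) \<in> borel_measurable \<rho>"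
    by (subst measurable_cong_sets[OF s\<rho> refl]) (rule measurable_compose[OF _ cost_fun_measurable], measurable)
  have "(\<integral>\<^sup>+w. ennreal (?c (fst (fst w), snd w)) \<partial>\<rho>) \<le> ennreal ((a + b') powr q)"
  proof (rule Minkowski_nn_integral[OF q ab m1 m2])
    show "(\<integral>\<^sup>+w. ennreal (?c (fst w)) \<partial>\<rho>) \<le> ennreal (a powr q)" using r(1)[OF cm] c1 by (simp add: total_cost_def)
    show "(\<integral>\<^sup>+w. ennreal (?c (snd (fst w), snd w)) \<partial>\<rho>) \<le> ennreal (b' powr q)" using r(2)[OF cm] c2 by (simp add: total_cost_def)
    fix w assume "w \<in> space \<rho>"
    then have w: "fst (fst (fst w)) \<in> paths N TX" "snd (fst (fst w)) \<in> paths N TY" "fst (snd (fst w)) \<in> paths N TX"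
      "snd (snd (fst w)) \<in> paths N TY" "fst (snd w) \<in> paths N TX" "snd (snd w) \<in> paths N TY"
      by (auto simp: sp space_pair_measure)
    let ?A = "(a + b') powr q" and ?a = "a / (a + b') / a powr q" and ?b = "b' / (a + b') / b' powr q"
    have "uX (fst (fst w), snd w) powr q \<le> (uX (fst w) + uX (snd (fst w), snd w)) powr q"
      using q w by (intro powr_mono2) (auto simp: uX_def intro: MX.triangle)
    also have "\<dots> \<le> ?A * (?a * uX (fst w) powr q + ?b * uX (snd (fst w), snd w) powr q)"
      by (rule powr_add_le[OF q ab]) (auto simp: uX_def)
    finally have 1: "uX (fst (fst w), snd w) powr q \<le> ?A * (?a * uX (fst w) powr q + ?b * uX (snd (fst w), snd w) powr q)" .
    have "uY (fst (fst w), snd w) powr q \<le> (uY (fst w) + uY (snd (fst w), snd w)) powr q"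
      using q w by (intro powr_mono2) (auto simp: uY_def intro: MY.triangle)
    also have "\<dots> \<le> ?A * (?a * uY (fst w) powr q + ?b * uY (snd (fst w), snd w) powr q)"
      by (rule powr_add_le[OF q ab]) (auto simp: uY_def)
    finally have 2: "uY (fst (fst w), snd w) powr q \<le> ?A * (?a * uY (fst w) powr q + ?b * uY (snd (fst w), snd w) powr q)" .
    show "?c (fst (fst w), snd w) \<le> ?A * (?a * ?c (fst w) + ?b * ?c (snd (fst w), snd w))"
      using add_mono[OF 1 2] unfolding cost_fun_def by (simp only: distrib_left add.assoc add.left_commute add.commute)
  qed (simp_all add: cost_fun_nonneg)
  then have "total_cost q \<sigma> \<le> ennreal ((a + b') powr q)"
    using r(3)[OF cm] by (simp add: total_cost_def)
  with \<sigma> show ?thesis by (rule that)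
qed

lemma total_cost_lower_exponent:
  assumes q: "1 \<le> q" "q < p" and D: "0 < D" and \<theta>: "prob_space \<theta>" "sets \<theta> = sets (BZ \<Otimes>\<^sub>M BZ)"
    and c: "total_cost p \<theta> \<le> ennreal (D powr p)"
  shows "total_cost q \<theta> \<le> ennreal ((2 powr (1 / q - 1 / p) * D) powr q)"
  unfolding total_cost_def cost_fun_def
proof (rule nn_integral_powr_sum_le[OF \<theta>(1) q D])
  show "uX \<in> borel_measurable \<theta>" "uY \<in> borel_measurable \<theta>"
    using uX_measurable uY_measurable by (simp_all add: measurable_cong_sets[OF \<theta>(2) refl])
  show "0 \<le> uX w" "0 \<le> uY w" for w by (simp_all add: uX_def uY_def)
  show "(\<integral>\<^sup>+w. ennreal (uX w powr p + uY w powr p) \<partial>\<theta>) \<le> ennreal (D powr p)"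
    using c by (simp only: total_cost_def cost_fun_def)
qed

end

section \<open>Stability\<close>

lemma prob_pD:
  assumes "\<mu> \<in> prob_p N T d p"
  shows "prob_space \<mu>" "sets \<mu> = sets (borel_of (path_top N T))" "paths N T \<noteq> {}"
  using assms by (auto simp: prob_p_def)

text \<open>The growth condition comes with its own reference points, while \<open>prob_p\<close>
  gives a finite moment about some other one. The triangle inequality and (u + v)^p \<le> 2^(p-1)
  (u^p + v^p) link the two.\<close>

lemma moment_finite:
  assumes T: "polish_path_space N T d" and p: "1 \<le> p" and \<mu>: "\<mu> \<in> prob_p N T d p" and x0: "x0 \<in> paths N T"
  shows "(\<lambda>x. d x0 x powr p) \<in> borel_measurable (borel_of (path_top N T))"
    and "(\<integral>\<^sup>+x. ennreal (d x0 x powr p) \<partial>\<mu>) < \<infinity>"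
proof -
  let ?B = "borel_of (path_top N T)"
  interpret Metric_space "paths N T" d using T by (simp add: polish_path_space_def)
  have m: "(\<lambda>x. d y x powr p) \<in> borel_measurable ?B" if "y \<in> paths N T" for y
  proof -
    have "(\<lambda>x. (y, x)) \<in> ?B \<rightarrow>\<^sub>M ?B \<Otimes>\<^sub>M ?B" using that by simp
    from measurable_compose[OF this metric_measurable[OF T]]
    have "(\<lambda>x. d y x) \<in> borel_measurable ?B" by simp
    then show ?thesis by measurable
  qed
  then show "(\<lambda>x. d x0 x powr p) \<in> borel_measurable ?B" using x0 .
  obtain x1 where x1: "x1 \<in> paths N T" "(\<integral>\<^sup>+x. ennreal (d x1 x powr p) \<partial>\<mu>) < \<infinity>"
    using \<mu> unfolding prob_p_def by blast
  interpret \<mu>: prob_space \<mu> using prob_pD(1)[OF \<mu>] .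
  note s = prob_pD(2)[OF \<mu>]
  have sp: "space \<mu> = paths N T" using sets_eq_imp_space_eq[OF s] by simp
  define k where "k = (1 + 1) powr p * (1 / (1 + 1) / 1 powr p)"
  have k: "0 \<le> k" by (simp add: k_def)
  have le: "d x0 x powr p \<le> k * d x0 x1 powr p + k * d x1 x powr p" if x: "x \<in> paths N T" for x
  proof -
    have "d x0 x powr p \<le> (d x0 x1 + d x1 x) powr p"
      using x x0 x1 p by (intro powr_mono2) (auto intro: triangle)
    also have "\<dots> \<le> k * d x0 x1 powr p + k * d x1 x powr p"
      using powr_add_le[OF p, of 1 1 "d x0 x1" "d x1 x"] by (simp add: k_def algebra_simps)
    finally show ?thesis .
  qed
  have m': "(\<lambda>x. ennreal (d x1 x powr p)) \<in> borel_measurable \<mu>"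
    using m[OF x1(1)] by (simp add: measurable_cong_sets[OF s refl])
  have "(\<integral>\<^sup>+x. ennreal (d x0 x powr p) \<partial>\<mu>) \<le> (\<integral>\<^sup>+x. ennreal (k * d x0 x1 powr p) + ennreal k * ennreal (d x1 x powr p) \<partial>\<mu>)"
  proof (rule nn_integral_mono)
    fix x assume "x \<in> space \<mu>"
    then have "ennreal (d x0 x powr p) \<le> ennreal (k * d x0 x1 powr p + k * d x1 x powr p)"
      by (intro ennreal_leI le) (simp add: sp)
    also have "\<dots> = ennreal (k * d x0 x1 powr p) + ennreal k * ennreal (d x1 x powr p)"
      using k by (simp add: ennreal_plus ennreal_mult)
    finally show "ennreal (d x0 x powr p) \<le> ennreal (k * d x0 x1 powr p) + ennreal k * ennreal (d x1 x powr p)" .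
  qed
  also have "\<dots> = ennreal (k * d x0 x1 powr p) + ennreal k * (\<integral>\<^sup>+x. ennreal (d x1 x powr p) \<partial>\<mu>)"
    using m' by (simp add: nn_integral_add nn_integral_cmult \<mu>.emeasure_space_1)
  also have "\<dots> < \<infinity>" using x1(2) by (simp add: ennreal_mult_less_top)
  finally show "(\<integral>\<^sup>+x. ennreal (d x0 x powr p) \<partial>\<mu>) < \<infinity>" .
qed

lemma ereal_diff_le_bound:
  assumes "a \<le> b + ereal k" "b \<le> a + ereal k" "\<bar>a\<bar> \<noteq> \<infinity>" "\<bar>b\<bar> \<noteq> \<infinity>"
  shows "\<bar>a - b\<bar> \<le> ereal k"
  using assms by (cases a; cases b) auto

lemma INF_le_INF_add:
  fixes F :: "'a \<Rightarrow> ereal" and G :: "'b \<Rightarrow> ereal"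
  assumes "\<And>x. x \<in> A \<Longrightarrow> \<exists>y\<in>B. G y \<le> F x + ereal k"
  shows "(INF y\<in>B. G y) \<le> (INF x\<in>A. F x) + ereal k"
proof -
  have "(INF y\<in>B. G y) - ereal k \<le> (INF x\<in>A. F x)"
  proof (rule INF_greatest)
    fix x assume "x \<in> A"
    then obtain y where "y \<in> B" "G y \<le> F x + ereal k" using assms by blast
    then have "(INF y\<in>B. G y) \<le> F x + ereal k" by (rule INF_lower2)
    then show "(INF y\<in>B. G y) - ereal k \<le> F x" by (simp add: ereal_minus_le)
  qed
  then show ?thesis by (simp add: ereal_minus_le)
qed

lemma INF_ereal_lessD:
  fixes f :: "_ \<Rightarrow> ennreal"
  assumes "(INF \<theta>\<in>A. enn2ereal (f \<theta>)) < ereal r"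
  shows "\<exists>\<theta>\<in>A. f \<theta> \<le> ennreal r"
proof -
  obtain \<theta> where \<theta>: "\<theta> \<in> A" "enn2ereal (f \<theta>) < ereal r" using assms by (auto simp: INF_less_iff)
  moreover have "0 < r" using le_less_trans[OF enn2ereal_nonneg \<theta>(2)] by simp
  ultimately have "enn2ereal (f \<theta>) \<le> enn2ereal (ennreal r)" by simp
  then have "f \<theta> \<le> ennreal r" by (simp add: less_eq_ennreal.rep_eq)
  with \<theta> show ?thesis by blast
qed

context polish_path_spaces
begin

text \<open>Actual bicausal couplings are carried along instead of infima; later \<open>D\<close> is
  an arbitrary number above \<Delta>.\<close>

definition close :: "real \<Rightarrow> real \<Rightarrow> _ measure \<Rightarrow> _ measure \<Rightarrow> _ measure \<Rightarrow> _ measure \<Rightarrow> bool" where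
  "close p D \<mu> \<mu>' \<nu> \<nu>' \<longleftrightarrow>
    (\<exists>\<gamma>X\<in>couplings_of Bicausal N PX PX \<mu> \<mu>'. \<exists>\<gamma>Y\<in>couplings_of Bicausal N PY PY \<nu> \<nu>'.
      (\<integral>\<^sup>+z. ennreal (dX (fst z) (snd z) powr p) \<partial>\<gamma>X) + (\<integral>\<^sup>+z. ennreal (dY (fst z) (snd z) powr p) \<partial>\<gamma>Y) \<le> ennreal (D powr p))"

lemma dXp_measurable: "(\<lambda>z. ennreal (dX (fst z) (snd z) powr p)) \<in> borel_measurable (BX \<Otimes>\<^sub>M BX)"
  using dX_measurable by measurable

lemma dYp_measurable: "(\<lambda>z. ennreal (dY (fst z) (snd z) powr p)) \<in> borel_measurable (BY \<Otimes>\<^sub>M BY)"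
  using dY_measurable by measurable

lemma close_sym:
  assumes \<mu>: "prob_space \<mu>" "sets \<mu> = sets BX" and \<mu>': "prob_space \<mu>'" "sets \<mu>' = sets BX"
    and \<nu>: "prob_space \<nu>" "sets \<nu> = sets BY" and \<nu>': "prob_space \<nu>'" "sets \<nu>' = sets BY"
    and "close p D \<mu> \<mu>' \<nu> \<nu>'"
  shows "close p D \<mu>' \<mu> \<nu>' \<nu>"
proof -
  obtain \<gamma>X \<gamma>Y where X: "\<gamma>X \<in> couplings_of Bicausal N PX PX \<mu> \<mu>'" and Y: "\<gamma>Y \<in> couplings_of Bicausal N PY PY \<nu> \<nu>'"
    and le: "(\<integral>\<^sup>+z. ennreal (dX (fst z) (snd z) powr p) \<partial>\<gamma>X) + (\<integral>\<^sup>+z. ennreal (dY (fst z) (snd z) powr p) \<partial>\<gamma>Y) \<le> ennreal (D powr p)"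
    using assms(9) unfolding close_def by blast
  have Xc: "\<gamma>X \<in> couplings \<mu> \<mu>'" and Yc: "\<gamma>Y \<in> couplings \<nu> \<nu>'" using X Y by (auto simp: couplings_of_def)
  have sX: "prod.swap \<in> \<gamma>X \<rightarrow>\<^sub>M BX \<Otimes>\<^sub>M BX"
    using measurable_swap by (simp add: measurable_cong_sets[OF couplingsD(2)[OF Xc \<mu> \<mu>'(2)] refl])
  have sY: "prod.swap \<in> \<gamma>Y \<rightarrow>\<^sub>M BY \<Otimes>\<^sub>M BY"
    using measurable_swap by (simp add: measurable_cong_sets[OF couplingsD(2)[OF Yc \<nu> \<nu>'(2)] refl])
  show ?thesis
    unfolding close_def
    using couplings_of_swap[OF PX PX \<mu> \<mu>' X] couplings_of_swap[OF PY PY \<nu> \<nu>' Y] le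
    by (intro bexI[of _ "distr \<gamma>X (BX \<Otimes>\<^sub>M BX) prod.swap"] bexI[of _ "distr \<gamma>Y (BY \<Otimes>\<^sub>M BY) prod.swap"])
       (simp_all add: nn_integral_distr'[OF sX dXp_measurable] nn_integral_distr'[OF sY dYp_measurable] MX.commute MY.commute)
qed

text \<open>The infima need not be attained, but D^p exceeds their sum \<delta>^p, and half of the
  excess is granted to each of two near-optimal couplings.\<close>

lemma close_of_wass:
  assumes p: "1 \<le> p" and \<delta>: "0 \<le> \<delta>" "\<delta> < D"
    and eq: "epowr (ereal \<delta>) p = epowr (wass Bicausal N TX dX p \<mu> \<mu>') p + epowr (wass Bicausal N TY dY p \<nu> \<nu>') p"
  shows "close p D \<mu> \<mu>' \<nu> \<nu>'"
proof -
  define IX where "IX = (INF \<theta>\<in>couplings_of Bicausal N PX PX \<mu> \<mu>'. enn2ereal (\<integral>\<^sup>+z. ennreal (dX (fst z) (snd z) powr p) \<partial>\<theta>))"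
  define IY where "IY = (INF \<theta>\<in>couplings_of Bicausal N PY PY \<nu> \<nu>'. enn2ereal (\<integral>\<^sup>+z. ennreal (dY (fst z) (snd z) powr p) \<partial>\<theta>))"
  have nn: "0 \<le> IX" "0 \<le> IY" unfolding IX_def IY_def by (auto intro!: INF_greatest)
  have "wass Bicausal N TX dX p \<mu> \<mu>' = epowr IX (1 / p)" "wass Bicausal N TY dY p \<nu> \<nu>' = epowr IY (1 / p)"
    unfolding wass_def IX_def IY_def by (simp_all add: case_prod_beta')
  then have sum: "ereal (\<delta> powr p) = IX + IY" using eq nn p by (simp add: epowr_inverse)
  obtain a where a: "IX = ereal a" using sum nn by (cases IX) auto
  obtain b where b: "IY = ereal b" using sum nn a by (cases IY) auto
  have ab: "\<delta> powr p = a + b" "0 \<le> a" "0 \<le> b" using sum nn a b by auto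
  define e where "e = (D powr p - \<delta> powr p) / 2"
  have "\<delta> powr p < D powr p" using \<delta> p by (intro powr_less_mono2) auto
  then have e: "0 < e" by (simp add: e_def)
  have "IX < ereal (a + e)" "IY < ereal (b + e)" using a b e by auto
  from INF_ereal_lessD[OF this(1)[unfolded IX_def]] INF_ereal_lessD[OF this(2)[unfolded IY_def]]
  obtain \<gamma>X \<gamma>Y where X: "\<gamma>X \<in> couplings_of Bicausal N PX PX \<mu> \<mu>'" "(\<integral>\<^sup>+z. ennreal (dX (fst z) (snd z) powr p) \<partial>\<gamma>X) \<le> ennreal (a + e)"
    and Y: "\<gamma>Y \<in> couplings_of Bicausal N PY PY \<nu> \<nu>'" "(\<integral>\<^sup>+z. ennreal (dY (fst z) (snd z) powr p) \<partial>\<gamma>Y) \<le> ennreal (b + e)"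
    by blast
  have "(\<integral>\<^sup>+z. ennreal (dX (fst z) (snd z) powr p) \<partial>\<gamma>X) + (\<integral>\<^sup>+z. ennreal (dY (fst z) (snd z) powr p) \<partial>\<gamma>Y) \<le> ennreal (a + e) + ennreal (b + e)"
    using X Y by (intro add_mono)
  also have "\<dots> = ennreal ((a + e) + (b + e))" using ab e by (intro ennreal_plus[symmetric]) auto
  also have "(a + e) + (b + e) = D powr p" using ab by (simp add: e_def field_simps)
  finally show ?thesis unfolding close_def using X Y by blast
qed

lemma shadow_step:
  assumes \<mu>: "prob_space \<mu>" "sets \<mu> = sets BX" and \<mu>': "prob_space \<mu>'" "sets \<mu>' = sets BX"
    and \<nu>: "prob_space \<nu>" "sets \<nu> = sets BY" and \<nu>': "prob_space \<nu>'" "sets \<nu>' = sets BY"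
    and cl: "close p D \<mu> \<mu>' \<nu> \<nu>'" and \<pi>: "\<pi> \<in> couplings_of b N PX PY \<mu> \<nu>"
  obtains \<pi>' \<theta> where "\<pi>' \<in> couplings_of b N PX PY \<mu>' \<nu>'" "\<theta> \<in> couplings_of Causal N PZ PZ \<pi> \<pi>'"
    "KL \<pi>' (\<mu>' \<Otimes>\<^sub>M \<nu>') \<le> KL \<pi> (\<mu> \<Otimes>\<^sub>M \<nu>)" "total_cost p \<theta> \<le> ennreal (D powr p)"
proof -
  obtain \<gamma>X \<gamma>Y where X: "\<gamma>X \<in> couplings_of Bicausal N PX PX \<mu> \<mu>'" and Y: "\<gamma>Y \<in> couplings_of Bicausal N PY PY \<nu> \<nu>'"
    and le: "(\<integral>\<^sup>+z. ennreal (dX (fst z) (snd z) powr p) \<partial>\<gamma>X) + (\<integral>\<^sup>+z. ennreal (dY (fst z) (snd z) powr p) \<partial>\<gamma>Y) \<le> ennreal (D powr p)"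
    using cl unfolding close_def by blast
  show ?thesis
  proof (rule shadow_coupling[OF PX PY \<mu> \<mu>' \<nu> \<nu>' X Y \<pi>])
    fix \<pi>' \<theta>
    assume 1: "\<pi>' \<in> couplings_of b N PX PY \<mu>' \<nu>'" "\<theta> \<in> couplings_of Causal N PZ PZ \<pi> \<pi>'"
      "KL \<pi>' (\<mu>' \<Otimes>\<^sub>M \<nu>') \<le> KL \<pi> (\<mu> \<Otimes>\<^sub>M \<nu>)"
      and int: "\<And>F G. F \<in> borel_measurable (BX \<Otimes>\<^sub>M BX) \<Longrightarrow> G \<in> borel_measurable (BY \<Otimes>\<^sub>M BY) \<Longrightarrow>
      (\<integral>\<^sup>+z. F (fst (fst z), fst (snd z)) + G (snd (fst z), snd (snd z)) \<partial>\<theta>) = (\<integral>\<^sup>+z. F z \<partial>\<gamma>X) + (\<integral>\<^sup>+z. G z \<partial>\<gamma>Y)"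
    have "total_cost p \<theta> = (\<integral>\<^sup>+z. ennreal (dX (fst (fst z)) (fst (snd z)) powr p) + ennreal (dY (snd (fst z)) (snd (snd z)) powr p) \<partial>\<theta>)"
      unfolding total_cost_def cost_fun_def uX_def uY_def by (intro nn_integral_cong ennreal_plus) auto
    also have "\<dots> = (\<integral>\<^sup>+z. ennreal (dX (fst z) (snd z) powr p) \<partial>\<gamma>X) + (\<integral>\<^sup>+z. ennreal (dY (fst z) (snd z) powr p) \<partial>\<gamma>Y)"
      using int[OF dXp_measurable dYp_measurable] by simp
    finally have "total_cost p \<theta> \<le> ennreal (D powr p)" using le by simp
    with 1 show ?thesis by (rule that)
  qed
qed

lemma cost_A_sym:
  assumes \<mu>: "prob_space \<mu>" "sets \<mu> = sets BX" and \<mu>': "prob_space \<mu>'" "sets \<mu>' = sets BX"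
    and \<nu>: "sets \<nu> = sets BY" and \<nu>': "sets \<nu>' = sets BY" and p: "1 \<le> p"
    and A: "cost_A N TX dX TY dY c L p \<mu> \<nu> \<mu>' \<nu>'"
  shows "cost_A N TX dX TY dY c L p \<mu>' \<nu>' \<mu> \<nu>"
  unfolding cost_A_def
proof (intro ballI)
  fix \<pi>' \<pi> assume \<pi>': "\<pi>' \<in> couplings \<mu>' \<nu>'" and \<pi>: "\<pi> \<in> couplings \<mu> \<nu>"
  have "wass2 Regular N TX dX TY dY p \<pi>' \<pi> = wass2 Regular N TX dX TY dY p \<pi> \<pi>'"
    using wass2_swap[OF couplingsD(1,2)[OF \<pi> \<mu> \<nu>] couplingsD(1,2)[OF \<pi>' \<mu>' \<nu>'], of p Regular] p by simp
  moreover have "ereal \<bar>(\<integral>z. c z \<partial>\<pi>) - (\<integral>z. c z \<partial>\<pi>')\<bar> \<le> ereal L * wass2 Regular N TX dX TY dY p \<pi> \<pi>'"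
    using A \<pi> \<pi>' unfolding cost_A_def by blast
  ultimately show "ereal \<bar>(\<integral>z. c z \<partial>\<pi>') - (\<integral>z. c z \<partial>\<pi>)\<bar> \<le> ereal L * wass2 Regular N TX dX TY dY p \<pi>' \<pi>"
    by (simp only: abs_minus_commute[of "\<integral>z. c z \<partial>\<pi>'"])
qed

lemma causal_imp_regular: "\<theta> \<in> couplings_of Causal n P Q \<pi> \<pi>' \<Longrightarrow> \<theta> \<in> couplings_of Regular n P Q \<pi> \<pi>'"
  by (simp add: couplings_of_def)

lemma cost_A_le:
  assumes "cost_A N TX dX TY dY c L p \<mu> \<nu> \<mu>' \<nu>'" "\<pi> \<in> couplings \<mu> \<nu>" "\<pi>' \<in> couplings \<mu>' \<nu>'"
    and \<theta>: "\<theta> \<in> couplings_of Causal N PZ PZ \<pi> \<pi>'" "total_cost p \<theta> \<le> ennreal (D powr p)"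
    and "0 \<le> D" "1 \<le> p" "0 < L"
  shows "\<bar>(\<integral>z. c z \<partial>\<pi>) - (\<integral>z. c z \<partial>\<pi>')\<bar> \<le> L * D"
proof -
  have "ereal \<bar>(\<integral>z. c z \<partial>\<pi>) - (\<integral>z. c z \<partial>\<pi>')\<bar> \<le> ereal L * wass2 Regular N TX dX TY dY p \<pi> \<pi>'"
    using assms unfolding cost_A_def by blast
  also have "\<dots> \<le> ereal L * ereal D"
    by (rule ereal_mult_left_mono[OF wass2_le[OF causal_imp_regular[OF \<theta>(1)] \<theta>(2)]]) (use assms in auto)
  finally show ?thesis by simp
qed

text \<open>The growth bound is a sum of functions of one coordinate each, so its integral depends
  on the marginals alone and one \<open>K\<close> serves all couplings.\<close>

lemma cost_integral_bound:
  assumes p: "1 \<le> p" and \<mu>: "\<mu> \<in> prob_p N TX dX p" and \<nu>: "\<nu> \<in> prob_p N TY dY p"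
    and growth: "growth_at_most N TX dX TY dY p c"
  shows "\<exists>K. \<forall>\<pi>\<in>couplings \<mu> \<nu>. \<bar>\<integral>z. c z \<partial>\<pi>\<bar> \<le> K \<and> (c \<in> borel_measurable BZ \<longrightarrow> integrable \<pi> c)"
proof -
  obtain x0 y0 where x0: "x0 \<in> paths N TX" and y0: "y0 \<in> paths N TY"
    and "bounded ((\<lambda>(x, y). c (x, y) / (1 + dX x0 x powr p + dY y0 y powr p)) ` (paths N TX \<times> paths N TY))"
    using growth unfolding growth_at_most_def by blast
  then obtain B where B: "\<And>x y. x \<in> paths N TX \<Longrightarrow> y \<in> paths N TY \<Longrightarrow> \<bar>c (x, y) / (1 + dX x0 x powr p + dY y0 y powr p)\<bar> \<le> B"
    by (fastforce simp: bounded_iff)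
  note \<mu>p = prob_pD(1,2)[OF \<mu>] and \<nu>p = prob_pD(1,2)[OF \<nu>]
  note mX = moment_finite[OF polX p \<mu> x0] and mY = moment_finite[OF polY p \<nu> y0]
  have B0: "0 \<le> B" using B[OF x0 y0] by (meson abs_ge_zero order_trans)
  have bnd: "\<bar>c z\<bar> \<le> B * (1 + dX x0 (fst z) powr p + dY y0 (snd z) powr p)"
    if "fst z \<in> paths N TX" "snd z \<in> paths N TY" for z
  proof -
    let ?h = "1 + dX x0 (fst z) powr p + dY y0 (snd z) powr p"
    have h: "0 < ?h" by (simp add: add_pos_nonneg)
    then have "\<bar>c z\<bar> / ?h \<le> B" using B[OF that] by (simp add: abs_divide abs_of_pos)
    then show ?thesis using h by (simp add: divide_le_eq)
  qed
  define KK where "KK = ennreal B * (1 + (\<integral>\<^sup>+x. ennreal (dX x0 x powr p) \<partial>\<mu>) + (\<integral>\<^sup>+y. ennreal (dY y0 y powr p) \<partial>\<nu>))"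
  have KK: "KK < \<infinity>" using mX(2) mY(2) by (simp add: KK_def ennreal_mult_less_top)
  have "\<bar>\<integral>z. c z \<partial>\<pi>\<bar> \<le> enn2real KK \<and> (c \<in> borel_measurable BZ \<longrightarrow> integrable \<pi> c)" if \<pi>: "\<pi> \<in> couplings \<mu> \<nu>" for \<pi>
  proof -
    note c = couplingsD[OF \<pi> \<mu>p \<nu>p(2)]
    interpret prob_space \<pi> by (rule c(1))
    have sp: "space \<pi> = paths N TX \<times> paths N TY" using sets_eq_imp_space_eq[OF c(2)] by (simp add: space_pair_measure)
    have f: "fst \<in> \<pi> \<rightarrow>\<^sub>M BX" and s: "snd \<in> \<pi> \<rightarrow>\<^sub>M BY" by (simp_all add: measurable_cong_sets[OF c(2) refl])
    have mx: "(\<lambda>x. ennreal (dX x0 x powr p)) \<in> borel_measurable BX" and my: "(\<lambda>y. ennreal (dY y0 y powr p)) \<in> borel_measurable BY"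
      using mX(1) mY(1) by measurable
    have int: "(\<integral>\<^sup>+z. ennreal \<bar>c z\<bar> \<partial>\<pi>) \<le> KK"
    proof -
      have "(\<integral>\<^sup>+z. ennreal \<bar>c z\<bar> \<partial>\<pi>) \<le> (\<integral>\<^sup>+z. ennreal B * (1 + ennreal (dX x0 (fst z) powr p) + ennreal (dY y0 (snd z) powr p)) \<partial>\<pi>)"
      proof (rule nn_integral_mono)
        fix z assume "z \<in> space \<pi>"
        then have "ennreal \<bar>c z\<bar> \<le> ennreal (B * (1 + dX x0 (fst z) powr p + dY y0 (snd z) powr p))"
          by (intro ennreal_leI bnd) (auto simp: sp)
        also have "\<dots> = ennreal B * (1 + ennreal (dX x0 (fst z) powr p) + ennreal (dY y0 (snd z) powr p))"
          using B0 by (simp add: ennreal_mult ennreal_plus)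
        finally show "ennreal \<bar>c z\<bar> \<le> ennreal B * (1 + ennreal (dX x0 (fst z) powr p) + ennreal (dY y0 (snd z) powr p))" .
      qed
      also have "\<dots> = ennreal B * (1 + (\<integral>\<^sup>+z. ennreal (dX x0 (fst z) powr p) \<partial>\<pi>) + (\<integral>\<^sup>+z. ennreal (dY y0 (snd z) powr p) \<partial>\<pi>))"
        using measurable_compose[OF f mx] measurable_compose[OF s my]
        by (simp add: nn_integral_cmult nn_integral_add emeasure_space_1)
      also have "\<dots> = KK"
        using nn_integral_distr'[OF f mx] nn_integral_distr'[OF s my] by (simp add: KK_def c(3,4))
      finally show ?thesis .
    qed
    show ?thesis
    proof (cases "c \<in> borel_measurable BZ")
      case True
      then have cm: "c \<in> borel_measurable \<pi>" by (simp add: measurable_cong_sets[OF c(2) refl])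
      have i: "integrable \<pi> c" using cm int KK by (intro integrableI_bounded) (auto intro: le_less_trans)
      have "ennreal \<bar>\<integral>z. c z \<partial>\<pi>\<bar> \<le> (\<integral>\<^sup>+z. ennreal \<bar>c z\<bar> \<partial>\<pi>)"
        using integral_norm_bound_ennreal[OF i] by simp
      then have "ennreal \<bar>\<integral>z. c z \<partial>\<pi>\<bar> \<le> KK" using int by (rule order_trans)
      then have "\<bar>\<integral>z. c z \<partial>\<pi>\<bar> \<le> enn2real KK"
        using KK enn2real_mono[of "ennreal \<bar>\<integral>z. c z \<partial>\<pi>\<bar>" KK] by simp
      then show ?thesis using i by simp
    next
      case False
      \<comment> \<open>A function that is not integrable has Bochner integral 0, which satisfies
        the bound.\<close>
      then have "\<not> integrable \<pi> c" by (auto dest: borel_measurable_integrable simp: measurable_cong_sets[OF c(2) refl])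
      then show ?thesis using False by (simp add: not_integrable_integral_eq)
    qed
  qed
  then show ?thesis by blast
qed

lemma integral_cost_mix:
  assumes p: "1 \<le> p" and \<mu>: "\<mu> \<in> prob_p N TX dX p" and \<nu>: "\<nu> \<in> prob_p N TY dY p"
    and growth: "growth_at_most N TX dX TY dY p c"
    and \<pi>: "\<pi> \<in> couplings \<mu> \<nu>" and \<pi>': "\<pi>' \<in> couplings \<mu> \<nu>" and s: "0 \<le> s" "s \<le> 1"
  shows "(\<integral>z. c z \<partial>mix s \<pi> \<pi>') = s * (\<integral>z. c z \<partial>\<pi>) + (1 - s) * (\<integral>z. c z \<partial>\<pi>')"
proof -
  note \<mu>p = prob_pD(1,2)[OF \<mu>] and \<nu>p = prob_pD(1,2)[OF \<nu>]
  note c1 = couplingsD[OF \<pi> \<mu>p \<nu>p(2)] and c2 = couplingsD[OF \<pi>' \<mu>p \<nu>p(2)]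
  have ss: "sets \<pi>' = sets \<pi>" using c1 c2 by simp
  have sm: "sets (mix s \<pi> \<pi>') = sets BZ" using sets_mix[OF s c1(1) c2(1) ss] c1(2) by simp
  show ?thesis
  proof (cases "c \<in> borel_measurable BZ")
    case True
    then have "integrable \<pi> c" "integrable \<pi>' c"
      using cost_integral_bound[OF p \<mu> \<nu> growth] \<pi> \<pi>' by blast+
    then show ?thesis by (rule integral_mix[OF s c1(1) c2(1) ss])
  next
    case False
    then have "\<not> integrable \<rho> c" if "sets \<rho> = sets BZ" for \<rho>
      by (auto dest: borel_measurable_integrable simp: measurable_cong_sets[OF that refl])
    then show ?thesis using c1(2) c2(2) sm by (simp add: not_integrable_integral_eq)
  qed
qed

text \<open>The product coupling has zero entropy and bounds both values from above; from below, the
  cost is bounded and entropy is nonnegative. Finiteness is what gives differences of values in the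
  extended reals their meaning.\<close>

lemma values_finite:
  assumes p: "1 \<le> p" and \<mu>: "\<mu> \<in> prob_p N TX dX p" and \<nu>: "\<nu> \<in> prob_p N TY dY p"
    and growth: "growth_at_most N TX dX TY dY p c"
  shows "\<bar>V_val b N TX TY \<mu> \<nu> c\<bar> \<noteq> \<infinity>" "\<bar>E_val b N TX TY \<mu> \<nu> c\<bar> \<noteq> \<infinity>"
proof -
  obtain K where K: "\<And>\<pi>. \<pi> \<in> couplings \<mu> \<nu> \<Longrightarrow> \<bar>\<integral>z. c z \<partial>\<pi>\<bar> \<le> K"
    using cost_integral_bound[OF p \<mu> \<nu> growth] by blast
  note \<mu>p = prob_pD(1,2)[OF \<mu>] and \<nu>p = prob_pD(1,2)[OF \<nu>]
  let ?C = "couplings_of b N PX PY \<mu> \<nu>" and ?R = "\<mu> \<Otimes>\<^sub>M \<nu>"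
  have R: "?R \<in> ?C" by (rule product_coupling[OF PX PY \<mu>p \<nu>p])
  have C: "\<pi> \<in> ?C \<Longrightarrow> \<pi> \<in> couplings \<mu> \<nu>" for \<pi> by (simp add: couplings_of_def)
  have pR: "prob_space ?R" by (rule prob_space_pair[OF \<mu>p(1) \<nu>p(1)])
  have sR: "sets ?R = sets BZ" by (rule sets_pair_measure_cong[OF \<mu>p(2) \<nu>p(2)])
  have "V_val b N TX TY \<mu> \<nu> c \<le> transport_costs c ?R" unfolding V_val_def by (rule INF_lower[OF R])
  also have "\<dots> \<le> ereal K" using K[OF C[OF R]] by (simp add: transport_costs_def)
  finally have 1: "V_val b N TX TY \<mu> \<nu> c \<le> ereal K" .
  have 2: "ereal (- K) \<le> V_val b N TX TY \<mu> \<nu> c"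
    unfolding V_val_def transport_costs_def by (rule INF_greatest) (use K C in \<open>fastforce simp: abs_le_iff\<close>)
  show "\<bar>V_val b N TX TY \<mu> \<nu> c\<bar> \<noteq> \<infinity>" using 1 2 by (cases "V_val b N TX TY \<mu> \<nu> c") auto
  have "E_val b N TX TY \<mu> \<nu> c \<le> entropic_costs \<mu> \<nu> c ?R" unfolding E_val_def by (rule INF_lower[OF R])
  also have "\<dots> \<le> ereal K" using K[OF C[OF R]] by (simp add: entropic_costs_def KL_self[OF pR])
  finally have 3: "E_val b N TX TY \<mu> \<nu> c \<le> ereal K" .
  have 4: "ereal (- K) \<le> E_val b N TX TY \<mu> \<nu> c"
    unfolding E_val_def
  proof (rule INF_greatest)
    fix \<pi> assume "\<pi> \<in> ?C"
    then have \<pi>: "\<pi> \<in> couplings \<mu> \<nu>" by (rule C)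
    note c = couplingsD[OF \<pi> \<mu>p \<nu>p(2)]
    have "ereal (- K) + 0 \<le> ereal (\<integral>z. c z \<partial>\<pi>) + KL \<pi> ?R"
      using K[OF \<pi>] c sR by (intro add_mono KL_nonneg pR) (auto simp: abs_le_iff)
    then show "ereal (- K) \<le> entropic_costs \<mu> \<nu> c \<pi>" by (simp add: entropic_costs_def)
  qed
  show "\<bar>E_val b N TX TY \<mu> \<nu> c\<bar> \<noteq> \<infinity>" using 3 4 by (cases "E_val b N TX TY \<mu> \<nu> c") auto
qed

lemma values_le:
  assumes \<mu>: "prob_space \<mu>" "sets \<mu> = sets BX" and \<mu>': "prob_space \<mu>'" "sets \<mu>' = sets BX"
    and \<nu>: "prob_space \<nu>" "sets \<nu> = sets BY" and \<nu>': "prob_space \<nu>'" "sets \<nu>' = sets BY"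
    and A: "cost_A N TX dX TY dY c L p \<mu> \<nu> \<mu>' \<nu>'" and p: "1 \<le> p" and L: "0 < L" and D: "0 \<le> D"
    and cl: "close p D \<mu> \<mu>' \<nu> \<nu>'"
  shows "V_val b N TX TY \<mu>' \<nu>' c \<le> V_val b N TX TY \<mu> \<nu> c + ereal (L * D)"
    and "E_val b N TX TY \<mu>' \<nu>' c \<le> E_val b N TX TY \<mu> \<nu> c + ereal (L * D)"
proof -
  have step: "\<exists>\<pi>'\<in>couplings_of b N PX PY \<mu>' \<nu>'. (\<integral>z. c z \<partial>\<pi>') \<le> (\<integral>z. c z \<partial>\<pi>) + L * D \<and> KL \<pi>' (\<mu>' \<Otimes>\<^sub>M \<nu>') \<le> KL \<pi> (\<mu> \<Otimes>\<^sub>M \<nu>)"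
    if \<pi>: "\<pi> \<in> couplings_of b N PX PY \<mu> \<nu>" for \<pi>
  proof -
    obtain \<pi>' \<theta> where 1: "\<pi>' \<in> couplings_of b N PX PY \<mu>' \<nu>'" "\<theta> \<in> couplings_of Causal N PZ PZ \<pi> \<pi>'"
      "KL \<pi>' (\<mu>' \<Otimes>\<^sub>M \<nu>') \<le> KL \<pi> (\<mu> \<Otimes>\<^sub>M \<nu>)" "total_cost p \<theta> \<le> ennreal (D powr p)"
      by (rule shadow_step[OF \<mu> \<mu>' \<nu> \<nu>' cl \<pi>])
    have "\<bar>(\<integral>z. c z \<partial>\<pi>) - (\<integral>z. c z \<partial>\<pi>')\<bar> \<le> L * D"
      by (rule cost_A_le[OF A _ _ 1(2,4) D p L]) (use \<pi> 1 in \<open>auto simp: couplings_of_def\<close>)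
    then show ?thesis using 1 by (intro bexI[of _ \<pi>']) auto
  qed
  show "V_val b N TX TY \<mu>' \<nu>' c \<le> V_val b N TX TY \<mu> \<nu> c + ereal (L * D)"
    unfolding V_val_def transport_costs_def by (rule INF_le_INF_add) (use step in fastforce)
  show "E_val b N TX TY \<mu>' \<nu>' c \<le> E_val b N TX TY \<mu> \<nu> c + ereal (L * D)"
    unfolding E_val_def entropic_costs_def
  proof (rule INF_le_INF_add)
    fix \<pi> assume "\<pi> \<in> couplings_of b N PX PY \<mu> \<nu>"
    from step[OF this] obtain \<pi>' where 1: "\<pi>' \<in> couplings_of b N PX PY \<mu>' \<nu>'"
      "(\<integral>z. c z \<partial>\<pi>') \<le> (\<integral>z. c z \<partial>\<pi>) + L * D" "KL \<pi>' (\<mu>' \<Otimes>\<^sub>M \<nu>') \<le> KL \<pi> (\<mu> \<Otimes>\<^sub>M \<nu>)" by blast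
    have "ereal (\<integral>z. c z \<partial>\<pi>') + KL \<pi>' (\<mu>' \<Otimes>\<^sub>M \<nu>') \<le> ereal ((\<integral>z. c z \<partial>\<pi>) + L * D) + KL \<pi> (\<mu> \<Otimes>\<^sub>M \<nu>)"
      using 1 by (intro add_mono) auto
    also have "\<dots> = ereal (\<integral>z. c z \<partial>\<pi>) + KL \<pi> (\<mu> \<Otimes>\<^sub>M \<nu>) + ereal (L * D)"
      by (cases "KL \<pi> (\<mu> \<Otimes>\<^sub>M \<nu>)") auto
    finally show "\<exists>y\<in>couplings_of b N PX PY \<mu>' \<nu>'. ereal (\<integral>z. c z \<partial>y) + KL y (\<mu>' \<Otimes>\<^sub>M \<nu>')
       \<le> ereal (\<integral>z. c z \<partial>\<pi>) + KL \<pi> (\<mu> \<Otimes>\<^sub>M \<nu>) + ereal (L * D)" using 1(1) by blast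
  qed
qed

text \<open>Finiteness of the value makes both entropies finite. Optimality of \<open>\<pi>'\<close>
  against the mixtures with \<pi>, which are again admissible, is exactly the hypothesis of
  \<open>KL_pythagoras\<close>, and the bound obtained there is the excess of \<pi> over the
  value.\<close>

lemma KL_optimizer_le:
  assumes p: "1 \<le> p" and \<mu>: "\<mu> \<in> prob_p N TX dX p" and \<nu>: "\<nu> \<in> prob_p N TY dY p"
    and growth: "growth_at_most N TX dX TY dY p c"
    and opt: "E_optimizer b N TX TY \<mu> \<nu> c \<pi>'" and \<pi>: "\<pi> \<in> couplings_of b N PX PY \<mu> \<nu>"
    and le: "entropic_costs \<mu> \<nu> c \<pi> \<le> E_val b N TX TY \<mu> \<nu> c + ereal e"
  shows "KL \<pi> \<pi>' \<le> ereal e"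
proof -
  note \<mu>p = prob_pD(1,2)[OF \<mu>] and \<nu>p = prob_pD(1,2)[OF \<nu>]
  let ?R = "\<mu> \<Otimes>\<^sub>M \<nu>"
  have \<pi>': "\<pi>' \<in> couplings_of b N PX PY \<mu> \<nu>" and E: "entropic_costs \<mu> \<nu> c \<pi>' = E_val b N TX TY \<mu> \<nu> c"
    using opt by (auto simp: E_optimizer_def)
  have C: "\<pi> \<in> couplings \<mu> \<nu>" "\<pi>' \<in> couplings \<mu> \<nu>" using \<pi> \<pi>' by (auto simp: couplings_of_def)
  note c1 = couplingsD[OF C(1) \<mu>p \<nu>p(2)] and c2 = couplingsD[OF C(2) \<mu>p \<nu>p(2)]
  have pR: "prob_space ?R" by (rule prob_space_pair[OF \<mu>p(1) \<nu>p(1)])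
  have sR: "sets ?R = sets BZ" by (rule sets_pair_measure_cong[OF \<mu>p(2) \<nu>p(2)])
  obtain v where v: "E_val b N TX TY \<mu> \<nu> c = ereal v" using values_finite(2)[OF p \<mu> \<nu> growth, of b]
    by (cases "E_val b N TX TY \<mu> \<nu> c") auto
  have s: "sets \<pi> = sets ?R" "sets \<pi>' = sets ?R" using c1 c2 sR by auto
  obtain k where k: "KL \<pi> ?R = ereal k" using le v KL_nonneg[OF c1(1) pR s(1)] by (cases "KL \<pi> ?R") (auto simp: entropic_costs_def)
  obtain k' where k': "KL \<pi>' ?R = ereal k'" using E v KL_nonneg[OF c2(1) pR s(2)] by (cases "KL \<pi>' ?R") (auto simp: entropic_costs_def)
  define I I' where "I = (\<integral>z. c z \<partial>\<pi>)" and "I' = (\<integral>z. c z \<partial>\<pi>')"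
  have "KL \<pi> \<pi>' \<le> ereal ((I + k) - (I' + k'))"
  proof (rule KL_pythagoras[OF c1(1) c2(1) pR s k k'])
    fix t :: real assume t: "0 < t" "t < 1"
    have t': "0 \<le> t" "t \<le> 1" using t by auto
    have "ereal (I' + k') = entropic_costs \<mu> \<nu> c \<pi>'" by (simp add: entropic_costs_def k' I'_def)
    also have "\<dots> \<le> entropic_costs \<mu> \<nu> c (mix t \<pi> \<pi>')"
      unfolding E E_val_def by (rule INF_lower[OF couplings_of_mix[OF PX PY \<mu>p \<nu>p \<pi> \<pi>' t']])
    also have "\<dots> = ereal (t * I + (1 - t) * I') + KL (mix t \<pi> \<pi>') ?R"
      by (simp add: entropic_costs_def integral_cost_mix[OF p \<mu> \<nu> growth C t'] I_def I'_def)
    finally show "ereal (I' + k') \<le> ereal (t * I + (1 - t) * I') + KL (mix t \<pi> \<pi>') ?R" .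
  qed
  also have "\<dots> \<le> ereal e"
    using le E v by (simp add: entropic_costs_def k k' I_def I'_def)
  finally show ?thesis .
qed

text \<open>The transport inequality enters only on the side of \<open>\<pi>'\<close>, so the lemma
  can be applied with the two problems in either order. \<open>b'\<close> is limited to the versions
  in which the coupling with the shadow is known to be admissible. \<open>D\<close> is positive
  because gluing divides by the bounds.\<close>

lemma optimizer_stability:
  assumes p: "1 \<le> q" "q < p"
    and \<mu>: "\<mu> \<in> prob_p N TX dX p" and \<mu>': "\<mu>' \<in> prob_p N TX dX p"
    and \<nu>: "\<nu> \<in> prob_p N TY dY p" and \<nu>': "\<nu>' \<in> prob_p N TY dY p"
    and growth: "growth_at_most N TX dX TY dY p c"
    and A: "cost_A N TX dX TY dY c L p \<mu> \<nu> \<mu>' \<nu>'" and L: "0 < L" and D: "0 < D"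
    and cl: "close p D \<mu> \<mu>' \<nu> \<nu>'" and C: "0 < C"
    and opt: "E_optimizer b N TX TY \<mu> \<nu> c \<pi>" and opt': "E_optimizer b N TX TY \<mu>' \<nu>' c \<pi>'"
    and b': "b' \<in> {Regular, Causal}"
    and T: "\<And>\<rho>. \<rho> \<in> couplings \<mu>' \<nu>' \<Longrightarrow> wass2 b' N TX dX TY dY q \<rho> \<pi>' \<le> ereal C * epowr (KL \<rho> \<pi>') (1 / (2 * q))"
  shows "wass2 b' N TX dX TY dY q \<pi> \<pi>' \<le> ereal (2 powr (1 / q - 1 / p) * D + C * (2 * L * D) powr (1 / (2 * q)))"
proof -
  have p1: "1 \<le> p" using p by simp
  note \<mu>p = prob_pD(1,2)[OF \<mu>] and \<nu>p = prob_pD(1,2)[OF \<nu>] and \<mu>p' = prob_pD(1,2)[OF \<mu>'] and \<nu>p' = prob_pD(1,2)[OF \<nu>']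
  have \<pi>: "\<pi> \<in> couplings_of b N PX PY \<mu> \<nu>" "entropic_costs \<mu> \<nu> c \<pi> = E_val b N TX TY \<mu> \<nu> c"
    and \<pi>': "\<pi>' \<in> couplings_of b N PX PY \<mu>' \<nu>'" using opt opt' by (auto simp: E_optimizer_def)
  have \<pi>c: "\<pi> \<in> couplings \<mu> \<nu>" and \<pi>c': "\<pi>' \<in> couplings \<mu>' \<nu>'" using \<pi> \<pi>' by (auto simp: couplings_of_def)
  note c = couplingsD[OF \<pi>c \<mu>p \<nu>p(2)] and c' = couplingsD[OF \<pi>c' \<mu>p' \<nu>p'(2)]
  obtain \<rho> \<theta> where \<rho>: "\<rho> \<in> couplings_of b N PX PY \<mu>' \<nu>'" and \<theta>: "\<theta> \<in> couplings_of Causal N PZ PZ \<pi> \<rho>"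
    and KL\<rho>: "KL \<rho> (\<mu>' \<Otimes>\<^sub>M \<nu>') \<le> KL \<pi> (\<mu> \<Otimes>\<^sub>M \<nu>)" and cost\<theta>: "total_cost p \<theta> \<le> ennreal (D powr p)"
    by (rule shadow_step[OF \<mu>p \<mu>p' \<nu>p \<nu>p' cl \<pi>(1)])
  have \<rho>c: "\<rho> \<in> couplings \<mu>' \<nu>'" using \<rho> by (simp add: couplings_of_def)
  note c\<rho> = couplingsD[OF \<rho>c \<mu>p' \<nu>p'(2)]
  have D0: "0 \<le> D" using D by simp
  have cI: "\<bar>(\<integral>z. c z \<partial>\<pi>) - (\<integral>z. c z \<partial>\<rho>)\<bar> \<le> L * D" by (rule cost_A_le[OF A \<pi>c \<rho>c \<theta> cost\<theta> D0 p1 L])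
  \<comment> \<open>The second L D: passing from \<pi> to its shadow costs one, and the value
    attained by \<pi> exceeds that of the other problem by at most another.\<close>
  have Esym: "E_val b N TX TY \<mu> \<nu> c \<le> E_val b N TX TY \<mu>' \<nu>' c + ereal (L * D)"
    by (rule values_le(2)[OF \<mu>p' \<mu>p \<nu>p' \<nu>p cost_A_sym[OF \<mu>p \<mu>p' \<nu>p(2) \<nu>p'(2) p1 A] p1 L D0 close_sym[OF \<mu>p \<mu>p' \<nu>p \<nu>p' cl]])
  have "entropic_costs \<mu>' \<nu>' c \<rho> \<le> ereal ((\<integral>z. c z \<partial>\<pi>) + L * D) + KL \<pi> (\<mu> \<Otimes>\<^sub>M \<nu>)"
    unfolding entropic_costs_def using cI KL\<rho> by (intro add_mono) auto
  also have "\<dots> = entropic_costs \<mu> \<nu> c \<pi> + ereal (L * D)"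
    unfolding entropic_costs_def by (cases "KL \<pi> (\<mu> \<Otimes>\<^sub>M \<nu>)") auto
  also have "\<dots> \<le> E_val b N TX TY \<mu>' \<nu>' c + ereal (L * D) + ereal (L * D)"
    unfolding \<pi>(2) by (intro add_right_mono Esym)
  also have "\<dots> = E_val b N TX TY \<mu>' \<nu>' c + ereal (2 * L * D)" by (cases "E_val b N TX TY \<mu>' \<nu>' c") auto
  finally have "KL \<rho> \<pi>' \<le> ereal (2 * L * D)"
    by (rule KL_optimizer_le[OF p1 \<mu>' \<nu>' growth opt' \<rho>])
  moreover have "0 \<le> KL \<rho> \<pi>'" by (rule KL_nonneg[OF c\<rho>(1) c'(1)]) (simp add: c\<rho> c')
  ultimately have "epowr (KL \<rho> \<pi>') (1 / (2 * q)) \<le> epowr (ereal (2 * L * D)) (1 / (2 * q))"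
    using p by (intro epowr_mono) auto
  then have "ereal C * epowr (KL \<rho> \<pi>') (1 / (2 * q)) \<le> ereal C * ereal ((2 * L * D) powr (1 / (2 * q)))"
    using C by (intro ereal_mult_left_mono) auto
  with T[OF \<rho>c] have W2: "wass2 b' N TX dX TY dY q \<rho> \<pi>' \<le> ereal (C * (2 * L * D) powr (1 / (2 * q)))"
    by simp
  let ?a = "2 powr (1 / q - 1 / p) * D" and ?b = "C * (2 * L * D) powr (1 / (2 * q))"
  have \<theta>b: "\<theta> \<in> couplings_of b' N PZ PZ \<pi> \<rho>" using \<theta> b' causal_imp_regular by auto
  have "\<theta> \<in> couplings \<pi> \<rho>" using \<theta> by (simp add: couplings_of_def)
  note c\<theta> = couplingsD[OF this c(1,2) c\<rho>(2)]
  have cq: "total_cost q \<theta> \<le> ennreal (?a powr q)" by (rule total_cost_lower_exponent[OF p D c\<theta>(1,2) cost\<theta>])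
  show ?thesis
  \<comment> \<open>Only a number strictly above the infimum is guaranteed to be reached by a
    coupling, hence the extra e.\<close>
  proof (rule ereal_le_epsilon2)
    fix e :: real assume e: "0 < e"
    have a0: "0 < ?a" using D by simp
    have b0: "0 < ?b + e" using C e by (simp add: add_nonneg_pos)
    have "wass2 b' N TX dX TY dY q \<rho> \<pi>' < ereal (?b + e)" using W2 e by (auto intro: le_less_trans)
    then obtain \<theta>2 where \<theta>2: "\<theta>2 \<in> couplings_of b' N PZ PZ \<rho> \<pi>'" "total_cost q \<theta>2 \<le> ennreal ((?b + e) powr q)"
      by (rule wass2_lessD[OF _ less_imp_le[OF b0] p(1)])
    obtain \<sigma> where "\<sigma> \<in> couplings_of b' N PZ PZ \<pi> \<pi>'" "total_cost q \<sigma> \<le> ennreal ((?a + (?b + e)) powr q)"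
      by (rule total_cost_glue[OF p(1) a0 b0 c(1,2) c\<rho>(1,2) c'(2) \<theta>b \<theta>2(1) b' cq \<theta>2(2)])
    then have "wass2 b' N TX dX TY dY q \<pi> \<pi>' \<le> ereal (?a + (?b + e))"
      by (rule wass2_le) (use a0 b0 p in auto)
    then show "wass2 b' N TX dX TY dY q \<pi> \<pi>' \<le> ereal (?a + ?b) + ereal e" by (simp add: add.assoc)
  qed
qed

end

text \<open>The bounds proved for every D above \<delta> depend continuously on D down to \<delta>,
  also when \<delta> = 0, because the exponent r is positive.\<close>

lemma ereal_le_limit_powr:
  assumes "\<And>D. \<delta> < D \<Longrightarrow> W \<le> ereal (k * D + C * (l * D) powr r)" "0 \<le> \<delta>" "0 < r" "0 \<le> l"
  shows "W \<le> ereal (k * \<delta> + C * (l * \<delta>) powr r)"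
proof -
  let ?D = "\<lambda>n. \<delta> + 1 / real (Suc n)"
  have D: "?D \<longlonglongrightarrow> \<delta>" using tendsto_add[OF tendsto_const[of \<delta>] LIMSEQ_Suc[OF lim_1_over_n]] by simp
  have "(\<lambda>n. (l * ?D n) powr r) \<longlonglongrightarrow> (l * \<delta>) powr r"
    by (rule tendsto_powr'[OF tendsto_mult[OF tendsto_const D] tendsto_const])
       (use assms in \<open>auto intro!: always_eventually\<close>)
  then have "(\<lambda>n. k * ?D n + C * (l * ?D n) powr r) \<longlonglongrightarrow> k * \<delta> + C * (l * \<delta>) powr r"
    by (intro tendsto_add tendsto_mult tendsto_const D)
  then have "(\<lambda>n. ereal (k * ?D n + C * (l * ?D n) powr r)) \<longlonglongrightarrow> ereal (k * \<delta> + C * (l * \<delta>) powr r)"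
    by (rule tendsto_ereal)
  then show ?thesis by (rule LIMSEQ_le_const) (auto intro!: assms(1))
qed

theorem theorem3p9:
  fixes N :: nat
    and TX :: "nat \<Rightarrow> 'a topology" and dX :: "(nat \<Rightarrow> 'a) \<Rightarrow> (nat \<Rightarrow> 'a) \<Rightarrow> real"
    and TY :: "nat \<Rightarrow> 'b topology" and dY :: "(nat \<Rightarrow> 'b) \<Rightarrow> (nat \<Rightarrow> 'b) \<Rightarrow> real"
    and b :: version
    and p L :: real and \<Delta> :: ereal
    and \<mu> \<mu>' :: "(nat \<Rightarrow> 'a) measure" and \<nu> \<nu>' :: "(nat \<Rightarrow> 'b) measure"
    and c :: "(nat \<Rightarrow> 'a) \<times> (nat \<Rightarrow> 'b) \<Rightarrow> real"
  assumes "1 \<le> N"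
    and "polish_path_space N TX dX" and "polish_path_space N TY dY"
    and "1 \<le> p"
    and "\<mu> \<in> prob_p N TX dX p" and "\<mu>' \<in> prob_p N TX dX p"
    and "\<nu> \<in> prob_p N TY dY p" and "\<nu>' \<in> prob_p N TY dY p"
    and "continuous_map (prod_topology (path_top N TX) (path_top N TY)) euclideanreal c"
    and "growth_at_most N TX dX TY dY p c"
    and "0 < L" and "cost_A N TX dX TY dY c L p \<mu> \<nu> \<mu>' \<nu>'"
    and "0 \<le> \<Delta>"
    and "epowr \<Delta> p = epowr (wass Bicausal N TX dX p \<mu> \<mu>') p + epowr (wass Bicausal N TY dY p \<nu> \<nu>') p"
  shows "\<bar>V_val b N TX TY \<mu> \<nu> c - V_val b N TX TY \<mu>' \<nu>' c\<bar> \<le> ereal L * \<Delta>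
       \<and> \<bar>E_val b N TX TY \<mu> \<nu> c - E_val b N TX TY \<mu>' \<nu>' c\<bar> \<le> ereal L * \<Delta>
       \<and> (\<forall>(q::real) (C::real) \<pi> \<pi>'.
            1 \<le> q \<and> q < p \<and> 0 < C \<and>
            E_optimizer b N TX TY \<mu> \<nu> c \<pi> \<and> E_optimizer b N TX TY \<mu>' \<nu>' c \<pi>' \<longrightarrow>
            (cond_T N TX dX TY dY q C \<mu> \<nu> \<longrightarrow>
               wass2 Regular N TX dX TY dY q \<pi> \<pi>'
                 \<le> ereal (2 powr (1 / q - 1 / p)) * \<Delta>
                   + ereal C * epowr (2 * ereal L * \<Delta>) (1 / (2 * q))) \<and>
            (cond_Ta N TX dX TY dY q C \<mu> \<nu> \<and> cond_Ta N TX dX TY dY q C \<mu>' \<nu>' \<longrightarrow>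
               max (wass2 Causal N TX dX TY dY q \<pi> \<pi>') (wass2 Anticausal N TX dX TY dY q \<pi> \<pi>')
                 \<le> ereal (2 powr (1 / q - 1 / p)) * \<Delta>
                   + ereal C * epowr (2 * ereal L * \<Delta>) (1 / (2 * q))))"
proof (cases \<Delta>)
  case PInf
  \<comment> \<open>If \<Delta> is infinite, every right-hand side is infinite, since
    \<open>L\<close> and \<open>C\<close> are positive.\<close>
  have "ereal C * epowr (2 * ereal L * \<Delta>) (1 / (2 * q)) = \<infinity>" if "0 < C" for C q
    using \<open>0 < L\<close> that by (simp add: PInf numeral_eq_ereal)
  moreover have "ereal (2 powr r) * \<Delta> = \<infinity>" for r by (simp add: PInf)
  moreover have "ereal L * \<Delta> = \<infinity>" using \<open>0 < L\<close> by (simp add: PInf)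
  ultimately show ?thesis by auto
next
  case MInf
  then show ?thesis using \<open>0 \<le> \<Delta>\<close> by simp
next
  case (real \<delta>)
  note polX = assms(2) and polY = assms(3) and p = assms(4)
    and \<mu> = assms(5) and \<mu>' = assms(6) and \<nu> = assms(7) and \<nu>' = assms(8)
    and growth = assms(10) and L = assms(11) and A = assms(12)
  note \<mu>p = prob_pD(1,2)[OF \<mu>] and \<mu>p' = prob_pD(1,2)[OF \<mu>'] and \<nu>p = prob_pD(1,2)[OF \<nu>] and \<nu>p' = prob_pD(1,2)[OF \<nu>']
  interpret polish_path_spaces N TX dX TY dY
    by unfold_locales (rule polX polY prob_pD(3)[OF \<mu>] prob_pD(3)[OF \<nu>])+
  have \<delta>: "0 \<le> \<delta>" using \<open>0 \<le> \<Delta>\<close> real by simp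
  have cl: "close p D \<mu> \<mu>' \<nu> \<nu>'" if "\<delta> < D" for D
    by (rule close_of_wass[OF p \<delta> that]) (use assms(14) real in simp)
  have cl': "close p D \<mu>' \<mu> \<nu>' \<nu>" if "\<delta> < D" for D
    by (rule close_sym[OF \<mu>p \<mu>p' \<nu>p \<nu>p' cl[OF that]])
  have A': "cost_A N TX dX TY dY c L p \<mu>' \<nu>' \<mu> \<nu>"
    by (rule cost_A_sym[OF \<mu>p \<mu>p' \<nu>p(2) \<nu>p'(2) p A])
  note fin = values_finite[OF p \<mu> \<nu> growth, of b] and fin' = values_finite[OF p \<mu>' \<nu>' growth, of b]
  have bound: "\<bar>V_val b N TX TY \<mu> \<nu> c - V_val b N TX TY \<mu>' \<nu>' c\<bar> \<le> ereal (L * D)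
      \<and> \<bar>E_val b N TX TY \<mu> \<nu> c - E_val b N TX TY \<mu>' \<nu>' c\<bar> \<le> ereal (L * D)" if "\<delta> < D" for D
  proof -
    have D: "0 \<le> D" using \<delta> that by simp
    note v = values_le[OF \<mu>p \<mu>p' \<nu>p \<nu>p' A p L D cl[OF that], of b]
      and v' = values_le[OF \<mu>p' \<mu>p \<nu>p' \<nu>p A' p L D cl'[OF that], of b]
    show ?thesis
      using ereal_diff_le_bound[OF v'(1) v(1) fin(1) fin'(1)] ereal_diff_le_bound[OF v'(2) v(2) fin(2) fin'(2)] by simp
  qed
  have rhs: "ereal (2 powr (1 / q - 1 / p)) * \<Delta> + ereal C * epowr (2 * ereal L * \<Delta>) (1 / (2 * q))
     = ereal (2 powr (1 / q - 1 / p) * \<delta> + C * (2 * L * \<delta>) powr (1 / (2 * q)))" for q C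
    by (simp add: real numeral_eq_ereal)
  \<comment> \<open>The limit lemma with its second term switched off by C = 0.\<close>
  have limit: "W \<le> ereal L * \<Delta>" if "\<And>D. \<delta> < D \<Longrightarrow> W \<le> ereal (L * D)" for W
    using ereal_le_limit_powr[of \<delta> W L 0 0 1] that \<delta> by (simp add: real)
  show ?thesis
  proof (intro conjI allI impI)
    show "\<bar>V_val b N TX TY \<mu> \<nu> c - V_val b N TX TY \<mu>' \<nu>' c\<bar> \<le> ereal L * \<Delta>"
      by (rule limit) (use bound in blast)
    show "\<bar>E_val b N TX TY \<mu> \<nu> c - E_val b N TX TY \<mu>' \<nu>' c\<bar> \<le> ereal L * \<Delta>"
      by (rule limit) (use bound in blast)
  next
    fix q C :: real and \<pi> \<pi>'
    assume H: "1 \<le> q \<and> q < p \<and> 0 < C \<and> E_optimizer b N TX TY \<mu> \<nu> c \<pi> \<and> E_optimizer b N TX TY \<mu>' \<nu>' c \<pi>'"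
    then have q: "1 \<le> q" "q < p" and C: "0 < C"
      and opt: "E_optimizer b N TX TY \<mu> \<nu> c \<pi>" and opt': "E_optimizer b N TX TY \<mu>' \<nu>' c \<pi>'" by auto
    let ?rhs = "ereal (2 powr (1 / q - 1 / p)) * \<Delta> + ereal C * epowr (2 * ereal L * \<Delta>) (1 / (2 * q))"
    have \<pi>c: "\<pi> \<in> couplings \<mu> \<nu>" and \<pi>c': "\<pi>' \<in> couplings \<mu>' \<nu>'"
      using opt opt' by (auto simp: E_optimizer_def couplings_of_def)
    note c = couplingsD[OF \<pi>c \<mu>p \<nu>p(2)] and c' = couplingsD[OF \<pi>c' \<mu>p' \<nu>p'(2)]
    have sw: "wass2 (swap_version b') N TX dX TY dY q \<pi>' \<pi> = wass2 b' N TX dX TY dY q \<pi> \<pi>'" for b'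
      by (rule wass2_swap[OF c(1,2) c'(1,2)]) (use q in simp)
    \<comment> \<open>The shadow of \<pi> is compared with \<open>\<pi>'\<close>, so the transport
      inequality is applied to couplings of \<open>\<mu>'\<close> and \<open>\<nu>'\<close>.\<close>
    have fwd: "wass2 b' N TX dX TY dY q \<pi> \<pi>' \<le> ?rhs" if b': "b' \<in> {Regular, Causal}"
      and T: "\<And>\<rho>. \<rho> \<in> couplings \<mu>' \<nu>' \<Longrightarrow> wass2 b' N TX dX TY dY q \<rho> \<pi>' \<le> ereal C * epowr (KL \<rho> \<pi>') (1 / (2 * q))" for b'
      unfolding rhs
    proof (rule ereal_le_limit_powr)
      fix D assume "\<delta> < D"
      then show "wass2 b' N TX dX TY dY q \<pi> \<pi>' \<le> ereal (2 powr (1 / q - 1 / p) * D + C * (2 * L * D) powr (1 / (2 * q)))"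
        using \<delta> by (intro optimizer_stability[OF q \<mu> \<mu>' \<nu> \<nu>' growth A L _ cl C opt opt' b' T]) auto
    qed (use \<delta> q L in auto)
    \<comment> \<open>The mirror image: the shadow of \<open>\<pi>'\<close> is compared with \<pi>,
      by the transport inequality for couplings of \<mu> and \<nu>.\<close>
    have bwd: "wass2 b' N TX dX TY dY q \<pi>' \<pi> \<le> ?rhs" if b': "b' \<in> {Regular, Causal}"
      and T: "\<And>\<rho>. \<rho> \<in> couplings \<mu> \<nu> \<Longrightarrow> wass2 b' N TX dX TY dY q \<rho> \<pi> \<le> ereal C * epowr (KL \<rho> \<pi>) (1 / (2 * q))" for b'
      unfolding rhs
    proof (rule ereal_le_limit_powr)
      fix D assume "\<delta> < D"
      then show "wass2 b' N TX dX TY dY q \<pi>' \<pi> \<le> ereal (2 powr (1 / q - 1 / p) * D + C * (2 * L * D) powr (1 / (2 * q)))"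
        using \<delta> by (intro optimizer_stability[OF q \<mu>' \<mu> \<nu>' \<nu> growth A' L _ cl' C opt' opt b' T]) auto
    qed (use \<delta> q L in auto)
    {
      \<comment> \<open>The inequality is available for \<mu> and \<nu> only, which calls for
        \<open>bwd\<close>; the regular distance is symmetric.\<close>
      assume T: "cond_T N TX dX TY dY q C \<mu> \<nu>"
      have "wass2 Regular N TX dX TY dY q \<pi>' \<pi> \<le> ?rhs"
        by (rule bwd) (use T \<pi>c in \<open>auto simp: cond_T_def\<close>)
      then show "wass2 Regular N TX dX TY dY q \<pi> \<pi>' \<le> ?rhs" using sw[of Regular] by simp
    next
      assume Ta: "cond_Ta N TX dX TY dY q C \<mu> \<nu> \<and> cond_Ta N TX dX TY dY q C \<mu>' \<nu>'"
      \<comment> \<open>A causal bound from \<open>\<pi>'\<close> to \<pi> is an anticausal bound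
        from \<pi> to \<open>\<pi>'\<close>; the causal one comes from \<open>fwd\<close>, on the
        other pair of marginals.\<close>
      have "wass2 Causal N TX dX TY dY q \<pi>' \<pi> \<le> ?rhs"
        by (rule bwd) (use Ta \<pi>c in \<open>auto simp: cond_Ta_def\<close>)
      then have "wass2 Anticausal N TX dX TY dY q \<pi> \<pi>' \<le> ?rhs" using sw[of Anticausal] by simp
      moreover have "wass2 Causal N TX dX TY dY q \<pi> \<pi>' \<le> ?rhs"
        by (rule fwd) (use Ta \<pi>c' in \<open>auto simp: cond_Ta_def\<close>)
      ultimately show "max (wass2 Causal N TX dX TY dY q \<pi> \<pi>') (wass2 Anticausal N TX dX TY dY q \<pi> \<pi>') \<le> ?rhs"
        by simp
    }
  qed
qed

end
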